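(* Let $f:X\to\mathbb{R}$, $X=W^{1,p}_0(\Omega)$, be the functional $$f(u)=\int_\Omega\Psi(\nabla u(x))\,dx-\int_\Omega G(x,u(x))\,dx,$$ where $\Omega$, $p$, $\Psi$, $g$, $G$ are as in the context, and assume: ($\Psi$) there exist $\kappa,\mu_1,\mu_2>0$ such that $\Psi-\mu_1\Psi_\kappa$ and $\mu_2\Psi_\kappa-\Psi$ are both convex on $\mathbb{R}^n$; ($g$) there exist $C>0$ and $0\le q<p^*-2$ such that $|\partial_sg(x,s)|\le C(1+|s|^q)$ for a.e. $x\in\Omega$ and all $s\in\mathbb{R}$. Assume that $\bar u=0$ is a critical point of $f$ and that $d^2f(0):X\to X^*$ is injective, and let $X=X^-\oplus X^+$ be the induced splitting described in the context. Let $c>0$ be a constant for which there is a neighborhood $\mathcal U\subset X$ of $0$ with $$d^2f(u)[v^-,v^-]\le-2c\,\|v^-\|^2\qquad\forall v^-\in X^-,\ \forall u\in\mathcal U .$$ Then there exist $\delta>0$ and $c_1>0$ such that $$d^2f(u)[u^+,u^+]\ge c_1\|u^+\|_{\mathbb{H}}^2-c\,\|u^-\|^2\qquad\forall u\in X \text{ with } \|u\|<\delta,$$ where $u=u^-+u^+$ is the decomposition of $u$ in the splitting $X=X^-\oplus X^+$.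
   Context: Setting: $\Omega\subset\mathbb{R}^n$ is an open bounded set with $C^1$ boundary; $p\in(2,n]$; $X:=W^{1,p}_0(\Omega)$ with norm $\|\cdot\|$; $p^*=\frac{np}{n-p}$ if $p<n$ and $p^*=+\infty$ if $p=n$. $\Psi:\mathbb{R}^n\to\mathbb{R}$ is $C^2$ with $\Psi(0)=0$, $\nabla\Psi(0)=0$. $g:\Omega\times\mathbb{R}\to\mathbb{R}$ has $g(\cdot,s)$ measurable for every $s$ and $g(x,\cdot)$ of class $C^1$ for a.e. $x$; $G(x,s):=\int_0^sg(x,t)\,dt$. For $\kappa>0$, $\Psi_\kappa(x):=\frac1p[(\kappa^2+|x|^2)^{p/2}-\kappa^2]$. The functional $f$ is regarded as real-valued and of class $C^2$ on $X$ (taken to be a consequence of the assumptions), with $$d^2f(u)[v,w]=\int_\Omega\Psi''(\nabla u)[\nabla v,\nabla w]\,dx-\int_\Omega\partial_sg(x,u(x))v(x)w(x)\,dx,$$ $\Psi''$ being the Hessian of $\Psi$. Splitting: with $\bar u=0$, let $\mathbb{H}$ be the Hilbert space completion of $C_0^\infty(\Omega)$ with respect to the scalar product $\langle v,w\rangle_{\mathbb{H}}:=\int_\Omega\Psi''(\nabla\bar u)[\nabla v,\nabla w]\,dx$, with norm $\|\cdot\|_{\mathbb{H}}$; it is isomorphic to $W^{1,2}_0(\Omega)$ and $X\hookrightarrow\mathbb{H}$ continuously. The bilinear form $d^2f(\bar u)$ extends to $\mathbb{H}$ and is represented, via the Riesz theorem, by a self-adjoint operator $H:\mathbb{H}\to\mathbb{H}$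 which is a compact perturbation of the identity. By injectivity of $d^2f(\bar u)$ and elliptic regularity, $\mathbb{H}=\mathbb{H}^-\oplus\mathbb{H}^+$ orthogonally, where $\mathbb{H}^-$ and $\mathbb{H}^+$ are the negative and positive eigenspaces of $H$ (closed spans of eigenvectors with negative, resp. positive, eigenvalue); $\mathbb{H}^-$ is finite dimensional and contained in $X$. Set $X^-:=\mathbb{H}^-$ and $X^+:=\mathbb{H}^+\cap X$, so that $X=X^-\oplus X^+$. On the finite dimensional space $X^-$, $\|\cdot\|$ denotes any fixed (equivalent) norm. *)

theory Defs
  imports "HOL-Analysis.Analysis"
begin

text \<open>
  Elements of Lebesgue and Sobolev spaces on \<Omega> are represented by functions on the whole space, of
  which only the values on \<Omega> matter, and only up to equality almost everywhere on \<Omega>.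
  All integrals are Lebesgue integrals for the completed measure on \<Omega>.
\<close>

text \<open>In finite dimension, continuity of all iterated directional derivatives is continuity of the
  iterated Frechet derivatives.\<close>

primrec class_C :: "nat \<Rightarrow> ('a::euclidean_space \<Rightarrow> real) \<Rightarrow> bool" where
  "class_C 0 f \<longleftrightarrow> continuous_on UNIV f"
| "class_C (Suc k) f \<longleftrightarrow>
     (\<forall>x. f differentiable (at x)) \<and> (\<forall>v. class_C k (\<lambda>x. frechet_derivative f (at x) v))"

definition hessian :: "('a::euclidean_space \<Rightarrow> real) \<Rightarrow> 'a \<Rightarrow> 'a \<Rightarrow> 'a \<Rightarrow> real" where
  "hessian \<Psi> x v w = frechet_derivative (\<lambda>y. frechet_derivative \<Psi> (at y) v) (at x) w"

definition test_functions :: "'a::euclidean_space set \<Rightarrow> ('a \<Rightarrow> real) set" where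
  "test_functions \<Omega> =
     {\<phi>. (\<forall>k. class_C k \<phi>) \<and> (\<exists>K. compact K \<and> K \<subseteq> \<Omega> \<and> (\<forall>x. x \<notin> K \<longrightarrow> \<phi> x = 0))}"

text \<open>Near each boundary point, \<Omega> is the strict epigraph, in the direction of a unit vector \<open>e\<close>,
  of a \<open>C\<^sup>1\<close> function on the hyperplane orthogonal to \<open>e\<close> (here extended to the whole space).\<close>

definition C1_boundary :: "'a::euclidean_space set \<Rightarrow> bool" where
  "C1_boundary \<Omega> \<longleftrightarrow>
     (\<forall>x0\<in>frontier \<Omega>. \<exists>r>0. \<exists>e \<gamma>. norm e = 1 \<and> class_C 1 \<gamma> \<and>
        \<Omega> \<inter> ball x0 r = {x \<in> ball x0 r. \<gamma> (x - (x \<bullet> e) *\<^sub>R e) < x \<bullet> e})"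

definition eq_ae :: "'a::euclidean_space set \<Rightarrow> ('a \<Rightarrow> real) \<Rightarrow> ('a \<Rightarrow> real) \<Rightarrow> bool" where
  "eq_ae \<Omega> u v \<longleftrightarrow> (AE x in lebesgue_on \<Omega>. u x = v x)"

definition locally_integrable ::
  "'a::euclidean_space set \<Rightarrow> ('a \<Rightarrow> 'b::{banach, second_countable_topology}) \<Rightarrow> bool" where
  "locally_integrable \<Omega> u \<longleftrightarrow> (\<forall>K. compact K \<and> K \<subseteq> \<Omega> \<longrightarrow> integrable (lebesgue_on K) u)"

definition weak_gradient ::
  "'a::euclidean_space set \<Rightarrow> ('a \<Rightarrow> real) \<Rightarrow> ('a \<Rightarrow> 'a) \<Rightarrow> bool" where
  "weak_gradient \<Omega> u U \<longleftrightarrow> locally_integrable \<Omega> u \<and> locally_integrable \<Omega> U \<and>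
     (\<forall>\<phi>\<in>test_functions \<Omega>. \<forall>i\<in>Basis.
        (\<integral>x. u x * frechet_derivative \<phi> (at x) i \<partial>lebesgue_on \<Omega>)
        = - (\<integral>x. (U x \<bullet> i) * \<phi> x \<partial>lebesgue_on \<Omega>))"

text \<open>Weak gradients are unique up to null sets, so the choice below is immaterial.\<close>

definition wgrad :: "'a::euclidean_space set \<Rightarrow> ('a \<Rightarrow> real) \<Rightarrow> 'a \<Rightarrow> 'a" where
  "wgrad \<Omega> u = (SOME U. weak_gradient \<Omega> u U)"

definition Lp :: "'a::euclidean_space set \<Rightarrow> real \<Rightarrow> ('a \<Rightarrow> 'b::euclidean_space) set" where
  "Lp \<Omega> p = {u \<in> borel_measurable (lebesgue_on \<Omega>).
               integrable (lebesgue_on \<Omega>) (\<lambda>x. norm (u x) powr p)}"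

definition W1 :: "real \<Rightarrow> 'a::euclidean_space set \<Rightarrow> ('a \<Rightarrow> real) set" where
  "W1 p \<Omega> = {u \<in> Lp \<Omega> p. \<exists>U\<in>Lp \<Omega> p. weak_gradient \<Omega> u U}"

definition W1_norm :: "real \<Rightarrow> 'a::euclidean_space set \<Rightarrow> ('a \<Rightarrow> real) \<Rightarrow> real" where
  "W1_norm p \<Omega> u =
     ((\<integral>x. \<bar>u x\<bar> powr p \<partial>lebesgue_on \<Omega>) + (\<integral>x. norm (wgrad \<Omega> u x) powr p \<partial>lebesgue_on \<Omega>))
       powr (1 / p)"

definition W10 :: "real \<Rightarrow> 'a::euclidean_space set \<Rightarrow> ('a \<Rightarrow> real) set" where
  "W10 p \<Omega> = {u \<in> W1 p \<Omega>. \<exists>\<phi>::nat \<Rightarrow> 'a \<Rightarrow> real. (\<forall>k. \<phi> k \<in> test_functions \<Omega>) \<and>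
                 (\<lambda>k. W1_norm p \<Omega> (\<lambda>x. u x - \<phi> k x)) \<longlonglongrightarrow> 0}"

definition sobolev_exponent :: "real \<Rightarrow> real \<Rightarrow> ereal" where
  "sobolev_exponent n p = (if p < n then ereal (n * p / (n - p)) else \<infinity>)"

text \<open>A norm on a space of functions modulo equality almost everywhere.\<close>

definition norm_on ::
  "'a::euclidean_space set \<Rightarrow> ('a \<Rightarrow> real) set \<Rightarrow> (('a \<Rightarrow> real) \<Rightarrow> real) \<Rightarrow> bool" where
  "norm_on \<Omega> V N \<longleftrightarrow>
     (\<forall>v\<in>V. 0 \<le> N v \<and> (N v = 0 \<longleftrightarrow> eq_ae \<Omega> v (\<lambda>_. 0))) \<and>
     (\<forall>v\<in>V. \<forall>a. N (\<lambda>x. a * v x) = \<bar>a\<bar> * N v) \<and>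
     (\<forall>v\<in>V. \<forall>w\<in>V. N (\<lambda>x. v x + w x) \<le> N v + N w)"

definition in_dual ::
  "('a \<Rightarrow> real) set \<Rightarrow> (('a \<Rightarrow> real) \<Rightarrow> real) \<Rightarrow> (('a \<Rightarrow> real) \<Rightarrow> real) \<Rightarrow> bool" where
  "in_dual X N L \<longleftrightarrow>
     (\<forall>v\<in>X. \<forall>w\<in>X. \<forall>a b. L (\<lambda>x. a * v x + b * w x) = a * L v + b * L w) \<and>
     (\<exists>K. \<forall>v\<in>X. \<bar>L v\<bar> \<le> K * N v)"

definition has_differential ::
  "('a \<Rightarrow> real) set \<Rightarrow> (('a \<Rightarrow> real) \<Rightarrow> real) \<Rightarrow> (('a \<Rightarrow> real) \<Rightarrow> real) \<Rightarrow> ('a \<Rightarrow> real) \<Rightarrow>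
   (('a \<Rightarrow> real) \<Rightarrow> real) \<Rightarrow> bool" where
  "has_differential X N F u L \<longleftrightarrow> in_dual X N L \<and>
     (\<forall>\<epsilon>>0. \<exists>\<delta>>0. \<forall>h\<in>X. N h < \<delta> \<longrightarrow> \<bar>F (\<lambda>x. u x + h x) - F u - L h\<bar> \<le> \<epsilon> * N h)"

definition critical_point ::
  "('a \<Rightarrow> real) set \<Rightarrow> (('a \<Rightarrow> real) \<Rightarrow> real) \<Rightarrow> (('a \<Rightarrow> real) \<Rightarrow> real) \<Rightarrow> ('a \<Rightarrow> real) \<Rightarrow> bool" where
  "critical_point X N F u \<longleftrightarrow> u \<in> X \<and> has_differential X N F u (\<lambda>_. 0)"

text \<open>\<open>F\<close> is of class \<open>C\<^sup>2\<close> on the function space \<open>X\<close> with norm \<open>N\<close>, with second differential \<open>D2\<close>: here \<open>D1\<close> is the differential of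
  \<open>F\<close>, a map into the dual of \<open>X\<close> which is differentiable in operator norm, and \<open>D2\<close> is continuous as
  a map into the bounded bilinear forms.\<close>

definition C2_functional ::
  "('a \<Rightarrow> real) set \<Rightarrow> (('a \<Rightarrow> real) \<Rightarrow> real) \<Rightarrow> (('a \<Rightarrow> real) \<Rightarrow> real) \<Rightarrow>
   (('a \<Rightarrow> real) \<Rightarrow> ('a \<Rightarrow> real) \<Rightarrow> ('a \<Rightarrow> real) \<Rightarrow> real) \<Rightarrow> bool" where
  "C2_functional X N F D2 \<longleftrightarrow>
     (\<exists>D1.
        (\<forall>u\<in>X. has_differential X N F u (D1 u)) \<and>
        (\<forall>u\<in>X. \<forall>\<epsilon>>0. \<exists>\<delta>>0. \<forall>h\<in>X. N h < \<delta> \<longrightarrow>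
           (\<forall>v\<in>X. \<bar>D1 (\<lambda>x. u x + h x) v - D1 u v - D2 u h v\<bar> \<le> \<epsilon> * N h * N v))) \<and>
     (\<forall>u\<in>X. (\<forall>v\<in>X. in_dual X N (D2 u v)) \<and> (\<forall>w\<in>X. in_dual X N (\<lambda>v. D2 u v w)) \<and>
        (\<exists>K. \<forall>v\<in>X. \<forall>w\<in>X. \<bar>D2 u v w\<bar> \<le> K * N v * N w)) \<and>
     (\<forall>u\<in>X. \<forall>\<epsilon>>0. \<exists>\<delta>>0. \<forall>u'\<in>X. N (\<lambda>x. u' x - u x) < \<delta> \<longrightarrow>
        (\<forall>v\<in>X. \<forall>w\<in>X. \<bar>D2 u' v w - D2 u v w\<bar> \<le> \<epsilon> * N v * N w))"

text \<open>The subtracted \<open>\<kappa>\<^sup>2\<close> (rather than \<open>\<kappa>\<^sup>p\<close>) is a normalisation without effect on convexity.\<close>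

definition Psi_kappa :: "real \<Rightarrow> real \<Rightarrow> 'a::euclidean_space \<Rightarrow> real" where
  "Psi_kappa p \<kappa> x = (1 / p) * ((\<kappa>\<^sup>2 + (norm x)\<^sup>2) powr (p / 2) - \<kappa>\<^sup>2)"

text \<open>The interval integral is oriented, as required for negative \<open>s\<close>.\<close>

definition primitive :: "('a \<Rightarrow> real \<Rightarrow> real) \<Rightarrow> 'a \<Rightarrow> real \<Rightarrow> real" where
  "primitive g x s = interval_lebesgue_integral lborel 0 (ereal s) (g x)"

definition functional ::
  "'a::euclidean_space set \<Rightarrow> ('a \<Rightarrow> real) \<Rightarrow> ('a \<Rightarrow> real \<Rightarrow> real) \<Rightarrow> ('a \<Rightarrow> real) \<Rightarrow> real" where
  "functional \<Omega> \<Psi> g u =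
     (\<integral>x. \<Psi> (wgrad \<Omega> u x) \<partial>lebesgue_on \<Omega>) - (\<integral>x. primitive g x (u x) \<partial>lebesgue_on \<Omega>)"

definition d2_functional ::
  "'a::euclidean_space set \<Rightarrow> ('a \<Rightarrow> real) \<Rightarrow> ('a \<Rightarrow> real \<Rightarrow> real) \<Rightarrow>
   ('a \<Rightarrow> real) \<Rightarrow> ('a \<Rightarrow> real) \<Rightarrow> ('a \<Rightarrow> real) \<Rightarrow> real" where
  "d2_functional \<Omega> \<Psi> g u v w =
     (\<integral>x. hessian \<Psi> (wgrad \<Omega> u x) (wgrad \<Omega> v x) (wgrad \<Omega> w x) \<partial>lebesgue_on \<Omega>)
     - (\<integral>x. deriv (g x) (u x) * v x * w x \<partial>lebesgue_on \<Omega>)"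

text \<open>The completion of the test functions for \<open>H_inner\<close> is realised on \<open>W10 2 \<Omega>\<close>: since \<open>hessian \<Psi> 0\<close>
  is positive definite, the norm is there equivalent to that of \<open>W\<^sup>1\<^sup>,\<^sup>2\<close>.\<close>

definition H_space :: "'a::euclidean_space set \<Rightarrow> ('a \<Rightarrow> real) set" where
  "H_space \<Omega> = W10 2 \<Omega>"

definition H_inner ::
  "'a::euclidean_space set \<Rightarrow> ('a \<Rightarrow> real) \<Rightarrow> ('a \<Rightarrow> real) \<Rightarrow> ('a \<Rightarrow> real) \<Rightarrow> real" where
  "H_inner \<Omega> \<Psi> v w = (\<integral>x. hessian \<Psi> 0 (wgrad \<Omega> v x) (wgrad \<Omega> w x) \<partial>lebesgue_on \<Omega>)"

definition H_norm :: "'a::euclidean_space set \<Rightarrow> ('a \<Rightarrow> real) \<Rightarrow> ('a \<Rightarrow> real) \<Rightarrow> real" where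
  "H_norm \<Omega> \<Psi> v = sqrt (H_inner \<Omega> \<Psi> v v)"

text \<open>The Riesz representative of the second differential at zero. As \<open>\<partial>\<^sub>s g(x,0)\<close> is bounded,
  the integral formula for the second differential at zero makes sense on all of \<open>H_space\<close>,
  and there gives the continuous extension.\<close>

definition H_operator ::
  "'a::euclidean_space set \<Rightarrow> ('a \<Rightarrow> real) \<Rightarrow> ('a \<Rightarrow> real \<Rightarrow> real) \<Rightarrow> ('a \<Rightarrow> real) \<Rightarrow> ('a \<Rightarrow> real)" where
  "H_operator \<Omega> \<Psi> g v =
     (SOME z. z \<in> H_space \<Omega> \<and>
        (\<forall>w\<in>H_space \<Omega>. H_inner \<Omega> \<Psi> z w = d2_functional \<Omega> \<Psi> g (\<lambda>_. 0) v w))"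

definition H_eigenvector ::
  "'a::euclidean_space set \<Rightarrow> ('a \<Rightarrow> real) \<Rightarrow> ('a \<Rightarrow> real \<Rightarrow> real) \<Rightarrow> real \<Rightarrow> ('a \<Rightarrow> real) \<Rightarrow> bool" where
  "H_eigenvector \<Omega> \<Psi> g l v \<longleftrightarrow> v \<in> H_space \<Omega> \<and> \<not> eq_ae \<Omega> v (\<lambda>_. 0) \<and>
     eq_ae \<Omega> (H_operator \<Omega> \<Psi> g v) (\<lambda>x. l * v x)"

definition H_closed_span ::
  "'a::euclidean_space set \<Rightarrow> ('a \<Rightarrow> real) \<Rightarrow> ('a \<Rightarrow> real) set \<Rightarrow> ('a \<Rightarrow> real) set" where
  "H_closed_span \<Omega> \<Psi> E =
     {v \<in> H_space \<Omega>. \<forall>\<epsilon>>0. \<exists>(m::nat) (a :: nat \<Rightarrow> real) e. (\<forall>i<m. e i \<in> E) \<and>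
         H_norm \<Omega> \<Psi> (\<lambda>x. v x - (\<Sum>i<m. a i * e i x)) < \<epsilon>}"

definition H_minus ::
  "'a::euclidean_space set \<Rightarrow> ('a \<Rightarrow> real) \<Rightarrow> ('a \<Rightarrow> real \<Rightarrow> real) \<Rightarrow> ('a \<Rightarrow> real) set" where
  "H_minus \<Omega> \<Psi> g = H_closed_span \<Omega> \<Psi> {v. \<exists>l<0. H_eigenvector \<Omega> \<Psi> g l v}"

definition H_plus ::
  "'a::euclidean_space set \<Rightarrow> ('a \<Rightarrow> real) \<Rightarrow> ('a \<Rightarrow> real \<Rightarrow> real) \<Rightarrow> ('a \<Rightarrow> real) set" where
  "H_plus \<Omega> \<Psi> g = H_closed_span \<Omega> \<Psi> {v. \<exists>l>0. H_eigenvector \<Omega> \<Psi> g l v}"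

text \<open>By elliptic regularity \<open>H_minus\<close> is finite dimensional and contained in \<open>W10 p \<Omega>\<close> in the situation
  of interest, so no intersection with \<open>W10 p \<Omega>\<close> is needed for \<open>X_minus\<close>.\<close>

definition X_minus ::
  "'a::euclidean_space set \<Rightarrow> ('a \<Rightarrow> real) \<Rightarrow> ('a \<Rightarrow> real \<Rightarrow> real) \<Rightarrow> ('a \<Rightarrow> real) set" where
  "X_minus \<Omega> \<Psi> g = H_minus \<Omega> \<Psi> g"

definition X_plus ::
  "real \<Rightarrow> 'a::euclidean_space set \<Rightarrow> ('a \<Rightarrow> real) \<Rightarrow> ('a \<Rightarrow> real \<Rightarrow> real) \<Rightarrow> ('a \<Rightarrow> real) set" where
  "X_plus p \<Omega> \<Psi> g = H_plus \<Omega> \<Psi> g \<inter> W10 p \<Omega>"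

end

theory Submission imports Defs begin

text \<open>
  Write \<open>ip\<close> for the scalar product of \<open>\<H>\<close> and \<open>k v w = \<integral> \<partial>\<^sub>s g(x,0) v w\<close>, so that the second
  differential at \<open>0\<close> is \<open>ip - k\<close>. Rellich's theorem makes \<open>k\<close> compact, so on the closed span of the
  eigenvectors with positive eigenvalue \<open>ip - k\<close> is coercive. The second differential at a small \<open>u\<close>
  is however not close to that at \<open>0\<close> in the norm of \<open>\<H>\<close>: neither \<open>\<Psi>''(\<nabla>u)\<close> nor \<open>\<partial>\<^sub>s g(x,u)\<close> is
  uniformly close to its value at \<open>0\<close>. Three observations replace this continuity.

  (1) Pointwise (\<open>hessian_lower\<close>), \<open>\<Psi>''(\<nabla>u)\<close> exceeds \<open>(1 - \<eta>) \<Psi>''(0) + k\<^sub>1 \<bar>\<nabla>u\<bar>\<^sup>p\<^sup>-\<^sup>2\<close> where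
  \<open>\<bar>\<nabla>u\<bar> \<le> \<rho>\<close>, and \<open>\<theta> \<Psi>''(0) + k\<^sub>1 \<bar>\<nabla>u\<bar>\<^sup>p\<^sup>-\<^sup>2\<close> elsewhere, with a fixed fraction \<open>\<theta> > 0\<close>. The loss is
  a form \<open>E \<le> ip\<close> supported where \<open>\<bar>\<nabla>u\<bar> > \<rho>\<close>, a set whose measure tends to \<open>0\<close> with \<open>u\<close>; so \<open>E\<close> is small on any finite set of fixed functions. That suffices (\<open>spectral_coercive\<close>): only
  finitely many eigenvalues are far from \<open>1\<close>, and where the eigenvalues are close to \<open>1\<close> the form
  \<open>k\<close> is negligible, so that \<open>\<theta> ip\<close> is enough.

  (2) The difference \<open>\<partial>\<^sub>s g(x,u) - \<partial>\<^sub>s g(x,0)\<close> is at most the sum of a bounded function whose integral tends to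
  \<open>0\<close> with \<open>u\<close>, which is small relative to \<open>ip\<close> by Sobolev's inequality (\<open>potential_small\<close>), and of
  a term of order \<open>\<bar>u\<bar>\<^sup>r\<^sup>-\<^sup>2\<close> for some subcritical \<open>r > p\<close>. The latter contributes at most a multiple
  of \<open>\<integral> \<bar>u\<bar>\<^sup>r + \<bar>u\<^sup>+\<bar>\<^sup>r\<close>.

  (3) This is not controlled by the norm of \<open>\<H>\<close>, but by the gain
  \<open>k\<^sub>1 \<integral> \<bar>\<nabla>u\<bar>\<^sup>p\<^sup>-\<^sup>2 \<bar>\<nabla>u\<^sup>+\<bar>\<^sup>2\<close> in (1): up to powers of \<open>u\<^sup>-\<close> the gain is at least a multiple of
  \<open>D = \<integral> \<bar>\<nabla>u\<^sup>+\<bar>\<^sup>p\<close>, while \<open>\<integral> \<bar>u\<^sup>+\<bar>\<^sup>r\<close> is at most a multiple of \<open>D powr (r / p)\<close>, and \<open>r / p > 1\<close>.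
  All the terms in \<open>u\<^sup>-\<close> have an exponent above \<open>2\<close>. On the negative space, within \<open>W10 p \<Omega>\<close>, all
  norms are equivalent: the hypothesis at \<open>u = 0\<close> says that \<open>k\<close> dominates \<open>ip\<close> there, which by compactness
  forces finite dimension. Hence these terms are absorbed by \<open>c \<parallel>u\<^sup>-\<parallel>\<^sup>2\<close>.

  The subcritical Sobolev inequality and Rellich's theorem are both derived from averages of test
  functions over cubes (\<open>sobolev_test\<close>, \<open>test_family_bound\<close>).
\<close>

section \<open>Smooth functions with compact support\<close>

lemma class_C_Suc_imp: "class_C (Suc k) f \<Longrightarrow> class_C k f"
proof (induction k arbitrary: f)
  case 0
  then show ?case
    by (auto intro!: differentiable_imp_continuous_on simp: differentiable_on_def
        intro: differentiable_at_withinI)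
next
  case (Suc k)
  then show ?case by (metis class_C.simps(2))
qed

lemma frechet_derivative_eqI:
  "(f has_derivative f') (at x) \<Longrightarrow> frechet_derivative f (at x) = f'"
  by (rule frechet_derivative_at[symmetric])

lemma class_C_const: "class_C k (\<lambda>_. c)"
proof (induction k arbitrary: c)
  case (Suc k)
  have "frechet_derivative (\<lambda>_::'a. c) (at x) v = 0" for x v
    by (simp add: frechet_derivative_eqI)
  then show ?case using Suc[of 0] by simp
qed simp

lemma class_C_add: "class_C k f \<Longrightarrow> class_C k g \<Longrightarrow> class_C k (\<lambda>x. f x + g x)"
proof (induction k arbitrary: f g)
  case (Suc k)
  have "frechet_derivative (\<lambda>x. f x + g x) (at x)
      = (\<lambda>v. frechet_derivative f (at x) v + frechet_derivative g (at x) v)" for x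
    using Suc.prems by (intro frechet_derivative_eqI has_derivative_add)
      (auto simp: frechet_derivative_works[symmetric])
  with Suc show ?case by (simp add: differentiable_add)
qed (auto intro: continuous_intros)

lemma class_C_mult: "class_C k f \<Longrightarrow> class_C k g \<Longrightarrow> class_C k (\<lambda>x. f x * g x)"
proof (induction k arbitrary: f g)
  case (Suc k)
  have "frechet_derivative (\<lambda>x. f x * g x) (at x)
      = (\<lambda>v. f x * frechet_derivative g (at x) v + frechet_derivative f (at x) v * g x)" for x
    using Suc.prems by (intro frechet_derivative_eqI has_derivative_mult)
      (auto simp: frechet_derivative_works[symmetric])
  moreover have "class_C k f" "class_C k g"
    using Suc.prems class_C_Suc_imp by blast+
  ultimately show ?case using Suc by (simp add: class_C_add differentiable_mult)
qed (auto intro: continuous_intros)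

lemma class_C_prod:
  "finite I \<Longrightarrow> (\<And>i. i \<in> I \<Longrightarrow> class_C k (f i)) \<Longrightarrow> class_C k (\<lambda>x. \<Prod>i\<in>I. f i x)"
  by (induction I rule: finite_induct) (auto intro: class_C_const class_C_mult)

definition grad :: "('a::euclidean_space \<Rightarrow> real) \<Rightarrow> 'a \<Rightarrow> 'a" where
  "grad \<phi> x = (\<Sum>i\<in>Basis. frechet_derivative \<phi> (at x) i *\<^sub>R i)"

lemma grad_inner:
  assumes "\<phi> differentiable (at x)"
  shows "grad \<phi> x \<bullet> v = frechet_derivative \<phi> (at x) v"
proof -
  have lin: "linear (frechet_derivative \<phi> (at x))"
    using assms frechet_derivative_works has_derivative_linear by blast
  have "frechet_derivative \<phi> (at x) v = frechet_derivative \<phi> (at x) (\<Sum>i\<in>Basis. (v \<bullet> i) *\<^sub>R i)"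
    by (simp add: euclidean_representation)
  also have "\<dots> = (\<Sum>i\<in>Basis. (v \<bullet> i) * frechet_derivative \<phi> (at x) i)"
    using lin by (simp add: linear_sum linear_cmul)
  finally show ?thesis
    by (simp add: grad_def inner_sum_left mult.commute inner_commute[of v])
qed

lemma grad_derivative:
  assumes "\<phi> differentiable (at x)"
  shows "(\<phi> has_derivative (\<lambda>v. grad \<phi> x \<bullet> v)) (at x)"
  using assms by (simp add: grad_inner frechet_derivative_works[symmetric])

lemma grad_eqI:
  assumes "(\<phi> has_derivative (\<lambda>v. w \<bullet> v)) (at x)"
  shows "grad \<phi> x = w"
  using grad_inner[of \<phi> x] frechet_derivative_eqI[OF assms] assms
  by (metis differentiable_def inner_commute vector_eq_rdot)

lemma test_functionsE:
  assumes "\<phi> \<in> test_functions \<Omega>"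
  obtains K where "compact K" "K \<subseteq> \<Omega>" "\<And>x. x \<notin> K \<Longrightarrow> \<phi> x = 0" "\<And>x. x \<notin> K \<Longrightarrow> grad \<phi> x = 0"
proof -
  obtain K where K: "compact K" "K \<subseteq> \<Omega>" "\<And>x. x \<notin> K \<Longrightarrow> \<phi> x = 0"
    using assms by (auto simp: test_functions_def)
  have "grad \<phi> x = 0" if "x \<notin> K" for x
  proof (rule grad_eqI)
    have "open (- K)" using K(1) compact_imp_closed by blast
    have "((\<lambda>_. 0) has_derivative (\<lambda>v. (0::'a) \<bullet> v)) (at x)" by simp
    then show "(\<phi> has_derivative (\<lambda>v. 0 \<bullet> v)) (at x)"
      by (rule has_derivative_transform_within_open[OF _ \<open>open (- K)\<close>]) (use that K(3) in auto)
  qed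
  with K that show ?thesis by blast
qed

lemma test_differentiable: "\<phi> \<in> test_functions \<Omega> \<Longrightarrow> \<phi> differentiable (at x)"
  unfolding test_functions_def by (auto dest!: spec[of _ "Suc 0"])

lemma test_continuous: "\<phi> \<in> test_functions \<Omega> \<Longrightarrow> continuous_on UNIV \<phi>"
  unfolding test_functions_def by (auto dest!: spec[of _ "0::nat"])

lemma test_grad_continuous: "\<phi> \<in> test_functions \<Omega> \<Longrightarrow> continuous_on UNIV (grad \<phi>)"
  unfolding test_functions_def grad_def[abs_def]
  by (auto dest!: spec[of _ "Suc 0"] intro!: continuous_intros)

lemma test_combo:
  assumes "\<phi> \<in> test_functions \<Omega>" "\<psi> \<in> test_functions \<Omega>"
  shows "(\<lambda>x. a * \<phi> x + b * \<psi> x) \<in> test_functions \<Omega>"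
proof -
  obtain K L where K: "compact K" "K \<subseteq> \<Omega>" "\<And>x. x \<notin> K \<Longrightarrow> \<phi> x = 0"
    and L: "compact L" "L \<subseteq> \<Omega>" "\<And>x. x \<notin> L \<Longrightarrow> \<psi> x = 0"
    using assms by (auto simp: test_functions_def)
  then have "compact (K \<union> L) \<and> K \<union> L \<subseteq> \<Omega> \<and> (\<forall>x. x \<notin> K \<union> L \<longrightarrow> a * \<phi> x + b * \<psi> x = 0)"
    by (auto intro: compact_Un)
  with assms show ?thesis
    unfolding test_functions_def
    by (intro CollectI conjI exI[of _ "K \<union> L"] allI class_C_add class_C_mult class_C_const) auto
qed

lemma grad_combo:
  assumes "\<phi> \<in> test_functions \<Omega>" "\<psi> \<in> test_functions \<Omega>"
  shows "grad (\<lambda>x. a * \<phi> x + b * \<psi> x) x = a *\<^sub>R grad \<phi> x + b *\<^sub>R grad \<psi> x"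
  using assms by (intro grad_eqI)
    (auto intro!: derivative_eq_intros grad_derivative test_differentiable simp: inner_add_left)

lemma test_zero: "(\<lambda>_. 0) \<in> test_functions \<Omega>"
  unfolding test_functions_def by (auto intro: class_C_const exI[of _ "{}"])

lemma grad_zero: "grad (\<lambda>_. 0) x = 0"
  by (rule grad_eqI) simp

lemma compact_support_integrable:
  fixes f :: "'a::euclidean_space \<Rightarrow> 'b::euclidean_space"
  assumes f: "continuous_on UNIV f" and K: "compact K" "\<And>x. x \<notin> K \<Longrightarrow> f x = 0"
  shows "integrable lborel f"
proof -
  have "integrable lborel (\<lambda>x. indicator K x *\<^sub>R f x)"
    by (rule borel_integrable_compact[OF K(1)]) (rule continuous_on_subset[OF f], simp)
  also have "(\<lambda>x. indicator K x *\<^sub>R f x) = f"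
    using K(2) by (auto simp: indicator_def)
  finally show ?thesis .
qed

lemma lborel_integral_translate:
  fixes f :: "'a::euclidean_space \<Rightarrow> 'b::euclidean_space"
  assumes [measurable]: "f \<in> borel_measurable borel"
  shows "(\<integral>x. f (c + x) \<partial>lborel) = (\<integral>x. f x \<partial>lborel)"
proof -
  have "(\<integral>x. f x \<partial>lborel) = (\<integral>x. f x \<partial>distr lborel borel ((+) c))"
    by (simp add: lborel_distr_plus)
  also have "\<dots> = (\<integral>x. f (c + x) \<partial>lborel)"
    by (rule integral_distr) auto
  finally show ?thesis by simp
qed

text \<open>The integral of a directional derivative vanishes: it is the limit of the integrals of the
  difference quotients, which vanish by translation invariance.\<close>

lemma integral_derivative_eq_0:
  fixes F :: "'a::euclidean_space \<Rightarrow> real" and e :: 'a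
  assumes d: "\<And>x. (F has_derivative (\<lambda>v. G x \<bullet> v)) (at x)" and G: "continuous_on UNIV G"
    and K: "compact K" "\<And>x. x \<notin> K \<Longrightarrow> F x = 0"
  shows "(\<integral>x. G x \<bullet> e \<partial>lborel) = 0"
proof -
  have cF: "continuous_on UNIV F"
    using d by (auto simp: continuous_on_eq_continuous_at intro: has_derivative_continuous)
  have [measurable]: "F \<in> borel_measurable borel" "G \<in> borel_measurable borel"
    using cF G by (auto intro: borel_measurable_continuous_onI)
  obtain b where b: "\<And>x. x \<in> K \<Longrightarrow> norm x \<le> b"
    using compact_imp_bounded[OF K(1)] unfolding bounded_iff by auto
  define L where "L = cball (0::'a) (b + norm e)"
  have L: "compact L" by (simp add: L_def)
  have "bounded (G ` cball 0 (b + 2 * norm e))"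
    by (intro compact_imp_bounded compact_continuous_image continuous_on_subset[OF G]) auto
  then obtain B where B: "\<And>x. norm x \<le> b + 2 * norm e \<Longrightarrow> norm (G x) \<le> B"
    unfolding bounded_iff by fastforce
  define s where "s k x = real (Suc k) * (F (inverse (real (Suc k)) *\<^sub>R e + x) - F x)" for k x
  have iF: "integrable lborel F"
    by (rule compact_support_integrable[OF cF K])
  have int0: "(\<integral>x. s k x \<partial>lborel) = 0" for k
  proof -
    have "integrable lborel (\<lambda>x. F (inverse (real (Suc k)) *\<^sub>R e + x))"
    proof (rule compact_support_integrable)
      show "continuous_on UNIV (\<lambda>x. F (inverse (real (Suc k)) *\<^sub>R e + x))"
        by (intro continuous_on_compose2[OF cF] continuous_intros) auto
      show "compact ((\<lambda>x. x - inverse (real (Suc k)) *\<^sub>R e) ` K)"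
        by (intro compact_continuous_image K(1) continuous_intros)
      show "F (inverse (real (Suc k)) *\<^sub>R e + x) = 0"
        if "x \<notin> (\<lambda>x. x - inverse (real (Suc k)) *\<^sub>R e) ` K" for x
        using that by (intro K(2)) (auto simp: image_iff algebra_simps)
    qed
    then show ?thesis
      unfolding s_def using iF by (simp add: lborel_integral_translate)
  qed
  have lim: "(\<lambda>k. s k x) \<longlonglongrightarrow> G x \<bullet> e" for x
  proof -
    have "((\<lambda>t. F (x + t *\<^sub>R e)) has_derivative (\<lambda>t. G x \<bullet> (t *\<^sub>R e))) (at 0)"
      by (rule has_derivative_compose[of "\<lambda>t. x + t *\<^sub>R e" "\<lambda>t. t *\<^sub>R e" 0 UNIV F "\<lambda>v. G x \<bullet> v"])
        (auto intro!: derivative_eq_intros d[of "x + 0", simplified])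
    then have "((\<lambda>t. F (x + t *\<^sub>R e)) has_real_derivative (G x \<bullet> e)) (at 0)"
      unfolding has_field_derivative_def by (rule has_derivative_eq_rhs) (auto simp: mult.commute)
    then have D: "((\<lambda>t. (F (x + t *\<^sub>R e) - F x) / t) \<longlongrightarrow> G x \<bullet> e) (at 0)"
      by (simp add: has_field_derivative_iff)
    have "filterlim (\<lambda>k. inverse (real (Suc k))) (at 0) sequentially"
      unfolding filterlim_at using LIMSEQ_inverse_real_of_nat by auto
    from filterlim_compose[OF D this] show ?thesis
      by (simp add: s_def divide_inverse mult.commute add.commute)
  qed
  have bound: "norm (s k x) \<le> indicator L x * (B * norm e)" for k x
  proof (cases "x \<in> L")
    case False
    let ?h = "inverse (real (Suc k)) *\<^sub>R e"
    have h: "norm ?h \<le> norm e"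
      using mult_left_le_one_le[of "norm e" "inverse (real (Suc k))"] by (simp add: field_simps)
    have "norm x > b + norm e" using False by (simp add: L_def)
    moreover have "norm (?h + x) \<ge> norm x - norm ?h"
      by (metis add.commute norm_diff_ineq)
    ultimately have "norm (?h + x) > b" "norm x > b" 
      using h norm_ge_zero[of e] by linarith+
    then have "F (?h + x) = 0" "F x = 0" using b K(2) by fastforce+
    then show ?thesis by (simp add: s_def False)
  next
    case True
    let ?h = "inverse (real (Suc k)) *\<^sub>R e"
    have h: "norm ?h \<le> norm e"
      using mult_left_le_one_le[of "norm e" "inverse (real (Suc k))"] by (simp add: field_simps)
    have x: "norm x \<le> b + norm e" using True by (simp add: L_def)
    have "norm (F (?h + x) - F x) \<le> B * norm (?h + x - x)"
    proof (rule differentiable_bound[where S="cball 0 (b + 2 * norm e)"])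
      show "convex (cball (0::'a) (b + 2 * norm e))" by simp
      show "(F has_derivative (\<lambda>v. G y \<bullet> v)) (at y within cball 0 (b + 2 * norm e))" for y
        using d has_derivative_at_withinI by blast
      show "onorm (\<lambda>v. G y \<bullet> v) \<le> B" if "y \<in> cball 0 (b + 2 * norm e)" for y
      proof (rule onorm_le)
        fix v have "norm (G y \<bullet> v) \<le> norm (G y) * norm v" by (simp add: Cauchy_Schwarz_ineq2)
        also have "\<dots> \<le> B * norm v" using that by (intro mult_right_mono B) auto
        finally show "norm (G y \<bullet> v) \<le> B * norm v" .
      qed
      have "norm (?h + x) \<le> norm ?h + norm x" by (rule norm_triangle_ineq)
      then show "?h + x \<in> cball 0 (b + 2 * norm e)" using h x by auto
      show "x \<in> cball 0 (b + 2 * norm e)" using x by simp (smt (verit) norm_ge_zero)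
    qed
    then have "real (Suc k) * norm (F (?h + x) - F x) \<le> real (Suc k) * (B * norm ?h)"
      by (intro mult_left_mono) auto
    also have "\<dots> = B * norm e" by (simp add: field_simps)
    finally show ?thesis using True by (simp add: s_def abs_mult)
  qed
  have "(\<lambda>k. \<integral>x. s k x \<partial>lborel) \<longlonglongrightarrow> (\<integral>x. G x \<bullet> e \<partial>lborel)"
  proof (rule integral_dominated_convergence)
    have "integrable lborel (indicator L :: 'a \<Rightarrow> real)"
      using compact_imp_closed[OF L] emeasure_bounded_finite[OF compact_imp_bounded[OF L]]
      by (intro integrable_real_indicator) auto
    then show "integrable lborel (\<lambda>x. indicator L x * (B * norm e))" by simp
    show "AE x in lborel. (\<lambda>k. s k x) \<longlonglongrightarrow> G x \<bullet> e" using lim by auto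
    show "AE x in lborel. norm (s k x) \<le> indicator L x * (B * norm e)" for k using bound by auto
  qed (auto simp: s_def[abs_def])
  then show ?thesis using int0 by (simp add: LIMSEQ_const_iff)
qed

lemma test_integration_by_parts:
  fixes \<phi> \<psi> :: "'a::euclidean_space \<Rightarrow> real"
  assumes "\<phi> \<in> test_functions \<Omega>" "\<psi> \<in> test_functions \<Omega>"
  shows "(\<integral>x. \<phi> x * (grad \<psi> x \<bullet> e) \<partial>lborel) = - (\<integral>x. (grad \<phi> x \<bullet> e) * \<psi> x \<partial>lborel)"
proof -
  note c = test_continuous[OF assms(1)] test_continuous[OF assms(2)]
    test_grad_continuous[OF assms(1)] test_grad_continuous[OF assms(2)]
  obtain K where K: "compact K" "\<And>x. x \<notin> K \<Longrightarrow> \<phi> x = 0" "\<And>x. x \<notin> K \<Longrightarrow> grad \<phi> x = 0"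
    using test_functionsE[OF assms(1)] by metis
  have "(\<integral>x. (\<phi> x *\<^sub>R grad \<psi> x + \<psi> x *\<^sub>R grad \<phi> x) \<bullet> e \<partial>lborel) = 0"
  proof (rule integral_derivative_eq_0)
    show "((\<lambda>x. \<phi> x * \<psi> x) has_derivative (\<lambda>v. (\<phi> x *\<^sub>R grad \<psi> x + \<psi> x *\<^sub>R grad \<phi> x) \<bullet> v)) (at x)" for x
      by (rule has_derivative_eq_rhs[OF has_derivative_mult[OF grad_derivative grad_derivative]])
        (auto simp: inner_add_left mult.commute intro: assms test_differentiable)
  qed (use K c in \<open>auto intro!: continuous_intros\<close>)
  moreover have "integrable lborel (\<lambda>x. \<phi> x * (grad \<psi> x \<bullet> e))"
      "integrable lborel (\<lambda>x. (grad \<phi> x \<bullet> e) * \<psi> x)"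
    by (intro compact_support_integrable[OF _ K(1)]; use K c in \<open>auto intro!: continuous_intros\<close>)+
  ultimately show ?thesis by (simp add: inner_add_left mult.commute)
qed

text \<open>These functions vanish to infinite order at the origin; the family is closed under
  differentiation up to linear combinations.\<close>

definition flat :: "nat \<Rightarrow> real \<Rightarrow> real" where
  "flat m t = (if t > 0 then (1 / t) ^ m * exp (- (1 / t)) else 0)"

lemma flat_deriv: "(flat m has_real_derivative (flat (m + 2) t - m * flat (m + 1) t)) (at t)"
proof -
  consider "t > 0" | "t < 0" | "t = 0" by linarith
  then show ?thesis
  proof cases
    case 1
    have d: "((\<lambda>t. 1 / t) has_real_derivative - (1 / t)\<^sup>2) (at t)"
      using 1 by (auto intro!: derivative_eq_intros simp: power2_eq_square)
    have e: "((\<lambda>t. exp (- (1 / t))) has_real_derivative exp (- (1 / t)) * (1 / t)\<^sup>2) (at t)"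
      using DERIV_chain2[OF DERIV_exp DERIV_minus[OF d]] by simp
    have "((\<lambda>t. (1 / t) ^ m * exp (- (1 / t))) has_real_derivative
        ((1 / t) ^ (m + 2) * exp (- (1 / t)) - m * ((1 / t) ^ (m + 1) * exp (- (1 / t))))) (at t)"
      by (rule DERIV_cong[OF DERIV_mult[OF DERIV_power[OF d] e]])
        (cases m; simp add: algebra_simps power2_eq_square)
    then have "(flat m has_real_derivative
        ((1 / t) ^ (m + 2) * exp (- (1 / t)) - m * ((1 / t) ^ (m + 1) * exp (- (1 / t))))) (at t)"
      by (rule has_field_derivative_transform_within_open[where S="{0<..}"]) (use 1 in \<open>auto simp: flat_def\<close>)
    then show ?thesis using 1 by (simp add: flat_def)
  next
    case 2
    have "((\<lambda>_. 0) has_real_derivative 0) (at t)" by simp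
    then have "(flat m has_real_derivative 0) (at t)"
      by (rule has_field_derivative_transform_within_open[where S="{..<0}"]) (use 2 in \<open>auto simp: flat_def\<close>)
    then show ?thesis using 2 by (simp add: flat_def)
  next
    case 3
    have "((\<lambda>h. flat m h / h) \<longlongrightarrow> 0) (at_left 0)"
      by (rule tendsto_eventually) (auto simp: eventually_at_filter flat_def)
    moreover have "((\<lambda>h. flat m h / h) \<longlongrightarrow> 0) (at_right 0)"
    proof -
      have "((\<lambda>h. inverse h ^ (m + 1) / exp (inverse h)) \<longlongrightarrow> 0) (at_right (0::real))"
        by (rule filterlim_compose[OF tendsto_power_div_exp_0 filterlim_inverse_at_top_right])
      then show ?thesis
        by (rule Lim_transform_eventually)
          (auto simp: eventually_at_filter flat_def exp_minus field_simps)
    qed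
    ultimately have "((\<lambda>h. flat m h / h) \<longlongrightarrow> 0) (at 0)"
      by (simp add: filterlim_split_at)
    then show ?thesis by (simp add: 3 has_field_derivative_iff flat_def)
  qed
qed

lemma flat_class_C: "class_C k (\<lambda>x::'a::euclidean_space. flat m (c * (x \<bullet> i) + b))"
proof (induction k arbitrary: m)
  case 0
  have "continuous_on UNIV (flat m)"
    by (auto simp: continuous_on_eq_continuous_at intro!: DERIV_isCont[OF flat_deriv])
  then show ?case
    by (auto intro!: continuous_on_compose2[of UNIV "flat m"] continuous_intros)
next
  case (Suc k)
  have D: "((\<lambda>x::'a. flat m (c * (x \<bullet> i) + b)) has_derivative
      (\<lambda>v. (c * (v \<bullet> i)) * (flat (m + 2) (c * (x \<bullet> i) + b) + - m * flat (m + 1) (c * (x \<bullet> i) + b)))) (at x)" for x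
  proof -
    have "((\<lambda>x::'a. flat m (c * (x \<bullet> i) + b)) has_derivative
      (\<lambda>v. (flat (m + 2) (c * (x \<bullet> i) + b) - m * flat (m + 1) (c * (x \<bullet> i) + b)) * (c * (v \<bullet> i)))) (at x)"
      by (rule has_derivative_compose[OF _ flat_deriv[unfolded has_field_derivative_def]])
        (auto intro!: derivative_eq_intros)
    then show ?thesis by (rule has_derivative_eq_rhs) (auto simp: algebra_simps)
  qed
  show ?case
    unfolding class_C.simps frechet_derivative_eqI[OF D]
    using D Suc by (intro conjI allI class_C_mult class_C_const class_C_add) (auto simp only: differentiable_def)
qed

text \<open>The coordinatewise sharpening by the factor \<open>Suc j\<close> makes the bumps converge to the indicator of the
  open box.\<close>

definition bump :: "'a::euclidean_space \<Rightarrow> 'a \<Rightarrow> nat \<Rightarrow> 'a \<Rightarrow> real" where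
  "bump a b j x = (\<Prod>i\<in>Basis. flat 0 (real (Suc j) * (x \<bullet> i) + - real (Suc j) * (a \<bullet> i))
                 * flat 0 (- real (Suc j) * (x \<bullet> i) + real (Suc j) * (b \<bullet> i)))"

lemma flat0_bounds: "0 \<le> flat 0 t" "flat 0 t \<le> 1"
  by (auto simp: flat_def)

lemma bump_bounds: "0 \<le> bump a b j x" "bump a b j x \<le> 1"
  unfolding bump_def by (auto intro!: prod_nonneg prod_le_1 mult_nonneg_nonneg mult_le_one flat0_bounds)

lemma bump_outside: "x \<notin> box a b \<Longrightarrow> bump a b j x = 0"
proof -
  assume "x \<notin> box a b"
  then obtain i where i: "i \<in> Basis" "x \<bullet> i \<le> a \<bullet> i \<or> b \<bullet> i \<le> x \<bullet> i"
    by (auto simp: mem_box not_less)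
  then have "real (Suc j) * (x \<bullet> i) + - real (Suc j) * (a \<bullet> i) \<le> 0 \<or>
      - real (Suc j) * (x \<bullet> i) + real (Suc j) * (b \<bullet> i) \<le> 0"
    using mult_left_mono[of "x \<bullet> i" "a \<bullet> i" "real (Suc j)"]
      mult_left_mono[of "b \<bullet> i" "x \<bullet> i" "real (Suc j)"]
    by (auto simp del: of_nat_Suc)
  then show ?thesis unfolding bump_def using i(1) by (auto intro!: bexI[of _ i] simp: flat_def)
qed

lemma bump_test:
  assumes "cbox a b \<subseteq> \<Omega>"
  shows "bump a b j \<in> test_functions \<Omega>"
proof -
  have "class_C k (bump a b j)" for k
    unfolding bump_def[abs_def] by (intro class_C_prod class_C_mult flat_class_C) auto
  moreover have "bump a b j x = 0" if "x \<notin> cbox a b" for x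
    using that box_subset_cbox[of a b] bump_outside by blast
  ultimately show ?thesis
    using assms unfolding test_functions_def by (auto intro!: exI[of _ "cbox a b"])
qed

lemma bump_limit: "(\<lambda>j. bump a b j x) \<longlonglongrightarrow> indicator (box a b) x"
proof (cases "x \<in> box a b")
  case True
  have *: "(\<lambda>j. flat 0 (real (Suc j) * d)) \<longlonglongrightarrow> 1" if "d > 0" for d :: real
  proof -
    have "(\<lambda>j. exp (- (inverse (real (Suc j)) * inverse d))) \<longlonglongrightarrow> exp (- (0 * inverse d))"
      by (intro tendsto_intros LIMSEQ_inverse_real_of_nat)
    then show ?thesis using that by (simp add: flat_def divide_inverse)
  qed
  have "(\<lambda>j. bump a b j x) \<longlonglongrightarrow> (\<Prod>i\<in>(Basis::'a set). 1 * 1)"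
    unfolding bump_def
  proof (intro tendsto_prod tendsto_mult)
    fix i :: 'a assume i: "i \<in> Basis"
    have "0 < x \<bullet> i - a \<bullet> i" "0 < b \<bullet> i - x \<bullet> i" using True i by (auto simp: mem_box)
    from this[THEN *]
    show "(\<lambda>j. flat 0 (real (Suc j) * (x \<bullet> i) + - real (Suc j) * (a \<bullet> i))) \<longlonglongrightarrow> 1"
      "(\<lambda>j. flat 0 (- real (Suc j) * (x \<bullet> i) + real (Suc j) * (b \<bullet> i))) \<longlonglongrightarrow> 1"
      by (simp_all add: algebra_simps)
  qed
  then show ?thesis using True by simp
qed (simp add: bump_outside)

section \<open>The fundamental lemma of the calculus of variations\<close>

lemma integral_lebesgue_on_eq_lborel:
  fixes f :: "'a::euclidean_space \<Rightarrow> 'b::euclidean_space"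
  assumes \<Omega>: "\<Omega> \<in> sets lebesgue" and f: "f \<in> borel_measurable borel" "\<And>x. x \<notin> \<Omega> \<Longrightarrow> f x = 0"
  shows "(\<integral>x. f x \<partial>lebesgue_on \<Omega>) = (\<integral>x. f x \<partial>lborel)"
    and "integrable (lebesgue_on \<Omega>) f \<longleftrightarrow> integrable lborel f"
proof -
  have *: "(\<lambda>x. indicator \<Omega> x *\<^sub>R f x) = f" using f(2) by (auto simp: indicator_def)
  have f': "f \<in> borel_measurable lborel" using f(1) by simp
  show "(\<integral>x. f x \<partial>lebesgue_on \<Omega>) = (\<integral>x. f x \<partial>lborel)"
    using \<Omega> integral_completion[OF f'] by (subst integral_restrict_space) (auto simp: *)
  show "integrable (lebesgue_on \<Omega>) f \<longleftrightarrow> integrable lborel f"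
    using \<Omega> integrable_completion[OF f'] by (subst integrable_restrict_space) (auto simp: *)
qed

text \<open>The boxes form an intersection-stable generator of the Borel sets.\<close>

lemma integrable_lborel_0_if_boxes:
  fixes f :: "'a::euclidean_space \<Rightarrow> real"
  assumes f: "integrable lborel f" and box: "\<And>c d. (\<integral>x. indicator (box c d) x * f x \<partial>lborel) = 0"
    and tot: "(\<integral>x. f x \<partial>lborel) = 0"
  shows "AE x in lborel. f x = 0"
proof (rule sigma_finite_measure.density_zero[OF sigma_finite_lborel f])
  fix A :: "'a set" assume "A \<in> sets lborel"
  then have A: "A \<in> sigma_sets UNIV (range (\<lambda>(a, b). box a b))"
    by (simp add: borel_eq_box)
  have borel: "B \<in> sets lborel" if "B \<in> sigma_sets UNIV (range (\<lambda>(a, b). box a b))" for B :: "'a set"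
    using that by (simp add: borel_eq_box)
  have "Int_stable (range (\<lambda>(a, b::'a). box a b))" "range (\<lambda>(a, b::'a). box a b) \<subseteq> Pow UNIV"
    by (auto simp: Int_stable_def box_Int_box)
  then show "set_lebesgue_integral lborel A f = 0" using A
  proof (induction rule: sigma_sets_induct_disjoint)
    case (basic A)
    then show ?case using box by (auto simp: set_lebesgue_integral_def)
  next
    case (compl A)
    have "(\<integral>x\<in>UNIV - A. f x \<partial>lborel) = (\<integral>x. f x - indicator A x *\<^sub>R f x \<partial>lborel)"
      unfolding set_lebesgue_integral_def
      by (rule Bochner_Integration.integral_cong) (auto simp: indicator_def)
    also have "\<dots> = (\<integral>x. f x \<partial>lborel) - (\<integral>x. indicator A x *\<^sub>R f x \<partial>lborel)"
      by (rule Bochner_Integration.integral_diff[OF f integrable_mult_indicator[OF borel[OF compl(1)] f]])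
    finally show ?case using compl tot by (simp add: set_lebesgue_integral_def)
  next
    case (union A)
    have "set_lebesgue_integral lborel (\<Union>i. A i) f = (\<Sum>i. set_lebesgue_integral lborel (A i) f)"
    proof (rule lebesgue_integral_countable_add)
      show "A i \<in> sets lborel" for i using union borel by auto
      show "A i \<inter> A j = {}" if "i \<noteq> j" for i j using union that by (auto simp: disjoint_family_on_def)
      show "set_integrable lborel (\<Union>i. A i) f"
        unfolding set_integrable_def
        using union borel by (intro integrable_mult_indicator[OF _ f] sets.countable_UN) (simp add: image_subset_iff)
    qed
    with union show ?case by simp
  qed (simp add: set_lebesgue_integral_def)
qed

lemma integrable_mult_compact_support:
  fixes U :: "'a::euclidean_space \<Rightarrow> 'b::euclidean_space"
  assumes \<Omega>: "open \<Omega>" and U: "locally_integrable \<Omega> U"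
    and f: "continuous_on UNIV (f :: 'a \<Rightarrow> real)" and K: "compact K" "K \<subseteq> \<Omega>" "\<And>x. x \<notin> K \<Longrightarrow> f x = 0"
  shows "integrable (lebesgue_on \<Omega>) (\<lambda>x. f x *\<^sub>R U x)"
proof -
  have KL: "K \<in> sets lebesgue" "\<Omega> \<in> sets lebesgue"
    using compact_imp_closed[OF K(1)] \<Omega> by auto
  have "integrable (lebesgue_on K) U" using U K by (auto simp: locally_integrable_def)
  then have UK: "integrable lebesgue (\<lambda>x. indicator K x *\<^sub>R U x)"
    using KL by (subst (asm) integrable_restrict_space) auto
  have "bounded (f ` K)" using K f by (intro compact_imp_bounded compact_continuous_image continuous_on_subset[OF f]) auto
  then obtain B where B: "\<And>x. x \<in> K \<Longrightarrow> \<bar>f x\<bar> \<le> B" unfolding bounded_iff by fastforce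
  have [measurable]: "f \<in> borel_measurable lebesgue"
    using borel_measurable_continuous_onI[OF f] by (simp add: measurable_completion)
  have "integrable lebesgue (\<lambda>x. f x *\<^sub>R (indicator K x *\<^sub>R U x))"
  proof (rule Bochner_Integration.integrable_bound)
    show "integrable lebesgue (\<lambda>x. B *\<^sub>R (indicator K x *\<^sub>R U x))" using UK by (intro integrable_scaleR_right)
    show "AE x in lebesgue. norm (f x *\<^sub>R indicat_real K x *\<^sub>R U x) \<le> norm (B *\<^sub>R indicat_real K x *\<^sub>R U x)"
      using B by (intro AE_I2) (auto simp: indicator_def intro!: mult_right_mono intro: order_trans[OF _ abs_ge_self])
    show "(\<lambda>x. f x *\<^sub>R indicat_real K x *\<^sub>R U x) \<in> borel_measurable lebesgue"
      by (rule borel_measurable_scaleR[OF _ borel_measurable_integrable[OF UK]]) simp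
  qed
  also have "(\<lambda>x. f x *\<^sub>R (indicator K x *\<^sub>R U x)) = (\<lambda>x. indicator \<Omega> x *\<^sub>R (f x *\<^sub>R U x))"
    using K by (auto simp: indicator_def fun_eq_iff)
  finally show ?thesis
    using KL by (subst integrable_restrict_space) auto
qed

text \<open>Bumps approximate indicators of boxes, so a function orthogonal to all test functions has
  vanishing integral over every box compactly contained in \<open>\<Omega>\<close>.\<close>

lemma fundamental_lemma:
  fixes h :: "'a::euclidean_space \<Rightarrow> real"
  assumes \<Omega>: "open \<Omega>" and h: "locally_integrable \<Omega> h"
    and orth: "\<And>\<phi>. \<phi> \<in> test_functions \<Omega> \<Longrightarrow> (\<integral>x. h x * \<phi> x \<partial>lebesgue_on \<Omega>) = 0"
  shows "AE x in lebesgue_on \<Omega>. h x = 0"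
proof -
  have \<Omega>L: "\<Omega> \<in> sets lebesgue" using \<Omega> by auto
  have box0: "AE x in lebesgue. x \<in> cbox a b \<longrightarrow> h x = 0" if ab: "cbox a b \<subseteq> \<Omega>" for a b
  proof -
    define f where "f x = indicator (box a b) x * h x" for x
    have "integrable (lebesgue_on (cbox a b)) h" using h ab by (auto simp: locally_integrable_def)
    then have ih: "integrable lebesgue (\<lambda>x. indicator (cbox a b) x * h x)"
      by (subst (asm) integrable_restrict_space) auto
    have "integrable lebesgue (\<lambda>x. indicator (box a b) x *\<^sub>R (indicator (cbox a b) x * h x))"
      using ih by (intro integrable_mult_indicator) auto
    also have "(\<lambda>x. indicator (box a b) x *\<^sub>R (indicator (cbox a b) x * h x)) = f"
      using box_subset_cbox[of a b] by (auto simp: f_def indicator_def fun_eq_iff)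
    finally have f: "integrable lebesgue f" .
    have int0: "(\<integral>x. indicator (box c d) x * f x \<partial>lebesgue) = 0" for c d
    proof -
      obtain e g where eg: "box c d \<inter> box a b = box e g" by (rule that[OF box_Int_box])
      show ?thesis
      proof (cases "box e g = {}")
        case True
        then have "(\<lambda>x. indicator (box c d) x * f x) = (\<lambda>_. 0)"
          using eg by (auto simp: f_def indicator_def fun_eq_iff)
        then show ?thesis by simp
      next
        case False
        have "box e g \<subseteq> box a b" using eg by blast
        then have "cbox e g \<subseteq> cbox a b" using False closure_mono[of "box e g" "box a b"]
          by (cases "box a b = {}") (auto simp: closure_box)
        then have sub: "cbox e g \<subseteq> \<Omega>" using ab by blast
        have [measurable]: "bump e g j \<in> borel_measurable lebesgue" for j
          using borel_measurable_continuous_onI[OF test_continuous[OF bump_test[OF sub]]]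
          by (simp add: measurable_completion)
        have "(\<lambda>j. \<integral>x. bump e g j x * (indicator (cbox a b) x * h x) \<partial>lebesgue)
            \<longlonglongrightarrow> (\<integral>x. indicator (box e g) x * (indicator (cbox a b) x * h x) \<partial>lebesgue)"
        proof (rule integral_dominated_convergence)
          show "integrable lebesgue (\<lambda>x. norm (indicator (cbox a b) x * h x))"
            using ih by (rule integrable_norm)
          show "AE x in lebesgue. (\<lambda>j. bump e g j x * (indicator (cbox a b) x * h x))
              \<longlonglongrightarrow> indicator (box e g) x * (indicator (cbox a b) x * h x)"
            by (intro AE_I2 tendsto_mult_right bump_limit)
          show "AE x in lebesgue. norm (bump e g j x * (indicator (cbox a b) x * h x))
              \<le> norm (indicator (cbox a b) x * h x)" for j
            using bump_bounds[of e g j] by (intro AE_I2) (auto simp: norm_mult abs_mult intro!: mult_left_le_one_le)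
        qed (use borel_measurable_integrable[OF ih] in \<open>auto intro!: borel_measurable_times borel_measurable_indicator\<close>)
        moreover have "(\<integral>x. bump e g j x * (indicator (cbox a b) x * h x) \<partial>lebesgue) = 0" for j
        proof -
          have "(\<integral>x. bump e g j x * (indicator (cbox a b) x * h x) \<partial>lebesgue)
              = (\<integral>x. indicator \<Omega> x *\<^sub>R (h x * bump e g j x) \<partial>lebesgue)"
            using \<open>box e g \<subseteq> box a b\<close> box_subset_cbox[of a b] ab bump_outside[of _ e g j]
            by (intro Bochner_Integration.integral_cong) (auto simp: indicator_def)
          also have "\<dots> = (\<integral>x. h x * bump e g j x \<partial>lebesgue_on \<Omega>)"
            using \<Omega>L by (subst integral_restrict_space) auto
          finally show ?thesis using orth[OF bump_test[OF sub]] by simp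
        qed
        ultimately have "(\<integral>x. indicator (box e g) x * (indicator (cbox a b) x * h x) \<partial>lebesgue) = 0"
          by (simp add: LIMSEQ_const_iff)
        moreover have "indicator (box c d) x * f x = indicator (box e g) x * (indicator (cbox a b) x * h x)" for x
          unfolding f_def eg[symmetric] using box_subset_cbox[of a b] by (auto simp: indicator_def)
        ultimately show ?thesis by simp
      qed
    qed
    obtain f' where f': "f' \<in> borel_measurable lborel" "AE x in lborel. f x = f' x"
      using completion_ex_borel_measurable_real[OF borel_measurable_integrable[OF f]] by auto
    then have [measurable]: "f' \<in> borel_measurable borel" by simp
    have ae: "AE x in lebesgue. f x = f' x" using f'(2) by (rule AE_completion)
    have [measurable]: "f' \<in> borel_measurable lebesgue" using f'(1) by (rule measurable_completion)
    note [measurable] = borel_measurable_integrable[OF f]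
    have "integrable lebesgue f'"
      using f integrable_cong_AE[OF _ _ ae] by auto
    then have i': "integrable lborel f'" using integrable_completion[OF f'(1)] by simp
    have z: "(\<integral>x. indicator (box c d) x * f' x \<partial>lborel) = 0" for c d
    proof -
      have "(\<integral>x. indicator (box c d) x * f' x \<partial>lborel) = (\<integral>x. indicator (box c d) x * f' x \<partial>lebesgue)"
        by (rule integral_completion[symmetric]) simp
      also have "\<dots> = (\<integral>x. indicator (box c d) x * f x \<partial>lebesgue)"
        by (rule integral_cong_AE; (intro borel_measurable_times borel_measurable_indicator)?) (use ae f in auto)
      finally show ?thesis using int0 by simp
    qed
    have "(\<integral>x. f' x \<partial>lborel) = (\<integral>x. f' x \<partial>lebesgue)"
      by (rule integral_completion[symmetric]) simp
    also have "\<dots> = (\<integral>x. indicator (box a b) x * f x \<partial>lebesgue)"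
    proof (rule integral_cong_AE)
      show "(\<lambda>x. indicator (box a b) x * f x) \<in> borel_measurable lebesgue"
        by (intro borel_measurable_times borel_measurable_indicator borel_measurable_integrable[OF f]) simp
      show "AE x in lebesgue. f' x = indicator (box a b) x * f x"
        using ae by eventually_elim (auto simp: f_def indicator_def)
    qed simp
    finally have "(\<integral>x. f' x \<partial>lborel) = 0" using int0 by simp
    from integrable_lborel_0_if_boxes[OF i' z this] have "AE x in lborel. f' x = 0" .
    then have "AE x in lebesgue. f' x = 0" by (rule AE_completion)
    moreover have "AE x in lebesgue. x \<notin> cbox a b - box a b"
      using negligible_frontier_interval[of a b] unfolding negligible_iff_null_sets by (rule AE_not_in)
    ultimately show ?thesis using ae by eventually_elim (auto simp: f_def)
  qed
  obtain \<D> where \<D>: "countable \<D>" "\<D> \<subseteq> Pow \<Omega>" "\<And>X. X \<in> \<D> \<Longrightarrow> \<exists>a b. X = cbox a b" "\<Union>\<D> = \<Omega>"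
    using open_countable_Union_open_cbox[OF \<Omega>] by metis
  have "AE x in lebesgue. x \<in> X \<longrightarrow> h x = 0" if XD: "X \<in> \<D>" for X
  proof -
    obtain a b where X: "X = cbox a b" using \<D>(3)[OF XD] by blast
    have "cbox a b \<subseteq> \<Omega>" using \<D>(2) XD X by blast
    from box0[OF this] show ?thesis by (simp add: X)
  qed
  then have "AE x in lebesgue. \<forall>X\<in>\<D>. x \<in> X \<longrightarrow> h x = 0"
    unfolding AE_ball_countable[OF \<D>(1)] by blast
  then have "AE x in lebesgue. x \<in> \<Omega> \<longrightarrow> h x = 0"
    by (rule AE_mp) (rule AE_I2, use \<D>(4) in blast)
  moreover have "\<Omega> \<inter> space lebesgue \<in> sets lebesgue" using \<Omega>L by simp
  ultimately show ?thesis by (simp add: AE_restrict_space_iff)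
qed

lemma weak_gradient_unique:
  fixes u :: "'a::euclidean_space \<Rightarrow> real"
  assumes \<Omega>: "open \<Omega>" and U: "weak_gradient \<Omega> u U" and V: "weak_gradient \<Omega> u V"
  shows "AE x in lebesgue_on \<Omega>. U x = V x"
proof -
  have lU: "locally_integrable \<Omega> U" and lV: "locally_integrable \<Omega> V"
    using U V by (auto simp: weak_gradient_def)
  have "AE x in lebesgue_on \<Omega>. (U x - V x) \<bullet> i = 0" if i: "i \<in> Basis" for i
  proof (rule fundamental_lemma[OF \<Omega>])
    show "locally_integrable \<Omega> (\<lambda>x. (U x - V x) \<bullet> i)"
      using lU lV by (auto simp: locally_integrable_def)
    fix \<phi> assume \<phi>: "\<phi> \<in> test_functions \<Omega>"
    obtain K where K: "compact K" "K \<subseteq> \<Omega>" "\<And>x. x \<notin> K \<Longrightarrow> \<phi> x = 0"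
      using test_functionsE[OF \<phi>] by metis
    note int = integrable_mult_compact_support[OF \<Omega> _ test_continuous[OF \<phi>] K]
    have "integrable (lebesgue_on \<Omega>) (\<lambda>x. (\<phi> x *\<^sub>R U x) \<bullet> i)" "integrable (lebesgue_on \<Omega>) (\<lambda>x. (\<phi> x *\<^sub>R V x) \<bullet> i)"
      using integrable_inner_left[OF int[OF lU]] integrable_inner_left[OF int[OF lV]] by blast+
    then have "(\<integral>x. (U x - V x) \<bullet> i * \<phi> x \<partial>lebesgue_on \<Omega>)
        = (\<integral>x. (U x \<bullet> i) * \<phi> x \<partial>lebesgue_on \<Omega>) - (\<integral>x. (V x \<bullet> i) * \<phi> x \<partial>lebesgue_on \<Omega>)"
      by (subst Bochner_Integration.integral_diff[symmetric]) (auto simp: inner_diff_left algebra_simps)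
    also have "\<dots> = 0"
      using U V i \<phi> unfolding weak_gradient_def by (simp add: eq_neg_iff_add_eq_0 neg_eq_iff_add_eq_0)
    finally show "(\<integral>x. (U x - V x) \<bullet> i * \<phi> x \<partial>lebesgue_on \<Omega>) = 0" .
  qed
  then have "AE x in lebesgue_on \<Omega>. \<forall>i\<in>Basis. (U x - V x) \<bullet> i = 0"
    by (intro AE_finite_allI) auto
  then show ?thesis
    by eventually_elim (metis eq_iff_diff_eq_0 euclidean_all_zero_iff)
qed

lemma wgrad_eq:
  assumes "open \<Omega>" "weak_gradient \<Omega> u U"
  shows "AE x in lebesgue_on \<Omega>. wgrad \<Omega> u x = U x"
  using weak_gradient_unique[OF assms(1) _ assms(2)] someI[of "weak_gradient \<Omega> u", OF assms(2)]
  by (simp add: wgrad_def)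

section \<open>Averages along curves: Sobolev and compactness estimates for test functions\<close>

definition unif :: "'a::euclidean_space set \<Rightarrow> 'a measure" where
  "unif S = density lborel (indicator S)"

lemma sets_unif[measurable_cong, simp]: "sets (unif S) = sets borel"
  by (simp add: unif_def)

lemma space_unif[simp]: "space (unif S) = UNIV"
  by (simp add: unif_def)

lemma emeasure_unif: "S \<in> sets borel \<Longrightarrow> emeasure (unif S) UNIV = emeasure lborel S"
  by (simp add: unif_def emeasure_density)

lemma AE_unif: "S \<in> sets borel \<Longrightarrow> AE x in unif S. x \<in> S"
  unfolding unif_def by (subst AE_density) (auto split: split_indicator_asm)

lemma nn_integral_unif_le:
  assumes [measurable]: "S \<in> sets borel" "f \<in> borel_measurable borel"
  shows "(\<integral>\<^sup>+x. f x \<partial>unif S) \<le> (\<integral>\<^sup>+x. f x \<partial>lborel)"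
  by (simp add: unif_def nn_integral_density)
     (auto intro!: nn_integral_mono simp: indicator_def)

lemma nn_integral_unif:
  assumes [measurable]: "S \<in> sets borel" "f \<in> borel_measurable borel"
  shows "(\<integral>\<^sup>+x. f x \<partial>unif S) = (\<integral>\<^sup>+x. indicator S x * f x \<partial>lborel)"
  by (simp add: unif_def nn_integral_density)

abbreviation unitT :: "real measure" where
  "unitT \<equiv> unif {0..1}"

definition cubeQ :: "'a::euclidean_space set" where
  "cubeQ = cbox One (2 *\<^sub>R One)"

lemma cubeQ_borel[measurable, simp]: "cubeQ \<in> sets borel"
  by (simp add: cubeQ_def)

lemma emeasure_cubeQ: "emeasure lborel (cubeQ :: 'a::euclidean_space set) = 1"
  by (simp add: cubeQ_def emeasure_lborel_cbox_eq inner_diff_left)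

lemma norm_cubeQ: "y \<in> cubeQ \<Longrightarrow> norm (y::'a::euclidean_space) \<le> 2 * real DIM('a)"
proof -
  assume "y \<in> cubeQ"
  then have "\<bar>y \<bullet> i\<bar> \<le> 2" if "i \<in> Basis" for i
    using that by (auto simp: cubeQ_def mem_box)
  then have "(\<Sum>i\<in>Basis. \<bar>y \<bullet> i\<bar>) \<le> (\<Sum>i\<in>(Basis::'a set). 2)" by (intro sum_mono) auto
  then show ?thesis using norm_le_l1[of y] by simp
qed

lemma emeasure_unit: "emeasure (unitT) UNIV = 1"
  by (simp add: emeasure_unif)

lemma emeasure_unifQ: "emeasure (unif (cubeQ::'a::euclidean_space set)) UNIV = 1"
  by (simp add: emeasure_unif emeasure_cubeQ)

lemma finite_measure_unit: "finite_measure unitT"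
  by (rule finite_measureI) (simp add: emeasure_unit)

lemma finite_measure_unifQ: "finite_measure (unif (cubeQ::'a::euclidean_space set))"
  by (rule finite_measureI) (simp add: emeasure_unifQ)

text \<open>Young's inequality \<open>a\<^sup>r\<^sup>-\<^sup>1 f \<le> (1 - 1/r) a\<^sup>r + f\<^sup>r / r\<close>, integrated, gives Jensen's
  inequality for powers without any integrability hypothesis.\<close>

lemma young_tangent:
  fixes a f r :: real
  assumes "a > 0" "f \<ge> 0" "r \<ge> 1"
  shows "a powr (r - 1) * f \<le> (1 - 1 / r) * a powr r + f powr r / r"
proof (cases "f = 0")
  case True
  then show ?thesis using assms by simp
next
  case False
  then have f: "f > 0" using assms by simp
  have "exp ((1 - 1/r) * (r * ln a) + (1/r) * (r * ln f)) \<le> (1 - 1/r) * exp (r * ln a) + (1/r) * exp (r * ln f)"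
    using convex_onD[OF exp_convex, of "1/r" "r * ln a" "r * ln f"] assms by (simp add: algebra_simps)
  moreover have "(1 - 1/r) * (r * ln a) + (1/r) * (r * ln f) = (r - 1) * ln a + ln f"
    using assms by (simp add: field_simps)
  ultimately have "exp ((r - 1) * ln a + ln f) \<le> (1 - 1/r) * exp (r * ln a) + (1/r) * exp (r * ln f)"
    by metis
  then show ?thesis
    using assms f unfolding exp_add by (simp add: powr_def)
qed

lemma jensen_powr:
  fixes f :: "'a \<Rightarrow> real"
  assumes mass: "emeasure M (space M) \<le> 1" and [measurable]: "f \<in> borel_measurable M"
    and f: "\<And>x. f x \<ge> 0" and a: "a \<ge> 0" and r: "r \<ge> 1"
    and le: "ennreal a \<le> (\<integral>\<^sup>+x. ennreal (f x) \<partial>M)"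
  shows "ennreal (a powr r) \<le> (\<integral>\<^sup>+x. ennreal (f x powr r) \<partial>M)"
proof (cases "a = 0")
  case False
  with a have a: "a > 0" by simp
  define I where "I = (\<integral>\<^sup>+x. ennreal (f x powr r) \<partial>M)"
  have "ennreal (a powr r) = ennreal (a powr (r - 1)) * ennreal a"
    using a by (simp add: ennreal_mult'[symmetric] powr_diff)
  also have "\<dots> \<le> ennreal (a powr (r - 1)) * (\<integral>\<^sup>+x. ennreal (f x) \<partial>M)"
    by (intro mult_left_mono le) simp
  also have "\<dots> = (\<integral>\<^sup>+x. ennreal (a powr (r - 1) * f x) \<partial>M)"
    using f by (subst nn_integral_cmult[symmetric]) (auto simp: ennreal_mult')
  also have "\<dots> \<le> (\<integral>\<^sup>+x. ennreal ((1 - 1/r) * a powr r) + ennreal (1/r) * ennreal (f x powr r) \<partial>M)"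
  proof (rule nn_integral_mono)
    fix x
    have "ennreal (a powr (r - 1) * f x) \<le> ennreal ((1 - 1/r) * a powr r + (1/r) * f x powr r)"
      using young_tangent[OF a f[of x] r] by (intro ennreal_leI) simp
    also have "\<dots> = ennreal ((1 - 1/r) * a powr r) + ennreal (1/r) * ennreal (f x powr r)"
      using r by (simp add: ennreal_mult'[symmetric])
    finally show "ennreal (a powr (r - 1) * f x) \<le> \<dots>" .
  qed
  also have "\<dots> = ennreal ((1 - 1/r) * a powr r) * emeasure M (space M) + ennreal (1/r) * I"
    unfolding I_def by (subst nn_integral_add) (auto simp: nn_integral_cmult)
  also have "\<dots> \<le> ennreal ((1 - 1/r) * a powr r) * 1 + ennreal (1/r) * I"
    by (intro add_right_mono mult_left_mono mass) simp
  finally have *: "ennreal (a powr r) \<le> ennreal ((1 - 1/r) * a powr r) + ennreal (1/r) * I" by simp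
  show ?thesis
  proof (cases I)
    case (real i)
    have "ennreal (a powr r) \<le> ennreal ((1 - 1/r) * a powr r + (1/r) * i)"
      using * real r by (simp add: ennreal_mult'[symmetric] ennreal_plus[symmetric] del: ennreal_plus)
    then have "a powr r \<le> (1 - 1/r) * a powr r + (1/r) * i"
      using real r by (subst (asm) ennreal_le_iff) auto
    then have "a powr r \<le> i" using r by (simp add: field_simps)
    then show ?thesis using real by (simp add: I_def[symmetric] ennreal_leI)
  qed (simp add: I_def[symmetric])
qed simp

lemma nn_integral_affine:
  fixes g :: "'a::euclidean_space \<Rightarrow> ennreal"
  assumes c: "c > 0" and [measurable]: "g \<in> borel_measurable borel"
  shows "ennreal (c ^ DIM('a)) * (\<integral>\<^sup>+y. g (x + c *\<^sub>R y) \<partial>lborel) = (\<integral>\<^sup>+y. g y \<partial>lborel)"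
proof -
  have "(\<integral>\<^sup>+y. g y \<partial>lborel) = (\<integral>\<^sup>+y. g y \<partial>density (distr lborel borel (\<lambda>y. x + c *\<^sub>R y)) (\<lambda>_. \<bar>c\<bar>^DIM('a)))"
    using lborel_affine[of c x] c by simp
  also have "\<dots> = (\<integral>\<^sup>+y. ennreal (c ^ DIM('a)) * g (x + c *\<^sub>R y) \<partial>lborel)"
    using c by (simp add: nn_integral_density nn_integral_distr)
  also have "\<dots> = ennreal (c ^ DIM('a)) * (\<integral>\<^sup>+y. g (x + c *\<^sub>R y) \<partial>lborel)"
    by (rule nn_integral_cmult) simp
  finally show ?thesis by simp
qed

lemma nn_integral_translate:
  fixes g :: "'a::euclidean_space \<Rightarrow> ennreal"
  assumes [measurable]: "g \<in> borel_measurable borel"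
  shows "(\<integral>\<^sup>+x. g (x + a) \<partial>lborel) = (\<integral>\<^sup>+x. g x \<partial>lborel)"
  using nn_integral_affine[of 1 g a] by (simp add: add.commute)

text \<open>The average over the cube \<open>x + h Q\<close>; as \<open>Q\<close> keeps away from the origin, the cube leaves any
  bounded set when \<open>h\<close> is large.\<close>

definition cube_avg :: "real \<Rightarrow> ('a::euclidean_space \<Rightarrow> real) \<Rightarrow> 'a \<Rightarrow> real" where
  "cube_avg h \<phi> x = (\<integral>y. \<phi> (x + h *\<^sub>R y) \<partial>unif cubeQ)"

lemma test_measurable:
  assumes "\<phi> \<in> test_functions \<Omega>"
  shows "\<phi> \<in> borel_measurable borel" "grad \<phi> \<in> borel_measurable borel"
  using assms by (auto intro: borel_measurable_continuous_onI test_continuous test_grad_continuous)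

lemma test_outside:
  assumes "\<phi> \<in> test_functions \<Omega>" "x \<notin> \<Omega>"
  shows "\<phi> x = 0" "grad \<phi> x = 0"
  using test_functionsE[OF assms(1)] assms(2) by (metis subsetD)+

lemma test_bounded:
  assumes "\<phi> \<in> test_functions \<Omega>"
  obtains B where "\<And>x. \<bar>\<phi> x\<bar> \<le> B" "\<And>x. norm (grad \<phi> x) \<le> B"
proof -
  obtain K where K: "compact K" "\<And>x. x \<notin> K \<Longrightarrow> \<phi> x = 0" "\<And>x. x \<notin> K \<Longrightarrow> grad \<phi> x = 0"
    using test_functionsE[OF assms] by metis
  have "bounded (\<phi> ` K)" "bounded (grad \<phi> ` K)"
    by (intro compact_imp_bounded compact_continuous_image K(1)
        continuous_on_subset[OF test_continuous[OF assms]]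
        continuous_on_subset[OF test_grad_continuous[OF assms]] subset_UNIV)+
  then obtain B1 B2 where B: "\<And>x. x \<in> K \<Longrightarrow> \<bar>\<phi> x\<bar> \<le> B1" "\<And>x. x \<in> K \<Longrightarrow> norm (grad \<phi> x) \<le> B2"
    unfolding bounded_iff by fastforce
  have "\<bar>\<phi> x\<bar> \<le> max 0 (max B1 B2)" "norm (grad \<phi> x) \<le> max 0 (max B1 B2)" for x
    using B[of x] K(2,3)[of x] by (cases "x \<in> K"; force)+
  then show ?thesis using that by blast
qed

lemma integrable_unifQ:
  fixes f :: "'a::euclidean_space \<Rightarrow> real"
  assumes "f \<in> borel_measurable borel" "\<And>x. \<bar>f x\<bar> \<le> B"
  shows "integrable (unif cubeQ) f"
  using assms by (intro finite_measure.integrable_const_bound[OF finite_measure_unifQ, of _ B]) auto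

text \<open>Along the curve \<open>t \<mapsto> x + R t\<^sup>m y\<close> the speed vanishes at \<open>t = 0\<close> to order \<open>m - 1\<close>; a large \<open>m\<close>
  compensates the concentration of the averages of the gradient as \<open>t\<close> tends to \<open>0\<close>.\<close>

lemma curve_estimate:
  fixes \<phi> :: "'a::euclidean_space \<Rightarrow> real"
  assumes \<phi>: "\<phi> \<in> test_functions \<Omega>" and R: "R \<ge> 0" and m: "m \<ge> 1"
  shows "ennreal \<bar>\<phi> (x + R *\<^sub>R y) - \<phi> x\<bar>
    \<le> (\<integral>\<^sup>+t. ennreal (R * real m * t ^ (m - 1) * norm y * norm (grad \<phi> (x + (R * t ^ m) *\<^sub>R y))) \<partial>unitT)"
proof -
  have [measurable]: "\<phi> \<in> borel_measurable borel" "grad \<phi> \<in> borel_measurable borel"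
    using test_measurable[OF \<phi>] by auto
  define s' where "s' (t::real) = grad \<phi> (x + (R * t ^ m) *\<^sub>R y) \<bullet> ((R * (real m * t ^ (m - 1))) *\<^sub>R y)" for t
  have cs: "continuous_on {0..1} s'"
    unfolding s'_def
    by (intro continuous_intros continuous_on_compose2[OF test_grad_continuous[OF \<phi>]]) auto
  have D: "((\<lambda>t. \<phi> (x + (R * t ^ m) *\<^sub>R y)) has_real_derivative s' t) (at t)" for t
  proof -
    have "((\<lambda>t. x + (R * t ^ m) *\<^sub>R y) has_derivative (\<lambda>h. (h * (R * (real m * t ^ (m - 1)))) *\<^sub>R y)) (at t)"
      by (auto intro!: derivative_eq_intros simp: algebra_simps)
    from has_derivative_compose[OF this grad_derivative[OF test_differentiable[OF \<phi>]]]
    show ?thesis unfolding has_field_derivative_def s'_def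
      by (rule has_derivative_eq_rhs) (auto simp: algebra_simps)
  qed
  have "(\<integral>t. indicator {0..1} t *\<^sub>R s' t \<partial>lborel) = \<phi> (x + (R * 1 ^ m) *\<^sub>R y) - \<phi> (x + (R * 0 ^ m) *\<^sub>R y)"
    by (rule integral_FTC_Icc)
      (auto intro: D[THEN has_real_derivative_iff_has_vector_derivative[THEN iffD1], THEN has_vector_derivative_at_within] cs)
  then have "ennreal \<bar>\<phi> (x + R *\<^sub>R y) - \<phi> x\<bar> = ennreal (norm (\<integral>t. indicator {0..1} t *\<^sub>R s' t \<partial>lborel))"
    using m by (simp add: zero_power)
  also have "\<dots> \<le> (\<integral>\<^sup>+t. ennreal (norm (indicator {0..1} t *\<^sub>R s' t)) \<partial>lborel)"
    by (rule integral_norm_bound_ennreal, rule borel_integrable_compact[OF _ cs]) auto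
  also have "\<dots> \<le> (\<integral>\<^sup>+t. indicator {0..1} t *
      ennreal (R * real m * t ^ (m - 1) * norm y * norm (grad \<phi> (x + (R * t ^ m) *\<^sub>R y))) \<partial>lborel)"
  proof (rule nn_integral_mono)
    fix t :: real
    show "ennreal (norm (indicator {0..1} t *\<^sub>R s' t)) \<le> indicator {0..1} t *
      ennreal (R * real m * t ^ (m - 1) * norm y * norm (grad \<phi> (x + (R * t ^ m) *\<^sub>R y)))"
    proof (cases "t \<in> {0..1}")
      case True
      have "norm (s' t) \<le> norm (grad \<phi> (x + (R * t ^ m) *\<^sub>R y)) * norm ((R * (real m * t ^ (m - 1))) *\<^sub>R y)"
        unfolding s'_def real_norm_def by (rule Cauchy_Schwarz_ineq2)
      also have "\<dots> = R * real m * t ^ (m - 1) * norm y * norm (grad \<phi> (x + (R * t ^ m) *\<^sub>R y))"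
        using R True by (simp add: abs_mult)
      finally show ?thesis using True by (simp add: ennreal_leI)
    qed simp
  qed
  also have "\<dots> = (\<integral>\<^sup>+t. ennreal (R * real m * t ^ (m - 1) * norm y * norm (grad \<phi> (x + (R * t ^ m) *\<^sub>R y))) \<partial>unitT)"
    by (rule nn_integral_unif[symmetric]) auto
  finally show ?thesis .
qed

text \<open>The curve estimate averaged over the end points \<open>y\<close> in the cube.\<close>

lemma avg_estimate:
  fixes \<phi> :: "'a::euclidean_space \<Rightarrow> real"
  assumes \<phi>: "\<phi> \<in> test_functions \<Omega>" and R: "R \<ge> 0" and m: "m \<ge> 1"
  shows "ennreal \<bar>\<phi> x - cube_avg R \<phi> x\<bar> \<le> (\<integral>\<^sup>+t. ennreal (2 * real DIM('a) * R * real m * t ^ (m - 1)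
    * cube_avg (R * t ^ m) (\<lambda>z. norm (grad \<phi> z)) x) \<partial>unitT)"
proof -
  note [measurable] = test_measurable[OF \<phi>]
  obtain B where B: "\<And>x. \<bar>\<phi> x\<bar> \<le> B" "\<And>x. norm (grad \<phi> x) \<le> B" using test_bounded[OF \<phi>] by metis
  interpret Q: finite_measure "unif (cubeQ::'a set)" by (rule finite_measure_unifQ)
  interpret T: finite_measure unitT by (rule finite_measure_unit)
  interpret P: pair_sigma_finite unitT "unif (cubeQ::'a set)" ..
  let ?G = "\<lambda>(t::real) y. norm (grad \<phi> (x + (R * t ^ m) *\<^sub>R y))"
  have i1: "integrable (unif cubeQ) (\<lambda>y. \<phi> (x + R *\<^sub>R y))"
    by (rule integrable_unifQ[where B=B]) (auto intro: B)
  have m1: "measure (unif cubeQ) (UNIV::'a set) = 1"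
    by (simp add: measure_def emeasure_unifQ)
  have "\<phi> x - cube_avg R \<phi> x = (\<integral>y. \<phi> x - \<phi> (x + R *\<^sub>R y) \<partial>unif cubeQ)"
    unfolding cube_avg_def using i1 by (subst Bochner_Integration.integral_diff) (auto simp: m1)
  then have "ennreal \<bar>\<phi> x - cube_avg R \<phi> x\<bar> = ennreal (norm (\<integral>y. \<phi> x - \<phi> (x + R *\<^sub>R y) \<partial>unif cubeQ))" by simp
  also have "\<dots> \<le> (\<integral>\<^sup>+y. ennreal (norm (\<phi> x - \<phi> (x + R *\<^sub>R y))) \<partial>unif cubeQ)"
    using i1 by (intro integral_norm_bound_ennreal) auto
  also have "\<dots> \<le> (\<integral>\<^sup>+y. (\<integral>\<^sup>+t. ennreal (2 * real DIM('a) * R * real m * t ^ (m - 1)) * ennreal (?G t y) \<partial>unitT) \<partial>unif cubeQ)"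
  proof (rule nn_integral_mono_AE, rule AE_mp[OF AE_unif[OF cubeQ_borel]], rule AE_I2, rule impI)
    fix y :: 'a assume y: "y \<in> cubeQ"
    have "ennreal (norm (\<phi> x - \<phi> (x + R *\<^sub>R y)))
      \<le> (\<integral>\<^sup>+t. ennreal (R * real m * t ^ (m - 1) * norm y * ?G t y) \<partial>unitT)"
      using curve_estimate[OF \<phi> R m, of x y] by (simp add: abs_minus_commute)
    also have "\<dots> \<le> (\<integral>\<^sup>+t. ennreal (2 * real DIM('a) * R * real m * t ^ (m - 1)) * ennreal (?G t y) \<partial>unitT)"
    proof (rule nn_integral_mono_AE, rule AE_mp[OF AE_unif], simp, rule AE_I2, rule impI)
      fix t :: real assume t: "t \<in> {0..1}"
      have "(R * real m * t ^ (m - 1)) * norm y * ?G t y \<le> (R * real m * t ^ (m - 1)) * (2 * real DIM('a)) * ?G t y"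
        using t R norm_cubeQ[OF y] by (intro mult_right_mono mult_left_mono) auto
      then show "ennreal (R * real m * t ^ (m - 1) * norm y * ?G t y)
          \<le> ennreal (2 * real DIM('a) * R * real m * t ^ (m - 1)) * ennreal (?G t y)"
        by (subst ennreal_mult''[symmetric]) (auto intro!: ennreal_leI simp: algebra_simps)
    qed
    finally show "ennreal (norm (\<phi> x - \<phi> (x + R *\<^sub>R y))) \<le> \<dots>" .
  qed
  also have "\<dots> = (\<integral>\<^sup>+t. (\<integral>\<^sup>+y. ennreal (2 * real DIM('a) * R * real m * t ^ (m - 1)) * ennreal (?G t y) \<partial>unif cubeQ) \<partial>unitT)"
    by (rule P.Fubini') measurable
  also have "\<dots> = (\<integral>\<^sup>+t. ennreal (2 * real DIM('a) * R * real m * t ^ (m - 1)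
    * cube_avg (R * t ^ m) (\<lambda>z. norm (grad \<phi> z)) x) \<partial>unitT)"
  proof (rule nn_integral_cong)
    fix t :: real
    have "(\<integral>\<^sup>+y. ennreal (?G t y) \<partial>unif cubeQ) = ennreal (cube_avg (R * t ^ m) (\<lambda>z. norm (grad \<phi> z)) x)"
      unfolding cube_avg_def
      by (rule nn_integral_eq_integral) (auto intro!: integrable_unifQ[where B=B] B)
    moreover have "cube_avg (R * t ^ m) (\<lambda>z. norm (grad \<phi> z)) x \<ge> 0"
      unfolding cube_avg_def by (rule integral_nonneg_AE) auto
    ultimately show "(\<integral>\<^sup>+y. ennreal (2 * real DIM('a) * R * real m * t ^ (m - 1)) * ennreal (?G t y) \<partial>unif cubeQ)
      = ennreal (2 * real DIM('a) * R * real m * t ^ (m - 1) * cube_avg (R * t ^ m) (\<lambda>z. norm (grad \<phi> z)) x)"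
      by (simp add: nn_integral_cmult ennreal_mult'')
  qed
  finally show ?thesis .
qed

lemma cube_avg_measurable:
  assumes [measurable]: "f \<in> borel_measurable borel"
  shows "(\<lambda>(x, h). cube_avg h f x) \<in> borel_measurable (borel \<Otimes>\<^sub>M borel)"
proof -
  interpret Q: finite_measure "unif (cubeQ::'a set)" by (rule finite_measure_unifQ)
  show ?thesis unfolding cube_avg_def case_prod_beta by measurable
qed

lemma cube_avg_measurable'[measurable (raw)]:
  assumes "f \<in> borel_measurable borel" "g \<in> borel_measurable M" "h \<in> borel_measurable M"
  shows "(\<lambda>z. cube_avg (h z) f (g z)) \<in> borel_measurable M"
  using measurable_compose[OF measurable_Pair[OF assms(2,3)] cube_avg_measurable[OF assms(1)]] by simp

text \<open>Averages of a nonnegative function: Jensen's inequality inside the cube, and the bound obtained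
  by rescaling the cube to all of space.\<close>

lemma cube_avg_powr:
  fixes g :: "'a::euclidean_space \<Rightarrow> real"
  assumes [measurable]: "g \<in> borel_measurable borel" and g: "\<And>x. 0 \<le> g x" "\<And>x. g x \<le> B" and p: "p \<ge> 1"
  shows "ennreal (cube_avg h g x powr p) \<le> (\<integral>\<^sup>+y. ennreal (g (x + h *\<^sub>R y) powr p) \<partial>unif cubeQ)"
proof (rule jensen_powr)
  show "ennreal (cube_avg h g x) \<le> (\<integral>\<^sup>+y. ennreal (g (x + h *\<^sub>R y)) \<partial>unif cubeQ)"
    unfolding cube_avg_def
    using g by (subst nn_integral_eq_integral) (auto intro!: integrable_unifQ[where B=B])
  show "0 \<le> cube_avg h g x" unfolding cube_avg_def using g by (intro integral_nonneg_AE) auto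
qed (use g p in \<open>auto simp: emeasure_unifQ\<close>)

lemma cube_avg_powr_le:
  fixes g :: "'a::euclidean_space \<Rightarrow> real"
  assumes [measurable]: "g \<in> borel_measurable borel" and g: "\<And>x. 0 \<le> g x" "\<And>x. g x \<le> B" and p: "p \<ge> 1"
    and h: "h > 0" and D: "(\<integral>\<^sup>+x. ennreal (g x powr p) \<partial>lborel) \<le> ennreal D" "D \<ge> 0"
  shows "h ^ DIM('a) * cube_avg h g x powr p \<le> D"
proof -
  have "ennreal (h ^ DIM('a) * cube_avg h g x powr p) = ennreal (h ^ DIM('a)) * ennreal (cube_avg h g x powr p)"
    using h by (simp add: ennreal_mult')
  also have "\<dots> \<le> ennreal (h ^ DIM('a)) * (\<integral>\<^sup>+y. ennreal (g (x + h *\<^sub>R y) powr p) \<partial>unif cubeQ)"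
    by (intro mult_left_mono cube_avg_powr[OF assms(1-4)]) simp
  also have "\<dots> \<le> ennreal (h ^ DIM('a)) * (\<integral>\<^sup>+y. ennreal (g (x + h *\<^sub>R y) powr p) \<partial>lborel)"
    by (intro mult_left_mono nn_integral_unif_le) auto
  also have "\<dots> = (\<integral>\<^sup>+x. ennreal (g x powr p) \<partial>lborel)"
    by (rule nn_integral_affine[OF h]) simp
  also note D(1)
  finally show ?thesis using D(2) by (simp add: ennreal_le_iff)
qed

lemma nn_integral_avg:
  fixes g :: "'a::euclidean_space \<Rightarrow> ennreal"
  assumes [measurable]: "g \<in> borel_measurable borel"
  shows "(\<integral>\<^sup>+x. (\<integral>\<^sup>+t. (\<integral>\<^sup>+y. g (x + (R * t ^ m) *\<^sub>R y) \<partial>unif cubeQ) \<partial>unitT) \<partial>lborel)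
    = (\<integral>\<^sup>+x. g x \<partial>lborel)"
proof -
  interpret Q: finite_measure "unif (cubeQ::'a set)" by (rule finite_measure_unifQ)
  interpret T: finite_measure unitT by (rule finite_measure_unit)
  interpret P1: pair_sigma_finite unitT "lborel :: 'a measure" ..
  interpret P2: pair_sigma_finite "unif (cubeQ::'a set)" "lborel :: 'a measure" ..
  have "(\<integral>\<^sup>+x. (\<integral>\<^sup>+t. (\<integral>\<^sup>+y. g (x + (R * t ^ m) *\<^sub>R y) \<partial>unif cubeQ) \<partial>unitT) \<partial>lborel)
     = (\<integral>\<^sup>+t. (\<integral>\<^sup>+x. (\<integral>\<^sup>+y. g (x + (R * t ^ m) *\<^sub>R y) \<partial>unif cubeQ) \<partial>lborel) \<partial>unitT)"
    by (rule P1.Fubini') measurable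
  also have "\<dots> = (\<integral>\<^sup>+t. (\<integral>\<^sup>+y. (\<integral>\<^sup>+x. g (x + (R * t ^ m) *\<^sub>R y) \<partial>lborel) \<partial>unif cubeQ) \<partial>unitT)"
    by (intro nn_integral_cong P2.Fubini') measurable
  also have "\<dots> = (\<integral>\<^sup>+x. g x \<partial>lborel)"
    by (simp add: nn_integral_translate emeasure_unifQ emeasure_unit)
  finally show ?thesis .
qed

text \<open>The subcritical Sobolev inequality, including Poincare's inequality as the case \<open>r = p\<close>. For
  fixed \<open>t\<close> the average over the cube is bounded by a negative power of \<open>t\<close>; the \<open>r - p\<close>
  surplus powers of the average are estimated in this way, the other \<open>p\<close> by Jensen's inequality.\<close>

lemma sobolev_test:
  fixes \<Omega> :: "'a::euclidean_space set"
  assumes \<Omega>: "bounded \<Omega>" and p: "1 \<le> p" "p \<le> r" and sub: "DIM('a) * ((r - p) / p) < r"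
  obtains C where "C > 0" "\<And>\<phi> D. \<phi> \<in> test_functions \<Omega> \<Longrightarrow> D > 0 \<Longrightarrow>
     (\<integral>\<^sup>+x. ennreal (norm (grad \<phi> x) powr p) \<partial>lborel) \<le> ennreal D \<Longrightarrow>
     (\<integral>\<^sup>+x. ennreal (\<bar>\<phi> x\<bar> powr r) \<partial>lborel) \<le> ennreal (C * D powr (r / p))"
proof -
  define n where "n = DIM('a)"
  define \<sigma> where "\<sigma> = (r - p) / p"
  have \<sigma>: "\<sigma> \<ge> 0" using p by (simp add: \<sigma>_def)
  obtain b where b: "\<And>x. x \<in> \<Omega> \<Longrightarrow> norm x \<le> b" and "b > 0" using \<Omega> bounded_pos by metis
  \<comment> \<open>The cube \<open>x + R Q\<close> misses \<open>\<Omega>\<close> for \<open>x \<in> \<Omega>\<close>, so the average of a test function over it vanishes.\<close>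
  define R where "R = 3 * b"
  have R: "R > 0" using \<open>b > 0\<close> by (simp add: R_def)
  \<comment> \<open>With this \<open>m\<close> the power of \<open>t\<close> that remains from the speed of the curve and the size of the cube is
    nonnegative. Its existence is the subcriticality of \<open>r\<close>.\<close>
  obtain m0 :: nat where m0: "r / (r - n * \<sigma>) < m0" using reals_Archimedean2 by blast
  define m where "m = max 2 m0"
  have m2: "m \<ge> 2" by (simp add: m_def)
  have "r \<le> m * (r - n * \<sigma>)"
  proof -
    have pos: "r - n * \<sigma> > 0" using sub by (simp add: n_def \<sigma>_def)
    have "r / (r - n * \<sigma>) \<le> m" using m0 by (simp add: m_def)
    then show ?thesis using pos by (simp add: field_simps)
  qed
  then have e: "(m - 1) * r - m * n * \<sigma> \<ge> 0" using m2 by (simp add: algebra_simps of_nat_diff)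
  define c where "c = 2 * n * R * m"
  have c: "c > 0" using R m2 by (simp add: c_def n_def)
  define C where "C = c powr r * R powr (- n * \<sigma>)"
  have "C > 0" using c R by (simp add: C_def)
  moreover have "(\<integral>\<^sup>+x. ennreal (\<bar>\<phi> x\<bar> powr r) \<partial>lborel) \<le> ennreal (C * D powr (r / p))"
    if \<phi>: "\<phi> \<in> test_functions \<Omega>" and D: "D > 0"
      and le: "(\<integral>\<^sup>+x. ennreal (norm (grad \<phi> x) powr p) \<partial>lborel) \<le> ennreal D" for \<phi> D
  proof -
    note [measurable] = test_measurable[OF \<phi>]
    obtain B where B: "\<And>x. \<bar>\<phi> x\<bar> \<le> B" "\<And>x. norm (grad \<phi> x) \<le> B" using test_bounded[OF \<phi>] by metis
    define J where "J t x = cube_avg (R * t ^ m) (\<lambda>z. norm (grad \<phi> z)) x" for t x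
    have J0: "J t x \<ge> 0" for t x unfolding J_def cube_avg_def by (rule integral_nonneg_AE) auto
    let ?V = "\<lambda>x t. \<integral>\<^sup>+y. ennreal (norm (grad \<phi> (x + (R * t ^ m) *\<^sub>R y)) powr p) \<partial>unif cubeQ"
    have F: "ennreal ((c * t ^ (m - 1) * J t x) powr r) \<le> ennreal (C * D powr \<sigma>) * ?V x t"
      if t: "t \<in> {0..1}" for t x
    proof (cases "t = 0")
      case True
      then show ?thesis using m2 by (simp add: zero_power)
    next
      case False
      with t have t: "0 < t" "t \<le> 1" by auto
      have s: "R * t ^ m > 0" using R t by simp
      have "(R * t ^ m) ^ n * J t x powr p \<le> D"
        unfolding J_def n_def
        by (rule cube_avg_powr_le[OF _ _ B(2) p(1) s le]) (use D in auto)
      then have "J t x powr p \<le> D / (R * t ^ m) ^ n"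
        using s by (simp only: pos_le_divide_eq zero_less_power mult.commute)
      then have "(J t x powr p) powr \<sigma> \<le> (D / (R * t ^ m) ^ n) powr \<sigma>"
        using \<sigma> by (intro powr_mono2) auto
      also have "(J t x powr p) powr \<sigma> = J t x powr (r - p)"
        using p by (simp add: powr_powr \<sigma>_def)
      also have "(D / (R * t ^ m) ^ n) powr \<sigma> = D powr \<sigma> * R powr (- n * \<sigma>) * t powr (- m * n * \<sigma>)"
        using D R t by (simp add: powr_divide powr_mult powr_powr powr_minus field_simps powr_realpow[symmetric])
      finally have JJ: "J t x powr (r - p) \<le> D powr \<sigma> * R powr (- n * \<sigma>) * t powr (- m * n * \<sigma>)" .
      have "(c * t ^ (m - 1) * J t x) powr r = c powr r * t powr ((m - 1) * r) * J t x powr r"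
        using c t J0 m2 by (simp add: powr_mult powr_powr powr_realpow[symmetric])
      also have "J t x powr r = J t x powr (r - p) * J t x powr p"
        by (simp add: powr_add[symmetric])
      also have "c powr r * t powr ((m - 1) * r) * (J t x powr (r - p) * J t x powr p)
        \<le> c powr r * t powr ((m - 1) * r) * ((D powr \<sigma> * R powr (- n * \<sigma>) * t powr (- m * n * \<sigma>)) * J t x powr p)"
        by (intro mult_left_mono mult_right_mono JJ) auto
      also have "\<dots> = (C * D powr \<sigma>) * (t powr ((m - 1) * r - m * n * \<sigma>) * J t x powr p)"
        using t by (simp add: C_def powr_diff powr_minus field_simps)
      also have "\<dots> \<le> (C * D powr \<sigma>) * (1 * J t x powr p)"
        using t e \<open>C > 0\<close> by (intro mult_left_mono mult_right_mono powr_le1) auto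
      finally have "ennreal ((c * t ^ (m - 1) * J t x) powr r) \<le> ennreal (C * D powr \<sigma>) * ennreal (J t x powr p)"
        using \<open>C > 0\<close> by (subst ennreal_mult''[symmetric]) (auto intro: ennreal_leI)
      also have "\<dots> \<le> ennreal (C * D powr \<sigma>) * ?V x t"
        unfolding J_def by (intro mult_left_mono cube_avg_powr[OF _ _ B(2) p(1)]) auto
      finally show ?thesis .
    qed
    have *: "ennreal (\<bar>\<phi> x\<bar> powr r) \<le> ennreal (C * D powr \<sigma>) * (\<integral>\<^sup>+t. ?V x t \<partial>unitT)" for x
    proof (cases "x \<in> \<Omega>")
      case False
      then show ?thesis by (simp add: test_outside[OF \<phi>])
    next
      case True
      have "cube_avg R \<phi> x = (\<integral>y. 0 \<partial>unif (cubeQ::'a set))"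
        unfolding cube_avg_def
      proof (rule integral_cong_AE, simp, simp, rule AE_mp[OF AE_unif[OF cubeQ_borel]], rule AE_I2, rule impI)
        fix y :: 'a assume y: "y \<in> cubeQ"
        obtain i :: 'a where i: "i \<in> Basis" using nonempty_Basis by blast
        have "y \<bullet> i \<ge> 1" using y i by (auto simp: cubeQ_def mem_box)
        then have "R * (y \<bullet> i) \<ge> 3 * b" using R mult_left_mono[of 1 "y \<bullet> i" R] by (simp add: R_def)
        moreover have "\<bar>x \<bullet> i\<bar> \<le> b" using b[OF True] Basis_le_norm[OF i, of x] by linarith
        ultimately have "(x + R *\<^sub>R y) \<bullet> i > b" using \<open>b > 0\<close> by (simp add: inner_add_left)
        then have "norm (x + R *\<^sub>R y) > b" using Basis_le_norm[OF i, of "x + R *\<^sub>R y"] by linarith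
        then have "x + R *\<^sub>R y \<notin> \<Omega>" using b by fastforce
        then show "\<phi> (x + R *\<^sub>R y) = 0" by (rule test_outside[OF \<phi>])
      qed
      then have A0: "cube_avg R \<phi> x = 0" by simp
      have "ennreal (\<bar>\<phi> x\<bar> powr r) \<le> (\<integral>\<^sup>+t. ennreal ((c * \<bar>t\<bar> ^ (m - 1) * J t x) powr r) \<partial>unitT)"
      proof (rule jensen_powr)
        show "ennreal \<bar>\<phi> x\<bar> \<le> (\<integral>\<^sup>+t. ennreal (c * \<bar>t\<bar> ^ (m - 1) * J t x) \<partial>unitT)"
        proof -
          have "ennreal \<bar>\<phi> x\<bar> \<le> (\<integral>\<^sup>+t. ennreal (c * t ^ (m - 1) * J t x) \<partial>unitT)"
            using avg_estimate[OF \<phi>, of R m x] A0 R m2 by (simp add: c_def n_def J_def)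
          also have "\<dots> = (\<integral>\<^sup>+t. ennreal (c * \<bar>t\<bar> ^ (m - 1) * J t x) \<partial>unitT)"
            by (rule nn_integral_cong_AE, rule AE_mp[OF AE_unif]) auto
          finally show ?thesis .
        qed
      qed (use c J0 p in \<open>auto simp: emeasure_unit J_def\<close>)
      also have "\<dots> \<le> (\<integral>\<^sup>+t. ennreal (C * D powr \<sigma>) * ?V x t \<partial>unitT)"
        by (rule nn_integral_mono_AE, rule AE_mp[OF AE_unif]) (use F in auto)
      also have "\<dots> = ennreal (C * D powr \<sigma>) * (\<integral>\<^sup>+t. ?V x t \<partial>unitT)"
      proof -
        interpret Q: finite_measure "unif (cubeQ::'a set)" by (rule finite_measure_unifQ)
        show ?thesis by (rule nn_integral_cmult) measurable
      qed
      finally show ?thesis .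
    qed
    have "(\<integral>\<^sup>+x. ennreal (\<bar>\<phi> x\<bar> powr r) \<partial>lborel)
      \<le> (\<integral>\<^sup>+x. ennreal (C * D powr \<sigma>) * (\<integral>\<^sup>+t. ?V x t \<partial>unitT) \<partial>lborel)"
      by (intro nn_integral_mono *)
    also have "\<dots> = ennreal (C * D powr \<sigma>) * (\<integral>\<^sup>+x. (\<integral>\<^sup>+t. ?V x t \<partial>unitT) \<partial>lborel)"
    proof -
      interpret Q: finite_measure "unif (cubeQ::'a set)" by (rule finite_measure_unifQ)
      interpret T: finite_measure unitT by (rule finite_measure_unit)
      show ?thesis by (rule nn_integral_cmult) measurable
    qed
    also have "\<dots> = ennreal (C * D powr \<sigma>) * (\<integral>\<^sup>+x. ennreal (norm (grad \<phi> x) powr p) \<partial>lborel)"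
      by (subst nn_integral_avg[of "\<lambda>z. ennreal (norm (grad \<phi> z) powr p)"]) auto
    also have "\<dots> \<le> ennreal (C * D powr \<sigma>) * ennreal D"
      by (intro mult_left_mono le) simp
    also have "\<dots> = ennreal (C * D powr (r / p))"
    proof -
      have "r / p = \<sigma> + 1" using p by (simp add: \<sigma>_def field_simps)
      then show ?thesis using D \<open>C > 0\<close> by (simp add: ennreal_mult'[symmetric] powr_add mult.assoc)
    qed
    finally show ?thesis .
  qed
  ultimately show ?thesis using that by blast
qed

text \<open>Averages over small cubes are close to the function in \<open>L\<^sup>2\<close>, uniformly for bounded gradients: the
  straight lines \<open>m = 1\<close> suffice for this.\<close>

lemma avg_L2_estimate:
  fixes \<phi> :: "'a::euclidean_space \<Rightarrow> real"
  assumes \<phi>: "\<phi> \<in> test_functions \<Omega>" and h: "h \<ge> 0"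
  shows "(\<integral>\<^sup>+x. ennreal ((\<phi> x - cube_avg h \<phi> x)\<^sup>2) \<partial>lborel)
    \<le> ennreal ((2 * real DIM('a) * h)\<^sup>2) * (\<integral>\<^sup>+x. ennreal ((norm (grad \<phi> x))\<^sup>2) \<partial>lborel)"
proof -
  note [measurable] = test_measurable[OF \<phi>]
  interpret Q: finite_measure "unif (cubeQ::'a set)" by (rule finite_measure_unifQ)
  interpret T: finite_measure unitT by (rule finite_measure_unit)
  obtain B where B: "\<And>x. \<bar>\<phi> x\<bar> \<le> B" "\<And>x. norm (grad \<phi> x) \<le> B" using test_bounded[OF \<phi>] by metis
  define J where "J t x = cube_avg (h * t ^ 1) (\<lambda>z. norm (grad \<phi> z)) x" for t x
  have J0: "J t x \<ge> 0" for t x unfolding J_def cube_avg_def by (rule integral_nonneg_AE) auto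
  let ?c = "2 * real DIM('a) * h"
  let ?V = "\<lambda>x (t::real). \<integral>\<^sup>+y. ennreal ((norm (grad \<phi> (x + (h * t ^ 1) *\<^sub>R y)))\<^sup>2) \<partial>unif cubeQ"
  have *: "ennreal ((\<phi> x - cube_avg h \<phi> x)\<^sup>2) \<le> ennreal (?c\<^sup>2) * (\<integral>\<^sup>+t. ?V x t \<partial>unitT)" for x
  proof -
    have "ennreal (\<bar>\<phi> x - cube_avg h \<phi> x\<bar> powr 2) \<le> (\<integral>\<^sup>+t. ennreal ((?c * J t x) powr 2) \<partial>unitT)"
    proof (rule jensen_powr)
      show "ennreal \<bar>\<phi> x - cube_avg h \<phi> x\<bar> \<le> (\<integral>\<^sup>+t. ennreal (?c * J t x) \<partial>unitT)"
        using avg_estimate[OF \<phi> h, of 1 x] by (simp add: J_def)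
    qed (use h J0 in \<open>auto simp: emeasure_unit J_def\<close>)
    also have "\<dots> \<le> (\<integral>\<^sup>+t. ennreal (?c\<^sup>2) * ?V x t \<partial>unitT)"
    proof (rule nn_integral_mono)
      fix t :: real
      have "ennreal ((?c * J t x) powr 2) = ennreal (?c\<^sup>2) * ennreal (J t x powr 2)"
      proof -
        have "(?c * J t x) powr 2 = ?c\<^sup>2 * J t x powr 2"
          using h J0[of t x] by (simp add: power_mult_distrib)
        then show ?thesis by (simp only: ennreal_mult' zero_le_power2)
      qed
      also have "\<dots> \<le> ennreal (?c\<^sup>2) * (\<integral>\<^sup>+y. ennreal ((norm (grad \<phi> (x + (h * t ^ 1) *\<^sub>R y))) powr 2) \<partial>unif cubeQ)"
        unfolding J_def by (intro mult_left_mono cube_avg_powr[OF _ _ B(2)]) auto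
      finally show "ennreal ((?c * J t x) powr 2) \<le> ennreal (?c\<^sup>2) * ?V x t" by simp
    qed
    also have "\<dots> = ennreal (?c\<^sup>2) * (\<integral>\<^sup>+t. ?V x t \<partial>unitT)"
      by (rule nn_integral_cmult) measurable
    finally show ?thesis by simp
  qed
  have "(\<integral>\<^sup>+x. ennreal ((\<phi> x - cube_avg h \<phi> x)\<^sup>2) \<partial>lborel)
     \<le> (\<integral>\<^sup>+x. ennreal (?c\<^sup>2) * (\<integral>\<^sup>+t. ?V x t \<partial>unitT) \<partial>lborel)"
    by (intro nn_integral_mono *)
  also have "\<dots> = ennreal (?c\<^sup>2) * (\<integral>\<^sup>+x. (\<integral>\<^sup>+t. ?V x t \<partial>unitT) \<partial>lborel)"
    by (rule nn_integral_cmult) measurable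
  also have "\<dots> = ennreal (?c\<^sup>2) * (\<integral>\<^sup>+x. ennreal ((norm (grad \<phi> x))\<^sup>2) \<partial>lborel)"
    by (subst nn_integral_avg[of "\<lambda>z. ennreal ((norm (grad \<phi> z))\<^sup>2)"]) auto
  finally show ?thesis .
qed

lemma cube_avg_sum:
  assumes "\<And>i. i < N \<Longrightarrow> \<phi> i \<in> test_functions \<Omega>"
  shows "cube_avg h (\<lambda>x. \<Sum>i<N. c i * \<phi> i x) x = (\<Sum>i<N. c i * cube_avg h (\<phi> i) x)"
proof -
  have "integrable (unif cubeQ) (\<lambda>y. \<phi> i (x + h *\<^sub>R y))" if i: "i < N" for i
  proof -
    note [measurable] = test_measurable[OF assms[OF i]]
    obtain B where B: "\<And>x. \<bar>\<phi> i x\<bar> \<le> B" using test_bounded[OF assms[OF i]] by metis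
    show ?thesis by (rule integrable_unifQ[where B=B]) (auto intro: B)
  qed
  then show ?thesis unfolding cube_avg_def by (subst Bochner_Integration.integral_sum) auto
qed

lemma test_combo_sum:
  fixes N :: nat
  assumes "\<And>i. i < N \<Longrightarrow> \<phi> i \<in> test_functions \<Omega>"
  shows "(\<lambda>x. \<Sum>i<N. c i * \<phi> i x) \<in> test_functions \<Omega>"
  using assms
proof (induction N)
  case (Suc N)
  then show ?case
    using test_combo[of "\<lambda>x. \<Sum>i<N. c i * \<phi> i x" \<Omega> "\<phi> N" 1 "c N"] by simp
qed (simp add: test_zero)

lemma test_integrable:
  assumes \<phi>: "\<phi> \<in> test_functions \<Omega>"
  shows "integrable lborel (\<lambda>x. (\<phi> x)\<^sup>2)" "integrable lborel (\<lambda>x. (norm (grad \<phi> x))\<^sup>2)"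
proof -
  obtain K where K: "compact K" "\<And>x. x \<notin> K \<Longrightarrow> \<phi> x = 0" "\<And>x. x \<notin> K \<Longrightarrow> grad \<phi> x = 0"
    using test_functionsE[OF \<phi>] by metis
  show "integrable lborel (\<lambda>x. (\<phi> x)\<^sup>2)" "integrable lborel (\<lambda>x. (norm (grad \<phi> x))\<^sup>2)"
    by (rule compact_support_integrable[OF _ K(1)];
        use K test_continuous[OF \<phi>] test_grad_continuous[OF \<phi>] in \<open>auto intro!: continuous_intros\<close>)+
qed

text \<open>A quantitative form of Rellich's theorem. If \<open>\<phi>\<^sub>i\<close> is an almost orthogonal family with
  bounded gradients, then \<open>\<Sum>\<^sub>i (A\<^sub>h \<phi>\<^sub>i x)\<^sup>2\<close> is bounded independently of the size of the family,
  being the square of the norm of a functional with bounded kernel; on the other hand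
  \<open>A\<^sub>h \<phi>\<^sub>i\<close> is close to \<open>\<phi>\<^sub>i\<close>, whose norm in \<open>L\<^sup>2\<close> is bounded below.\<close>

lemma test_family_bound:
  fixes \<Omega> :: "'a::euclidean_space set"
  assumes \<Omega>: "bounded \<Omega>" and K: "K > 0" and \<epsilon>: "\<epsilon> > 0"
  shows "\<exists>N0::nat. \<forall>N \<phi>. (\<forall>i<N. \<phi> i \<in> test_functions \<Omega>) \<longrightarrow>
      (\<forall>c. (\<integral>x. (\<Sum>i<N. c i * \<phi> i x)\<^sup>2 \<partial>lborel) \<le> K * (\<Sum>i<N. (c i)\<^sup>2)) \<longrightarrow>
      (\<forall>i<N. (\<integral>x. (norm (grad (\<phi> i) x))\<^sup>2 \<partial>lborel) \<le> K) \<longrightarrow>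
      (\<forall>i<N. \<epsilon> \<le> (\<integral>x. (\<phi> i x)\<^sup>2 \<partial>lborel)) \<longrightarrow> N \<le> N0"
proof -
  define n where "n = real DIM('a)"
  have n: "n > 0" by (simp add: n_def)
  \<comment> \<open>The scale at which replacing \<open>\<phi>\<^sub>i\<close> by its average costs at most half of the lower bound \<open>\<epsilon>\<close>.\<close>
  define h where "h = sqrt (\<epsilon> / (16 * K * n\<^sup>2))"
  have h: "h > 0" using \<epsilon> K n by (simp add: h_def)
  have hK: "(2 * n * h)\<^sup>2 * K = \<epsilon> / 4"
    using \<epsilon> K n by (simp add: h_def power_mult_distrib field_simps)
  obtain b where b: "\<And>x. x \<in> \<Omega> \<Longrightarrow> norm x \<le> b" and "b > 0" using \<Omega> bounded_pos by metis
  define L where "L = cball (0::'a) b"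
  have [measurable]: "L \<in> sets borel" by (simp add: L_def)
  define W where "W = measure lborel L"
  have W: "emeasure lborel L = ennreal W"
    unfolding W_def L_def using emeasure_lborel_cball_finite[of "0::'a" b]
    by (intro emeasure_eq_ennreal_measure) auto
  have W0: "W \<ge> 0" by (simp add: W_def)
  define H where "H = h ^ DIM('a)"
  have H: "H > 0" using h by (simp add: H_def)
  obtain N0 :: nat where N0: "4 * K * W / (H * \<epsilon>) \<le> N0" using real_arch_simple by blast
  have "N \<le> N0" if \<phi>: "\<And>i. i < N \<Longrightarrow> \<phi> i \<in> test_functions \<Omega>"
    and c: "\<And>c. (\<integral>x. (\<Sum>i<N. c i * \<phi> i x)\<^sup>2 \<partial>lborel) \<le> K * (\<Sum>i<N. (c i)\<^sup>2)"
    and g: "\<And>i. i < N \<Longrightarrow> (\<integral>x. (norm (grad (\<phi> i) x))\<^sup>2 \<partial>lborel) \<le> K"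
    and low: "\<And>i. i < N \<Longrightarrow> (\<integral>x. (\<phi> i x)\<^sup>2 \<partial>lborel) \<ge> \<epsilon>" for N and \<phi> :: "nat \<Rightarrow> 'a \<Rightarrow> real"
  proof -
    define A where "A i x = cube_avg h (\<phi> i) x" for i x
    have [measurable]: "\<phi> i \<in> borel_measurable borel" "grad (\<phi> i) \<in> borel_measurable borel" if "i < N" for i
      using test_measurable[OF \<phi>[OF that]] by auto
    have mA[measurable]: "A i \<in> borel_measurable borel" if "i < N" for i
      unfolding A_def[abs_def] using that by measurable
    have S: "(\<Sum>i<N. (A i x)\<^sup>2) \<le> K / H" for x
    proof -
      let ?S = "\<Sum>i<N. (A i x)\<^sup>2"
      \<comment> \<open>The combination that realises the norm of the functional \<open>\<phi> \<mapsto> A\<^sub>h \<phi> x\<close> on the span.\<close>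
      define \<psi> where "\<psi> = (\<lambda>z. \<Sum>i<N. A i x * \<phi> i z)"
      have \<psi>: "\<psi> \<in> test_functions \<Omega>" unfolding \<psi>_def by (rule test_combo_sum[OF \<phi>])
      note [measurable] = test_measurable[OF \<psi>]
      obtain B where B: "\<And>x. \<bar>\<psi> x\<bar> \<le> B" using test_bounded[OF \<psi>] by metis
      have S0: "?S \<ge> 0" by (intro sum_nonneg) auto
      have "cube_avg h \<psi> x = ?S"
        unfolding \<psi>_def by (subst cube_avg_sum[OF \<phi>]) (auto simp: A_def power2_eq_square)
      moreover have "\<bar>cube_avg h \<psi> x\<bar> \<le> cube_avg h (\<lambda>z. \<bar>\<psi> z\<bar>) x"
        unfolding cube_avg_def by (rule integral_abs_bound)
      ultimately have le: "?S \<le> cube_avg h (\<lambda>z. \<bar>\<psi> z\<bar>) x" by simp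
      have "(\<integral>\<^sup>+z. ennreal (\<bar>\<psi> z\<bar> powr 2) \<partial>lborel) = ennreal (\<integral>z. (\<psi> z)\<^sup>2 \<partial>lborel)"
        using test_integrable(1)[OF \<psi>] by (simp add: nn_integral_eq_integral)
      also have "\<dots> \<le> ennreal (K * ?S)" unfolding \<psi>_def by (intro ennreal_leI c)
      finally have "h ^ DIM('a) * cube_avg h (\<lambda>z. \<bar>\<psi> z\<bar>) x powr 2 \<le> K * ?S"
        using B K S0 by (intro cube_avg_powr_le[OF _ _ _ _ h]) auto
      then have "H * (cube_avg h (\<lambda>z. \<bar>\<psi> z\<bar>) x)\<^sup>2 \<le> K * ?S"
        using le S0 by (simp add: H_def)
      moreover have "H * ?S\<^sup>2 \<le> H * (cube_avg h (\<lambda>z. \<bar>\<psi> z\<bar>) x)\<^sup>2"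
        using le S0 H by (intro mult_left_mono power_mono) auto
      ultimately have "?S * (H * ?S) \<le> ?S * K" by (simp add: power2_eq_square algebra_simps)
      then have "?S = 0 \<or> H * ?S \<le> K" using S0 by (metis less_eq_real_def mult_le_cancel_left_pos)
      then show ?thesis using H K by (auto simp: field_simps)
    qed
    have one: "ennreal \<epsilon> \<le> ennreal (\<epsilon> / 2) + (\<integral>\<^sup>+x. indicator L x * ennreal (2 * (A i x)\<^sup>2) \<partial>lborel)"
      if i: "i < N" for i
    proof -
      note [measurable] = mA[OF i] test_measurable[OF \<phi>[OF i]]
      have "ennreal \<epsilon> \<le> ennreal (\<integral>x. (\<phi> i x)\<^sup>2 \<partial>lborel)" using low[OF i] by (rule ennreal_leI)
      also have "\<dots> = (\<integral>\<^sup>+x. ennreal ((\<phi> i x)\<^sup>2) \<partial>lborel)"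
        using test_integrable(1)[OF \<phi>[OF i]] by (simp add: nn_integral_eq_integral)
      also have "\<dots> \<le> (\<integral>\<^sup>+x. 2 * ennreal ((\<phi> i x - A i x)\<^sup>2) + indicator L x * ennreal (2 * (A i x)\<^sup>2) \<partial>lborel)"
      proof (rule nn_integral_mono)
        fix x
        show "ennreal ((\<phi> i x)\<^sup>2) \<le> 2 * ennreal ((\<phi> i x - A i x)\<^sup>2) + indicator L x * ennreal (2 * (A i x)\<^sup>2)"
        proof (cases "x \<in> L")
          case True
          have "(\<phi> i x)\<^sup>2 \<le> 2 * (\<phi> i x - A i x)\<^sup>2 + 2 * (A i x)\<^sup>2"
            using zero_le_power2[of "\<phi> i x - 2 * A i x"] by (simp add: power2_eq_square algebra_simps)
          then have "ennreal ((\<phi> i x)\<^sup>2) \<le> ennreal (2 * (\<phi> i x - A i x)\<^sup>2 + 2 * (A i x)\<^sup>2)" by (rule ennreal_leI)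
          also have "\<dots> = 2 * ennreal ((\<phi> i x - A i x)\<^sup>2) + ennreal (2 * (A i x)\<^sup>2)"
            by (subst ennreal_plus) (auto simp: ennreal_mult')
          finally show ?thesis using True by simp
        next
          case False
          then have "x \<notin> \<Omega>" using b by (auto simp: L_def)
          then show ?thesis by (simp add: test_outside[OF \<phi>[OF i]])
        qed
      qed
      also have "\<dots> = 2 * (\<integral>\<^sup>+x. ennreal ((\<phi> i x - A i x)\<^sup>2) \<partial>lborel)
          + (\<integral>\<^sup>+x. indicator L x * ennreal (2 * (A i x)\<^sup>2) \<partial>lborel)"
        by (subst nn_integral_add) (auto simp: nn_integral_cmult)
      also have "2 * (\<integral>\<^sup>+x. ennreal ((\<phi> i x - A i x)\<^sup>2) \<partial>lborel) \<le> ennreal (\<epsilon> / 2)"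
      proof -
        have "(\<integral>\<^sup>+x. ennreal ((\<phi> i x - A i x)\<^sup>2) \<partial>lborel)
          \<le> ennreal ((2 * n * h)\<^sup>2) * (\<integral>\<^sup>+x. ennreal ((norm (grad (\<phi> i) x))\<^sup>2) \<partial>lborel)"
          using avg_L2_estimate[OF \<phi>[OF i], of h] h by (simp add: A_def n_def)
        also have "(\<integral>\<^sup>+x. ennreal ((norm (grad (\<phi> i) x))\<^sup>2) \<partial>lborel) \<le> ennreal K"
          using test_integrable(2)[OF \<phi>[OF i]] g[OF i] by (simp add: nn_integral_eq_integral ennreal_leI)
        finally have "(\<integral>\<^sup>+x. ennreal ((\<phi> i x - A i x)\<^sup>2) \<partial>lborel) \<le> ennreal ((2 * n * h)\<^sup>2) * ennreal K"
          by (simp add: mult_left_mono)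
        also have "\<dots> = ennreal (\<epsilon> / 4)" by (simp only: hK ennreal_mult'[symmetric] zero_le_power2)
        finally have "2 * (\<integral>\<^sup>+x. ennreal ((\<phi> i x - A i x)\<^sup>2) \<partial>lborel) \<le> ennreal 2 * ennreal (\<epsilon> / 4)"
          by (simp add: mult_left_mono)
        then show ?thesis using \<epsilon> by (simp only: ennreal_mult'[symmetric]) simp
      qed
      finally show ?thesis by (simp add: add_right_mono)
    qed
    have "ennreal (N * \<epsilon>) = (\<Sum>i<N. ennreal \<epsilon>)"
      using \<epsilon> by (simp add: ennreal_mult' ennreal_of_nat_eq_real_of_nat)
    also have "\<dots> \<le> (\<Sum>i<N. ennreal (\<epsilon> / 2) + (\<integral>\<^sup>+x. indicator L x * ennreal (2 * (A i x)\<^sup>2) \<partial>lborel))"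
      by (intro sum_mono one) auto
    also have "\<dots> = ennreal (N * (\<epsilon> / 2)) + (\<Sum>i<N. (\<integral>\<^sup>+x. indicator L x * ennreal (2 * (A i x)\<^sup>2) \<partial>lborel))"
    proof -
      have "(\<Sum>i<N. ennreal (\<epsilon> / 2)) = ennreal (N * (\<epsilon> / 2))"
        using \<epsilon> by (subst sum_ennreal) auto
      then show ?thesis by (simp only: sum.distrib)
    qed
    also have "(\<Sum>i<N. (\<integral>\<^sup>+x. indicator L x * ennreal (2 * (A i x)\<^sup>2) \<partial>lborel))
      = (\<integral>\<^sup>+x. (\<Sum>i<N. indicator L x * ennreal (2 * (A i x)\<^sup>2)) \<partial>lborel)"
      by (rule nn_integral_sum[symmetric]) (use mA in auto)
    also have "\<dots> \<le> (\<integral>\<^sup>+x. indicator L x * ennreal (2 * K / H) \<partial>lborel)"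
    proof (rule nn_integral_mono)
      fix x
      have "(\<Sum>i<N. ennreal (2 * (A i x)\<^sup>2)) = ennreal (2 * (\<Sum>i<N. (A i x)\<^sup>2))"
        by (subst sum_ennreal) (auto simp: sum_distrib_left)
      also have "\<dots> \<le> ennreal (2 * K / H)" using S[of x] by (intro ennreal_leI) simp
      finally have "(\<Sum>i<N. ennreal (2 * (A i x)\<^sup>2)) \<le> ennreal (2 * K / H)" .
      then show "(\<Sum>i<N. indicator L x * ennreal (2 * (A i x)\<^sup>2)) \<le> indicator L x * ennreal (2 * K / H)"
        by (simp add: sum_distrib_left[symmetric] mult_left_mono)
    qed
    also have "\<dots> = ennreal (2 * K / H * W)"
      using K H W0 by (simp add: nn_integral_multc W ennreal_mult'[symmetric] mult.commute)
    finally have "ennreal (N * \<epsilon>) \<le> ennreal (N * (\<epsilon> / 2)) + ennreal (2 * K / H * W)"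
      by (simp add: add_left_mono)
    also have "\<dots> = ennreal (N * (\<epsilon> / 2) + 2 * K / H * W)"
      using \<epsilon> K H W0 by (subst ennreal_plus) auto
    finally have "N * \<epsilon> \<le> N * (\<epsilon> / 2) + 2 * K / H * W"
      using \<epsilon> K H W0 by (subst (asm) ennreal_le_iff) auto
    then have "real N \<le> 4 * K * W / (H * \<epsilon>)"
      using \<epsilon> H by (simp add: field_simps)
    then show ?thesis using N0 by linarith
  qed
  then show ?thesis by blast
qed

section \<open>Sobolev functions vanishing on the boundary\<close>

lemma norm_add_powr_le:
  fixes x y :: "'b::real_normed_vector"
  assumes "p \<ge> 0"
  shows "norm (x + y) powr p \<le> 2 powr p * (norm x powr p + norm y powr p)"
proof -
  have "norm (x + y) \<le> 2 * max (norm x) (norm y)" using norm_triangle_ineq[of x y] by linarith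
  then have "norm (x + y) powr p \<le> (2 * max (norm x) (norm y)) powr p"
    using assms by (intro powr_mono2) auto
  also have "\<dots> = 2 powr p * max (norm x) (norm y) powr p"
    by (simp add: powr_mult)
  also have "\<dots> \<le> 2 powr p * (norm x powr p + norm y powr p)"
    by (intro mult_left_mono) (auto simp: max_def)
  finally show ?thesis .
qed

text \<open>A lower power is controlled by a small constant plus a multiple of a higher one; on a set of finite
  measure this makes convergence in \<open>L\<^sup>p\<close> imply convergence in \<open>L\<^sup>q\<close>.\<close>

lemma powr_le_interp:
  fixes a :: real
  assumes "a \<ge> 0" "q \<le> p" "q > 0" "\<eta> > 0"
  shows "a powr q \<le> \<eta> powr q + \<eta> powr (q - p) * a powr p"
proof (cases "a \<le> \<eta>")
  case True
  then have "a powr q \<le> \<eta> powr q" using assms by (intro powr_mono2) auto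
  then show ?thesis by (simp add: add_increasing2)
next
  case False
  then have "a powr (q - p) \<le> \<eta> powr (q - p)" using assms by (intro powr_mono2') auto
  then have "a powr (q - p) * a powr p \<le> \<eta> powr (q - p) * a powr p" by (intro mult_right_mono) auto
  moreover have "a powr (q - p) * a powr p = a powr q" using False assms by (simp add: powr_add[symmetric])
  ultimately show ?thesis by (smt (verit) powr_ge_zero)
qed

locale bounded_open =
  fixes \<Omega> :: "'a::euclidean_space set"
  assumes open_\<Omega>: "open \<Omega>" and bounded_\<Omega>: "bounded \<Omega>"
begin

abbreviation M where "M \<equiv> lebesgue_on \<Omega>"

lemma \<Omega>_lmeasurable: "\<Omega> \<in> lmeasurable"
  using bounded_\<Omega> open_\<Omega> by (rule lmeasurable_open)

lemma \<Omega>_sets: "\<Omega> \<in> sets lebesgue"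
  using open_\<Omega> by simp

sublocale finite_measure M
  by (rule finite_measure_lebesgue_on[OF \<Omega>_lmeasurable])

lemma measurable_AE_eq:
  fixes f g :: "'a \<Rightarrow> 'b::euclidean_space"
  assumes f: "f \<in> borel_measurable M" and ae: "AE x in M. f x = g x"
  shows "g \<in> borel_measurable M"
proof -
  let ?f = "\<lambda>x. if x \<in> \<Omega> then f x else 0" and ?g = "\<lambda>x. if x \<in> \<Omega> then g x else 0"
  have "?f \<in> borel_measurable lebesgue"
    using f borel_measurable_if[OF \<Omega>_sets] by blast
  moreover have "AE x in lebesgue. ?f x = ?g x"
    using ae \<Omega>_sets by (simp add: AE_restrict_space_iff)
  ultimately have "?g \<in> borel_measurable lebesgue" by (rule borel_measurable_AE)
  then show ?thesis using borel_measurable_if[OF \<Omega>_sets] by blast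
qed

lemma test_int:
  fixes f :: "'a \<Rightarrow> 'b::euclidean_space"
  assumes "f \<in> borel_measurable borel" "\<And>x. x \<notin> \<Omega> \<Longrightarrow> f x = 0"
  shows "(\<integral>x. f x \<partial>M) = (\<integral>x. f x \<partial>lborel)" "integrable M f \<longleftrightarrow> integrable lborel f"
  using integral_lebesgue_on_eq_lborel[OF \<Omega>_sets assms] by auto

lemma borel_M: "f \<in> borel_measurable borel \<Longrightarrow> f \<in> borel_measurable M"
  by (rule measurable_restrict_space1, rule measurable_completion) simp

lemma bounded_integrable_M:
  fixes f :: "'a \<Rightarrow> 'b::euclidean_space"
  assumes "f \<in> borel_measurable M" "\<And>x. norm (f x) \<le> B"
  shows "integrable M f"
  using assms by (intro integrable_const_bound[of _ B]) auto

lemma LpD: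
  assumes "u \<in> Lp \<Omega> p"
  shows "u \<in> borel_measurable M" "integrable M (\<lambda>x. norm (u x) powr p)"
  using assms by (auto simp: Lp_def)

lemma LpI:
  assumes "u \<in> borel_measurable M" "integrable M (\<lambda>x. norm (u x) powr p)"
  shows "u \<in> Lp \<Omega> p"
  using assms by (auto simp: Lp_def)

lemma Lp_scale:
  fixes u :: "'a \<Rightarrow> 'b::euclidean_space"
  assumes "u \<in> Lp \<Omega> p" shows "(\<lambda>x. a *\<^sub>R u x) \<in> Lp \<Omega> p"
  using LpD[OF assms] by (intro LpI) (auto simp: powr_mult)

lemma Lp_add:
  fixes u v :: "'a \<Rightarrow> 'b::euclidean_space"
  assumes p: "p \<ge> 0" and "u \<in> Lp \<Omega> p" "v \<in> Lp \<Omega> p"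
  shows "(\<lambda>x. u x + v x) \<in> Lp \<Omega> p"
    and "(\<integral>x. norm (u x + v x) powr p \<partial>M)
      \<le> 2 powr p * ((\<integral>x. norm (u x) powr p \<partial>M) + (\<integral>x. norm (v x) powr p \<partial>M))"
proof -
  note u = LpD[OF assms(2)] and v = LpD[OF assms(3)]
  note [measurable] = u(1) v(1)
  have i: "integrable M (\<lambda>x. 2 powr p * (norm (u x) powr p + norm (v x) powr p))" using u v by auto
  have "integrable M (\<lambda>x. norm (u x + v x) powr p)"
    by (rule Bochner_Integration.integrable_bound[OF i]) (auto intro!: AE_I2 norm_add_powr_le[OF p])
  then show "(\<lambda>x. u x + v x) \<in> Lp \<Omega> p" by (intro LpI) auto
  have "(\<integral>x. norm (u x + v x) powr p \<partial>M) \<le> (\<integral>x. 2 powr p * (norm (u x) powr p + norm (v x) powr p) \<partial>M)"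
    by (rule integral_mono) (use i \<open>integrable M (\<lambda>x. norm (u x + v x) powr p)\<close> norm_add_powr_le[OF p] in auto)
  then show "(\<integral>x. norm (u x + v x) powr p \<partial>M)
      \<le> 2 powr p * ((\<integral>x. norm (u x) powr p \<partial>M) + (\<integral>x. norm (v x) powr p \<partial>M))"
    using u v by simp
qed

lemma Lp_combo:
  fixes u v :: "'a \<Rightarrow> 'b::euclidean_space"
  assumes "p \<ge> 0" "u \<in> Lp \<Omega> p" "v \<in> Lp \<Omega> p"
  shows "(\<lambda>x. a *\<^sub>R u x + b *\<^sub>R v x) \<in> Lp \<Omega> p"
  using assms by (intro Lp_add Lp_scale)

lemma Lp_diff:
  fixes u v :: "'a \<Rightarrow> 'b::euclidean_space"
  assumes "p \<ge> 0" "u \<in> Lp \<Omega> p" "v \<in> Lp \<Omega> p"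
  shows "(\<lambda>x. u x - v x) \<in> Lp \<Omega> p"
  using Lp_combo[OF assms, of 1 "-1"] by simp

lemma Lp_mono:
  fixes u :: "'a \<Rightarrow> 'b::euclidean_space"
  assumes "u \<in> Lp \<Omega> p" "0 < q" "q \<le> p"
  shows "u \<in> Lp \<Omega> q"
proof (rule LpI)
  note u = LpD[OF assms(1)]
  note [measurable] = u(1)
  show "integrable M (\<lambda>x. norm (u x) powr q)"
  proof (rule Bochner_Integration.integrable_bound)
    show "integrable M (\<lambda>x. 1 + norm (u x) powr p)" using u by simp
    show "AE x in M. norm (norm (u x) powr q) \<le> norm (1 + norm (u x) powr p)"
      using powr_le_interp[OF norm_ge_zero assms(3,2), of 1] by (intro AE_I2) simp
  qed simp
qed (rule LpD[OF assms(1)])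

lemma Lp_conv_mono:
  fixes u :: "nat \<Rightarrow> 'a \<Rightarrow> 'b::euclidean_space"
  assumes u: "\<And>k. u k \<in> Lp \<Omega> p" and q: "0 < q" "q \<le> p"
    and conv: "(\<lambda>k. \<integral>x. norm (u k x) powr p \<partial>M) \<longlonglongrightarrow> 0"
  shows "(\<lambda>k. \<integral>x. norm (u k x) powr q \<partial>M) \<longlonglongrightarrow> 0"
proof (rule LIMSEQ_I)
  fix e :: real assume e: "e > 0"
  define W where "W = measure M \<Omega> + 1"
  have W: "W > 0" by (simp add: W_def add_nonneg_pos)
  define \<eta> where "\<eta> = (e / (2 * W)) powr (1 / q)"
  have \<eta>: "\<eta> > 0" "\<eta> powr q = e / (2 * W)" using e W q by (auto simp: \<eta>_def powr_powr)
  have le: "(\<integral>x. norm (u k x) powr q \<partial>M) \<le> e / 2 + \<eta> powr (q - p) * (\<integral>x. norm (u k x) powr p \<partial>M)" for k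
  proof -
    have "(\<integral>x. norm (u k x) powr q \<partial>M) \<le> (\<integral>x. \<eta> powr q + \<eta> powr (q - p) * norm (u k x) powr p \<partial>M)"
      using LpD[OF u] LpD[OF Lp_mono[OF u q]] \<eta> q by (intro integral_mono powr_le_interp) auto
    also have "\<dots> = \<eta> powr q * measure M \<Omega> + \<eta> powr (q - p) * (\<integral>x. norm (u k x) powr p \<partial>M)"
      using LpD[OF u] by simp
    also have "\<eta> powr q * measure M \<Omega> \<le> e / (2 * W) * W"
      unfolding \<eta>(2) using e W by (intro mult_left_mono) (auto simp: W_def)
    also have "\<dots> = e / 2" using W by simp
    finally show ?thesis by simp
  qed
  have "\<forall>\<^sub>F k in sequentially. (\<integral>x. norm (u k x) powr p \<partial>M) < e / (2 * \<eta> powr (q - p))"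
    using order_tendstoD(2)[OF conv, of "e / (2 * \<eta> powr (q - p))"] e \<eta> by simp
  then have "\<forall>\<^sub>F k in sequentially. (\<integral>x. norm (u k x) powr q \<partial>M) < e"
  proof eventually_elim
    case (elim k)
    then have "\<eta> powr (q - p) * (\<integral>x. norm (u k x) powr p \<partial>M) < e / 2"
      using \<eta> by (simp add: field_simps)
    then show ?case using le[of k] by simp
  qed
  then show "\<exists>no. \<forall>k\<ge>no. norm ((\<integral>x. norm (u k x) powr q \<partial>M) - 0) < e"
    by (auto simp: eventually_sequentially integral_nonneg_AE)
qed

lemma Lp_conv_AE_subseq:
  fixes u :: "nat \<Rightarrow> 'a \<Rightarrow> 'b::euclidean_space"
  assumes u: "\<And>k. u k \<in> Lp \<Omega> p" and p: "0 < p"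
    and conv: "(\<lambda>k. \<integral>x. norm (u k x) powr p \<partial>M) \<longlonglongrightarrow> 0"
  obtains r :: "nat \<Rightarrow> nat" where "strict_mono r" "AE x in M. (\<lambda>k. u (r k) x) \<longlonglongrightarrow> 0"
proof -
  have "(\<lambda>k. \<integral>x. norm (norm (u k x) powr p) \<partial>M) \<longlonglongrightarrow> 0" using conv by simp
  from tendsto_L1_AE_subseq[OF LpD(2)[OF u] this]
  obtain r where r: "strict_mono r" "AE x in M. (\<lambda>k. norm (u (r k) x) powr p) \<longlonglongrightarrow> 0" by blast
  have "AE x in M. (\<lambda>k. u (r k) x) \<longlonglongrightarrow> 0"
    using r(2)
  proof eventually_elim
    case (elim x)
    have "(\<lambda>k. (norm (u (r k) x) powr p) powr (1 / p)) \<longlonglongrightarrow> 0 powr (1 / p)"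
      using p by (intro tendsto_powr' elim tendsto_const) auto
    then show ?case using p by (simp add: powr_powr tendsto_norm_zero_iff)
  qed
  with r(1) that show ?thesis by blast
qed

lemma locally_integrable_if_integrable:
  fixes u :: "'a \<Rightarrow> 'b::euclidean_space"
  assumes "integrable M u" shows "locally_integrable \<Omega> u"
  unfolding locally_integrable_def
proof (intro allI impI)
  fix K assume K: "compact K \<and> K \<subseteq> \<Omega>"
  then have KL: "K \<in> sets lebesgue" using compact_imp_closed by fastforce
  have "integrable lebesgue (\<lambda>x. indicator \<Omega> x *\<^sub>R u x)"
    using assms \<Omega>_sets by (subst (asm) integrable_restrict_space) auto
  then have "integrable lebesgue (\<lambda>x. indicator K x *\<^sub>R (indicator \<Omega> x *\<^sub>R u x))"
    using KL by (rule integrable_mult_indicator[rotated])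
  also have "(\<lambda>x. indicator K x *\<^sub>R (indicator \<Omega> x *\<^sub>R u x)) = (\<lambda>x. indicator K x *\<^sub>R u x)"
    using K by (auto simp: indicator_def fun_eq_iff)
  finally show "integrable (lebesgue_on K) u"
    using KL by (subst integrable_restrict_space) auto
qed

lemma Lp_integrable:
  fixes u :: "'a \<Rightarrow> 'b::euclidean_space"
  assumes "u \<in> Lp \<Omega> p" "1 \<le> p" shows "integrable M u"
proof -
  have "u \<in> Lp \<Omega> 1" using Lp_mono[OF assms(1)] assms(2) by simp
  from LpD[OF this] show ?thesis by (simp add: integrable_norm_iff)
qed

lemma test_Lp:
  assumes \<phi>: "\<phi> \<in> test_functions \<Omega>" and p: "p \<ge> 0"
  shows "\<phi> \<in> Lp \<Omega> p" "grad \<phi> \<in> Lp \<Omega> p"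
proof -
  note [measurable] = test_measurable[OF \<phi>, THEN borel_M]
  obtain B where B: "\<And>x. \<bar>\<phi> x\<bar> \<le> B" "\<And>x. norm (grad \<phi> x) \<le> B" using test_bounded[OF \<phi>] by metis
  show "\<phi> \<in> Lp \<Omega> p" "grad \<phi> \<in> Lp \<Omega> p"
    using p by (intro LpI bounded_integrable_M[of _ "B powr p"]; simp add: powr_mono2 B)+
qed

lemma weak_gradient_iff:
  "weak_gradient \<Omega> u U \<longleftrightarrow> locally_integrable \<Omega> u \<and> locally_integrable \<Omega> U \<and>
     (\<forall>\<phi>\<in>test_functions \<Omega>. \<forall>i\<in>Basis.
        (\<integral>x. (grad \<phi> x \<bullet> i) *\<^sub>R u x \<partial>M) = - (\<integral>x. (\<phi> x *\<^sub>R U x) \<bullet> i \<partial>M))"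
  unfolding weak_gradient_def
  by (auto simp: grad_inner[OF test_differentiable] mult.commute)

lemma weak_gradient_combo:
  assumes u: "weak_gradient \<Omega> u U" and v: "weak_gradient \<Omega> v V"
  shows "weak_gradient \<Omega> (\<lambda>x. a * u x + b * v x) (\<lambda>x. a *\<^sub>R U x + b *\<^sub>R V x)"
  unfolding weak_gradient_iff
proof (intro conjI ballI)
  have l: "locally_integrable \<Omega> u" "locally_integrable \<Omega> v" "locally_integrable \<Omega> U" "locally_integrable \<Omega> V"
    using u v by (auto simp: weak_gradient_iff)
  then show "locally_integrable \<Omega> (\<lambda>x. a * u x + b * v x)" "locally_integrable \<Omega> (\<lambda>x. a *\<^sub>R U x + b *\<^sub>R V x)"
    by (auto simp: locally_integrable_def)
  fix \<phi> and i :: 'a assume \<phi>: "\<phi> \<in> test_functions \<Omega>" and i: "i \<in> Basis"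
  obtain K where K: "compact K" "K \<subseteq> \<Omega>" "\<And>x. x \<notin> K \<Longrightarrow> \<phi> x = 0" "\<And>x. x \<notin> K \<Longrightarrow> grad \<phi> x = 0"
    using test_functionsE[OF \<phi>] by metis
  have c: "continuous_on UNIV (\<lambda>x. grad \<phi> x \<bullet> i)"
    by (intro continuous_intros test_grad_continuous[OF \<phi>])
  note int = integrable_mult_compact_support[OF open_\<Omega> _ test_continuous[OF \<phi>] K(1-3)]
    and int' = integrable_mult_compact_support[OF open_\<Omega> _ c K(1,2)]
  have 1: "integrable M (\<lambda>x. (grad \<phi> x \<bullet> i) *\<^sub>R u x)" "integrable M (\<lambda>x. (grad \<phi> x \<bullet> i) *\<^sub>R v x)"
    using int'[OF l(1)] int'[OF l(2)] K(4) by auto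
  have 2: "integrable M (\<lambda>x. (\<phi> x *\<^sub>R U x) \<bullet> i)" "integrable M (\<lambda>x. (\<phi> x *\<^sub>R V x) \<bullet> i)"
    using integrable_inner_left[OF int[OF l(3)]] integrable_inner_left[OF int[OF l(4)]] by blast+
  have "(\<integral>x. (grad \<phi> x \<bullet> i) *\<^sub>R (a * u x + b * v x) \<partial>M)
      = (\<integral>x. a * ((grad \<phi> x \<bullet> i) *\<^sub>R u x) + b * ((grad \<phi> x \<bullet> i) *\<^sub>R v x) \<partial>M)"
    by (simp add: algebra_simps)
  also have "\<dots> = a * (\<integral>x. (grad \<phi> x \<bullet> i) *\<^sub>R u x \<partial>M) + b * (\<integral>x. (grad \<phi> x \<bullet> i) *\<^sub>R v x \<partial>M)"
    using 1 by (subst Bochner_Integration.integral_add) auto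
  also have "\<dots> = - (a * (\<integral>x. (\<phi> x *\<^sub>R U x) \<bullet> i \<partial>M) + b * (\<integral>x. (\<phi> x *\<^sub>R V x) \<bullet> i \<partial>M))"
    using u v \<phi> i by (simp add: weak_gradient_iff)
  also have "a * (\<integral>x. (\<phi> x *\<^sub>R U x) \<bullet> i \<partial>M) + b * (\<integral>x. (\<phi> x *\<^sub>R V x) \<bullet> i \<partial>M)
      = (\<integral>x. a * ((\<phi> x *\<^sub>R U x) \<bullet> i) + b * ((\<phi> x *\<^sub>R V x) \<bullet> i) \<partial>M)"
    using 2 by (subst Bochner_Integration.integral_add) auto
  also have "\<dots> = (\<integral>x. (\<phi> x *\<^sub>R (a *\<^sub>R U x + b *\<^sub>R V x)) \<bullet> i \<partial>M)"
    by (simp add: inner_add_left algebra_simps)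
  finally show "(\<integral>x. (grad \<phi> x \<bullet> i) *\<^sub>R (a * u x + b * v x) \<partial>M)
      = - (\<integral>x. (\<phi> x *\<^sub>R (a *\<^sub>R U x + b *\<^sub>R V x)) \<bullet> i \<partial>M)" .
qed

lemma weak_gradient_test:
  assumes \<phi>: "\<phi> \<in> test_functions \<Omega>"
  shows "weak_gradient \<Omega> \<phi> (grad \<phi>)"
  unfolding weak_gradient_iff
proof (intro conjI ballI)
  show "locally_integrable \<Omega> \<phi>" "locally_integrable \<Omega> (grad \<phi>)"
    using test_Lp[OF \<phi>, of 1] by (auto intro: locally_integrable_if_integrable Lp_integrable)
  fix \<psi> and i :: 'a assume \<psi>: "\<psi> \<in> test_functions \<Omega>" and i: "i \<in> Basis"
  note [measurable] = test_measurable[OF \<phi>] test_measurable[OF \<psi>]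
  have "(\<integral>x. (grad \<psi> x \<bullet> i) *\<^sub>R \<phi> x \<partial>M) = (\<integral>x. \<phi> x * (grad \<psi> x \<bullet> i) \<partial>lborel)"
    using test_outside[OF \<phi>] by (subst test_int) (auto simp: mult.commute)
  also have "\<dots> = - (\<integral>x. (grad \<phi> x \<bullet> i) * \<psi> x \<partial>lborel)"
    by (rule test_integration_by_parts[OF \<phi> \<psi>])
  also have "(\<integral>x. (grad \<phi> x \<bullet> i) * \<psi> x \<partial>lborel) = (\<integral>x. (\<psi> x *\<^sub>R grad \<phi> x) \<bullet> i \<partial>M)"
    using test_outside[OF \<psi>] by (subst test_int) (auto simp: mult.commute)
  finally show "(\<integral>x. (grad \<psi> x \<bullet> i) *\<^sub>R \<phi> x \<partial>M) = - (\<integral>x. (\<psi> x *\<^sub>R grad \<phi> x) \<bullet> i \<partial>M)" .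
qed

lemma integral_mult_limit:
  fixes f :: "nat \<Rightarrow> 'a \<Rightarrow> real"
  assumes f: "\<And>k. integrable M (f k)" and u: "integrable M u"
    and conv: "(\<lambda>k. \<integral>x. \<bar>u x - f k x\<bar> \<partial>M) \<longlonglongrightarrow> 0"
    and b: "b \<in> borel_measurable M" "\<And>x. \<bar>b x\<bar> \<le> B"
  shows "(\<lambda>k. \<integral>x. b x * f k x \<partial>M) \<longlonglongrightarrow> (\<integral>x. b x * u x \<partial>M)"
proof (rule LIM_zero_cancel, rule Lim_null_comparison)
  have im: "integrable M (\<lambda>x. b x * g x)" if "integrable M g" for g :: "'a \<Rightarrow> real"
  proof (rule Bochner_Integration.integrable_bound)
    show "integrable M (\<lambda>x. B * g x)" using that by simp
    show "AE x in M. norm (b x * g x) \<le> norm (B * g x)"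
      using b(2) by (intro AE_I2) (auto simp: abs_mult intro!: mult_right_mono intro: order_trans[OF _ abs_ge_self])
  qed (use b that in measurable)
  show "(\<lambda>k. B * (\<integral>x. \<bar>u x - f k x\<bar> \<partial>M)) \<longlonglongrightarrow> 0"
    using tendsto_mult_right_zero[OF conv] by simp
  show "\<forall>\<^sub>F k in sequentially. norm ((\<integral>x. b x * f k x \<partial>M) - (\<integral>x. b x * u x \<partial>M)) \<le> B * (\<integral>x. \<bar>u x - f k x\<bar> \<partial>M)"
  proof (intro always_eventually allI)
    fix k
    have "(\<integral>x. b x * f k x \<partial>M) - (\<integral>x. b x * u x \<partial>M) = (\<integral>x. b x * (f k x - u x) \<partial>M)"
      using im f u by (simp add: right_diff_distrib)
    then have "norm ((\<integral>x. b x * f k x \<partial>M) - (\<integral>x. b x * u x \<partial>M)) \<le> (\<integral>x. norm (b x * (f k x - u x)) \<partial>M)"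
      using integral_norm_bound[of M "\<lambda>x. b x * (f k x - u x)"] by simp
    also have "\<dots> \<le> (\<integral>x. B * \<bar>u x - f k x\<bar> \<partial>M)"
      using f u b(2) by (intro integral_mono integrable_norm im) (auto simp: abs_mult abs_minus_commute intro!: mult_right_mono)
    finally show "norm ((\<integral>x. b x * f k x \<partial>M) - (\<integral>x. b x * u x \<partial>M)) \<le> B * (\<integral>x. \<bar>u x - f k x\<bar> \<partial>M)"
      by simp
  qed
qed

text \<open>A function of \<open>W\<^sup>1\<^sup>,\<^sup>p\<^sub>0\<close> together with its weak gradient, as an \<open>L\<^sup>p\<close>-limit of pairs
  \<open>(\<phi>, \<nabla>\<phi>)\<close>. Unlike membership in \<^term>\<open>W10 p \<Omega>\<close>, this notion is manifestly stable under linear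
  combinations and limits.\<close>

definition sob :: "real \<Rightarrow> ('a \<Rightarrow> real) \<Rightarrow> ('a \<Rightarrow> 'a) \<Rightarrow> bool" where
  "sob p u U \<longleftrightarrow> u \<in> Lp \<Omega> p \<and> U \<in> Lp \<Omega> p \<and> (\<exists>\<phi>. (\<forall>k::nat. \<phi> k \<in> test_functions \<Omega>) \<and>
     (\<lambda>k. \<integral>x. norm (u x - \<phi> k x) powr p \<partial>M) \<longlonglongrightarrow> 0 \<and>
     (\<lambda>k. \<integral>x. norm (U x - grad (\<phi> k) x) powr p \<partial>M) \<longlonglongrightarrow> 0)"

lemma sob_Lp: "sob p u U \<Longrightarrow> u \<in> Lp \<Omega> p" "sob p u U \<Longrightarrow> U \<in> Lp \<Omega> p"
  by (auto simp: sob_def)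

lemma sobE:
  assumes "sob p u U"
  obtains \<phi> where "\<And>k::nat. \<phi> k \<in> test_functions \<Omega>"
    "(\<lambda>k. \<integral>x. norm (u x - \<phi> k x) powr p \<partial>M) \<longlonglongrightarrow> 0"
    "(\<lambda>k. \<integral>x. norm (U x - grad (\<phi> k) x) powr p \<partial>M) \<longlonglongrightarrow> 0"
  using assms by (auto simp: sob_def)

lemma sob_mono:
  assumes s: "sob p u U" and q: "0 < q" "q \<le> p"
  shows "sob q u U"
proof -
  obtain \<phi> where \<phi>: "\<And>k. \<phi> k \<in> test_functions \<Omega>"
    "(\<lambda>k. \<integral>x. norm (u x - \<phi> k x) powr p \<partial>M) \<longlonglongrightarrow> 0"
    "(\<lambda>k. \<integral>x. norm (U x - grad (\<phi> k) x) powr p \<partial>M) \<longlonglongrightarrow> 0"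
    by (rule sobE[OF s], rule that)
  note Lp = sob_Lp[OF s]
  have "(\<lambda>k. \<integral>x. norm (u x - \<phi> k x) powr q \<partial>M) \<longlonglongrightarrow> 0"
    by (rule Lp_conv_mono[OF _ q \<phi>(2)]) (use Lp \<phi>(1) q in \<open>simp_all add: Lp_diff test_Lp\<close>)
  moreover have "(\<lambda>k. \<integral>x. norm (U x - grad (\<phi> k) x) powr q \<partial>M) \<longlonglongrightarrow> 0"
    by (rule Lp_conv_mono[OF _ q \<phi>(3)]) (use Lp \<phi>(1) q in \<open>simp_all add: Lp_diff test_Lp\<close>)
  ultimately show ?thesis
    using Lp_mono[OF Lp(1) q] Lp_mono[OF Lp(2) q] \<phi>(1) by (auto simp: sob_def)
qed

lemma sob_weak_gradient:
  assumes s: "sob p u U" and p: "1 \<le> p"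
  shows "weak_gradient \<Omega> u U"
proof -
  have s1: "sob 1 u U" using sob_mono[OF s] p by simp
  obtain \<phi> where \<phi>: "\<And>k. \<phi> k \<in> test_functions \<Omega>"
    "(\<lambda>k. \<integral>x. norm (u x - \<phi> k x) powr 1 \<partial>M) \<longlonglongrightarrow> 0"
    "(\<lambda>k. \<integral>x. norm (U x - grad (\<phi> k) x) powr 1 \<partial>M) \<longlonglongrightarrow> 0"
    by (rule sobE[OF s1], rule that)
  have iu: "integrable M u" and iU: "integrable M U"
    using sob_Lp[OF s1] by (auto intro: Lp_integrable)
  have i\<phi>: "integrable M (\<phi> k)" "integrable M (grad (\<phi> k))" for k
    using test_Lp[OF \<phi>(1), of 1] by (auto intro: Lp_integrable)
  show ?thesis unfolding weak_gradient_iff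
  proof (intro conjI ballI)
    show "locally_integrable \<Omega> u" "locally_integrable \<Omega> U"
      using iu iU by (auto intro: locally_integrable_if_integrable)
    fix \<psi> and i :: 'a assume \<psi>: "\<psi> \<in> test_functions \<Omega>" and i: "i \<in> Basis"
    obtain B where B: "\<And>x. \<bar>\<psi> x\<bar> \<le> B" "\<And>x. norm (grad \<psi> x) \<le> B" using test_bounded[OF \<psi>] by metis
    have Bi: "\<bar>grad \<psi> x \<bullet> i\<bar> \<le> B" for x
      using B(2)[of x] Basis_le_norm[OF i, of "grad \<psi> x"] by linarith
    note [measurable] = test_measurable[OF \<psi>, THEN borel_M]
    have "(\<lambda>k. \<integral>x. (grad \<psi> x \<bullet> i) * \<phi> k x \<partial>M) \<longlonglongrightarrow> (\<integral>x. (grad \<psi> x \<bullet> i) * u x \<partial>M)"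
      by (rule integral_mult_limit[where B=B]) (use \<phi>(2) iu i\<phi> Bi in auto)
    moreover have "(\<lambda>k. \<integral>x. \<psi> x * (grad (\<phi> k) x \<bullet> i) \<partial>M) \<longlonglongrightarrow> (\<integral>x. \<psi> x * (U x \<bullet> i) \<partial>M)"
    proof (rule integral_mult_limit[where B=B])
      show "(\<lambda>k. \<integral>x. \<bar>U x \<bullet> i - grad (\<phi> k) x \<bullet> i\<bar> \<partial>M) \<longlonglongrightarrow> 0"
      proof (rule Lim_null_comparison[OF always_eventually, OF allI])
        fix k
        have "(\<integral>x. \<bar>U x \<bullet> i - grad (\<phi> k) x \<bullet> i\<bar> \<partial>M) \<le> (\<integral>x. norm (U x - grad (\<phi> k) x) \<partial>M)"
          using iU i\<phi> by (intro integral_mono)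
            (auto simp: inner_diff_left[symmetric] intro: Basis_le_norm[OF i])
        then show "norm (\<integral>x. \<bar>U x \<bullet> i - grad (\<phi> k) x \<bullet> i\<bar> \<partial>M) \<le> (\<integral>x. norm (U x - grad (\<phi> k) x) \<partial>M)"
          by (simp add: integral_nonneg_AE)
      qed (use \<phi>(3) in simp)
    qed (use iU i\<phi> B in auto)
    moreover have "(\<integral>x. (grad \<psi> x \<bullet> i) * \<phi> k x \<partial>M) = - (\<integral>x. \<psi> x * (grad (\<phi> k) x \<bullet> i) \<partial>M)" for k
      using weak_gradient_test[OF \<phi>(1)[of k]] \<psi> i by (simp add: weak_gradient_iff)
    ultimately have "(\<integral>x. (grad \<psi> x \<bullet> i) * u x \<partial>M) = - (\<integral>x. \<psi> x * (U x \<bullet> i) \<partial>M)"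
      by (metis (no_types, lifting) LIMSEQ_unique tendsto_minus ext)
    then show "(\<integral>x. (grad \<psi> x \<bullet> i) *\<^sub>R u x \<partial>M) = - (\<integral>x. (\<psi> x *\<^sub>R U x) \<bullet> i \<partial>M)" by simp
  qed
qed

lemma sob_wgrad:
  assumes "sob p u U" "1 \<le> p"
  shows "AE x in M. wgrad \<Omega> u x = U x"
  by (rule wgrad_eq[OF open_\<Omega> sob_weak_gradient[OF assms]])

lemma norm_AE_cong:
  fixes f g :: "'a \<Rightarrow> 'b::euclidean_space"
  assumes ae: "AE x in M. f x = g x" and f: "f \<in> borel_measurable M"
  shows "(\<integral>x. norm (f x) powr p \<partial>M) = (\<integral>x. norm (g x) powr p \<partial>M)"
proof -
  note [measurable] = f measurable_AE_eq[OF f ae]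
  show ?thesis by (rule integral_cong_AE) (use ae in auto)
qed

lemma Lp_AE_cong:
  fixes f g :: "'a \<Rightarrow> 'b::euclidean_space"
  assumes f: "f \<in> Lp \<Omega> p" and ae: "AE x in M. f x = g x"
  shows "g \<in> Lp \<Omega> p"
proof (rule LpI)
  note [measurable] = LpD(1)[OF f] measurable_AE_eq[OF LpD(1)[OF f] ae]
  show "g \<in> borel_measurable M" by simp
  show "integrable M (\<lambda>x. norm (g x) powr p)"
    using LpD(2)[OF f] by (rule integrable_cong_AE_imp) (use ae in auto)
qed

lemma sob_AE_cong:
  assumes s: "sob p u U" and u: "AE x in M. u x = u' x" and U: "AE x in M. U x = U' x"
  shows "sob p u' U'"
proof -
  obtain \<phi> where \<phi>: "\<And>k. \<phi> k \<in> test_functions \<Omega>"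
    "(\<lambda>k. \<integral>x. norm (u x - \<phi> k x) powr p \<partial>M) \<longlonglongrightarrow> 0"
    "(\<lambda>k. \<integral>x. norm (U x - grad (\<phi> k) x) powr p \<partial>M) \<longlonglongrightarrow> 0"
    by (rule sobE[OF s], rule that)
  note [measurable] = LpD(1)[OF sob_Lp(1)[OF s]] LpD(1)[OF sob_Lp(2)[OF s]]
    test_measurable[OF \<phi>(1), THEN borel_M]
  have "(\<integral>x. norm (u x - \<phi> k x) powr p \<partial>M) = (\<integral>x. norm (u' x - \<phi> k x) powr p \<partial>M)" for k
    by (rule norm_AE_cong) (use u in auto)
  moreover have "(\<integral>x. norm (U x - grad (\<phi> k) x) powr p \<partial>M) = (\<integral>x. norm (U' x - grad (\<phi> k) x) powr p \<partial>M)" for k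
    by (rule norm_AE_cong) (use U in auto)
  ultimately show ?thesis
    unfolding sob_def using \<phi> Lp_AE_cong[OF sob_Lp(1)[OF s] u] Lp_AE_cong[OF sob_Lp(2)[OF s] U] by auto
qed

lemma sob_combo:
  assumes p: "0 \<le> p" and u: "sob p u U" and v: "sob p v V"
  shows "sob p (\<lambda>x. a * u x + b * v x) (\<lambda>x. a *\<^sub>R U x + b *\<^sub>R V x)"
proof -
  obtain \<phi> where \<phi>: "\<And>k. \<phi> k \<in> test_functions \<Omega>"
    "(\<lambda>k. \<integral>x. norm (u x - \<phi> k x) powr p \<partial>M) \<longlonglongrightarrow> 0"
    "(\<lambda>k. \<integral>x. norm (U x - grad (\<phi> k) x) powr p \<partial>M) \<longlonglongrightarrow> 0"
    by (rule sobE[OF u], rule that)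
  obtain \<psi> where \<psi>: "\<And>k. \<psi> k \<in> test_functions \<Omega>"
    "(\<lambda>k. \<integral>x. norm (v x - \<psi> k x) powr p \<partial>M) \<longlonglongrightarrow> 0"
    "(\<lambda>k. \<integral>x. norm (V x - grad (\<psi> k) x) powr p \<partial>M) \<longlonglongrightarrow> 0"
    by (rule sobE[OF v], rule that)
  have conv: "(\<lambda>k. \<integral>x. norm (a *\<^sub>R F k x + b *\<^sub>R G k x) powr p \<partial>M) \<longlonglongrightarrow> 0"
    if F: "\<And>k. F k \<in> Lp \<Omega> p" "(\<lambda>k. \<integral>x. norm (F k x) powr p \<partial>M) \<longlonglongrightarrow> 0"
      and G: "\<And>k. G k \<in> Lp \<Omega> p" "(\<lambda>k. \<integral>x. norm (G k x) powr p \<partial>M) \<longlonglongrightarrow> 0"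
    for F G :: "nat \<Rightarrow> 'a \<Rightarrow> 'b::euclidean_space"
  proof (rule Lim_null_comparison[OF always_eventually, OF allI])
    show "(\<lambda>k. 2 powr p * (\<bar>a\<bar> powr p * (\<integral>x. norm (F k x) powr p \<partial>M)
        + \<bar>b\<bar> powr p * (\<integral>x. norm (G k x) powr p \<partial>M))) \<longlonglongrightarrow> 0"
      by (rule tendsto_eq_intros F(2) G(2) refl)+ simp
    show "norm (\<integral>x. norm (a *\<^sub>R F k x + b *\<^sub>R G k x) powr p \<partial>M)
      \<le> 2 powr p * (\<bar>a\<bar> powr p * (\<integral>x. norm (F k x) powr p \<partial>M) + \<bar>b\<bar> powr p * (\<integral>x. norm (G k x) powr p \<partial>M))" for k
      using Lp_add(2)[OF p Lp_scale[OF F(1)] Lp_scale[OF G(1)], of a k b k]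
      by (simp add: integral_nonneg_AE powr_mult)
  qed
  have "(\<lambda>k. \<integral>x. norm (a *\<^sub>R (u x - \<phi> k x) + b *\<^sub>R (v x - \<psi> k x)) powr p \<partial>M) \<longlonglongrightarrow> 0"
    by (rule conv) (use \<phi> \<psi> sob_Lp[OF u] sob_Lp[OF v] p in \<open>simp_all add: Lp_diff test_Lp\<close>)
  moreover have "(\<lambda>k. \<integral>x. norm (a *\<^sub>R (U x - grad (\<phi> k) x) + b *\<^sub>R (V x - grad (\<psi> k) x)) powr p \<partial>M) \<longlonglongrightarrow> 0"
    by (rule conv) (use \<phi> \<psi> sob_Lp[OF u] sob_Lp[OF v] p in \<open>simp_all add: Lp_diff test_Lp\<close>)
  ultimately show ?thesis
    unfolding sob_def
    using Lp_combo[OF p sob_Lp(1)[OF u] sob_Lp(1)[OF v]] Lp_combo[OF p sob_Lp(2)[OF u] sob_Lp(2)[OF v]]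
      test_combo[OF \<phi>(1) \<psi>(1)]
    by (intro conjI exI[of _ "\<lambda>k x. a * \<phi> k x + b * \<psi> k x"])
      (auto simp: grad_combo[OF \<phi>(1) \<psi>(1)] algebra_simps)
qed

lemma sob_test: "\<phi> \<in> test_functions \<Omega> \<Longrightarrow> 0 \<le> p \<Longrightarrow> sob p \<phi> (grad \<phi>)"
  unfolding sob_def by (auto intro: test_Lp intro!: exI[of _ "\<lambda>_. \<phi>"])

lemma sob_zero: "0 \<le> p \<Longrightarrow> sob p (\<lambda>_. 0) (\<lambda>_. 0)"
  using sob_test[OF test_zero] by (simp add: grad_zero[abs_def])

lemma sob_W10:
  assumes s: "sob p u U" and p: "1 \<le> p"
  shows "u \<in> W10 p \<Omega>"
proof -
  obtain \<phi> where \<phi>: "\<And>k. \<phi> k \<in> test_functions \<Omega>"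
    "(\<lambda>k. \<integral>x. norm (u x - \<phi> k x) powr p \<partial>M) \<longlonglongrightarrow> 0"
    "(\<lambda>k. \<integral>x. norm (U x - grad (\<phi> k) x) powr p \<partial>M) \<longlonglongrightarrow> 0"
    by (rule sobE[OF s], rule that)
  note Lp = sob_Lp[OF s] and wg = sob_weak_gradient[OF s p]
  have "(\<integral>x. norm (wgrad \<Omega> (\<lambda>x. u x - \<phi> k x) x) powr p \<partial>M) = (\<integral>x. norm (U x - grad (\<phi> k) x) powr p \<partial>M)" for k
  proof -
    have d: "sob p (\<lambda>x. u x - \<phi> k x) (\<lambda>x. U x - grad (\<phi> k) x)"
      using sob_combo[OF _ s sob_test[OF \<phi>(1)], of 1 "-1" k] p by simp
    show ?thesis
      by (rule norm_AE_cong[symmetric])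
        (use sob_wgrad[OF d p] LpD(1)[OF sob_Lp(2)[OF d]] in \<open>auto elim: AE_mp\<close>)
  qed
  then have "W1_norm p \<Omega> (\<lambda>x. u x - \<phi> k x) = ((\<integral>x. norm (u x - \<phi> k x) powr p \<partial>M)
      + (\<integral>x. norm (U x - grad (\<phi> k) x) powr p \<partial>M)) powr (1 / p)" for k
    by (simp add: W1_norm_def)
  moreover have "(\<lambda>k. ((\<integral>x. norm (u x - \<phi> k x) powr p \<partial>M)
      + (\<integral>x. norm (U x - grad (\<phi> k) x) powr p \<partial>M)) powr (1 / p)) \<longlonglongrightarrow> (0 + 0) powr (1 / p)"
    using p by (intro tendsto_powr' tendsto_add \<phi>(2,3) tendsto_const)
      (auto intro!: always_eventually add_nonneg_nonneg integral_nonneg_AE)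
  ultimately have "(\<lambda>k. W1_norm p \<Omega> (\<lambda>x. u x - \<phi> k x)) \<longlonglongrightarrow> 0" using p by simp
  then show ?thesis
    unfolding W10_def W1_def using Lp wg \<phi>(1) by blast
qed

lemma W10_sob:
  assumes u: "u \<in> W10 p \<Omega>" and p: "1 \<le> p"
  shows "sob p u (wgrad \<Omega> u)"
proof -
  obtain U where U: "U \<in> Lp \<Omega> p" "weak_gradient \<Omega> u U" and uL: "u \<in> Lp \<Omega> p"
    using u by (auto simp: W10_def W1_def)
  obtain \<phi> where \<phi>: "\<And>k. \<phi> k \<in> test_functions \<Omega>" "(\<lambda>k. W1_norm p \<Omega> (\<lambda>x. u x - \<phi> k x)) \<longlonglongrightarrow> 0"
    using u by (auto simp: W10_def)
  define a where "a k = (\<integral>x. norm (u x - \<phi> k x) powr p \<partial>M)" for k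
  define b where "b k = (\<integral>x. norm (U x - grad (\<phi> k) x) powr p \<partial>M)" for k
  have ab: "a k \<ge> 0" "b k \<ge> 0" for k by (auto simp: a_def b_def intro: integral_nonneg_AE)
  have "(\<integral>x. norm (wgrad \<Omega> (\<lambda>x. u x - \<phi> k x) x) powr p \<partial>M) = b k" for k
  proof -
    have "weak_gradient \<Omega> (\<lambda>x. u x - \<phi> k x) (\<lambda>x. U x - grad (\<phi> k) x)"
      using weak_gradient_combo[OF U(2) weak_gradient_test[OF \<phi>(1)], of 1 "-1" k] by simp
    from wgrad_eq[OF open_\<Omega> this]
    have "AE x in M. U x - grad (\<phi> k) x = wgrad \<Omega> (\<lambda>x. u x - \<phi> k x) x" by auto
    from norm_AE_cong[OF this] show ?thesis
      using LpD(1)[OF Lp_diff[OF _ U(1) test_Lp(2)[OF \<phi>(1)]]] p by (simp add: b_def)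
  qed
  then have "W1_norm p \<Omega> (\<lambda>x. u x - \<phi> k x) = (a k + b k) powr (1 / p)" for k
    by (simp add: W1_norm_def a_def)
  then have "(\<lambda>k. (a k + b k) powr (1 / p)) \<longlonglongrightarrow> 0" using \<phi>(2) by simp
  then have "(\<lambda>k. ((a k + b k) powr (1 / p)) powr p) \<longlonglongrightarrow> 0 powr p"
    using p by (intro tendsto_powr' tendsto_const) auto
  moreover have "((a k + b k) powr (1 / p)) powr p = a k + b k" for k
    using p ab[of k] by (simp add: powr_powr)
  ultimately have c: "(\<lambda>k. a k + b k) \<longlonglongrightarrow> 0" using p by simp
  have "a \<longlonglongrightarrow> 0" "b \<longlonglongrightarrow> 0"
    by (rule Lim_null_comparison[OF always_eventually c]; use ab in \<open>auto simp: add_increasing\<close>)+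
  then have "sob p u U" unfolding sob_def using uL U(1) \<phi>(1) by (auto simp: a_def[abs_def] b_def[abs_def])
  then show ?thesis
    by (rule sob_AE_cong) (use wgrad_eq[OF open_\<Omega> U(2)] in auto)
qed

lemma nn_integral_M_le:
  assumes "f \<in> borel_measurable borel"
  shows "(\<integral>\<^sup>+x. f x \<partial>M) \<le> (\<integral>\<^sup>+x. f x \<partial>lborel)"
proof -
  have "(\<integral>\<^sup>+x. f x \<partial>M) = (\<integral>\<^sup>+x. f x * indicator \<Omega> x \<partial>lebesgue)"
    using \<Omega>_sets by (subst nn_integral_restrict_space) auto
  also have "\<dots> \<le> (\<integral>\<^sup>+x. f x \<partial>lebesgue)"
    by (intro nn_integral_mono) (auto simp: indicator_def)
  finally show ?thesis by (simp add: nn_integral_completion)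
qed

text \<open>The Sobolev inequality passes to the closure by Fatou's lemma.\<close>

lemma sob_sobolev:
  assumes p: "1 \<le> p" "p \<le> r" and sub: "DIM('a) * ((r - p) / p) < r"
  obtains C where "C > 0" "\<And>u U D. sob p u U \<Longrightarrow> D > 0 \<Longrightarrow> (\<integral>x. norm (U x) powr p \<partial>M) \<le> D \<Longrightarrow>
     u \<in> Lp \<Omega> r \<and> (\<integral>x. norm (u x) powr r \<partial>M) \<le> C * D powr (r / p)"
proof -
  obtain C where C: "C > 0" "\<And>\<phi> D. \<phi> \<in> test_functions \<Omega> \<Longrightarrow> D > 0 \<Longrightarrow>
     (\<integral>\<^sup>+x. ennreal (norm (grad \<phi> x) powr p) \<partial>lborel) \<le> ennreal D \<Longrightarrow>
     (\<integral>\<^sup>+x. ennreal (\<bar>\<phi> x\<bar> powr r) \<partial>lborel) \<le> ennreal (C * D powr (r / p))"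
    using sobolev_test[OF bounded_\<Omega> p sub] by metis
  define C' where "C' = C * (2 powr p * 2) powr (r / p)"
  have "C' > 0" using C(1) by (simp add: C'_def)
  moreover have "u \<in> Lp \<Omega> r \<and> (\<integral>x. norm (u x) powr r \<partial>M) \<le> C' * D powr (r / p)"
    if s: "sob p u U" and D: "D > 0" and le: "(\<integral>x. norm (U x) powr p \<partial>M) \<le> D" for u U D
  proof -
    obtain \<phi> where \<phi>: "\<And>k. \<phi> k \<in> test_functions \<Omega>"
      "(\<lambda>k. \<integral>x. norm (u x - \<phi> k x) powr p \<partial>M) \<longlonglongrightarrow> 0"
      "(\<lambda>k. \<integral>x. norm (U x - grad (\<phi> k) x) powr p \<partial>M) \<longlonglongrightarrow> 0"
      by (rule sobE[OF s], rule that)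
    note Lp = sob_Lp[OF s]
    note [measurable] = LpD(1)[OF Lp(1)] test_measurable[OF \<phi>(1), THEN borel_M] test_measurable[OF \<phi>(1)]
    define E where "E = ennreal (C' * D powr (r / p))"
    have "\<forall>\<^sub>F k in sequentially. (\<integral>x. norm (U x - grad (\<phi> k) x) powr p \<partial>M) < D"
      using order_tendstoD(2)[OF \<phi>(3) D] .
    then have ev: "\<forall>\<^sub>F k in sequentially. (\<integral>\<^sup>+x. ennreal (\<bar>\<phi> k x\<bar> powr r) \<partial>M) \<le> E"
    proof eventually_elim
      case (elim k)
      have d: "(\<lambda>x. grad (\<phi> k) x - U x) \<in> Lp \<Omega> p" using Lp(2) test_Lp(2)[OF \<phi>(1)] p by (intro Lp_diff) auto
      have "(\<integral>x. norm (grad (\<phi> k) x) powr p \<partial>M) = (\<integral>x. norm (U x + (grad (\<phi> k) x - U x)) powr p \<partial>M)"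
        by simp
      also have "\<dots> \<le> 2 powr p * ((\<integral>x. norm (U x) powr p \<partial>M) + (\<integral>x. norm (grad (\<phi> k) x - U x) powr p \<partial>M))"
        by (rule Lp_add(2)[OF _ Lp(2) d]) (use p in auto)
      also have "\<dots> \<le> 2 powr p * (D + D)"
        using elim le by (intro mult_left_mono add_mono) (auto simp: norm_minus_commute)
      finally have g: "(\<integral>x. norm (grad (\<phi> k) x) powr p \<partial>M) \<le> 2 powr p * 2 * D" by simp
      have "(\<integral>\<^sup>+x. ennreal (norm (grad (\<phi> k) x) powr p) \<partial>lborel) = ennreal (\<integral>x. norm (grad (\<phi> k) x) powr p \<partial>lborel)"
      proof (rule nn_integral_eq_integral)
        have "integrable M (\<lambda>x. norm (grad (\<phi> k) x) powr p)"
          using LpD(2)[OF test_Lp(2)[OF \<phi>(1)[of k]]] p by auto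
        then show "integrable lborel (\<lambda>x. norm (grad (\<phi> k) x) powr p)"
          by (subst (asm) test_int(2)) (use test_outside[OF \<phi>(1)[of k]] in auto)
      qed simp
      also have "(\<integral>x. norm (grad (\<phi> k) x) powr p \<partial>lborel) = (\<integral>x. norm (grad (\<phi> k) x) powr p \<partial>M)"
        by (rule test_int(1)[symmetric]) (use test_outside[OF \<phi>(1)[of k]] in auto)
      also have "ennreal \<dots> \<le> ennreal (2 powr p * 2 * D)" using g by (rule ennreal_leI)
      finally have "(\<integral>\<^sup>+x. ennreal (\<bar>\<phi> k x\<bar> powr r) \<partial>lborel) \<le> ennreal (C * (2 powr p * 2 * D) powr (r / p))"
        using D by (intro C(2)[OF \<phi>(1)]) auto
      also have "\<dots> = E" using D by (simp add: E_def C'_def powr_mult mult.assoc)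
      finally show ?case
        using nn_integral_M_le[of "\<lambda>x. ennreal (\<bar>\<phi> k x\<bar> powr r)"] by simp
    qed
    have uk: "(\<lambda>x. u x - \<phi> k x) \<in> Lp \<Omega> p" for k using Lp(1) test_Lp(1)[OF \<phi>(1)] p by (intro Lp_diff) auto
    obtain \<rho> where \<rho>: "strict_mono \<rho>" "AE x in M. (\<lambda>k. u x - \<phi> (\<rho> k) x) \<longlonglongrightarrow> 0"
      using Lp_conv_AE_subseq[OF uk _ \<phi>(2)] p by auto
    have "(\<integral>\<^sup>+x. ennreal (\<bar>u x\<bar> powr r) \<partial>M) = (\<integral>\<^sup>+x. liminf (\<lambda>k. ennreal (\<bar>\<phi> (\<rho> k) x\<bar> powr r)) \<partial>M)"
    proof (rule nn_integral_cong_AE)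
      show "AE x in M. ennreal (\<bar>u x\<bar> powr r) = liminf (\<lambda>k. ennreal (\<bar>\<phi> (\<rho> k) x\<bar> powr r))"
        using \<rho>(2)
      proof eventually_elim
        case (elim x)
        have "(\<lambda>k. u x - (u x - \<phi> (\<rho> k) x)) \<longlonglongrightarrow> u x - 0" by (intro tendsto_diff elim tendsto_const)
        then have "(\<lambda>k. \<bar>\<phi> (\<rho> k) x\<bar> powr r) \<longlonglongrightarrow> \<bar>u x\<bar> powr r"
          using p by (intro tendsto_powr' tendsto_rabs tendsto_const) auto
        then have "(\<lambda>k. ennreal (\<bar>\<phi> (\<rho> k) x\<bar> powr r)) \<longlonglongrightarrow> ennreal (\<bar>u x\<bar> powr r)"
          by (rule tendsto_ennrealI)
        from lim_imp_Liminf[OF _ this] show ?case by simp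
      qed
    qed
    also have "\<dots> \<le> liminf (\<lambda>k. (\<integral>\<^sup>+x. ennreal (\<bar>\<phi> (\<rho> k) x\<bar> powr r) \<partial>M))"
      by (rule nn_integral_liminf) simp
    also have "\<dots> \<le> liminf (\<lambda>k. E)"
      by (rule Liminf_mono) (use eventually_subseq[OF \<rho>(1) ev] in simp)
    also have "\<dots> = E" by (simp add: Liminf_const)
    finally have fin: "(\<integral>\<^sup>+x. ennreal (\<bar>u x\<bar> powr r) \<partial>M) \<le> E" .
    have i: "integrable M (\<lambda>x. \<bar>u x\<bar> powr r)"
      by (rule integrableI_bounded) (use fin in \<open>auto simp: E_def intro: le_less_trans\<close>)
    then have "(\<integral>x. \<bar>u x\<bar> powr r \<partial>M) \<le> C' * D powr (r / p)"
      using fin nn_integral_eq_integral[OF i] \<open>C' > 0\<close> by (simp add: E_def)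
    with i show ?thesis by (auto intro!: LpI)
  qed
  ultimately show ?thesis using that by blast
qed

lemma sobolev:
  assumes p: "1 \<le> p" "p \<le> r" and sub: "DIM('a) * ((r - p) / p) < r"
  obtains C where "C > 0" "\<And>u U. sob p u U \<Longrightarrow>
     u \<in> Lp \<Omega> r \<and> (\<integral>x. norm (u x) powr r \<partial>M) \<le> C * (\<integral>x. norm (U x) powr p \<partial>M) powr (r / p)"
proof -
  obtain C where C: "C > 0" "\<And>u U D. sob p u U \<Longrightarrow> D > 0 \<Longrightarrow> (\<integral>x. norm (U x) powr p \<partial>M) \<le> D \<Longrightarrow>
     u \<in> Lp \<Omega> r \<and> (\<integral>x. norm (u x) powr r \<partial>M) \<le> C * D powr (r / p)"
    using sob_sobolev[OF p sub] by metis
  have "u \<in> Lp \<Omega> r \<and> (\<integral>x. norm (u x) powr r \<partial>M) \<le> C * (\<integral>x. norm (U x) powr p \<partial>M) powr (r / p)"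
    if s: "sob p u U" for u U
  proof -
    let ?I = "\<integral>x. norm (U x) powr p \<partial>M"
    have I0: "?I \<ge> 0" by (rule integral_nonneg_AE) simp
    have le: "u \<in> Lp \<Omega> r \<and> (\<integral>x. norm (u x) powr r \<partial>M) \<le> C * (?I + inverse (real (Suc n))) powr (r / p)" for n
      by (rule C(2)[OF s]) (use I0 in \<open>auto intro: add_nonneg_pos\<close>)
    have "(\<lambda>n. C * (?I + inverse (real (Suc n))) powr (r / p)) \<longlonglongrightarrow> C * (?I + 0) powr (r / p)"
      using p I0 by (intro tendsto_mult tendsto_powr' tendsto_add tendsto_const LIMSEQ_inverse_real_of_nat)
        (auto intro!: always_eventually add_nonneg_nonneg)
    then have "(\<integral>x. norm (u x) powr r \<partial>M) \<le> C * (?I + 0) powr (r / p)"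
      by (rule LIMSEQ_le_const) (use le in blast)
    then show ?thesis using le by simp
  qed
  with C(1) that show ?thesis by blast
qed

end

section \<open>Symmetric forms on spaces of functions\<close>

text \<open>Elements of function spaces are determined only up to null sets, so forms on them are merely
  semidefinite. Forms are therefore considered on sets of representatives, without a quotient.\<close>

locale fspace =
  fixes V :: "('x \<Rightarrow> real) set"
  assumes zero_V: "(\<lambda>_. 0) \<in> V"
    and combo_V: "u \<in> V \<Longrightarrow> v \<in> V \<Longrightarrow> (\<lambda>x. a * u x + b * v x) \<in> V"
begin

lemma add_V: "u \<in> V \<Longrightarrow> v \<in> V \<Longrightarrow> (\<lambda>x. u x + v x) \<in> V"
  using combo_V[of u v 1 1] by simp

lemma diff_V: "u \<in> V \<Longrightarrow> v \<in> V \<Longrightarrow> (\<lambda>x. u x - v x) \<in> V"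
  using combo_V[of u v 1 "-1"] by simp

lemma scale_V: "u \<in> V \<Longrightarrow> (\<lambda>x. a * u x) \<in> V"
  using combo_V[of u u a 0] by simp

lemma sum_V:
  fixes m :: nat
  assumes "\<And>i. i < m \<Longrightarrow> e i \<in> V"
  shows "(\<lambda>x. \<Sum>i<m. c i * e i x) \<in> V"
  using assms
proof (induction m)
  case (Suc m)
  then show ?case using combo_V[of "\<lambda>x. \<Sum>i<m. c i * e i x" "e m" 1 "c m"] by simp
qed (simp add: zero_V)

definition bil :: "(('x \<Rightarrow> real) \<Rightarrow> ('x \<Rightarrow> real) \<Rightarrow> real) \<Rightarrow> bool" where
  "bil T \<longleftrightarrow> (\<forall>u\<in>V. \<forall>v\<in>V. \<forall>w\<in>V. \<forall>a b. T (\<lambda>x. a * u x + b * v x) w = a * T u w + b * T v w) \<and>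
     (\<forall>u\<in>V. \<forall>v\<in>V. T u v = T v u)"

definition psd :: "(('x \<Rightarrow> real) \<Rightarrow> ('x \<Rightarrow> real) \<Rightarrow> real) \<Rightarrow> bool" where
  "psd T \<longleftrightarrow> bil T \<and> (\<forall>v\<in>V. T v v \<ge> 0)"

lemma psd_bil: "psd T \<Longrightarrow> bil T" and psd_nonneg: "psd T \<Longrightarrow> v \<in> V \<Longrightarrow> T v v \<ge> 0"
  by (auto simp: psd_def)

lemma bil_sym: "bil T \<Longrightarrow> u \<in> V \<Longrightarrow> v \<in> V \<Longrightarrow> T u v = T v u"
  by (auto simp: bil_def)

lemma bil_left:
  "bil T \<Longrightarrow> u \<in> V \<Longrightarrow> v \<in> V \<Longrightarrow> w \<in> V \<Longrightarrow> T (\<lambda>x. a * u x + b * v x) w = a * T u w + b * T v w"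
  by (auto simp: bil_def)

lemma bil_right:
  assumes "bil T" "u \<in> V" "v \<in> V" "w \<in> V"
  shows "T w (\<lambda>x. a * u x + b * v x) = a * T w u + b * T w v"
  using assms bil_left[OF assms, of a b] by (simp add: bil_sym[of T w] combo_V)

lemma bil_diff_left: "bil T \<Longrightarrow> u \<in> V \<Longrightarrow> v \<in> V \<Longrightarrow> w \<in> V \<Longrightarrow> T (\<lambda>x. u x - v x) w = T u w - T v w"
  using bil_left[of T u v w 1 "-1"] by simp

lemma bil_scale: "bil T \<Longrightarrow> u \<in> V \<Longrightarrow> T (\<lambda>x. a * u x) (\<lambda>x. a * u x) = a\<^sup>2 * T u u"
  using bil_left[of T u u "\<lambda>x. a * u x" a 0] bil_right[of T u u u a 0]
  by (simp add: scale_V power2_eq_square)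

lemma bil_quadratic:
  assumes T: "bil T" and uv: "u \<in> V" "v \<in> V"
  shows "T (\<lambda>x. a * u x + b * v x) (\<lambda>x. a * u x + b * v x) = a\<^sup>2 * T u u + 2 * a * b * T u v + b\<^sup>2 * T v v"
  using bil_left[OF T uv combo_V[OF uv, of a b], of a b]
    bil_right[OF T uv uv(1), of a b] bil_right[OF T uv uv(2), of a b] bil_sym[OF T uv]
  by (simp add: power2_eq_square algebra_simps)

lemma bil_zero: "bil T \<Longrightarrow> w \<in> V \<Longrightarrow> T (\<lambda>_. 0) w = 0"
  using bil_left[of T "\<lambda>_. 0" "\<lambda>_. 0" w 0 0] by (simp add: zero_V)

lemma bil_sum_left:
  fixes m :: nat
  assumes T: "bil T" and e: "\<And>i. i < m \<Longrightarrow> e i \<in> V" and w: "w \<in> V"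
  shows "T (\<lambda>x. \<Sum>i<m. c i * e i x) w = (\<Sum>i<m. c i * T (e i) w)"
  using e
proof (induction m)
  case (Suc m)
  then show ?case
    using bil_left[OF T sum_V[of m e c] _ w, of "e m" 1 "c m"] by simp
qed (simp add: bil_zero[OF T w])

lemma bil_sum_right:
  fixes m :: nat
  assumes T: "bil T" and e: "\<And>i. i < m \<Longrightarrow> e i \<in> V" and w: "w \<in> V"
  shows "T w (\<lambda>x. \<Sum>i<m. c i * e i x) = (\<Sum>i<m. c i * T w (e i))"
proof -
  have "(\<lambda>x. \<Sum>i<m. c i * e i x) \<in> V" by (rule sum_V[OF e])
  then have "T w (\<lambda>x. \<Sum>i<m. c i * e i x) = T (\<lambda>x. \<Sum>i<m. c i * e i x) w" by (rule bil_sym[OF T w])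
  also have "\<dots> = (\<Sum>i<m. c i * T (e i) w)" by (rule bil_sum_left[OF T e w])
  also have "\<dots> = (\<Sum>i<m. c i * T w (e i))"
    by (intro sum.cong refl) (simp add: bil_sym[OF T w e])
  finally show ?thesis .
qed

lemma bil_sum2:
  fixes m :: nat
  assumes T: "bil T" and e: "\<And>i. i < m \<Longrightarrow> e i \<in> V"
  shows "T (\<lambda>x. \<Sum>i<m. c i * e i x) (\<lambda>x. \<Sum>j<m. d j * e j x) = (\<Sum>i<m. \<Sum>j<m. c i * d j * T (e i) (e j))"
  by (subst bil_sum_left[OF T e sum_V[OF e]]; simp add: bil_sum_right[OF T e e] sum_distrib_left mult.assoc)

lemma bil_combine:
  assumes "bil S" "bil T"
  shows "bil (\<lambda>u v. a * S u v + b * T u v)"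
  using assms unfolding bil_def by (simp add: algebra_simps)

lemma psd_cs:
  assumes T: "psd T" and uv: "u \<in> V" "v \<in> V"
  shows "(T u v)\<^sup>2 \<le> T u u * T v v"
proof -
  have q: "0 \<le> a\<^sup>2 * T u u + 2 * a * b * T u v + b\<^sup>2 * T v v" for a b
    using psd_nonneg[OF T combo_V[OF uv, of a b]] bil_quadratic[OF psd_bil[OF T] uv, of a b] by simp
  show ?thesis
  proof (cases "T v v = 0")
    case True
    have "T u v = 0"
    proof (rule ccontr)
      assume ne: "T u v \<noteq> 0"
      have "0 \<le> T u u + 2 * b * T u v" for b using q[of 1 b] True by simp
      from this[of "- (T u u + 1) / (2 * T u v)"] ne show False by (simp add: field_simps)
    qed
    then show ?thesis by (simp add: True)
  next
    case False
    then have pos: "T v v > 0" using psd_nonneg[OF T uv(2)] by simp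
    have "0 \<le> T v v * (T u u * T v v - (T u v)\<^sup>2)"
      using q[of "T v v" "- T u v"] by (simp add: power2_eq_square algebra_simps)
    then show ?thesis using pos by (simp add: zero_le_mult_iff)
  qed
qed

lemma psd_cs_abs:
  assumes T: "psd T" and uv: "u \<in> V" "v \<in> V"
  shows "\<bar>T u v\<bar> \<le> sqrt (T u u) * sqrt (T v v)"
  using real_sqrt_le_mono[OF psd_cs[OF assms]] by (simp add: real_sqrt_mult)

lemma psd_null: "psd T \<Longrightarrow> u \<in> V \<Longrightarrow> v \<in> V \<Longrightarrow> T u u = 0 \<Longrightarrow> T u v = 0"
  using psd_cs[of T u v] by simp

lemma psd_triangle:
  assumes T: "psd T" and uv: "u \<in> V" "v \<in> V"
  shows "sqrt (T (\<lambda>x. u x + v x) (\<lambda>x. u x + v x)) \<le> sqrt (T u u) + sqrt (T v v)"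
proof (rule real_le_lsqrt)
  show "0 \<le> sqrt (T u u) + sqrt (T v v)" using psd_nonneg[OF T] uv by simp
  have "T (\<lambda>x. u x + v x) (\<lambda>x. u x + v x) = T u u + 2 * T u v + T v v"
    using bil_quadratic[OF psd_bil[OF T] uv, of 1 1] by simp
  also have "\<dots> \<le> T u u + 2 * (sqrt (T u u) * sqrt (T v v)) + T v v"
    using psd_cs_abs[OF assms] by simp
  also have "\<dots> = (sqrt (T u u) + sqrt (T v v))\<^sup>2"
    using psd_nonneg[OF T] uv by (simp add: power2_sum)
  finally show "T (\<lambda>x. u x + v x) (\<lambda>x. u x + v x) \<le> (sqrt (T u u) + sqrt (T v v))\<^sup>2" .
qed

lemma psd_triangle_sum:
  fixes m :: nat
  assumes T: "psd T" and e: "\<And>i. i < m \<Longrightarrow> e i \<in> V"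
  shows "sqrt (T (\<lambda>x. \<Sum>i<m. c i * e i x) (\<lambda>x. \<Sum>i<m. c i * e i x)) \<le> (\<Sum>i<m. \<bar>c i\<bar> * sqrt (T (e i) (e i)))"
  using e
proof (induction m)
  case (Suc m)
  have "sqrt (T (\<lambda>x. (\<Sum>i<m. c i * e i x) + c m * e m x) (\<lambda>x. (\<Sum>i<m. c i * e i x) + c m * e m x))
     \<le> sqrt (T (\<lambda>x. \<Sum>i<m. c i * e i x) (\<lambda>x. \<Sum>i<m. c i * e i x)) + sqrt (T (\<lambda>x. c m * e m x) (\<lambda>x. c m * e m x))"
    using Suc.prems by (intro psd_triangle[OF T] sum_V scale_V) auto
  also have "sqrt (T (\<lambda>x. c m * e m x) (\<lambda>x. c m * e m x)) = \<bar>c m\<bar> * sqrt (T (e m) (e m))"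
    using Suc.prems by (simp add: bil_scale[OF psd_bil[OF T]] real_sqrt_mult)
  finally show ?case using Suc by simp
qed (simp add: bil_zero[OF psd_bil[OF T]] zero_V)

lemma psd_add_le:
  assumes T: "psd T" and uv: "u \<in> V" "v \<in> V" and t: "t > 0"
  shows "T (\<lambda>x. u x + v x) (\<lambda>x. u x + v x) \<le> (1 + 1 / t) * T u u + (1 + t) * T v v"
proof -
  have "0 \<le> T u u - 2 * t * T u v + t\<^sup>2 * T v v"
    using psd_nonneg[OF T combo_V[OF uv, of 1 "- t"]] bil_quadratic[OF psd_bil[OF T] uv, of 1 "- t"] by simp
  then have "0 \<le> (T u u - 2 * t * T u v + t\<^sup>2 * T v v) / t" using t by simp
  then have "2 * T u v \<le> T u u / t + t * T v v"
    using t by (simp add: add_divide_distrib diff_divide_distrib power2_eq_square)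
  then show ?thesis
    using bil_quadratic[OF psd_bil[OF T] uv, of 1 1] by (simp add: algebra_simps)
qed

end

locale hspace = fspace V for V :: "('x \<Rightarrow> real) set" +
  fixes ip :: "('x \<Rightarrow> real) \<Rightarrow> ('x \<Rightarrow> real) \<Rightarrow> real"
  assumes psd_ip: "psd ip"
begin

lemmas bil_ip = psd_bil[OF psd_ip]

definition nrm :: "('x \<Rightarrow> real) \<Rightarrow> real" where "nrm v = sqrt (ip v v)"

lemma nrm_nonneg: "v \<in> V \<Longrightarrow> nrm v \<ge> 0"
  using psd_nonneg[OF psd_ip] by (simp add: nrm_def)

lemma nrm_sq: "v \<in> V \<Longrightarrow> (nrm v)\<^sup>2 = ip v v"
  using psd_nonneg[OF psd_ip] by (simp add: nrm_def)

lemma ip_cs: "u \<in> V \<Longrightarrow> v \<in> V \<Longrightarrow> \<bar>ip u v\<bar> \<le> nrm u * nrm v"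
  using psd_cs_abs[OF psd_ip] by (simp add: nrm_def)

lemma nrm_triangle: "u \<in> V \<Longrightarrow> v \<in> V \<Longrightarrow> nrm (\<lambda>x. u x + v x) \<le> nrm u + nrm v"
  using psd_triangle[OF psd_ip] by (simp add: nrm_def)

lemma nrm_scale: "u \<in> V \<Longrightarrow> nrm (\<lambda>x. a * u x) = \<bar>a\<bar> * nrm u"
  by (simp add: nrm_def bil_scale[OF bil_ip] real_sqrt_mult)

text \<open>Riesz representation: a minimiser of \<open>ip z z - 2 l z\<close> exists, since minimising sequences are
  Cauchy sequences by the parallelogram identity.\<close>

lemma riesz:
  assumes complete: "\<And>s. (\<And>k. s k \<in> V) \<Longrightarrow>
        (\<And>e. e > 0 \<Longrightarrow> \<exists>n::nat. \<forall>i\<ge>n. \<forall>j\<ge>n. nrm (\<lambda>x. s i x - s j x) < e) \<Longrightarrow>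
        \<exists>z\<in>V. (\<lambda>k. nrm (\<lambda>x. s k x - z x)) \<longlonglongrightarrow> 0"
    and lin: "\<And>u v a b. u \<in> V \<Longrightarrow> v \<in> V \<Longrightarrow> l (\<lambda>x. a * u x + b * v x) = a * l u + b * l v"
    and bound: "\<And>v. v \<in> V \<Longrightarrow> \<bar>l v\<bar> \<le> C * nrm v"
  shows "\<exists>z\<in>V. \<forall>w\<in>V. ip z w = l w"
proof -
  define J where "J z = ip z z - 2 * l z" for z
  have below: "J z \<ge> - C\<^sup>2" if "z \<in> V" for z
  proof -
    have "2 * l z \<le> 2 * (C * nrm z)" using bound[OF that] by simp
    also have "\<dots> \<le> (nrm z)\<^sup>2 + C\<^sup>2"
      using zero_le_power2[of "nrm z - C"] by (simp add: power2_diff algebra_simps)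
    finally show ?thesis using nrm_sq[OF that] by (simp add: J_def)
  qed
  define I where "I = Inf (J ` V)"
  have bdd: "bdd_below (J ` V)" using below by (auto simp: bdd_below_def)
  have ne: "J ` V \<noteq> {}" using zero_V by auto
  have I_le: "I \<le> J z" if "z \<in> V" for z
    unfolding I_def using bdd that by (auto intro: cInf_lower)
  have "\<exists>z\<in>V. J z < I + inverse (real (Suc k))" for k
  proof -
    have "Inf (J ` V) < I + inverse (real (Suc k))" by (simp add: I_def)
    then show ?thesis using cInf_lessD[OF ne] by blast
  qed
  then obtain s where s: "\<And>k. s k \<in> V" "\<And>k. J (s k) < I + inverse (real (Suc k))" by metis
  have Jcombo: "J (\<lambda>x. a * u x + b * v x) = a\<^sup>2 * ip u u + 2 * a * b * ip u v + b\<^sup>2 * ip v v - 2 * a * l u - 2 * b * l v"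
    if "u \<in> V" "v \<in> V" for u v a b
    using that by (simp add: J_def bil_quadratic[OF bil_ip] lin)
  have par: "(nrm (\<lambda>x. s i x - s j x))\<^sup>2 \<le> 2 * inverse (real (Suc i)) + 2 * inverse (real (Suc j))" for i j
  proof -
    define \<delta> where "\<delta> k = inverse (real (Suc k))" for k
    define mid where "mid = (\<lambda>x. (1/2) * s i x + (1/2) * s j x)"
    have Imid: "I \<le> J mid" unfolding mid_def by (rule I_le[OF combo_V[OF s(1) s(1)]])
    have "ip (\<lambda>x. s i x - s j x) (\<lambda>x. s i x - s j x) = ip (s i) (s i) - 2 * ip (s i) (s j) + ip (s j) (s j)"
      using bil_quadratic[OF bil_ip s(1) s(1), of 1 i "-1" j] by simp
    also have "\<dots> = 2 * J (s i) + 2 * J (s j) - 4 * J mid"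
      unfolding mid_def Jcombo[OF s(1) s(1)] by (simp add: J_def power2_eq_square algebra_simps)
    also have "\<dots> \<le> 2 * (I + inverse (real (Suc i))) + 2 * (I + inverse (real (Suc j))) - 4 * I"
      using s(2)[of i, folded \<delta>_def] s(2)[of j, folded \<delta>_def] Imid
      unfolding \<delta>_def[symmetric] by argo
    finally show ?thesis using nrm_sq[OF diff_V[OF s(1) s(1)], of i j] by simp
  qed
  have "\<exists>z\<in>V. (\<lambda>k. nrm (\<lambda>x. s k x - z x)) \<longlonglongrightarrow> 0"
  proof (rule complete[OF s(1)])
    fix e :: real assume e: "e > 0"
    obtain n where n: "inverse (real (Suc n)) < e\<^sup>2 / 4" using reals_Archimedean[of "e\<^sup>2 / 4"] e by auto
    have "nrm (\<lambda>x. s i x - s j x) < e" if "i \<ge> n" "j \<ge> n" for i j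
    proof -
      have "inverse (real (Suc i)) \<le> inverse (real (Suc n))" "inverse (real (Suc j)) \<le> inverse (real (Suc n))"
        using that by auto
      then have "(nrm (\<lambda>x. s i x - s j x))\<^sup>2 < e\<^sup>2" using par[of i j] n by linarith
      then show ?thesis using e by (simp add: power2_less_imp_less)
    qed
    then show "\<exists>n. \<forall>i\<ge>n. \<forall>j\<ge>n. nrm (\<lambda>x. s i x - s j x) < e" by blast
  qed
  then obtain z where z: "z \<in> V" "(\<lambda>k. nrm (\<lambda>x. s k x - z x)) \<longlonglongrightarrow> 0" by blast
  have Jz: "J z \<le> I"
  proof (rule LIMSEQ_le_const)
    define d where "d k = (\<lambda>x. s k x - z x)" for k
    have d: "d k \<in> V" for k unfolding d_def using s(1) z(1) by (rule diff_V)
    have dz: "(\<lambda>k. nrm (d k)) \<longlonglongrightarrow> 0" using z(2) by (simp add: d_def)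
    show "(\<lambda>k. I + inverse (real (Suc k)) + 2 * (nrm (d k) * nrm z) + 2 * (C * nrm (d k))) \<longlonglongrightarrow> I"
      by (rule tendsto_eq_intros LIMSEQ_inverse_real_of_nat dz refl)+ simp
    have "J z \<le> I + inverse (real (Suc k)) + 2 * (nrm (d k) * nrm z) + 2 * (C * nrm (d k))" for k
    proof -
      have "s k = (\<lambda>x. 1 * z x + 1 * d k x)" by (simp add: d_def)
      then have "J (s k) = ip z z + 2 * ip z (d k) + ip (d k) (d k) - 2 * l z - 2 * l (d k)"
        using Jcombo[OF z(1) d, of 1 1 k] by simp
      then have "J z = J (s k) - 2 * ip z (d k) - ip (d k) (d k) + 2 * l (d k)" by (simp add: J_def)
      moreover have "- 2 * ip z (d k) \<le> 2 * (nrm (d k) * nrm z)"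
        using ip_cs[OF z(1) d, of k] by (simp add: mult.commute)
      moreover have "2 * l (d k) \<le> 2 * (C * nrm (d k))" using bound[OF d, of k] by simp
      ultimately show ?thesis using s(2)[of k] psd_nonneg[OF psd_ip d, of k] by linarith
    qed
    then show "\<exists>N. \<forall>n\<ge>N. J z \<le> I + inverse (real (Suc n)) + 2 * (nrm (d n) * nrm z) + 2 * (C * nrm (d n))"
      by blast
  qed
  have "ip z w = l w" if w: "w \<in> V" for w
  proof (rule ccontr)
    assume ne: "ip z w \<noteq> l w"
    have ineq: "0 \<le> 2 * t * (ip z w - l w) + t\<^sup>2 * ip w w" for t
    proof -
      have "J z \<le> J (\<lambda>x. 1 * z x + t * w x)" using Jz I_le[OF combo_V[OF z(1) w, of 1 t]] by simp
      also have "\<dots> = J z + (2 * t * (ip z w - l w) + t\<^sup>2 * ip w w)"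
        unfolding Jcombo[OF z(1) w] by (simp add: J_def algebra_simps)
      finally show ?thesis by simp
    qed
    define q where "q = ip z w - l w"
    have w0: "ip w w \<ge> 0" by (rule psd_nonneg[OF psd_ip w])
    have "0 \<le> 2 * (- q / (ip w w + 1)) * q + (- q / (ip w w + 1))\<^sup>2 * ip w w"
      using ineq[of "- q / (ip w w + 1)"] by (simp add: q_def)
    also have "\<dots> = - (q\<^sup>2 * (ip w w + 2)) / (ip w w + 1)\<^sup>2"
    proof -
      define W where "W = ip w w + 1"
      have W: "W \<noteq> 0" "ip w w = W - 1" using w0 by (auto simp: W_def)
      show ?thesis unfolding W(2) using W(1) by (simp add: field_simps power2_eq_square)
    qed
    also have "\<dots> < 0"
      using w0 ne by (intro divide_neg_pos) (auto simp: q_def mult_pos_pos zero_less_power2)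
    finally show False by simp
  qed
  with z(1) show ?thesis by blast
qed

definition cspan :: "('x \<Rightarrow> real) set \<Rightarrow> ('x \<Rightarrow> real) set" where
  "cspan E = {v \<in> V. \<forall>\<epsilon>>0. \<exists>(m::nat) (a :: nat \<Rightarrow> real) e. (\<forall>i<m. e i \<in> E) \<and>
         nrm (\<lambda>x. v x - (\<Sum>i<m. a i * e i x)) < \<epsilon>}"

lemma cspan_V: "v \<in> cspan E \<Longrightarrow> v \<in> V"
  by (simp add: cspan_def)

lemma cspanE:
  assumes "v \<in> cspan E" "\<epsilon> > 0"
  obtains m :: nat and a e where "\<And>i. i < m \<Longrightarrow> e i \<in> E" "nrm (\<lambda>x. v x - (\<Sum>i<m. a i * e i x)) < \<epsilon>"
  using assms unfolding cspan_def by blast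

lemma cspan_null:
  assumes "v \<in> V" "ip v v = 0"
  shows "v \<in> cspan E"
  using assms unfolding cspan_def by (auto simp: nrm_def intro!: exI[of _ "0::nat"])

lemma cspan_combo:
  assumes E: "E \<subseteq> V" and uv: "u \<in> cspan E" "v \<in> cspan E"
  shows "(\<lambda>x. a * u x + b * v x) \<in> cspan E"
proof -
  have V: "u \<in> V" "v \<in> V" using uv cspan_V by auto
  have "\<exists>(m::nat) c e. (\<forall>i<m. e i \<in> E) \<and> nrm (\<lambda>x. (a * u x + b * v x) - (\<Sum>i<m. c i * e i x)) < \<epsilon>"
    if \<epsilon>: "\<epsilon> > 0" for \<epsilon>
  proof -
    define d where "d = \<epsilon> / (\<bar>a\<bar> + \<bar>b\<bar> + 1)"
    have d: "d > 0" using \<epsilon> by (simp add: d_def)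
    obtain m c e where 1: "\<And>i. i < (m::nat) \<Longrightarrow> e i \<in> E" "nrm (\<lambda>x. u x - (\<Sum>i<m. c i * e i x)) < d"
      by (rule cspanE[OF uv(1) d], rule that)
    obtain n c' e' where 2: "\<And>i. i < (n::nat) \<Longrightarrow> e' i \<in> E" "nrm (\<lambda>x. v x - (\<Sum>i<n. c' i * e' i x)) < d"
      by (rule cspanE[OF uv(2) d], rule that)
    define f where "f i = (if i < m then e i else e' (i - m))" for i
    define g where "g i = (if i < m then a * c i else b * c' (i - m))" for i
    have fE: "f i \<in> E" if "i < m + n" for i using that 1(1) 2(1)[of "i - m"] by (auto simp: f_def)
    have s: "(\<Sum>i<m + n. g i * f i x) = a * (\<Sum>i<m. c i * e i x) + b * (\<Sum>i<n. c' i * e' i x)" for x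
    proof -
      have "(\<Sum>i<m + n. g i * f i x) = (\<Sum>i<m. g i * f i x) + (\<Sum>i<n. g (m + i) * f (m + i) x)"
        by (induction n) auto
      then show ?thesis by (simp add: f_def g_def sum_distrib_left mult.assoc)
    qed
    let ?p = "\<lambda>x. u x - (\<Sum>i<m. c i * e i x)" and ?q = "\<lambda>x. v x - (\<Sum>i<n. c' i * e' i x)"
    have pq: "?p \<in> V" "?q \<in> V" using E 1(1) 2(1) by (intro diff_V V sum_V; auto)+
    have "nrm (\<lambda>x. (a * u x + b * v x) - (\<Sum>i<m + n. g i * f i x)) = nrm (\<lambda>x. a * ?p x + b * ?q x)"
      unfolding s by (simp add: algebra_simps)
    also have "\<dots> \<le> nrm (\<lambda>x. a * ?p x) + nrm (\<lambda>x. b * ?q x)"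
      using pq by (intro nrm_triangle scale_V)
    also have "\<dots> = \<bar>a\<bar> * nrm ?p + \<bar>b\<bar> * nrm ?q" using nrm_scale[OF pq(1)] nrm_scale[OF pq(2)] by simp
    also have "\<dots> \<le> \<bar>a\<bar> * d + \<bar>b\<bar> * d" using 1(2) 2(2) by (intro add_mono mult_left_mono) auto
    also have "\<dots> < (\<bar>a\<bar> + \<bar>b\<bar> + 1) * d" using d by (simp add: algebra_simps)
    also have "\<dots> = \<epsilon>" by (simp add: d_def)
    finally show ?thesis using fE by blast
  qed
  then show ?thesis using combo_V[OF V] by (simp add: cspan_def)
qed

text \<open>Quadratic inequalities and orthogonality pass from finite linear combinations to the closed
  span.\<close>

lemma cspan_quadratic_nonneg:
  assumes E: "E \<subseteq> V" and T: "bil T" and bound: "\<And>u v. u \<in> V \<Longrightarrow> v \<in> V \<Longrightarrow> \<bar>T u v\<bar> \<le> C * nrm u * nrm v"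
    and fin: "\<And>(m::nat) a e. (\<And>i. i < m \<Longrightarrow> e i \<in> E) \<Longrightarrow> 0 \<le> T (\<lambda>x. \<Sum>i<m. a i * e i x) (\<lambda>x. \<Sum>i<m. a i * e i x)"
    and v: "v \<in> cspan E"
  shows "0 \<le> T v v"
proof (rule ccontr)
  assume neg: "\<not> 0 \<le> T v v"
  have vV: "v \<in> V" by (rule cspan_V[OF v])
  define C' where "C' = \<bar>C\<bar> + 1"
  have C': "C' > 0" by (simp add: C'_def)
  have bound': "\<bar>T u v\<bar> \<le> C' * (nrm u * nrm v)" if "u \<in> V" "v \<in> V" for u v
  proof -
    have "C * nrm u * nrm v \<le> C' * (nrm u * nrm v)"
      unfolding mult.assoc C'_def using nrm_nonneg that by (intro mult_right_mono) auto
    then show ?thesis using bound[OF that] by linarith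
  qed
  define d where "d = min 1 (- T v v / (2 * C' * (2 * nrm v + 1)))"
  have n0: "nrm v \<ge> 0" by (rule nrm_nonneg[OF vV])
  have "- T v v / (2 * C' * (2 * nrm v + 1)) > 0"
    using neg C' n0 by (intro divide_pos_pos mult_pos_pos add_nonneg_pos) auto
  then have d: "d > 0" by (simp add: d_def)
  obtain m a e where e: "\<And>i. i < (m::nat) \<Longrightarrow> e i \<in> E" and small: "nrm (\<lambda>x. v x - (\<Sum>i<m. a i * e i x)) < d"
    by (rule cspanE[OF v d], rule that)
  define s where "s = (\<lambda>x. \<Sum>i<m. a i * e i x)"
  define w where "w = (\<lambda>x. v x - s x)"
  have sV: "s \<in> V" unfolding s_def using E e by (intro sum_V) auto
  have wV: "w \<in> V" unfolding w_def by (rule diff_V[OF vV sV])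
  have nw: "nrm w < d" using small by (simp add: w_def s_def)
  have "T s s = T v v - 2 * T v w + T w w"
  proof -
    have "s = (\<lambda>x. 1 * v x + (-1) * w x)" by (simp add: w_def)
    then show ?thesis using bil_quadratic[OF T vV wV, of 1 "-1"] by simp
  qed
  moreover have "0 \<le> T s s" unfolding s_def by (rule fin[OF e])
  moreover have "\<bar>T v w\<bar> \<le> C' * (nrm v * d)"
    using bound'[OF vV wV] nw n0 C' by (smt (verit) mult_left_mono)
  moreover have "\<bar>T w w\<bar> \<le> C' * d"
  proof -
    have "nrm w * nrm w \<le> d * 1"
      using nw nrm_nonneg[OF wV] by (intro mult_mono) (auto simp: d_def)
    then show ?thesis using bound'[OF wV wV] C' by (smt (verit) mult_left_mono)
  qed
  ultimately have "- T v v \<le> C' * d * (2 * nrm v + 1)" by (simp add: algebra_simps)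
  also have "\<dots> \<le> C' * (- T v v / (2 * C' * (2 * nrm v + 1))) * (2 * nrm v + 1)"
    using C' n0 by (intro mult_right_mono mult_left_mono) (auto simp: d_def)
  also have "\<dots> = - T v v / 2"
  proof -
    define Y where "Y = 2 * nrm v + 1"
    have "Y \<noteq> 0" using n0 by (simp add: Y_def)
    then show ?thesis unfolding Y_def[symmetric] using C' by simp
  qed
  finally show False using neg by simp
qed

lemma cspan_orthogonal1:
  assumes E: "E \<subseteq> V" and w: "w \<in> V" and orth: "\<And>e. e \<in> E \<Longrightarrow> ip e w = 0" and v: "v \<in> cspan E"
  shows "ip v w = 0"
proof (rule ccontr)
  assume ne: "ip v w \<noteq> 0"
  have vV: "v \<in> V" by (rule cspan_V[OF v])
  have d: "\<bar>ip v w\<bar> / (nrm w + 1) > 0" using ne nrm_nonneg[OF w] by simp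
  obtain m a e where e: "\<And>i. i < (m::nat) \<Longrightarrow> e i \<in> E"
    and small: "nrm (\<lambda>x. v x - (\<Sum>i<m. a i * e i x)) < \<bar>ip v w\<bar> / (nrm w + 1)"
    by (rule cspanE[OF v d], rule that)
  define s where "s = (\<lambda>x. \<Sum>i<m. a i * e i x)"
  have sV: "s \<in> V" unfolding s_def using E e by (intro sum_V) auto
  have "ip s w = 0" unfolding s_def using E e w orth by (subst bil_sum_left[OF bil_ip]) auto
  then have "\<bar>ip v w\<bar> = \<bar>ip (\<lambda>x. v x - s x) w\<bar>" using bil_diff_left[OF bil_ip vV sV w] by simp
  also have "\<dots> \<le> nrm (\<lambda>x. v x - s x) * nrm w" by (rule ip_cs[OF diff_V[OF vV sV] w])
  also have "\<dots> \<le> \<bar>ip v w\<bar> / (nrm w + 1) * nrm w"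
    using small nrm_nonneg[OF w] by (intro mult_right_mono) (auto simp: s_def)
  also have "\<dots> < \<bar>ip v w\<bar>" using ne nrm_nonneg[OF w] by (simp add: field_simps)
  finally show False by simp
qed

lemma cspan_orthogonal:
  assumes "E \<subseteq> V" "F \<subseteq> V" "\<And>e f. e \<in> E \<Longrightarrow> f \<in> F \<Longrightarrow> ip e f = 0" "v \<in> cspan E" "w \<in> cspan F"
  shows "ip v w = 0"
proof (rule cspan_orthogonal1[OF assms(1) cspan_V[OF assms(5)] _ assms(4)])
  fix e assume e: "e \<in> E"
  then have "ip w e = 0"
    using assms(2,3) assms(1) bil_sym[OF bil_ip] by (intro cspan_orthogonal1[OF assms(2) _ _ assms(5)]) (metis subsetD)+
  then show "ip e w = 0" using bil_sym[OF bil_ip, of e w] e assms(1) cspan_V[OF assms(5)] by auto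
qed

definition onfam :: "nat \<Rightarrow> (nat \<Rightarrow> 'x \<Rightarrow> real) \<Rightarrow> bool" where
  "onfam N e \<longleftrightarrow> (\<forall>i<N. e i \<in> V) \<and> (\<forall>i<N. \<forall>j<N. ip (e i) (e j) = (if i = j then 1 else 0))"

lemma onfam_V: "onfam N e \<Longrightarrow> i < N \<Longrightarrow> e i \<in> V"
  by (simp add: onfam_def)

lemma onfam_sum_ip:
  assumes e: "onfam N e"
  shows "ip (\<lambda>x. \<Sum>i<N. c i * e i x) (\<lambda>x. \<Sum>i<N. c i * e i x) = (\<Sum>i<N. (c i)\<^sup>2)"
proof -
  have "ip (\<lambda>x. \<Sum>i<N. c i * e i x) (\<lambda>x. \<Sum>i<N. c i * e i x) = (\<Sum>i<N. \<Sum>j<N. c i * c j * ip (e i) (e j))"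
    by (rule bil_sum2[OF bil_ip onfam_V[OF e]])
  also have "\<dots> = (\<Sum>i<N. \<Sum>j<N. if j = i then (c i)\<^sup>2 else 0)"
    using e by (intro sum.cong) (auto simp: onfam_def power2_eq_square)
  finally show ?thesis by simp
qed

text \<open>A maximal orthonormal family in \<open>S\<close> spans \<open>S\<close>, provided that \<open>S\<close> contains the multiples
  of components orthogonal to the family.\<close>

lemma maximal_onfam:
  assumes S: "S \<subseteq> V" and bound: "\<And>N e. onfam N e \<Longrightarrow> (\<And>i. i < N \<Longrightarrow> e i \<in> S) \<Longrightarrow> N \<le> N0"
    and stable: "\<And>N e s a. onfam N e \<Longrightarrow> (\<And>i. i < N \<Longrightarrow> e i \<in> S) \<Longrightarrow> s \<in> S \<Longrightarrow> a \<noteq> 0 \<Longrightarrow>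
       ip (\<lambda>x. s x - (\<Sum>i<N. ip s (e i) * e i x)) (\<lambda>x. s x - (\<Sum>i<N. ip s (e i) * e i x)) \<noteq> 0 \<Longrightarrow>
       (\<lambda>x. a * (s x - (\<Sum>i<N. ip s (e i) * e i x))) \<in> S"
  obtains N e where "onfam N e" "\<And>i. i < N \<Longrightarrow> e i \<in> S"
    "\<And>s. s \<in> S \<Longrightarrow> ip (\<lambda>x. s x - (\<Sum>i<N. ip s (e i) * e i x)) (\<lambda>x. s x - (\<Sum>i<N. ip s (e i) * e i x)) = 0"
proof -
  define P where "P N \<longleftrightarrow> (\<exists>e. onfam N e \<and> (\<forall>i<N. e i \<in> S))" for N
  have P0: "P 0" by (auto simp: P_def onfam_def)
  have Pb: "N \<le> N0" if "P N" for N using that bound by (auto simp: P_def)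
  define N where "N = (GREATEST N. P N)"
  have "P N" unfolding N_def using GreatestI_nat[of P 0 N0] P0 Pb by blast
  have max: "N' \<le> N" if "P N'" for N' unfolding N_def using Greatest_le_nat[of P N' N0] that Pb by blast
  obtain e where e: "onfam N e" "\<And>i. i < N \<Longrightarrow> e i \<in> S" using \<open>P N\<close> by (auto simp: P_def)
  have "ip (\<lambda>x. s x - (\<Sum>i<N. ip s (e i) * e i x)) (\<lambda>x. s x - (\<Sum>i<N. ip s (e i) * e i x)) = 0" if s: "s \<in> S" for s
  proof (rule ccontr)
    define r where "r = (\<lambda>x. s x - (\<Sum>i<N. ip s (e i) * e i x))"
    assume ne: "ip (\<lambda>x. s x - (\<Sum>i<N. ip s (e i) * e i x)) (\<lambda>x. s x - (\<Sum>i<N. ip s (e i) * e i x)) \<noteq> 0"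
    then have rr: "ip r r \<noteq> 0" by (simp add: r_def)
    have sV: "s \<in> V" using s S by auto
    have eV: "e i \<in> V" if "i < N" for i using onfam_V[OF e(1) that] .
    have PV: "(\<lambda>x. \<Sum>i<N. ip s (e i) * e i x) \<in> V" by (rule sum_V[OF eV])
    have rV: "r \<in> V" unfolding r_def by (rule diff_V[OF sV PV])
    have orth: "ip r (e j) = 0" if j: "j < N" for j
    proof -
      have "ip (\<lambda>x. \<Sum>i<N. ip s (e i) * e i x) (e j) = (\<Sum>i<N. ip s (e i) * ip (e i) (e j))"
        by (rule bil_sum_left[OF bil_ip eV eV[OF j]])
      also have "\<dots> = (\<Sum>i<N. if i = j then ip s (e j) else 0)"
        using e(1) j by (intro sum.cong) (auto simp: onfam_def)
      also have "\<dots> = ip s (e j)" using j by simp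
      finally show ?thesis unfolding r_def by (simp add: bil_diff_left[OF bil_ip sV PV eV[OF j]])
    qed
    have pos: "nrm r > 0" using rr psd_nonneg[OF psd_ip rV] by (simp add: nrm_def)
    define f where "f = (\<lambda>x. (1 / nrm r) * r x)"
    have fS: "f \<in> S" unfolding f_def r_def by (rule stable[OF e s _ ne]) (use pos in \<open>auto simp: r_def\<close>)
    have fV: "f \<in> V" using fS S by auto
    have ff: "ip f f = 1"
      unfolding f_def bil_scale[OF bil_ip rV] using rr nrm_sq[OF rV] by (simp add: power_divide)
    have fe: "ip f (e j) = 0" if "j < N" for j
      using bil_left[OF bil_ip rV rV eV[OF that], of "1 / nrm r" 0] orth[OF that] by (simp add: f_def)
    have fe': "ip (e j) f = 0" if "j < N" for j
      using fe[OF that] bil_sym[OF bil_ip fV eV[OF that]] by simp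
    have "onfam (Suc N) (e(N := f))"
      using e(1) fV ff fe fe' by (auto simp: onfam_def less_Suc_eq)
    then have "P (Suc N)" unfolding P_def using e(2) fS by (intro exI[of _ "e(N := f)"]) (auto simp: less_Suc_eq)
    from max[OF this] show False by simp
  qed
  with e that show ?thesis by blast
qed

lemma bounded_coordinates_subseq:
  fixes c :: "nat \<Rightarrow> nat \<Rightarrow> real"
  assumes "\<And>n i. i < N \<Longrightarrow> \<bar>c n i\<bar> \<le> 1"
  shows "\<exists>r l. strict_mono r \<and> (\<forall>i<N. (\<lambda>n. c (r n) i) \<longlonglongrightarrow> l i)"
  using assms
proof (induction N)
  case 0
  show ?case by (rule exI[of _ id]) (auto simp: strict_mono_def)
next
  case (Suc N)
  then obtain r l where r: "strict_mono r" "\<forall>i<N. (\<lambda>n. c (r n) i) \<longlonglongrightarrow> l i" by auto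
  have "seq_compact {-1..1::real}" by (simp add: compact_imp_seq_compact)
  moreover have "\<forall>n. c (r n) N \<in> {-1..1}" using Suc.prems[of N] by (auto simp: abs_le_iff minus_le_iff)
  ultimately obtain l' r' where r': "strict_mono r'" "((\<lambda>n. c (r n) N) \<circ> r') \<longlonglongrightarrow> l'"
    by (metis seq_compactE)
  have "(\<lambda>n. c ((r \<circ> r') n) i) \<longlonglongrightarrow> (l(N := l')) i" if "i < Suc N" for i
  proof (cases "i = N")
    case True
    then show ?thesis using r'(2) by (simp add: o_def)
  next
    case False
    then have "(\<lambda>n. c (r n) i) \<longlonglongrightarrow> l i" using that r(2) by simp
    from LIMSEQ_subseq_LIMSEQ[OF this r'(1)] show ?thesis using False by (simp add: o_def)
  qed
  moreover have "strict_mono (r \<circ> r')" by (rule strict_mono_o[OF r(1) r'(1)])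
  ultimately show ?case by blast
qed

text \<open>Any other norm on the span of a finite orthonormal family dominates \<open>nrm\<close>, by compactness
  of the unit sphere in coefficient space.\<close>

lemma finite_dim_norm_lower_bound:
  fixes Nf :: "('x \<Rightarrow> real) \<Rightarrow> real"
  assumes e: "onfam N e"
    and nonneg: "\<And>c. Nf (\<lambda>x. \<Sum>i<N. c i * e i x) \<ge> 0"
    and scale: "\<And>c a. Nf (\<lambda>x. a * (\<Sum>i<N. c i * e i x)) = \<bar>a\<bar> * Nf (\<lambda>x. \<Sum>i<N. c i * e i x)"
    and add: "\<And>c d. Nf (\<lambda>x. (\<Sum>i<N. c i * e i x) + (\<Sum>i<N. d i * e i x))
        \<le> Nf (\<lambda>x. \<Sum>i<N. c i * e i x) + Nf (\<lambda>x. \<Sum>i<N. d i * e i x)"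
    and definite: "\<And>c. Nf (\<lambda>x. \<Sum>i<N. c i * e i x) = 0 \<Longrightarrow> ip (\<lambda>x. \<Sum>i<N. c i * e i x) (\<lambda>x. \<Sum>i<N. c i * e i x) = 0"
  obtains d where "d > 0" "\<And>c. d * (\<Sum>i<N. (c i)\<^sup>2) \<le> (Nf (\<lambda>x. \<Sum>i<N. c i * e i x))\<^sup>2"
proof -
  define s where "s c = (\<lambda>x. \<Sum>i<N. c i * e i x)" for c
  have ipss: "ip (s c) (s c) = (\<Sum>i<N. (c i)\<^sup>2)" for c
    unfolding s_def by (rule onfam_sum_ip[OF e])
  have upper: "Nf (s c) \<le> (\<Sum>i<N. \<bar>c i\<bar> * Nf (e i))" for c
  proof -
    have "Nf (\<lambda>x. \<Sum>i<m. c i * e i x) \<le> (\<Sum>i<m. \<bar>c i\<bar> * Nf (e i))" if "m \<le> N" for m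
      using that
    proof (induction m)
      case 0
      show ?case using scale[of 0 "\<lambda>_. 0"] by simp
    next
      case (Suc m)
      have 1: "(\<lambda>x. \<Sum>i<m. c i * e i x) = (\<lambda>x. \<Sum>i<N. (if i < m then c i else 0) * e i x)"
        using Suc.prems by (intro ext sum.mono_neutral_cong_left) auto
      have 2: "(\<lambda>x. a * e m x) = (\<lambda>x. \<Sum>i<N. (if i = m then a else 0) * e i x)" for a
      proof
        fix x
        have "(\<Sum>i<N. (if i = m then a else 0) * e i x) = (\<Sum>i<N. if i = m then a * e m x else 0)"
          by (intro sum.cong) auto
        then show "a * e m x = (\<Sum>i<N. (if i = m then a else 0) * e i x)" using Suc.prems by simp
      qed
      have "Nf (\<lambda>x. (\<Sum>i<m. c i * e i x) + c m * e m x) \<le> Nf (\<lambda>x. \<Sum>i<m. c i * e i x) + Nf (\<lambda>x. c m * e m x)"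
        unfolding fun_cong[OF 1] fun_cong[OF 2] by (rule add)
      also have "Nf (\<lambda>x. c m * e m x) = \<bar>c m\<bar> * Nf (e m)"
        using scale[of "c m" "\<lambda>i. if i = m then 1 else 0"] unfolding fun_cong[OF 2[of 1, symmetric]] by simp
      finally show ?case using Suc by simp
    qed
    then show ?thesis by (simp add: s_def)
  qed
  have "\<exists>d>0. \<forall>c. d * (\<Sum>i<N. (c i)\<^sup>2) \<le> (Nf (s c))\<^sup>2"
  proof (rule ccontr)
    assume neg: "\<not> ?thesis"
    have "\<exists>c. (\<Sum>i<N. (c i)\<^sup>2) = 1 \<and> (Nf (s c))\<^sup>2 < inverse (real (Suc n))" for n
    proof -
      from neg obtain c where c: "(Nf (s c))\<^sup>2 < inverse (real (Suc n)) * (\<Sum>i<N. (c i)\<^sup>2)"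
        by (metis inverse_positive_iff_positive not_le of_nat_0_less_iff zero_less_Suc)
      define q where "q = (\<Sum>i<N. (c i)\<^sup>2)"
      have "q \<ge> 0" by (simp add: q_def sum_nonneg)
      moreover have "q \<noteq> 0" using c zero_le_power2[of "Nf (s c)"] by (auto simp: q_def)
      ultimately have q: "q > 0" by simp
      have 1: "(\<Sum>i<N. (c i / sqrt q)\<^sup>2) = 1"
        using q by (simp add: power_divide sum_divide_distrib[symmetric] q_def[symmetric])
      have "s (\<lambda>i. c i / sqrt q) = (\<lambda>x. (1 / sqrt q) * s c x)"
        by (simp add: s_def sum_distrib_left)
      then have "Nf (s (\<lambda>i. c i / sqrt q)) = \<bar>1 / sqrt q\<bar> * Nf (s c)"
        using scale[of "1 / sqrt q" c] by (simp add: s_def)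
      then have "(Nf (s (\<lambda>i. c i / sqrt q)))\<^sup>2 = (Nf (s c))\<^sup>2 / q"
        using q by (simp add: power_divide)
      also have "\<dots> < inverse (real (Suc n))" using c q by (simp add: q_def[symmetric] divide_less_eq)
      finally show ?thesis using 1 by (intro exI[of _ "\<lambda>i. c i / sqrt q"]) simp
    qed
    then obtain c where c: "\<And>n. (\<Sum>i<N. (c n i)\<^sup>2) = 1" "\<And>n. (Nf (s (c n)))\<^sup>2 < inverse (real (Suc n))"
      by metis
    have c1: "\<bar>c n i\<bar> \<le> 1" if "i < N" for n i
    proof -
      have "(c n i)\<^sup>2 \<le> (\<Sum>i<N. (c n i)\<^sup>2)" using that by (intro member_le_sum) auto
      then show ?thesis using c(1) by (simp add: abs_square_le_1)
    qed
    obtain r l where r: "strict_mono r" "\<forall>i<N. (\<lambda>n. c (r n) i) \<longlonglongrightarrow> l i"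
      using bounded_coordinates_subseq[of N c] c1 by blast
    have "(\<lambda>n. \<Sum>i<N. (c (r n) i)\<^sup>2) \<longlonglongrightarrow> (\<Sum>i<N. (l i)\<^sup>2)"
      using r(2) by (intro tendsto_sum tendsto_power) auto
    then have l1: "(\<Sum>i<N. (l i)\<^sup>2) = 1" using c(1) by (simp add: LIMSEQ_const_iff)
    have "(\<lambda>n. sqrt (inverse (real (Suc n)))) \<longlonglongrightarrow> sqrt 0"
      by (intro tendsto_real_sqrt LIMSEQ_inverse_real_of_nat)
    from LIMSEQ_subseq_LIMSEQ[OF this r(1)]
    have z1: "(\<lambda>n. sqrt (inverse (real (Suc (r n))))) \<longlonglongrightarrow> 0" by (simp add: o_def)
    have "(\<lambda>n. \<Sum>i<N. \<bar>l i - c (r n) i\<bar> * Nf (e i)) \<longlonglongrightarrow> (\<Sum>i<N. \<bar>l i - l i\<bar> * Nf (e i))"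
      using r(2) by (intro tendsto_sum tendsto_mult tendsto_rabs tendsto_diff tendsto_const) auto
    then have z2: "(\<lambda>n. \<Sum>i<N. \<bar>l i - c (r n) i\<bar> * Nf (e i)) \<longlonglongrightarrow> 0" by simp
    have "Nf (s l) \<le> (\<Sum>i<N. \<bar>l i - c (r n) i\<bar> * Nf (e i)) + sqrt (inverse (real (Suc (r n))))" for n
    proof -
      have "Nf (s l) = Nf (\<lambda>x. s (\<lambda>i. l i - c (r n) i) x + s (c (r n)) x)"
        by (simp add: s_def sum.distrib[symmetric] algebra_simps)
      also have "\<dots> \<le> Nf (s (\<lambda>i. l i - c (r n) i)) + Nf (s (c (r n)))"
        unfolding s_def by (rule add)
      also have "Nf (s (c (r n))) \<le> sqrt (inverse (real (Suc (r n))))"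
        using c(2)[of "r n"] by (intro real_le_rsqrt) simp
      finally show ?thesis using upper[of "\<lambda>i. l i - c (r n) i"] by simp
    qed
    then have "Nf (s l) \<le> 0 + 0"
      by (intro LIMSEQ_le_const[OF tendsto_add[OF z2 z1]]) auto
    then have "Nf (s l) = 0" using nonneg[of l] by (simp add: s_def)
    then have "ip (s l) (s l) = 0" using definite[of l] by (simp add: s_def)
    then show False using l1 ipss[of l] by simp
  qed
  then obtain d where "d > 0" "\<And>c. d * (\<Sum>i<N. (c i)\<^sup>2) \<le> (Nf (s c))\<^sup>2" by blast
  then show ?thesis using that unfolding s_def by blast
qed

end

section \<open>Compact perturbations of the identity\<close>

text \<open>The form \<open>ip - k\<close> is represented by the identity minus a compact operator; compactness of \<open>k\<close> is
  expressed through orthonormal families. The eigenvectors of \<open>ip - k\<close> are described weakly.\<close>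

locale spectral = hspace V ip for V :: "('x \<Rightarrow> real) set" and ip +
  fixes k :: "('x \<Rightarrow> real) \<Rightarrow> ('x \<Rightarrow> real) \<Rightarrow> real" and Ck :: real
  assumes bil_k: "bil k"
    and k_bound: "u \<in> V \<Longrightarrow> v \<in> V \<Longrightarrow> \<bar>k u v\<bar> \<le> Ck * nrm u * nrm v"
    and compact_k: "\<epsilon> > 0 \<Longrightarrow> \<exists>N0. \<forall>N e. onfam N e \<longrightarrow> (\<forall>i<N. \<epsilon> \<le> \<bar>k (e i) (e i)\<bar>) \<longrightarrow> N \<le> N0"
begin

definition eig :: "real \<Rightarrow> ('x \<Rightarrow> real) \<Rightarrow> bool" where
  "eig l v \<longleftrightarrow> v \<in> V \<and> ip v v \<noteq> 0 \<and> (\<forall>w\<in>V. k v w = (1 - l) * ip v w)"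

lemma eig_V: "eig l v \<Longrightarrow> v \<in> V"
  by (simp add: eig_def)

lemma eig_orthogonal:
  assumes "eig l v" "eig l' v'" "l \<noteq> l'"
  shows "ip v v' = 0"
proof -
  have V: "v \<in> V" "v' \<in> V" using assms by (auto simp: eig_def)
  have "(1 - l) * ip v v' = k v v'" using assms V by (simp add: eig_def)
  also have "\<dots> = k v' v" by (rule bil_sym[OF bil_k V])
  also have "\<dots> = (1 - l') * ip v v'" using assms V bil_sym[OF bil_ip V] by (simp add: eig_def)
  finally show ?thesis using assms(3) by (simp add: algebra_simps)
qed

text \<open>Since distinct eigenspaces are orthogonal, the double sum below is the square of the norm of
  \<open>\<Sum>\<^sub>i a\<^sub>i \<surd>(g (l\<^sub>i)) f\<^sub>i\<close>.\<close>

lemma eig_sum_nonneg: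
  fixes m :: nat and g :: "real \<Rightarrow> real"
  assumes f: "\<And>i. i < m \<Longrightarrow> eig (l i) (f i)" and g: "\<And>i. i < m \<Longrightarrow> a i \<noteq> 0 \<Longrightarrow> 0 \<le> g (l i)"
  shows "0 \<le> (\<Sum>i<m. \<Sum>j<m. a i * a j * (g (l i) * ip (f i) (f j)))"
proof -
  define b where "b i = a i * sqrt (g (l i))" for i
  have fV: "f i \<in> V" if "i < m" for i using f[OF that] by (rule eig_V)
  have "0 \<le> ip (\<lambda>x. \<Sum>i<m. b i * f i x) (\<lambda>x. \<Sum>i<m. b i * f i x)"
    by (rule psd_nonneg[OF psd_ip sum_V[OF fV]])
  also have "\<dots> = (\<Sum>i<m. \<Sum>j<m. b i * b j * ip (f i) (f j))"
    by (rule bil_sum2[OF bil_ip fV])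
  also have "\<dots> = (\<Sum>i<m. \<Sum>j<m. a i * a j * (g (l i) * ip (f i) (f j)))"
  proof (intro sum.cong refl)
    fix i j assume ij: "i \<in> {..<m}" "j \<in> {..<m}"
    show "b i * b j * ip (f i) (f j) = a i * a j * (g (l i) * ip (f i) (f j))"
    proof (cases "l i = l j \<and> a i \<noteq> 0")
      case True
      then have "sqrt (g (l i)) * sqrt (g (l j)) = g (l i)" using g[of i] ij by simp
      then show ?thesis by (simp add: b_def algebra_simps)
    next
      case False
      then show ?thesis using eig_orthogonal[OF f f, of i j] ij by (auto simp: b_def)
    qed
  qed
  finally show ?thesis .
qed

lemma eig_k_sum:
  fixes m :: nat
  assumes f: "\<And>i. i < m \<Longrightarrow> eig (l i) (f i)"
  shows "k (\<lambda>x. \<Sum>i<m. c i * f i x) (\<lambda>x. \<Sum>i<m. d i * f i x)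
    = (\<Sum>i<m. \<Sum>j<m. c i * d j * ((1 - l i) * ip (f i) (f j)))"
proof -
  have fV: "f i \<in> V" if "i < m" for i using f[OF that] by (rule eig_V)
  show ?thesis
    by (subst bil_sum2[OF bil_k fV]) (use f fV in \<open>auto intro!: sum.cong simp: eig_def\<close>)
qed

lemma eig_k_le:
  fixes m :: nat and a :: "nat \<Rightarrow> real"
  assumes f: "\<And>i. i < m \<Longrightarrow> eig (l i) (f i)" and \<beta>: "\<And>i. i < m \<Longrightarrow> a i \<noteq> 0 \<Longrightarrow> 1 - l i \<le> \<beta>"
  defines "v \<equiv> \<lambda>x. \<Sum>i<m. a i * f i x"
  shows "k v v \<le> \<beta> * ip v v"
proof -
  have ip: "ip v v = (\<Sum>i<m. \<Sum>j<m. a i * a j * ip (f i) (f j))"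
    unfolding v_def by (rule bil_sum2[OF bil_ip eig_V[OF f]])
  have kv: "k v v = (\<Sum>i<m. \<Sum>j<m. a i * a j * ((1 - l i) * ip (f i) (f j)))"
    unfolding v_def by (rule eig_k_sum[OF f])
  have "0 \<le> (\<Sum>i<m. \<Sum>j<m. a i * a j * ((\<beta> - (1 - l i)) * ip (f i) (f j)))"
    using \<beta> by (intro eig_sum_nonneg[OF f, where g="\<lambda>l. \<beta> - (1 - l)"]) auto
  also have "\<dots> = \<beta> * ip v v - k v v"
    unfolding ip kv by (simp add: sum_distrib_left sum_subtractf[symmetric] algebra_simps)
  finally show ?thesis by simp
qed

text \<open>Subtracting from an eigenvector its components along orthonormal eigenvectors leaves an eigenvector
  for the same eigenvalue, because components along other eigenvalues vanish.\<close>

lemma eig_component: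
  assumes e: "onfam N e" and l: "\<And>i. i < N \<Longrightarrow> eig (l i) (e i)" and s: "eig l' s" and a: "a \<noteq> 0"
    and ne: "ip (\<lambda>x. s x - (\<Sum>i<N. ip s (e i) * e i x)) (\<lambda>x. s x - (\<Sum>i<N. ip s (e i) * e i x)) \<noteq> 0"
  shows "eig l' (\<lambda>x. a * (s x - (\<Sum>i<N. ip s (e i) * e i x)))"
proof -
  define P where "P = (\<lambda>x. \<Sum>i<N. ip s (e i) * e i x)"
  define r where "r = (\<lambda>x. s x - P x)"
  have sV: "s \<in> V" using s by (rule eig_V)
  have eV: "e i \<in> V" if "i < N" for i using onfam_V[OF e that] .
  have PV: "P \<in> V" unfolding P_def by (rule sum_V[OF eV])
  have rV: "r \<in> V" unfolding r_def by (rule diff_V[OF sV PV])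
  have kr: "k r w = (1 - l') * ip r w" if w: "w \<in> V" for w
  proof -
    have "k P w = (\<Sum>i<N. ip s (e i) * ((1 - l i) * ip (e i) w))"
      unfolding P_def using l w by (subst bil_sum_left[OF bil_k eV w]) (auto simp: eig_def)
    also have "\<dots> = (\<Sum>i<N. (1 - l') * (ip s (e i) * ip (e i) w))"
    proof (intro sum.cong refl)
      fix i assume "i \<in> {..<N}"
      then show "ip s (e i) * ((1 - l i) * ip (e i) w) = (1 - l') * (ip s (e i) * ip (e i) w)"
        using eig_orthogonal[OF s l, of i] by (cases "l i = l'") auto
    qed
    also have "\<dots> = (1 - l') * ip P w"
      unfolding P_def by (subst bil_sum_left[OF bil_ip eV w]) (auto simp: sum_distrib_left)
    finally show ?thesis
      using s w unfolding r_def bil_diff_left[OF bil_k sV PV w] bil_diff_left[OF bil_ip sV PV w]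
      by (simp add: eig_def algebra_simps)
  qed
  have "ip (\<lambda>x. a * r x) (\<lambda>x. a * r x) \<noteq> 0"
    using a ne by (simp add: bil_scale[OF bil_ip rV]) (simp add: r_def P_def)
  moreover have "k (\<lambda>x. a * r x) w = (1 - l') * ip (\<lambda>x. a * r x) w" if w: "w \<in> V" for w
    using bil_left[OF bil_k rV rV w, of a 0] bil_left[OF bil_ip rV rV w, of a 0] kr[OF w] by simp
  ultimately have "eig l' (\<lambda>x. a * r x)" using scale_V[OF rV] by (simp add: eig_def)
  then show ?thesis by (simp add: r_def P_def)
qed

definition pos_eig :: "('x \<Rightarrow> real) set" where
  "pos_eig = {v. \<exists>l>0. eig l v}"

lemma pos_eig_V: "pos_eig \<subseteq> V"
  by (auto simp: pos_eig_def eig_V)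

text \<open>On the closed span of the eigenvectors with positive eigenvalue the form \<open>ip - k\<close> is coercive,
  and it remains so if \<open>ip\<close> is weakened by a form \<open>E \<le> ip\<close> that is small on a suitable finite set of
  vectors. Only finitely many eigenvalues, counted with multiplicity, are at distance \<open>\<epsilon>\<close> or more
  from \<open>1\<close>; on their span \<open>E\<close> is small and \<open>ip - k\<close> is bounded below by the smallest positive
  eigenvalue, while on the remaining eigenvectors \<open>k\<close> itself is small and the part
  \<open>\<theta> ip\<close>, which survives the subtraction of \<open>E\<close>, suffices.\<close>

lemma spectral_coercive:
  assumes \<theta>: "0 < \<theta>" "\<theta> \<le> 1/2"
  obtains \<eta> c1 \<omega> :: real and N :: nat and e where "0 < \<eta>" "\<eta> \<le> 1/2" "c1 > 0" "\<omega> > 0" "\<And>i. i < N \<Longrightarrow> e i \<in> V"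
    "\<And>E v. psd E \<Longrightarrow> (\<And>v. v \<in> V \<Longrightarrow> E v v \<le> ip v v) \<Longrightarrow> (\<And>i. i < N \<Longrightarrow> E (e i) (e i) \<le> \<omega>) \<Longrightarrow>
      v \<in> cspan pos_eig \<Longrightarrow> c1 * ip v v \<le> (1 - \<eta>) * ip v v - (1 - \<eta> - \<theta>) * E v v - k v v"
proof -
  define \<epsilon> where "\<epsilon> = \<theta> / 4"
  have \<epsilon>: "\<epsilon> > 0" using \<theta> by (simp add: \<epsilon>_def)
  define S where "S = {v. \<exists>l>0. \<epsilon> \<le> \<bar>1 - l\<bar> \<and> eig l v}"
  obtain N0 where N0: "\<And>N e. onfam N e \<Longrightarrow> (\<forall>i<N. \<epsilon> \<le> \<bar>k (e i) (e i)\<bar>) \<Longrightarrow> N \<le> N0"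
    using compact_k[OF \<epsilon>] by blast
  have SV: "S \<subseteq> V" by (auto simp: S_def eig_V)
  obtain N e where e: "onfam N e" "\<And>i. i < N \<Longrightarrow> e i \<in> S"
    and span: "\<And>s. s \<in> S \<Longrightarrow> ip (\<lambda>x. s x - (\<Sum>i<N. ip s (e i) * e i x)) (\<lambda>x. s x - (\<Sum>i<N. ip s (e i) * e i x)) = 0"
  proof (rule maximal_onfam[OF SV])
    fix N e assume e: "onfam N e" "\<And>i. i < N \<Longrightarrow> e i \<in> S"
    have "\<epsilon> \<le> \<bar>k (e i) (e i)\<bar>" if "i < N" for i
    proof -
      obtain l where "\<epsilon> \<le> \<bar>1 - l\<bar>" "eig l (e i)" using e(2)[OF \<open>i < N\<close>] by (auto simp: S_def)
      moreover have "ip (e i) (e i) = 1" using e(1) \<open>i < N\<close> by (simp add: onfam_def)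
      ultimately show ?thesis by (simp add: eig_def)
    qed
    then show "N \<le> N0" using N0[OF e(1)] by blast
  next
    fix N e s and a :: real
    assume e: "onfam N e" "\<And>i. i < N \<Longrightarrow> e i \<in> S" and s: "s \<in> S" and a: "a \<noteq> 0"
      and ne: "ip (\<lambda>x. s x - (\<Sum>i<N. ip s (e i) * e i x)) (\<lambda>x. s x - (\<Sum>i<N. ip s (e i) * e i x)) \<noteq> 0"
    have "\<forall>i. \<exists>l. i < N \<longrightarrow> eig l (e i)" using e(2) by (auto simp: S_def)
    then obtain l where l: "\<And>i. i < N \<Longrightarrow> eig (l i) (e i)" by metis
    obtain l' where l': "l' > 0" "\<epsilon> \<le> \<bar>1 - l'\<bar>" "eig l' s" using s by (auto simp: S_def)
    show "(\<lambda>x. a * (s x - (\<Sum>i<N. ip s (e i) * e i x))) \<in> S"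
      using eig_component[OF e(1) l l'(3) a ne] l' by (auto simp: S_def)
  qed blast
  have "\<forall>i. \<exists>l. i < N \<longrightarrow> l > 0 \<and> eig l (e i)" using e(2) by (fastforce simp: S_def)
  then obtain l where l: "\<And>i. i < N \<Longrightarrow> l i > 0" "\<And>i. i < N \<Longrightarrow> eig (l i) (e i)" by metis
  have eV: "e i \<in> V" if "i < N" for i using onfam_V[OF e(1) that] .
  define \<rho> where "\<rho> = Min (insert (1/2) (l ` {..<N}))"
  have \<rho>0: "\<rho> > 0" using l(1) by (simp add: \<rho>_def)
  have \<rho>12: "\<rho> \<le> 1/2" unfolding \<rho>_def by (rule Min_le) auto
  have \<rho>l: "\<rho> \<le> l i" if "i < N" for i using that by (simp add: \<rho>_def)
  \<comment> \<open>Every positive eigenvalue far from \<open>1\<close> occurs among the \<open>l i\<close>: an eigenvector for another one would be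
    orthogonal to the maximal family.\<close>
  have low: "\<rho> \<le> l'" if l': "l' > 0" "\<epsilon> \<le> \<bar>1 - l'\<bar>" "eig l' s" for l' s
  proof (rule ccontr)
    assume less: "\<not> \<rho> \<le> l'"
    have sS: "s \<in> S" using l' by (auto simp: S_def)
    have "ip s (e i) = 0" if "i < N" for i
      using eig_orthogonal[OF l'(3) l(2)[OF that]] \<rho>l[OF that] less by auto
    then have "(\<lambda>x. s x - (\<Sum>i<N. ip s (e i) * e i x)) = s" by simp
    then have "ip s s = 0" using span[OF sS] by simp
    then show False using l'(3) by (simp add: eig_def)
  qed
  define t where "t = \<theta> / 4"
  have t: "t > 0" using \<theta> by (simp add: t_def)
  define \<eta> where "\<eta> = \<rho> / 4"
  define \<omega> where "\<omega> = \<rho> / (4 * (1 + 1 / t) * ((real N)\<^sup>2 + 1))"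
  define c1 where "c1 = min (\<rho> / 2) (\<theta> / 2)"
  have \<eta>: "0 < \<eta>" "\<eta> \<le> 1/2" using \<rho>0 \<rho>12 by (auto simp: \<eta>_def)
  have \<omega>: "\<omega> > 0" unfolding \<omega>_def using \<rho>0 t by (intro divide_pos_pos mult_pos_pos add_pos_pos add_nonneg_pos) auto
  have c1le: "c1 \<le> \<rho> / 2" "c1 \<le> \<theta> / 2" unfolding c1_def by (rule min.cobounded1, rule min.cobounded2)
  have c1: "c1 > 0" using \<rho>0 \<theta> by (simp add: c1_def)
  have "c1 * ip v v \<le> (1 - \<eta>) * ip v v - (1 - \<eta> - \<theta>) * E v v - k v v"
    if E: "psd E" and Eip: "\<And>v. v \<in> V \<Longrightarrow> E v v \<le> ip v v" and small: "\<And>i. i < N \<Longrightarrow> E (e i) (e i) \<le> \<omega>"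
      and v: "v \<in> cspan pos_eig" for E v
  proof -
    define \<sigma> where "\<sigma> = 1 - \<eta> - \<theta>"
    have \<sigma>: "0 \<le> \<sigma>" "\<sigma> \<le> 1" using \<eta> \<theta> by (auto simp: \<sigma>_def)
    define T where "T u w = 1 * ((1 - \<eta> - c1) * ip u w + (- \<sigma>) * E u w) + (-1) * k u w" for u w
    have bilT: "bil T" unfolding T_def[abs_def]
      by (intro bil_combine[where S="\<lambda>u w. (1 - \<eta> - c1) * ip u w + (- \<sigma>) * E u w"] bil_combine bil_ip psd_bil[OF E] bil_k)
    have "0 \<le> T v v"
    proof (rule cspan_quadratic_nonneg[OF pos_eig_V bilT _ _ v])
      fix u w assume uw: "u \<in> V" "w \<in> V"
      have nn: "nrm u * nrm w \<ge> 0" using nrm_nonneg[OF uw(1)] nrm_nonneg[OF uw(2)] by simp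
      have "\<bar>E u w\<bar> \<le> sqrt (E u u) * sqrt (E w w)" by (rule psd_cs_abs[OF E uw])
      also have "\<dots> \<le> nrm u * nrm w"
        unfolding nrm_def using Eip uw psd_nonneg[OF E] psd_nonneg[OF psd_ip] by (intro mult_mono) auto
      finally have Eb: "\<bar>E u w\<bar> \<le> nrm u * nrm w" .
      have "\<bar>T u w\<bar> \<le> \<bar>1 - \<eta> - c1\<bar> * \<bar>ip u w\<bar> + \<sigma> * \<bar>E u w\<bar> + \<bar>k u w\<bar>"
      proof -
        have "\<bar>T u w\<bar> \<le> \<bar>(1 - \<eta> - c1) * ip u w\<bar> + \<bar>\<sigma> * E u w\<bar> + \<bar>k u w\<bar>" unfolding T_def by simp
        then show ?thesis using \<sigma> by (simp add: abs_mult)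
      qed
      also have "\<dots> \<le> \<bar>1 - \<eta> - c1\<bar> * (nrm u * nrm w) + \<sigma> * (nrm u * nrm w) + Ck * nrm u * nrm w"
        using \<sigma> by (intro add_mono mult_left_mono ip_cs[OF uw] Eb k_bound[OF uw]) auto
      finally show "\<bar>T u w\<bar> \<le> (\<bar>1 - \<eta> - c1\<bar> + \<sigma> + Ck) * nrm u * nrm w" by (simp add: algebra_simps)
    next
      fix m :: nat and a :: "nat \<Rightarrow> real" and f assume f: "\<And>i. i < m \<Longrightarrow> f i \<in> pos_eig"
      have "\<forall>i. \<exists>l. i < m \<longrightarrow> l > 0 \<and> eig l (f i)" using f by (auto simp: pos_eig_def)
      then obtain l' where l': "\<And>i. i < m \<Longrightarrow> l' i > 0" "\<And>i. i < m \<Longrightarrow> eig (l' i) (f i)" by metis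
      have fV: "f i \<in> V" if "i < m" for i using eig_V[OF l'(2)[OF that]] .
      \<comment> \<open>The components with eigenvalue far from \<open>1\<close> and close to \<open>1\<close>.\<close>
      define a1 where "a1 i = (if \<epsilon> \<le> \<bar>1 - l' i\<bar> then a i else 0)" for i
      define a2 where "a2 i = (if \<epsilon> \<le> \<bar>1 - l' i\<bar> then 0 else a i)" for i
      define v1 where "v1 = (\<lambda>x. \<Sum>i<m. a1 i * f i x)"
      define v2 where "v2 = (\<lambda>x. \<Sum>i<m. a2 i * f i x)"
      define v where "v = (\<lambda>x. \<Sum>i<m. a i * f i x)"
      have V12: "v1 \<in> V" "v2 \<in> V" unfolding v1_def v2_def by (rule sum_V[OF fV]; assumption)+
      have v12: "v = (\<lambda>x. v1 x + v2 x)"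
        unfolding v_def v1_def v2_def a1_def a2_def
        by (rule ext, subst sum.distrib[symmetric], rule sum.cong) auto
      have orth: "a1 i * a2 j * ip (f i) (f j) = 0" if "i < m" "j < m" for i j
        using eig_orthogonal[OF l'(2) l'(2), of i j] that by (auto simp: a1_def a2_def)
      have ip12: "ip v1 v2 = 0"
      proof -
        have "ip v1 v2 = (\<Sum>i<m. \<Sum>j<m. a1 i * a2 j * ip (f i) (f j))"
          unfolding v1_def v2_def by (rule bil_sum2[OF bil_ip fV])
        also have "\<dots> = 0" using orth by (intro sum.neutral ballI) simp
        finally show ?thesis .
      qed
      have k12: "k v1 v2 = 0"
      proof -
        have "k v1 v2 = (\<Sum>i<m. \<Sum>j<m. (1 - l' i) * (a1 i * a2 j * ip (f i) (f j)))"
          unfolding v1_def v2_def by (subst eig_k_sum[where l=l']) (auto simp: l'(2) algebra_simps)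
        also have "\<dots> = 0" using orth by (intro sum.neutral ballI) simp
        finally show ?thesis .
      qed
      have k1: "k v1 v1 \<le> (1 - \<rho>) * ip v1 v1"
        unfolding v1_def
        by (rule eig_k_le[OF l'(2)]) (use low l' in \<open>auto simp: a1_def split: if_splits\<close>)
      have k2: "k v2 v2 \<le> \<epsilon> * ip v2 v2"
        unfolding v2_def
        by (rule eig_k_le[OF l'(2)]) (auto simp: a2_def split: if_splits)
      have i1: "ip v1 v1 \<ge> 0" and i2: "ip v2 v2 \<ge> 0" using V12 psd_nonneg[OF psd_ip] by auto
      have E1: "E v1 v1 \<le> (real N)\<^sup>2 * \<omega> * ip v1 v1"
      proof -
        \<comment> \<open>\<open>v1\<close> agrees with its projection \<open>p\<close> to the maximal family up to a null vector of \<open>ip\<close>, hence of \<open>E\<close>.\<close>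
        define c where "c i = ip v1 (e i)" for i
        define p where "p = (\<lambda>x. \<Sum>i<N. c i * e i x)"
        define d where "d = (\<lambda>x. v1 x - p x)"
        have pV: "p \<in> V" unfolding p_def by (rule sum_V[OF eV])
        have dV: "d \<in> V" unfolding d_def by (rule diff_V[OF V12(1) pV])
        define q where "q j = (\<lambda>x. f j x - (\<Sum>i<N. ip (f j) (e i) * e i x))" for j
        have qV: "q j \<in> V" if "j < m" for j
          unfolding q_def by (rule diff_V[OF fV[OF that] sum_V[OF eV]])
        have d_eq: "d = (\<lambda>x. \<Sum>j<m. a1 j * q j x)"
        proof
          fix x
          have "c i = (\<Sum>j<m. a1 j * ip (f j) (e i))" if "i < N" for i
            unfolding c_def v1_def by (rule bil_sum_left[OF bil_ip fV eV[OF that]])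
          then have "p x = (\<Sum>i<N. \<Sum>j<m. a1 j * ip (f j) (e i) * e i x)"
            unfolding p_def by (intro sum.cong) (auto simp: sum_distrib_right)
          also have "\<dots> = (\<Sum>j<m. a1 j * (\<Sum>i<N. ip (f j) (e i) * e i x))"
            by (subst sum.swap) (simp add: sum_distrib_left mult.assoc)
          finally show "d x = (\<Sum>j<m. a1 j * q j x)"
            by (simp add: d_def v1_def q_def right_diff_distrib sum_subtractf)
        qed
        have "sqrt (ip d d) \<le> (\<Sum>j<m. \<bar>a1 j\<bar> * sqrt (ip (q j) (q j)))"
          unfolding d_eq by (rule psd_triangle_sum[OF psd_ip qV])
        also have "\<dots> = 0"
        proof (intro sum.neutral ballI)
          fix j assume j: "j \<in> {..<m}"
          show "\<bar>a1 j\<bar> * sqrt (ip (q j) (q j)) = 0"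
          proof (cases "\<epsilon> \<le> \<bar>1 - l' j\<bar>")
            case True
            then have "f j \<in> S" using l' j by (auto simp: S_def)
            then show ?thesis using span by (simp add: q_def)
          qed (simp add: a1_def)
        qed
        finally have "ip d d = 0" using psd_nonneg[OF psd_ip dV] by simp
        then have Ed: "E d d = 0" using Eip[OF dV] psd_nonneg[OF E dV] by simp
        have "sqrt (E v1 v1) = sqrt (E (\<lambda>x. p x + d x) (\<lambda>x. p x + d x))" by (simp add: d_def)
        also have "\<dots> \<le> sqrt (E p p) + sqrt (E d d)" by (rule psd_triangle[OF E pV dV])
        also have "sqrt (E d d) = 0" by (simp add: Ed)
        also have "sqrt (E p p) \<le> (\<Sum>i<N. \<bar>c i\<bar> * sqrt (E (e i) (e i)))"
          unfolding p_def by (rule psd_triangle_sum[OF E eV])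
        also have "\<dots> \<le> (\<Sum>i<N. nrm v1 * sqrt \<omega>)"
        proof (intro sum_mono mult_mono)
          fix i assume i: "i \<in> {..<N}"
          have "nrm (e i) = 1" using e(1) i by (simp add: nrm_def onfam_def)
          then show "\<bar>c i\<bar> \<le> nrm v1" using ip_cs[OF V12(1) eV, of i] i by (simp add: c_def)
          show "sqrt (E (e i) (e i)) \<le> sqrt \<omega>" using small i by simp
          show "0 \<le> sqrt (E (e i) (e i))" using psd_nonneg[OF E eV] i by simp
        qed (rule nrm_nonneg[OF V12(1)])
        finally have "sqrt (E v1 v1) \<le> N * (nrm v1 * sqrt \<omega>)" by simp
        then have "(sqrt (E v1 v1))\<^sup>2 \<le> (N * (nrm v1 * sqrt \<omega>))\<^sup>2"
          using psd_nonneg[OF E V12(1)] by (intro power_mono) auto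
        then show ?thesis
          using psd_nonneg[OF E V12(1)] nrm_sq[OF V12(1)] \<omega> by (simp add: power_mult_distrib algebra_simps)
      qed
      have E2: "E v2 v2 \<le> ip v2 v2" by (rule Eip[OF V12(2)])
      have ipv: "ip v v = ip v1 v1 + ip v2 v2"
        using bil_quadratic[OF bil_ip V12, of 1 1] ip12 by (simp add: v12)
      have kv: "k v v = k v1 v1 + k v2 v2"
        using bil_quadratic[OF bil_k V12, of 1 1] k12 by (simp add: v12)
      have "E v v \<le> (1 + 1 / t) * E v1 v1 + (1 + t) * E v2 v2"
        unfolding v12 by (rule psd_add_le[OF E V12 t])
      also have "\<dots> \<le> (1 + 1 / t) * ((real N)\<^sup>2 * \<omega> * ip v1 v1) + (1 + t) * ip v2 v2"
        using E1 E2 t by (intro add_mono mult_left_mono) auto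
      also have "\<dots> \<le> (\<rho> / 4) * ip v1 v1 + (1 + t) * ip v2 v2"
      proof -
        have "(1 + 1 / t) * ((real N)\<^sup>2 * \<omega>) \<le> (1 + 1 / t) * (((real N)\<^sup>2 + 1) * \<omega>)"
          using t \<omega> by (intro mult_left_mono mult_right_mono) auto
        also have "\<dots> = \<rho> / 4"
        proof -
          have "1 + 1 / t \<noteq> 0" "(real N)\<^sup>2 + 1 \<noteq> 0"
            using t by (auto simp: add_pos_pos less_imp_neq[symmetric] add_nonneg_pos)
          then show ?thesis unfolding \<omega>_def by (simp add: divide_simps)
        qed
        finally have "(1 + 1 / t) * ((real N)\<^sup>2 * \<omega>) * ip v1 v1 \<le> \<rho> / 4 * ip v1 v1"
          using i1 by (rule mult_right_mono)
        then show ?thesis by (simp add: mult.assoc)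
      qed
      finally have Ev: "\<sigma> * E v v \<le> \<rho> / 4 * ip v1 v1 + \<sigma> * (1 + t) * ip v2 v2"
      proof -
        assume "E v v \<le> (\<rho> / 4) * ip v1 v1 + (1 + t) * ip v2 v2"
        then have "\<sigma> * E v v \<le> \<sigma> * ((\<rho> / 4) * ip v1 v1 + (1 + t) * ip v2 v2)"
          using \<sigma> by (intro mult_left_mono)
        moreover have "\<sigma> * ((\<rho> / 4) * ip v1 v1) \<le> 1 * ((\<rho> / 4) * ip v1 v1)"
          using \<sigma> \<rho>0 i1 by (intro mult_right_mono) auto
        ultimately show ?thesis by (simp add: algebra_simps)
      qed
      have "\<sigma> * t \<le> \<theta> / 4" using \<sigma> t mult_right_mono[of \<sigma> 1 t] by (simp add: t_def)
      then have "\<theta> / 2 * ip v2 v2 \<le> (1 - \<eta> - \<sigma> * (1 + t) - \<epsilon>) * ip v2 v2"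
        using i2 by (intro mult_right_mono) (auto simp: \<sigma>_def \<epsilon>_def algebra_simps)
      then have "c1 * ip v2 v2 \<le> (1 - \<eta> - \<sigma> * (1 + t) - \<epsilon>) * ip v2 v2"
        using mult_right_mono[OF c1le(2) i2] by linarith
      moreover have "c1 * ip v1 v1 \<le> (1 - \<eta> - \<rho> / 4 - (1 - \<rho>)) * ip v1 v1"
        using mult_right_mono[OF c1le(1) i1] by (simp add: \<eta>_def)
      ultimately have "c1 * ip v v \<le> (1 - \<eta>) * ip v v - \<sigma> * E v v - k v v"
        unfolding ipv kv using Ev k1 k2 by (simp add: algebra_simps)
      then show "0 \<le> T (\<lambda>x. \<Sum>i<m. a i * f i x) (\<lambda>x. \<Sum>i<m. a i * f i x)"
        by (simp add: T_def v_def[symmetric] algebra_simps)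
    qed
    then show ?thesis by (simp add: T_def \<sigma>_def algebra_simps)
  qed
  with \<eta> \<omega> c1 eV that show ?thesis by blast
qed

end

section \<open>The energy space\<close>

context bounded_open
begin

lemma Lp2_D:
  fixes u :: "'a \<Rightarrow> 'b::euclidean_space"
  assumes "u \<in> Lp \<Omega> 2" shows "u \<in> borel_measurable M" "integrable M (\<lambda>x. (norm (u x))\<^sup>2)"
  using LpD[OF assms] by auto

lemma Lp2_I:
  fixes u :: "'a \<Rightarrow> 'b::euclidean_space"
  assumes "u \<in> borel_measurable M" "integrable M (\<lambda>x. (norm (u x))\<^sup>2)" shows "u \<in> Lp \<Omega> 2"
  using assms by (intro LpI) auto

text \<open>Completeness of \<open>L\<^sup>2\<close>: a subsequence of a Cauchy sequence converges almost everywhere, and its limit is the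
  limit in \<open>L\<^sup>2\<close> by Fatou's lemma.\<close>

lemma L2_complete:
  fixes f :: "nat \<Rightarrow> 'a \<Rightarrow> 'b::euclidean_space"
  assumes f: "\<And>k. f k \<in> Lp \<Omega> 2"
    and cauchy: "\<And>e. e > 0 \<Longrightarrow> \<exists>n. \<forall>i\<ge>n. \<forall>j\<ge>n. (\<integral>x. (norm (f i x - f j x))\<^sup>2 \<partial>M) < e"
  obtains F where "F \<in> Lp \<Omega> 2" "(\<lambda>k. \<integral>x. (norm (f k x - F x))\<^sup>2 \<partial>M) \<longlonglongrightarrow> 0"
proof -
  have d: "(\<lambda>x. f i x - f j x) \<in> Lp \<Omega> 2" for i j using f by (intro Lp_diff) auto
  note [measurable] = Lp2_D(1)[OF f]
  have f1: "integrable M (f k)" for k using Lp_integrable[OF f] by simp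
  have c1: "\<exists>n. \<forall>i\<ge>n. \<forall>j\<ge>n. (\<integral>x. norm (f i x - f j x) \<partial>M) < e" if e: "e > 0" for e
  proof -
    define W where "W = measure M \<Omega> + 1"
    have W: "W > 0" by (simp add: W_def add_nonneg_pos)
    define \<eta> where "\<eta> = e / (2 * W)"
    have \<eta>: "\<eta> > 0" using e W by (simp add: \<eta>_def)
    obtain n where n: "\<And>i j. i \<ge> n \<Longrightarrow> j \<ge> n \<Longrightarrow> (\<integral>x. (norm (f i x - f j x))\<^sup>2 \<partial>M) < \<eta> * (e / 2)"
      using cauchy[of "\<eta> * (e / 2)"] \<eta> e by auto
    have "(\<integral>x. norm (f i x - f j x) \<partial>M) < e" if "i \<ge> n" "j \<ge> n" for i j
    proof -
      have pt: "y \<le> \<eta> + y\<^sup>2 / \<eta>" for y :: real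
      proof -
        have "0 \<le> (2 * y - \<eta>)\<^sup>2 + 3 * \<eta>\<^sup>2" by simp
        then have "y * \<eta> \<le> \<eta> * \<eta> + y\<^sup>2" by (simp add: power2_eq_square algebra_simps)
        then show ?thesis using \<eta> by (simp add: field_simps power2_eq_square)
      qed
      have "(\<integral>x. norm (f i x - f j x) \<partial>M) \<le> (\<integral>x. \<eta> + (norm (f i x - f j x))\<^sup>2 / \<eta> \<partial>M)"
        using f1 Lp2_D(2)[OF d] by (intro integral_mono pt) auto
      also have "\<dots> = \<eta> * measure M \<Omega> + (\<integral>x. (norm (f i x - f j x))\<^sup>2 \<partial>M) / \<eta>"
        using Lp2_D(2)[OF d] by simp
      also have "\<dots> < \<eta> * W + e / 2"
      proof (rule add_le_less_mono)
        show "\<eta> * measure M \<Omega> \<le> \<eta> * W" using \<eta> by (simp add: W_def)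
        show "(\<integral>x. (norm (f i x - f j x))\<^sup>2 \<partial>M) / \<eta> < e / 2"
          using n[OF that] \<eta> by (simp add: field_simps)
      qed
      also have "\<dots> = e" using W by (simp add: \<eta>_def)
      finally show ?thesis .
    qed
    then show ?thesis by blast
  qed
  obtain r where r: "strict_mono r" "AE x in M. Cauchy (\<lambda>i. f (r i) x)"
    using cauchy_L1_AE_cauchy_subseq[OF f1 c1] by blast
  define F where "F x = lim (\<lambda>i. f (r i) x)" for x
  have [measurable]: "F \<in> borel_measurable M" unfolding F_def[abs_def] by measurable
  have lim: "AE x in M. (\<lambda>i. f (r i) x) \<longlonglongrightarrow> F x"
    using r(2) by eventually_elim (simp add: F_def Cauchy_convergent_iff convergent_LIMSEQ_iff)
  have tail: "(\<integral>\<^sup>+x. ennreal ((norm (f k x - F x))\<^sup>2) \<partial>M) \<le> ennreal e"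
    if n: "\<And>i j. i \<ge> n \<Longrightarrow> j \<ge> n \<Longrightarrow> (\<integral>x. (norm (f i x - f j x))\<^sup>2 \<partial>M) < e" and k: "k \<ge> n" for n k e
  proof -
    have "(\<integral>\<^sup>+x. ennreal ((norm (f k x - F x))\<^sup>2) \<partial>M)
        = (\<integral>\<^sup>+x. liminf (\<lambda>i. ennreal ((norm (f k x - f (r i) x))\<^sup>2)) \<partial>M)"
    proof (rule nn_integral_cong_AE)
      show "AE x in M. ennreal ((norm (f k x - F x))\<^sup>2) = liminf (\<lambda>i. ennreal ((norm (f k x - f (r i) x))\<^sup>2))"
        using lim
      proof eventually_elim
        case (elim x)
        have "(\<lambda>i. ennreal ((norm (f k x - f (r i) x))\<^sup>2)) \<longlonglongrightarrow> ennreal ((norm (f k x - F x))\<^sup>2)"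
          by (intro tendsto_ennrealI tendsto_power tendsto_norm tendsto_diff tendsto_const elim)
        from lim_imp_Liminf[OF _ this] show ?case by simp
      qed
    qed
    also have "\<dots> \<le> liminf (\<lambda>i. (\<integral>\<^sup>+x. ennreal ((norm (f k x - f (r i) x))\<^sup>2) \<partial>M))"
      by (rule nn_integral_liminf) simp
    also have "\<dots> \<le> liminf (\<lambda>i. ennreal e)"
    proof (rule Liminf_mono, rule eventually_mono[OF eventually_ge_at_top[of n]])
      fix i assume "i \<ge> n"
      then have "r i \<ge> n" using seq_suble[OF r(1), of i] by linarith
      then show "(\<integral>\<^sup>+x. ennreal ((norm (f k x - f (r i) x))\<^sup>2) \<partial>M) \<le> ennreal e"
        using n[OF k, of "r i"] Lp2_D(2)[OF d, of k "r i"] by (simp add: nn_integral_eq_integral ennreal_leI)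
    qed
    finally show ?thesis by (simp add: Liminf_const)
  qed
  have tail_int: "integrable M (\<lambda>x. (norm (f k x - F x))\<^sup>2) \<and> (\<integral>x. (norm (f k x - F x))\<^sup>2 \<partial>M) \<le> e"
    if e: "e > 0" and n: "\<And>i j. i \<ge> n \<Longrightarrow> j \<ge> n \<Longrightarrow> (\<integral>x. (norm (f i x - f j x))\<^sup>2 \<partial>M) < e" and k: "k \<ge> n" for n k e
  proof -
    have t: "(\<integral>\<^sup>+x. ennreal ((norm (f k x - F x))\<^sup>2) \<partial>M) \<le> ennreal e" by (rule tail[OF n k])
    have i: "integrable M (\<lambda>x. (norm (f k x - F x))\<^sup>2)"
      by (rule integrableI_bounded) (use t in \<open>auto intro: le_less_trans\<close>)
    then show ?thesis using t e by (simp add: nn_integral_eq_integral)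
  qed
  obtain n1 where n1: "\<And>i j. i \<ge> n1 \<Longrightarrow> j \<ge> n1 \<Longrightarrow> (\<integral>x. (norm (f i x - f j x))\<^sup>2 \<partial>M) < 1"
    using cauchy[of 1] by auto
  have "(\<lambda>x. f n1 x - F x) \<in> Lp \<Omega> 2"
    using tail_int[OF _ n1, of n1] by (intro Lp2_I) auto
  from Lp_diff[OF _ f this, of n1] have FL: "F \<in> Lp \<Omega> 2" by simp
  moreover have "(\<lambda>k. \<integral>x. (norm (f k x - F x))\<^sup>2 \<partial>M) \<longlonglongrightarrow> 0"
  proof (rule LIMSEQ_I)
    fix e :: real assume e: "e > 0"
    obtain n where n: "\<And>i j. i \<ge> n \<Longrightarrow> j \<ge> n \<Longrightarrow> (\<integral>x. (norm (f i x - f j x))\<^sup>2 \<partial>M) < e / 2"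
      using cauchy[of "e / 2"] e by auto
    have "norm ((\<integral>x. (norm (f k x - F x))\<^sup>2 \<partial>M) - 0) < e" if "k \<ge> n" for k
      using tail_int[OF _ n that] e by (simp add: integral_nonneg_AE)
    then show "\<exists>n. \<forall>k\<ge>n. norm ((\<integral>x. (norm (f k x - F x))\<^sup>2 \<partial>M) - 0) < e" by blast
  qed
  ultimately show ?thesis using that by blast
qed

lemma sob_approx:
  assumes s: "sob p u U" and p: "0 \<le> p" and e: "e > 0"
  obtains \<phi> where "\<phi> \<in> test_functions \<Omega>" "(\<integral>x. norm (u x - \<phi> x) powr p \<partial>M) < e"
    "(\<integral>x. norm (U x - grad \<phi> x) powr p \<partial>M) < e"
proof -
  obtain \<phi> where \<phi>: "\<And>k. \<phi> k \<in> test_functions \<Omega>"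
    "(\<lambda>k. \<integral>x. norm (u x - \<phi> k x) powr p \<partial>M) \<longlonglongrightarrow> 0"
    "(\<lambda>k. \<integral>x. norm (U x - grad (\<phi> k) x) powr p \<partial>M) \<longlonglongrightarrow> 0"
    by (rule sobE[OF s], rule that)
  have "\<forall>\<^sub>F k in sequentially. (\<integral>x. norm (u x - \<phi> k x) powr p \<partial>M) < e \<and>
      (\<integral>x. norm (U x - grad (\<phi> k) x) powr p \<partial>M) < e"
    using order_tendstoD(2)[OF \<phi>(2) e] order_tendstoD(2)[OF \<phi>(3) e] by eventually_elim auto
  then show ?thesis using \<phi>(1) that by (auto simp: eventually_sequentially)
qed

lemma sob_closed:
  assumes s: "\<And>k. sob 2 (z k) (Z k)" and u: "u \<in> Lp \<Omega> 2" and U: "U \<in> Lp \<Omega> 2"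
    and c1: "(\<lambda>k. \<integral>x. (norm (z k x - u x))\<^sup>2 \<partial>M) \<longlonglongrightarrow> 0"
    and c2: "(\<lambda>k. \<integral>x. (norm (Z k x - U x))\<^sup>2 \<partial>M) \<longlonglongrightarrow> 0"
  shows "sob 2 u U"
proof -
  have "\<forall>k. \<exists>\<phi>. \<phi> \<in> test_functions \<Omega> \<and> (\<integral>x. norm (z k x - \<phi> x) powr 2 \<partial>M) < inverse (real (Suc k)) \<and>
    (\<integral>x. norm (Z k x - grad \<phi> x) powr 2 \<partial>M) < inverse (real (Suc k))"
  proof
    fix k
    have "inverse (real (Suc k)) > 0" by simp
    then show "\<exists>\<phi>. \<phi> \<in> test_functions \<Omega> \<and> (\<integral>x. norm (z k x - \<phi> x) powr 2 \<partial>M) < inverse (real (Suc k)) \<and>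
    (\<integral>x. norm (Z k x - grad \<phi> x) powr 2 \<partial>M) < inverse (real (Suc k))"
      by (rule sob_approx[OF s[of k], rotated]) auto
  qed
  from choice[OF this] obtain \<phi> where \<phi>: "\<And>k. \<phi> k \<in> test_functions \<Omega>"
    "\<And>k. (\<integral>x. norm (z k x - \<phi> k x) powr 2 \<partial>M) < inverse (real (Suc k))"
    "\<And>k. (\<integral>x. norm (Z k x - grad (\<phi> k) x) powr 2 \<partial>M) < inverse (real (Suc k))" by blast
  have lim: "(\<lambda>k. \<integral>x. norm (w x - \<psi> k x) powr 2 \<partial>M) \<longlonglongrightarrow> 0"
    if y: "\<And>k. y k \<in> Lp \<Omega> 2" and w: "w \<in> Lp \<Omega> 2" and \<psi>: "\<And>k. \<psi> k \<in> Lp \<Omega> 2"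
      and c: "(\<lambda>k. \<integral>x. (norm (y k x - w x))\<^sup>2 \<partial>M) \<longlonglongrightarrow> 0"
      and b: "\<And>k. (\<integral>x. norm (y k x - \<psi> k x) powr 2 \<partial>M) < inverse (real (Suc k))"
    for y \<psi> :: "nat \<Rightarrow> 'a \<Rightarrow> 'b::euclidean_space" and w
  proof (rule Lim_null_comparison[OF always_eventually, OF allI])
    fix k
    have "(\<integral>x. norm ((w x - y k x) + (y k x - \<psi> k x)) powr 2 \<partial>M)
      \<le> 2 powr 2 * ((\<integral>x. norm (w x - y k x) powr 2 \<partial>M) + (\<integral>x. norm (y k x - \<psi> k x) powr 2 \<partial>M))"
      by (rule Lp_add(2)) (use y w \<psi> in \<open>simp_all add: Lp_diff\<close>)
    also have "\<dots> \<le> 4 * ((\<integral>x. (norm (y k x - w x))\<^sup>2 \<partial>M) + inverse (real (Suc k)))"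
      using b[of k] by (simp add: norm_minus_commute)
    finally show "norm (\<integral>x. norm (w x - \<psi> k x) powr 2 \<partial>M)
        \<le> 4 * ((\<integral>x. (norm (y k x - w x))\<^sup>2 \<partial>M) + inverse (real (Suc k)))"
      by (simp add: integral_nonneg_AE)
  next
    show "(\<lambda>k. 4 * ((\<integral>x. (norm (y k x - w x))\<^sup>2 \<partial>M) + inverse (real (Suc k)))) \<longlonglongrightarrow> 0"
      by (rule tendsto_eq_intros c LIMSEQ_inverse_real_of_nat refl)+ simp
  qed
  have "(\<lambda>k. \<integral>x. norm (u x - \<phi> k x) powr 2 \<partial>M) \<longlonglongrightarrow> 0"
    by (rule lim[OF sob_Lp(1)[OF s] u test_Lp(1)[OF \<phi>(1)] c1 \<phi>(2)]) simp
  moreover have "(\<lambda>k. \<integral>x. norm (U x - grad (\<phi> k) x) powr 2 \<partial>M) \<longlonglongrightarrow> 0"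
    by (rule lim[OF sob_Lp(2)[OF s] U test_Lp(2)[OF \<phi>(1)] c2 \<phi>(3)]) simp
  ultimately show ?thesis unfolding sob_def using u U \<phi>(1) by auto
qed

lemma poincare:
  obtains Cp where "Cp > 0" "\<And>u U. sob 2 u U \<Longrightarrow> (\<integral>x. (u x)\<^sup>2 \<partial>M) \<le> Cp * (\<integral>x. (norm (U x))\<^sup>2 \<partial>M)"
proof -
  obtain C where C: "C > 0" "\<And>u U. sob 2 u U \<Longrightarrow>
     u \<in> Lp \<Omega> 2 \<and> (\<integral>x. norm (u x) powr 2 \<partial>M) \<le> C * (\<integral>x. norm (U x) powr 2 \<partial>M) powr (2 / 2)"
    by (rule sobolev[of 2 2]) auto
  have "(\<integral>x. (u x)\<^sup>2 \<partial>M) \<le> C * (\<integral>x. (norm (U x))\<^sup>2 \<partial>M)" if "sob 2 u U" for u U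
    using C(2)[OF that] by (simp add: integral_nonneg_AE)
  with C(1) that show ?thesis by blast
qed

lemma W10_combo:
  assumes p: "1 \<le> p" and u: "u \<in> W10 p \<Omega>" and v: "v \<in> W10 p \<Omega>"
  shows "(\<lambda>x. a * u x + b * v x) \<in> W10 p \<Omega>"
    and "AE x in M. wgrad \<Omega> (\<lambda>x. a * u x + b * v x) x = a *\<^sub>R wgrad \<Omega> u x + b *\<^sub>R wgrad \<Omega> v x"
proof -
  have s: "sob p (\<lambda>x. a * u x + b * v x) (\<lambda>x. a *\<^sub>R wgrad \<Omega> u x + b *\<^sub>R wgrad \<Omega> v x)"
    using p by (intro sob_combo W10_sob u v) auto
  show "(\<lambda>x. a * u x + b * v x) \<in> W10 p \<Omega>" by (rule sob_W10[OF s p])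
  show "AE x in M. wgrad \<Omega> (\<lambda>x. a * u x + b * v x) x = a *\<^sub>R wgrad \<Omega> u x + b *\<^sub>R wgrad \<Omega> v x"
    by (rule sob_wgrad[OF s p])
qed

lemma W10_zero:
  assumes "1 \<le> p" shows "(\<lambda>_. 0) \<in> W10 p \<Omega>" "AE x in M. wgrad \<Omega> (\<lambda>_. 0) x = 0"
proof -
  have s: "sob p (\<lambda>_. 0) (\<lambda>_. 0)" using assms by (intro sob_zero) simp
  show "(\<lambda>_. 0) \<in> W10 p \<Omega>" "AE x in M. wgrad \<Omega> (\<lambda>_. 0) x = 0"
    using sob_W10[OF s assms] sob_wgrad[OF s assms] by auto
qed

lemma W10_AE_cong:
  assumes p: "1 \<le> p" and u: "u \<in> W10 p \<Omega>" and ae: "AE x in M. u x = v x"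
  shows "v \<in> W10 p \<Omega>" "AE x in M. wgrad \<Omega> v x = wgrad \<Omega> u x"
proof -
  have s: "sob p v (wgrad \<Omega> u)" by (rule sob_AE_cong[OF W10_sob[OF u p] ae]) simp
  show "v \<in> W10 p \<Omega>" "AE x in M. wgrad \<Omega> v x = wgrad \<Omega> u x"
    using sob_W10[OF s p] sob_wgrad[OF s p] by auto
qed

lemma W10_mono: "u \<in> W10 p \<Omega> \<Longrightarrow> 1 \<le> q \<Longrightarrow> q \<le> p \<Longrightarrow> u \<in> W10 q \<Omega>"
  using sob_W10[OF sob_mono[OF W10_sob]] by simp

lemma W10_Lp:
  assumes "u \<in> W10 p \<Omega>" "1 \<le> p"
  shows "u \<in> Lp \<Omega> p" "wgrad \<Omega> u \<in> Lp \<Omega> p"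
  using sob_Lp[OF W10_sob[OF assms]] by auto

end

lemma bilinear_sum_Basis:
  fixes B :: "'a::euclidean_space \<Rightarrow> 'a \<Rightarrow> real"
  assumes B: "bilinear B"
  shows "B v w = (\<Sum>i\<in>Basis. \<Sum>j\<in>Basis. (v \<bullet> i) * (w \<bullet> j) * B i j)"
proof -
  have L: "linear (\<lambda>v. B v w)" "linear (B v)" for v w using B by (auto simp: bilinear_def)
  have "B v w = B (\<Sum>i\<in>Basis. (v \<bullet> i) *\<^sub>R i) w" by (simp only: euclidean_representation)
  also have "\<dots> = (\<Sum>i\<in>Basis. (v \<bullet> i) * B i w)"
    by (simp only: linear_sum[OF L(1)] linear_cmul[OF L(1)] real_scaleR_def)
  also have "\<dots> = (\<Sum>i\<in>Basis. (v \<bullet> i) * B i (\<Sum>j\<in>Basis. (w \<bullet> j) *\<^sub>R j))"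
    by (simp only: euclidean_representation)
  also have "\<dots> = (\<Sum>i\<in>Basis. \<Sum>j\<in>Basis. (v \<bullet> i) * (w \<bullet> j) * B i j)"
    by (simp only: linear_sum[OF L(2)] linear_cmul[OF L(2)] real_scaleR_def sum_distrib_left mult.assoc)
  finally show ?thesis .
qed

text \<open>The constant matrix \<open>A\<close> stands for the Hessian at \<open>0\<close>, the potential \<open>a\<close> for \<open>\<partial>\<^sub>s g(x,0)\<close>.\<close>

locale elliptic = bounded_open \<Omega> for \<Omega> :: "'a::euclidean_space set" +
  fixes A :: "'a \<Rightarrow> 'a \<Rightarrow> real" and a :: "'a \<Rightarrow> real" and lam Lam Ca :: real
  assumes A_lin: "A (s *\<^sub>R x + t *\<^sub>R y) z = s * A x z + t * A y z"
    and A_sym: "A x y = A y x"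
    and A_low: "lam * (norm x)\<^sup>2 \<le> A x x" and A_up: "A x x \<le> Lam * (norm x)\<^sup>2"
    and lam: "lam > 0" and Ca: "Ca > 0"
    and a_meas[measurable]: "a \<in> borel_measurable M" and a_bound: "AE x in M. \<bar>a x\<bar> \<le> Ca"
begin

definition V :: "('a \<Rightarrow> real) set" where "V = W10 2 \<Omega>"

definition form :: "('a \<Rightarrow> real) \<Rightarrow> ('a \<Rightarrow> real) \<Rightarrow> ('a \<Rightarrow> real) \<Rightarrow> real" where
  "form \<tau> u v = (\<integral>x. \<tau> x * A (wgrad \<Omega> u x) (wgrad \<Omega> v x) \<partial>M)"

definition ipA :: "('a \<Rightarrow> real) \<Rightarrow> ('a \<Rightarrow> real) \<Rightarrow> real" where
  "ipA u v = (\<integral>x. A (wgrad \<Omega> u x) (wgrad \<Omega> v x) \<partial>M)"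

definition ka :: "('a \<Rightarrow> real) \<Rightarrow> ('a \<Rightarrow> real) \<Rightarrow> real" where
  "ka u v = (\<integral>x. a x * u x * v x \<partial>M)"

lemma ipA_form: "ipA = form (\<lambda>_. 1)"
  by (simp add: fun_eq_iff ipA_def form_def)

lemma A_nonneg: "A x x \<ge> 0"
  using A_low[of x] lam by (smt (verit) mult_nonneg_nonneg zero_le_power2)

lemma Lam_nonneg: "Lam \<ge> 0"
proof -
  obtain i :: 'a where "i \<in> Basis" using nonempty_Basis by blast
  then show ?thesis using A_nonneg[of i] A_up[of i] by simp
qed

lemma A_bilinear: "bilinear A"
proof -
  have 1: "linear (\<lambda>x. A x z)" for z
  proof (rule linearI)
    show "A (x + y) z = A x z + A y z" for x y using A_lin[of 1 x 1 y z] by simp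
    show "A (c *\<^sub>R x) z = c *\<^sub>R A x z" for c x using A_lin[of c x 0 x z] by simp
  qed
  have eq: "(\<lambda>z. A x z) = (\<lambda>z. A z x)" for x by (rule ext) (rule A_sym)
  have 2: "linear (\<lambda>z. A x z)" for x by (subst eq) (rule 1)
  show ?thesis unfolding bilinear_def using 1 2 by blast
qed

lemma A_bound: "\<bar>A x y\<bar> \<le> Lam * ((norm x)\<^sup>2 + (norm y)\<^sup>2)"
proof -
  have "A (x + y) (x + y) = A x x + 2 * A x y + A y y" "A (x - y) (x - y) = A x x - 2 * A x y + A y y"
    using A_sym[of x y] A_bilinear by (auto simp: bilinear_ladd bilinear_radd bilinear_lsub bilinear_rsub)
  then have "2 * \<bar>A x y\<bar> \<le> A x x + A y y" using A_nonneg[of "x + y"] A_nonneg[of "x - y"] by linarith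
  also have "\<dots> \<le> Lam * ((norm x)\<^sup>2 + (norm y)\<^sup>2)" using A_up[of x] A_up[of y] by (simp add: algebra_simps)
  finally show ?thesis by linarith
qed

lemma A_measurable:
  assumes [measurable]: "U \<in> borel_measurable N" "W \<in> borel_measurable N"
  shows "(\<lambda>x. A (U x) (W x)) \<in> borel_measurable N"
proof -
  show ?thesis unfolding bilinear_sum_Basis[OF A_bilinear, of "U _" "W _"] by measurable
qed

lemma form_integrable:
  assumes U: "U \<in> Lp \<Omega> 2" and W: "W \<in> Lp \<Omega> 2" and \<tau>: "\<tau> \<in> borel_measurable M" "\<And>x. \<bar>\<tau> x\<bar> \<le> B"
  shows "integrable M (\<lambda>x. \<tau> x * A (U x) (W x))"
proof (rule Bochner_Integration.integrable_bound)
  show "integrable M (\<lambda>x. B * (Lam * ((norm (U x))\<^sup>2 + (norm (W x))\<^sup>2)))"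
    using Lp2_D[OF U] Lp2_D[OF W] by simp
  show "AE x in M. norm (\<tau> x * A (U x) (W x)) \<le> norm (B * (Lam * ((norm (U x))\<^sup>2 + (norm (W x))\<^sup>2)))"
  proof (rule AE_I2)
    fix x
    have B: "B \<ge> 0" using \<tau>(2)[of x] by linarith
    have "\<bar>\<tau> x\<bar> * \<bar>A (U x) (W x)\<bar> \<le> B * (Lam * ((norm (U x))\<^sup>2 + (norm (W x))\<^sup>2))"
      using B \<tau>(2) A_bound by (intro mult_mono) auto
    then show "norm (\<tau> x * A (U x) (W x)) \<le> norm (B * (Lam * ((norm (U x))\<^sup>2 + (norm (W x))\<^sup>2)))"
      using B Lam_nonneg by (simp add: abs_mult)
  qed
qed (use \<tau> A_measurable[OF Lp2_D(1)[OF U] Lp2_D(1)[OF W]] in measurable)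

lemma A_integrable:
  assumes "U \<in> Lp \<Omega> 2" "W \<in> Lp \<Omega> 2"
  shows "integrable M (\<lambda>x. A (U x) (W x))"
  using form_integrable[OF assms, of "\<lambda>_. 1" 1] by simp

lemma V_Lp: "u \<in> V \<Longrightarrow> u \<in> Lp \<Omega> 2" "u \<in> V \<Longrightarrow> wgrad \<Omega> u \<in> Lp \<Omega> 2"
  using W10_Lp[of u 2] by (auto simp: V_def)

lemma V_sob: "u \<in> V \<Longrightarrow> sob 2 u (wgrad \<Omega> u)"
  using W10_sob[of u 2] by (simp add: V_def)

lemma form_cong:
  assumes [measurable]: "\<tau> \<in> borel_measurable M" and m: "wgrad \<Omega> u \<in> borel_measurable M"
    "U \<in> borel_measurable M" "wgrad \<Omega> v \<in> borel_measurable M"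
    and ae: "AE x in M. wgrad \<Omega> u x = U x"
  shows "form \<tau> u v = (\<integral>x. \<tau> x * A (U x) (wgrad \<Omega> v x) \<partial>M)"
  unfolding form_def
proof (rule integral_cong_AE)
  show "(\<lambda>x. \<tau> x * A (wgrad \<Omega> u x) (wgrad \<Omega> v x)) \<in> borel_measurable M"
    "(\<lambda>x. \<tau> x * A (U x) (wgrad \<Omega> v x)) \<in> borel_measurable M"
    by (intro borel_measurable_times assms(1) A_measurable m)+
  show "AE x in M. \<tau> x * A (wgrad \<Omega> u x) (wgrad \<Omega> v x) = \<tau> x * A (U x) (wgrad \<Omega> v x)"
    using ae by eventually_elim simp
qed

sublocale fspace V
proof
  show "(\<lambda>_. 0) \<in> V" using W10_zero(1)[of 2] by (simp add: V_def)
  show "(\<lambda>x. s * u x + t * v x) \<in> V" if "u \<in> V" "v \<in> V" for u v s t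
    using W10_combo(1)[of 2 u v s t] that by (simp add: V_def)
qed

lemma form_bil:
  assumes \<tau>: "\<tau> \<in> borel_measurable M" "\<And>x. \<bar>\<tau> x\<bar> \<le> B"
  shows "bil (form \<tau>)"
  unfolding bil_def
proof (intro conjI ballI allI)
  show "form \<tau> u v = form \<tau> v u" for u v unfolding form_def by (simp only: A_sym[of "wgrad \<Omega> u _" "wgrad \<Omega> v _"])
  fix u v w s t assume V: "u \<in> V" "v \<in> V" "w \<in> V"
  have "form \<tau> (\<lambda>x. s * u x + t * v x) w = (\<integral>x. \<tau> x * A (s *\<^sub>R wgrad \<Omega> u x + t *\<^sub>R wgrad \<Omega> v x) (wgrad \<Omega> w x) \<partial>M)"
    by (rule form_cong[OF \<tau>(1)])
      (use W10_combo(2)[of 2 u v s t] V V_Lp(2)[THEN Lp2_D(1)] V_Lp(2)[OF combo_V, THEN Lp2_D(1)] in \<open>auto simp: V_def\<close>)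
  also have "\<dots> = (\<integral>x. s * (\<tau> x * A (wgrad \<Omega> u x) (wgrad \<Omega> w x)) + t * (\<tau> x * A (wgrad \<Omega> v x) (wgrad \<Omega> w x)) \<partial>M)"
    by (simp add: A_lin algebra_simps)
  also have "\<dots> = s * form \<tau> u w + t * form \<tau> v w"
    unfolding form_def
    using form_integrable[OF V_Lp(2)[OF V(1)] V_Lp(2)[OF V(3)] \<tau>] form_integrable[OF V_Lp(2)[OF V(2)] V_Lp(2)[OF V(3)] \<tau>]
    by simp
  finally show "form \<tau> (\<lambda>x. s * u x + t * v x) w = s * form \<tau> u w + t * form \<tau> v w" .
qed

lemma form_psd:
  assumes \<tau>: "\<tau> \<in> borel_measurable M" "\<And>x. \<bar>\<tau> x\<bar> \<le> B" "\<And>x. 0 \<le> \<tau> x"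
  shows "psd (form \<tau>)"
  unfolding psd_def using form_bil[OF \<tau>(1,2)] \<tau>(3) A_nonneg
  by (auto simp: form_def intro!: integral_nonneg_AE)

lemma form_mono:
  assumes "\<tau> \<in> borel_measurable M" "\<And>x. \<bar>\<tau> x\<bar> \<le> B" "\<sigma> \<in> borel_measurable M" "\<And>x. \<bar>\<sigma> x\<bar> \<le> B"
    "\<And>x. \<tau> x \<le> \<sigma> x" and u: "u \<in> V"
  shows "form \<tau> u u \<le> form \<sigma> u u"
  unfolding form_def
  using assms(5) A_nonneg
  by (intro integral_mono form_integrable[where B=B, OF V_Lp(2)[OF u] V_Lp(2)[OF u]] assms(1-4) mult_right_mono)

sublocale hspace V ipA
  by unfold_locales (auto simp: ipA_form intro!: form_psd[where B=1])

lemma ipA_low: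
  assumes u: "u \<in> V" shows "lam * (\<integral>x. (norm (wgrad \<Omega> u x))\<^sup>2 \<partial>M) \<le> ipA u u"
proof -
  have "(\<integral>x. lam * (norm (wgrad \<Omega> u x))\<^sup>2 \<partial>M) \<le> ipA u u"
    unfolding ipA_def using Lp2_D(2)[OF V_Lp(2)[OF u]]
    by (intro integral_mono A_low A_integrable V_Lp(2)[OF u]) simp
  then show ?thesis by simp
qed

lemma ipA_up:
  assumes u: "u \<in> V" shows "ipA u u \<le> Lam * (\<integral>x. (norm (wgrad \<Omega> u x))\<^sup>2 \<partial>M)"
proof -
  have "ipA u u \<le> (\<integral>x. Lam * (norm (wgrad \<Omega> u x))\<^sup>2 \<partial>M)"
    unfolding ipA_def using Lp2_D(2)[OF V_Lp(2)[OF u]]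
    by (intro integral_mono A_up A_integrable V_Lp(2)[OF u]) simp
  then show ?thesis by simp
qed

lemma L2_le_ipA:
  obtains C where "C > 0" "\<And>u. u \<in> V \<Longrightarrow> (\<integral>x. (u x)\<^sup>2 \<partial>M) \<le> C * ipA u u"
proof -
  obtain Cp where Cp: "Cp > 0" "\<And>u U. sob 2 u U \<Longrightarrow> (\<integral>x. (u x)\<^sup>2 \<partial>M) \<le> Cp * (\<integral>x. (norm (U x))\<^sup>2 \<partial>M)"
    using poincare by blast
  have "(\<integral>x. (u x)\<^sup>2 \<partial>M) \<le> Cp / lam * ipA u u" if u: "u \<in> V" for u
  proof -
    have "(\<integral>x. (u x)\<^sup>2 \<partial>M) \<le> Cp / lam * (lam * (\<integral>x. (norm (wgrad \<Omega> u x))\<^sup>2 \<partial>M))"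
      using Cp(2)[OF V_sob[OF u]] lam by simp
    also have "\<dots> \<le> Cp / lam * ipA u u" using ipA_low[OF u] Cp(1) lam by (intro mult_left_mono) auto
    finally show ?thesis .
  qed
  moreover have "Cp / lam > 0" using Cp(1) lam by simp
  ultimately show ?thesis using that by blast
qed

lemma ipA_0_iff:
  assumes u: "u \<in> V" shows "ipA u u = 0 \<longleftrightarrow> eq_ae \<Omega> u (\<lambda>_. 0)"
proof
  assume z: "ipA u u = 0"
  obtain C where "C > 0" "\<And>u. u \<in> V \<Longrightarrow> (\<integral>x. (u x)\<^sup>2 \<partial>M) \<le> C * ipA u u" using L2_le_ipA by blast
  then have "(\<integral>x. (u x)\<^sup>2 \<partial>M) \<le> 0" using u z by fastforce
  moreover have "0 \<le> (\<integral>x. (u x)\<^sup>2 \<partial>M)" by (rule integral_nonneg_AE) simp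
  ultimately have "(\<integral>x. (u x)\<^sup>2 \<partial>M) = 0" by simp
  then have "AE x in M. (u x)\<^sup>2 = 0"
    using Lp2_D(2)[OF V_Lp(1)[OF u]] by (subst (asm) integral_nonneg_eq_0_iff_AE) auto
  then show "eq_ae \<Omega> u (\<lambda>_. 0)" by (simp add: eq_ae_def)
next
  assume "eq_ae \<Omega> u (\<lambda>_. 0)"
  then have ae: "AE x in M. 0 = u x" by (auto simp: eq_ae_def elim: AE_mp)
  have "AE x in M. wgrad \<Omega> u x = wgrad \<Omega> (\<lambda>_. 0) x"
    by (rule W10_AE_cong(2)[OF _ W10_zero(1) ae]) auto
  then have 0: "AE x in M. wgrad \<Omega> u x = 0" using W10_zero(2)[of 2] by auto
  have A0: "A 0 0 = 0" using A_bilinear by (simp add: bilinear_lzero)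
  have "ipA u u = (\<integral>x. 0 \<partial>M)" unfolding ipA_def
  proof (rule integral_cong_AE)
    show "(\<lambda>x. A (wgrad \<Omega> u x) (wgrad \<Omega> u x)) \<in> borel_measurable M"
      by (intro A_measurable Lp2_D(1) V_Lp(2) u)
    show "AE x in M. A (wgrad \<Omega> u x) (wgrad \<Omega> u x) = 0" using 0 by eventually_elim (simp add: A0)
  qed simp
  then show "ipA u u = 0" by simp
qed

lemma ipA_complete:
  assumes s: "\<And>k. s k \<in> V"
    and c: "\<And>e. e > 0 \<Longrightarrow> \<exists>n::nat. \<forall>i\<ge>n. \<forall>j\<ge>n. nrm (\<lambda>x. s i x - s j x) < e"
  shows "\<exists>z\<in>V. (\<lambda>k. nrm (\<lambda>x. s k x - z x)) \<longlonglongrightarrow> 0"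
proof -
  obtain C where C: "C > 0" "\<And>u. u \<in> V \<Longrightarrow> (\<integral>x. (u x)\<^sup>2 \<partial>M) \<le> C * ipA u u" using L2_le_ipA by blast
  have gd: "AE x in M. wgrad \<Omega> (\<lambda>x. u x - v x) x = wgrad \<Omega> u x - wgrad \<Omega> v x" if "u \<in> V" "v \<in> V" for u v
    using W10_combo(2)[of 2 u v 1 "-1"] that by (simp add: V_def)
  have g2: "(\<integral>x. (norm (wgrad \<Omega> u x - wgrad \<Omega> v x))\<^sup>2 \<partial>M) = (\<integral>x. (norm (wgrad \<Omega> (\<lambda>x. u x - v x) x))\<^sup>2 \<partial>M)"
    if "u \<in> V" "v \<in> V" for u v
    by (rule integral_cong_AE) (use gd[OF that] that V_Lp(2)[THEN Lp2_D(1)] V_Lp(2)[OF diff_V, THEN Lp2_D(1)] in auto)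
  have sq: "ipA (\<lambda>x. u x - v x) (\<lambda>x. u x - v x) = (nrm (\<lambda>x. u x - v x))\<^sup>2" if "u \<in> V" "v \<in> V" for u v
    using nrm_sq[OF diff_V[OF that]] by simp
  have cip: "\<exists>n. \<forall>i\<ge>n. \<forall>j\<ge>n. ipA (\<lambda>x. s i x - s j x) (\<lambda>x. s i x - s j x) < e" if e: "e > 0" for e
  proof -
    obtain n where n: "\<And>i j. i \<ge> n \<Longrightarrow> j \<ge> n \<Longrightarrow> nrm (\<lambda>x. s i x - s j x) < sqrt e" using c[of "sqrt e"] e by auto
    have "ipA (\<lambda>x. s i x - s j x) (\<lambda>x. s i x - s j x) < e" if "i \<ge> n" "j \<ge> n" for i j
      using n[OF that] by (simp add: nrm_def)
    then show ?thesis by blast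
  qed
  have c1: "\<exists>n. \<forall>i\<ge>n. \<forall>j\<ge>n. (\<integral>x. (norm (s i x - s j x))\<^sup>2 \<partial>M) < e" if e: "e > 0" for e
  proof -
    obtain n where n: "\<And>i j. i \<ge> n \<Longrightarrow> j \<ge> n \<Longrightarrow> ipA (\<lambda>x. s i x - s j x) (\<lambda>x. s i x - s j x) < e / C"
      using cip[of "e / C"] e C(1) by auto
    have "(\<integral>x. (norm (s i x - s j x))\<^sup>2 \<partial>M) < e" if "i \<ge> n" "j \<ge> n" for i j
      using n[OF that] C(2)[OF diff_V[OF s s], of i j] C(1) by (simp add: field_simps)
    then show ?thesis by blast
  qed
  have c2: "\<exists>n. \<forall>i\<ge>n. \<forall>j\<ge>n. (\<integral>x. (norm (wgrad \<Omega> (s i) x - wgrad \<Omega> (s j) x))\<^sup>2 \<partial>M) < e" if e: "e > 0" for e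
  proof -
    obtain n where n: "\<And>i j. i \<ge> n \<Longrightarrow> j \<ge> n \<Longrightarrow> ipA (\<lambda>x. s i x - s j x) (\<lambda>x. s i x - s j x) < lam * e"
      using cip[of "lam * e"] e lam by auto
    have "(\<integral>x. (norm (wgrad \<Omega> (s i) x - wgrad \<Omega> (s j) x))\<^sup>2 \<partial>M) < e" if "i \<ge> n" "j \<ge> n" for i j
      using le_less_trans[OF ipA_low[OF diff_V[OF s s], of i j] n[OF that]] lam
      by (simp add: g2[OF s s])
    then show ?thesis by blast
  qed
  obtain z where z: "z \<in> Lp \<Omega> 2" "(\<lambda>k. \<integral>x. (norm (s k x - z x))\<^sup>2 \<partial>M) \<longlonglongrightarrow> 0"
    by (rule L2_complete[of s, OF V_Lp(1)[OF s] c1]) (assumption | rule that)+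
  obtain Z where Z: "Z \<in> Lp \<Omega> 2" "(\<lambda>k. \<integral>x. (norm (wgrad \<Omega> (s k) x - Z x))\<^sup>2 \<partial>M) \<longlonglongrightarrow> 0"
    by (rule L2_complete[of "\<lambda>k. wgrad \<Omega> (s k)", OF V_Lp(2)[OF s] c2]) (assumption | rule that)+
  have zZ: "sob 2 z Z" by (rule sob_closed[OF V_sob[OF s] z(1) Z(1) z(2) Z(2)])
  have zV: "z \<in> V" unfolding V_def by (rule sob_W10[OF zZ]) simp
  have wz: "AE x in M. wgrad \<Omega> z x = Z x" by (rule sob_wgrad[OF zZ]) simp
  have "(\<lambda>k. ipA (\<lambda>x. s k x - z x) (\<lambda>x. s k x - z x)) \<longlonglongrightarrow> 0"
  proof (rule Lim_null_comparison[OF always_eventually, OF allI])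
    show "(\<lambda>k. Lam * (\<integral>x. (norm (wgrad \<Omega> (s k) x - Z x))\<^sup>2 \<partial>M)) \<longlonglongrightarrow> 0"
      using tendsto_mult_right_zero[OF Z(2)] by simp
    fix k
    have "(\<integral>x. (norm (wgrad \<Omega> (s k) x - Z x))\<^sup>2 \<partial>M) = (\<integral>x. (norm (wgrad \<Omega> (s k) x - wgrad \<Omega> z x))\<^sup>2 \<partial>M)"
      by (rule integral_cong_AE)
        (use wz V_Lp(2)[OF s, THEN Lp2_D(1)] V_Lp(2)[OF zV, THEN Lp2_D(1)] Lp2_D(1)[OF Z(1)] in auto)
    then show "norm (ipA (\<lambda>x. s k x - z x) (\<lambda>x. s k x - z x)) \<le> Lam * (\<integral>x. (norm (wgrad \<Omega> (s k) x - Z x))\<^sup>2 \<partial>M)"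
      using ipA_up[OF diff_V[OF s zV], of k] psd_nonneg[OF psd_ip diff_V[OF s zV], of k] by (simp add: g2[OF s zV])
  qed
  then have "(\<lambda>k. sqrt (ipA (\<lambda>x. s k x - z x) (\<lambda>x. s k x - z x))) \<longlonglongrightarrow> sqrt 0"
    by (intro tendsto_real_sqrt)
  then show ?thesis using zV by (auto simp: nrm_def)
qed

lemma ka_integrable:
  assumes "u \<in> Lp \<Omega> 2" "v \<in> Lp \<Omega> 2"
  shows "integrable M (\<lambda>x. a x * u x * v x)"
proof (rule Bochner_Integration.integrable_bound)
  note u = Lp2_D[OF assms(1)] and v = Lp2_D[OF assms(2)]
  note [measurable] = u(1) v(1)
  show "integrable M (\<lambda>x. Ca * ((norm (u x))\<^sup>2 + (norm (v x))\<^sup>2))" using u v by simp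
  show "(\<lambda>x. a x * u x * v x) \<in> borel_measurable M" by simp
  show "AE x in M. norm (a x * u x * v x) \<le> norm (Ca * ((norm (u x))\<^sup>2 + (norm (v x))\<^sup>2))"
    using a_bound
  proof eventually_elim
    case (elim x)
    have "2 * \<bar>u x * v x\<bar> \<le> (u x)\<^sup>2 + (v x)\<^sup>2"
      using zero_le_power2[of "\<bar>u x\<bar> - \<bar>v x\<bar>"] by (simp add: power2_diff abs_mult)
    then have "\<bar>u x * v x\<bar> \<le> (u x)\<^sup>2 + (v x)\<^sup>2" by linarith
    then have "\<bar>a x\<bar> * \<bar>u x * v x\<bar> \<le> Ca * ((u x)\<^sup>2 + (v x)\<^sup>2)" using elim Ca by (intro mult_mono) auto
    then show ?case using Ca by (simp add: abs_mult mult.assoc)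
  qed
qed

lemma ka_bil: "bil ka"
  unfolding bil_def
proof (intro conjI ballI allI)
  show "ka u v = ka v u" for u v by (simp add: ka_def mult.commute mult.left_commute)
  fix u v w s t assume V: "u \<in> V" "v \<in> V" "w \<in> V"
  have "ka (\<lambda>x. s * u x + t * v x) w = (\<integral>x. s * (a x * u x * w x) + t * (a x * v x * w x) \<partial>M)"
    by (simp add: ka_def algebra_simps)
  also have "\<dots> = s * ka u w + t * ka v w"
    unfolding ka_def using ka_integrable[OF V_Lp(1)[OF V(1)] V_Lp(1)[OF V(3)]] ka_integrable[OF V_Lp(1)[OF V(2)] V_Lp(1)[OF V(3)]]
    by simp
  finally show "ka (\<lambda>x. s * u x + t * v x) w = s * ka u w + t * ka v w" .
qed

lemma ka_diag: "u \<in> V \<Longrightarrow> \<bar>ka u u\<bar> \<le> Ca * (\<integral>x. (u x)\<^sup>2 \<partial>M)"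
proof -
  assume u: "u \<in> V"
  have "\<bar>ka u u\<bar> \<le> (\<integral>x. \<bar>a x * u x * u x\<bar> \<partial>M)" unfolding ka_def by (rule integral_abs_bound)
  also have "\<dots> \<le> (\<integral>x. Ca * (u x)\<^sup>2 \<partial>M)"
  proof (rule integral_mono_AE)
    show "integrable M (\<lambda>x. \<bar>a x * u x * u x\<bar>)" using ka_integrable[OF V_Lp(1)[OF u] V_Lp(1)[OF u]] by simp
    show "integrable M (\<lambda>x. Ca * (u x)\<^sup>2)" using Lp2_D(2)[OF V_Lp(1)[OF u]] by simp
    show "AE x in M. \<bar>a x * u x * u x\<bar> \<le> Ca * (u x)\<^sup>2"
      using a_bound by eventually_elim (auto simp: abs_mult power2_eq_square mult.assoc intro!: mult_right_mono)
  qed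
  finally show ?thesis by simp
qed

text \<open>A symmetric form bounded on the diagonal is bounded: the forms \<open>K ip \<plusminus> ka\<close> satisfy the Cauchy-Schwarz
  inequality.\<close>

lemma ka_bound:
  obtains C where "C \<ge> 0" "\<And>u v. u \<in> V \<Longrightarrow> v \<in> V \<Longrightarrow> \<bar>ka u v\<bar> \<le> C * nrm u * nrm v"
proof -
  obtain C where C: "C > 0" "\<And>u. u \<in> V \<Longrightarrow> (\<integral>x. (u x)\<^sup>2 \<partial>M) \<le> C * ipA u u" using L2_le_ipA by blast
  define K where "K = Ca * C"
  have K: "K \<ge> 0" using C(1) Ca by (simp add: K_def)
  have diag: "\<bar>ka u u\<bar> \<le> K * ipA u u" if "u \<in> V" for u
    using ka_diag[OF that] mult_left_mono[OF C(2)[OF that] less_imp_le[OF Ca]]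
    unfolding K_def mult.assoc by linarith
  define P where "P u v = K * ipA u v + 1 * ka u v" for u v
  define Q where "Q u v = K * ipA u v + (-1) * ka u v" for u v
  have "psd P" unfolding psd_def P_def[abs_def]
    using bil_combine[OF bil_ip ka_bil, of K 1] diag by (auto simp: abs_le_iff) (smt (verit))
  moreover have "psd Q" unfolding psd_def Q_def[abs_def]
    using bil_combine[OF bil_ip ka_bil, of K "-1"] diag by (auto simp: abs_le_iff)
  moreover have b: "\<bar>P' u v\<bar> \<le> 2 * K * (nrm u * nrm v)"
    if "psd P'" "\<And>u. u \<in> V \<Longrightarrow> P' u u \<le> 2 * K * ipA u u" "u \<in> V" "v \<in> V" for P' u v
  proof -
    have "\<bar>P' u v\<bar> \<le> sqrt (P' u u) * sqrt (P' v v)" by (rule psd_cs_abs[OF that(1,3,4)])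
    also have "\<dots> \<le> sqrt (2 * K * ipA u u) * sqrt (2 * K * ipA v v)"
      using that psd_nonneg[OF that(1)] psd_nonneg[OF psd_ip] K by (intro mult_mono) auto
    also have "\<dots> = 2 * K * (nrm u * nrm v)"
    proof -
      define c where "c = sqrt (2 * K)"
      have "c * c = 2 * K" using K by (simp add: c_def)
      moreover have "sqrt (2 * K * ipA u u) * sqrt (2 * K * ipA v v) = (c * c) * (nrm u * nrm v)"
        unfolding real_sqrt_mult[of "2 * K"] c_def[symmetric] nrm_def by (simp add: algebra_simps)
      ultimately show ?thesis by simp
    qed
    finally show ?thesis .
  qed
  moreover have "P u u \<le> 2 * K * ipA u u" "Q u u \<le> 2 * K * ipA u u" if "u \<in> V" for u
    using diag[OF that] by (auto simp: P_def Q_def abs_le_iff)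
  ultimately have PQ: "\<bar>P u v\<bar> \<le> 2 * K * (nrm u * nrm v)" "\<bar>Q u v\<bar> \<le> 2 * K * (nrm u * nrm v)"
    if "u \<in> V" "v \<in> V" for u v using that by blast+
  have "\<bar>ka u v\<bar> \<le> (2 * K) * nrm u * nrm v" if "u \<in> V" "v \<in> V" for u v
  proof -
    have "\<bar>ka u v\<bar> = \<bar>P u v - Q u v\<bar> / 2" by (simp add: P_def Q_def)
    also have "\<dots> \<le> (\<bar>P u v\<bar> + \<bar>Q u v\<bar>) / 2" by (simp add: abs_triangle_ineq4)
    also have "\<dots> \<le> 2 * K * (nrm u * nrm v)" using PQ[OF that] by simp
    finally show ?thesis by simp
  qed
  then show ?thesis using K that[of "2 * K"] by simp
qed

text \<open>The members of an orthonormal family may be replaced by test functions, as closely as their number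
  requires; the bound for families of test functions is independent of that number.\<close>

lemma ka_compact:
  assumes \<epsilon>: "\<epsilon> > 0"
  shows "\<exists>N0. \<forall>N e. onfam N e \<longrightarrow> (\<forall>i<N. \<epsilon> \<le> \<bar>ka (e i) (e i)\<bar>) \<longrightarrow> N \<le> N0"
proof -
  obtain C where C: "C > 0" "\<And>u. u \<in> V \<Longrightarrow> (\<integral>x. (u x)\<^sup>2 \<partial>M) \<le> C * ipA u u" using L2_le_ipA by blast
  define K where "K = max (2 * C + 2) (4 / lam + 4)"
  define \<epsilon>' where "\<epsilon>' = \<epsilon> / (4 * Ca)"
  have K: "K > 0" using C(1) by (simp add: K_def)
  have \<epsilon>': "\<epsilon>' > 0" using \<epsilon> Ca by (simp add: \<epsilon>'_def)
  obtain N0 :: nat where N0: "\<forall>N \<phi>. (\<forall>i<N. \<phi> i \<in> test_functions \<Omega>) \<longrightarrow>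
      (\<forall>c. (\<integral>x. (\<Sum>i<N. c i * \<phi> i x)\<^sup>2 \<partial>lborel) \<le> K * (\<Sum>i<N. (c i)\<^sup>2)) \<longrightarrow>
      (\<forall>i<N. (\<integral>x. (norm (grad (\<phi> i) x))\<^sup>2 \<partial>lborel) \<le> K) \<longrightarrow>
      (\<forall>i<N. \<epsilon>' \<le> (\<integral>x. (\<phi> i x)\<^sup>2 \<partial>lborel)) \<longrightarrow> N \<le> N0"
    using test_family_bound[OF bounded_\<Omega> K \<epsilon>'] by blast
  have "N \<le> N0" if e: "onfam N e" and low: "\<And>i. i < N \<Longrightarrow> \<epsilon> \<le> \<bar>ka (e i) (e i)\<bar>" for N e
  proof -
    define \<delta> where "\<delta> = min \<epsilon>' (1 / (real N + 1))"
    have \<delta>: "\<delta> > 0" "\<delta> \<le> \<epsilon>'" "N * \<delta> \<le> 1" "\<delta> \<le> 1"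
    proof -
      show "\<delta> > 0" using \<epsilon>' by (simp add: \<delta>_def)
      show "\<delta> \<le> \<epsilon>'" by (simp add: \<delta>_def)
      have "\<delta> \<le> 1 / (real N + 1)" unfolding \<delta>_def by (rule min.cobounded2)
      then have *: "\<delta> * (real N + 1) \<le> 1" by (simp add: field_simps)
      with \<open>\<delta> > 0\<close> show "N * \<delta> \<le> 1" by (simp add: algebra_simps)
      have "0 \<le> N * \<delta>" using \<open>\<delta> > 0\<close> by simp
      then show "\<delta> \<le> 1" using * by (simp add: algebra_simps)
    qed
    have eV: "e i \<in> V" if "i < N" for i using onfam_V[OF e that] .
    have e1: "ipA (e i) (e i) = 1" if "i < N" for i using e that by (simp add: onfam_def)
    have "\<forall>i. \<exists>\<phi>. i < N \<longrightarrow> \<phi> \<in> test_functions \<Omega> \<and> (\<integral>x. norm (e i x - \<phi> x) powr 2 \<partial>M) < \<delta>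
        \<and> (\<integral>x. norm (wgrad \<Omega> (e i) x - grad \<phi> x) powr 2 \<partial>M) < \<delta>"
    proof
      fix i
      show "\<exists>\<phi>. i < N \<longrightarrow> \<phi> \<in> test_functions \<Omega> \<and> (\<integral>x. norm (e i x - \<phi> x) powr 2 \<partial>M) < \<delta>
        \<and> (\<integral>x. norm (wgrad \<Omega> (e i) x - grad \<phi> x) powr 2 \<partial>M) < \<delta>"
      proof (cases "i < N")
        case True
        show ?thesis by (rule sob_approx[OF V_sob[OF eV[OF True]] _ \<delta>(1)]) auto
      qed simp
    qed
    from choice[OF this] obtain \<phi> where
      \<phi>: "\<And>i. i < N \<Longrightarrow> \<phi> i \<in> test_functions \<Omega>"
      "\<And>i. i < N \<Longrightarrow> (\<integral>x. norm (e i x - \<phi> i x) powr 2 \<partial>M) < \<delta>"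
      "\<And>i. i < N \<Longrightarrow> (\<integral>x. norm (wgrad \<Omega> (e i) x - grad (\<phi> i) x) powr 2 \<partial>M) < \<delta>" by blast
    have eL: "e i \<in> Lp \<Omega> 2" "wgrad \<Omega> (e i) \<in> Lp \<Omega> 2" if "i < N" for i
      using V_Lp[OF eV[OF that]] by auto
    have \<phi>L: "\<phi> i \<in> Lp \<Omega> 2" "grad (\<phi> i) \<in> Lp \<Omega> 2" if "i < N" for i
      using test_Lp[OF \<phi>(1)[OF that], of 2] by auto
    have dL: "(\<lambda>x. e i x - \<phi> i x) \<in> Lp \<Omega> 2" "(\<lambda>x. grad (\<phi> i) x - wgrad \<Omega> (e i) x) \<in> Lp \<Omega> 2" if "i < N" for i
      using eL[OF that] \<phi>L[OF that] by (auto intro: Lp_diff)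
    have M_lborel: "(\<integral>x. (\<psi> x)\<^sup>2 \<partial>lborel) = (\<integral>x. (\<psi> x)\<^sup>2 \<partial>M)"
      "(\<integral>x. (norm (grad \<psi> x))\<^sup>2 \<partial>lborel) = (\<integral>x. (norm (grad \<psi> x))\<^sup>2 \<partial>M)" if "\<psi> \<in> test_functions \<Omega>" for \<psi>
      using test_measurable[OF that] test_outside[OF that] by (auto intro!: test_int(1)[symmetric])
    show ?thesis
    proof (rule N0[rule_format])
      show "\<phi> i \<in> test_functions \<Omega>" if "i < N" for i by (rule \<phi>(1)[OF that])
    next
      fix c :: "nat \<Rightarrow> real"
      let ?c2 = "\<Sum>i<N. (c i)\<^sup>2"
      have c2: "?c2 \<ge> 0" by (intro sum_nonneg) auto
      define S where "S = (\<lambda>x. \<Sum>i<N. c i * e i x)"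
      have SV: "S \<in> V" unfolding S_def by (rule sum_V[OF eV])
      have ipS: "ipA S S = ?c2" unfolding S_def by (rule onfam_sum_ip[OF e])
      have pt: "(\<Sum>i<N. c i * \<phi> i x)\<^sup>2 \<le> 2 * (S x)\<^sup>2 + 2 * (?c2 * (\<Sum>i<N. (e i x - \<phi> i x)\<^sup>2))" for x
      proof -
        define q where "q = (\<Sum>i<N. c i * (e i x - \<phi> i x))"
        have eq: "(\<Sum>i<N. c i * \<phi> i x) = S x - q"
          by (simp add: S_def q_def right_diff_distrib sum_subtractf)
        have "(\<Sum>i<N. c i * \<phi> i x)\<^sup>2 \<le> 2 * (S x)\<^sup>2 + 2 * q\<^sup>2"
          unfolding eq using zero_le_power2[of "S x + q"] by (simp add: power2_eq_square algebra_simps)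
        moreover have "q\<^sup>2 \<le> ?c2 * (\<Sum>i<N. (e i x - \<phi> i x)\<^sup>2)"
          unfolding q_def by (rule Cauchy_Schwarz_ineq_sum)
        ultimately show ?thesis by linarith
      qed
      have iS: "integrable M (\<lambda>x. (S x)\<^sup>2)" using Lp2_D(2)[OF V_Lp(1)[OF SV]] by simp
      have id: "integrable M (\<lambda>x. (e i x - \<phi> i x)\<^sup>2)" if "i < N" for i using Lp2_D(2)[OF dL(1)[OF that]] by simp
      have t: "(\<lambda>x. \<Sum>i<N. c i * \<phi> i x) \<in> test_functions \<Omega>" by (rule test_combo_sum[OF \<phi>(1)])
      have "(\<integral>x. (\<Sum>i<N. c i * \<phi> i x)\<^sup>2 \<partial>lborel) = (\<integral>x. (\<Sum>i<N. c i * \<phi> i x)\<^sup>2 \<partial>M)"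
        by (rule M_lborel(1)[OF t])
      also have "\<dots> \<le> (\<integral>x. 2 * (S x)\<^sup>2 + 2 * (?c2 * (\<Sum>i<N. (e i x - \<phi> i x)\<^sup>2)) \<partial>M)"
      proof (rule integral_mono)
        show "integrable M (\<lambda>x. (\<Sum>i<N. c i * \<phi> i x)\<^sup>2)" using Lp2_D(2)[OF test_Lp(1)[OF t]] by simp
        show "integrable M (\<lambda>x. 2 * (S x)\<^sup>2 + 2 * (?c2 * (\<Sum>i<N. (e i x - \<phi> i x)\<^sup>2)))"
          by (intro Bochner_Integration.integrable_add integrable_mult_right Bochner_Integration.integrable_sum iS id) simp
      qed (rule pt)
      also have "\<dots> = 2 * (\<integral>x. (S x)\<^sup>2 \<partial>M) + 2 * (?c2 * (\<Sum>i<N. \<integral>x. (e i x - \<phi> i x)\<^sup>2 \<partial>M))"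
      proof -
        have "integrable M (\<lambda>x. \<Sum>i<N. (e i x - \<phi> i x)\<^sup>2)"
          by (intro Bochner_Integration.integrable_sum id) simp
        moreover have "(\<integral>x. (\<Sum>i<N. (e i x - \<phi> i x)\<^sup>2) \<partial>M) = (\<Sum>i<N. \<integral>x. (e i x - \<phi> i x)\<^sup>2 \<partial>M)"
          by (intro Bochner_Integration.integral_sum id) simp
        ultimately show ?thesis using iS by simp
      qed
      also have "\<dots> \<le> 2 * (C * ?c2) + 2 * (?c2 * 1)"
      proof -
        have "(\<Sum>i<N. \<integral>x. (e i x - \<phi> i x)\<^sup>2 \<partial>M) \<le> (\<Sum>i<N. \<delta>)"
          using \<phi>(2) by (intro sum_mono) (auto intro: less_imp_le)
        then have "(\<Sum>i<N. \<integral>x. (e i x - \<phi> i x)\<^sup>2 \<partial>M) \<le> 1" using \<delta>(3) by simp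
        then show ?thesis using C(2)[OF SV] c2 by (intro add_mono mult_left_mono) (auto simp: ipS)
      qed
      also have "\<dots> = (2 * C + 2) * ?c2" by (simp add: algebra_simps)
      also have "\<dots> \<le> K * ?c2" using c2 by (intro mult_right_mono) (auto simp: K_def)
      finally show "(\<integral>x. (\<Sum>i<N. c i * \<phi> i x)\<^sup>2 \<partial>lborel) \<le> K * ?c2" .
    next
      fix i assume i: "i < N"
      have "(\<integral>x. norm (wgrad \<Omega> (e i) x + (grad (\<phi> i) x - wgrad \<Omega> (e i) x)) powr 2 \<partial>M)
        \<le> 2 powr 2 * ((\<integral>x. norm (wgrad \<Omega> (e i) x) powr 2 \<partial>M) + (\<integral>x. norm (grad (\<phi> i) x - wgrad \<Omega> (e i) x) powr 2 \<partial>M))"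
        by (rule Lp_add(2)[OF _ eL(2)[OF i] dL(2)[OF i]]) simp
      also have "\<dots> \<le> 4 * (1 / lam + 1)"
      proof -
        have "(\<integral>x. norm (wgrad \<Omega> (e i) x) powr 2 \<partial>M) \<le> 1 / lam"
          using ipA_low[OF eV[OF i]] e1[OF i] lam by (simp add: field_simps)
        moreover have "(\<integral>x. norm (grad (\<phi> i) x - wgrad \<Omega> (e i) x) powr 2 \<partial>M) \<le> 1"
          using \<phi>(3)[OF i] \<delta>(4) by (simp add: norm_minus_commute)
        ultimately show ?thesis by simp
      qed
      also have "\<dots> \<le> K" by (simp add: K_def)
      finally show "(\<integral>x. (norm (grad (\<phi> i) x))\<^sup>2 \<partial>lborel) \<le> K"
        by (simp add: M_lborel(2)[OF \<phi>(1)[OF i]])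
    next
      fix i assume i: "i < N"
      have "\<epsilon> \<le> Ca * (\<integral>x. (e i x)\<^sup>2 \<partial>M)" using low[OF i] ka_diag[OF eV[OF i]] by linarith
      then have "4 * \<epsilon>' \<le> (\<integral>x. (e i x)\<^sup>2 \<partial>M)" using Ca by (simp add: \<epsilon>'_def field_simps)
      also have "\<dots> \<le> (\<integral>x. 2 * (\<phi> i x)\<^sup>2 + 2 * (e i x - \<phi> i x)\<^sup>2 \<partial>M)"
      proof (rule integral_mono)
        show "(e i x)\<^sup>2 \<le> 2 * (\<phi> i x)\<^sup>2 + 2 * (e i x - \<phi> i x)\<^sup>2" for x
          using zero_le_power2[of "e i x - 2 * \<phi> i x"] by (simp add: power2_eq_square algebra_simps)
      qed (use Lp2_D(2)[OF eL(1)[OF i]] Lp2_D(2)[OF \<phi>L(1)[OF i]] Lp2_D(2)[OF dL(1)[OF i]] in auto)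
      also have "\<dots> = 2 * (\<integral>x. (\<phi> i x)\<^sup>2 \<partial>M) + 2 * (\<integral>x. (e i x - \<phi> i x)\<^sup>2 \<partial>M)"
        using Lp2_D(2)[OF \<phi>L(1)[OF i]] Lp2_D(2)[OF dL(1)[OF i]] by simp
      also have "(\<integral>x. (e i x - \<phi> i x)\<^sup>2 \<partial>M) \<le> \<epsilon>'" using \<phi>(2)[OF i] \<delta>(2) by simp
      finally show "\<epsilon>' \<le> (\<integral>x. (\<phi> i x)\<^sup>2 \<partial>lborel)"
        by (simp add: M_lborel(1)[OF \<phi>(1)[OF i]])
    qed
  qed
  then show ?thesis by blast
qed

definition Ck where "Ck = (SOME C. \<forall>u\<in>V. \<forall>v\<in>V. \<bar>ka u v\<bar> \<le> C * nrm u * nrm v)"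

sublocale spectral V ipA ka Ck
proof
  show "bil ka" by (rule ka_bil)
  have "\<exists>C. \<forall>u\<in>V. \<forall>v\<in>V. \<bar>ka u v\<bar> \<le> C * nrm u * nrm v" using ka_bound by metis
  from someI_ex[OF this] show "\<bar>ka u v\<bar> \<le> Ck * nrm u * nrm v" if "u \<in> V" "v \<in> V" for u v
    using that by (simp add: Ck_def)
qed (rule ka_compact)

lemma riesz_form: "v \<in> V \<Longrightarrow> \<exists>z\<in>V. \<forall>w\<in>V. ipA z w = ipA v w - ka v w"
proof (rule riesz[OF ipA_complete, where C="nrm v + Ck * nrm v"])
  assume v: "v \<in> V"
  show "ipA v (\<lambda>x. s * u x + t * w x) - ka v (\<lambda>x. s * u x + t * w x) = s * (ipA v u - ka v u) + t * (ipA v w - ka v w)"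
    if "u \<in> V" "w \<in> V" for u w s t
    unfolding bil_right[OF bil_ip that v] bil_right[OF bil_k that v] by (simp add: algebra_simps)
  show "\<bar>ipA v w - ka v w\<bar> \<le> (nrm v + Ck * nrm v) * nrm w" if w: "w \<in> V" for w
    using ip_cs[OF v w] k_bound[OF v w] by (simp add: algebra_simps)
qed auto

end

section \<open>The Hessian of the energy density\<close>

lemma class_C_2D:
  assumes "class_C 2 \<Psi>"
  shows "\<Psi> differentiable (at x)" "(\<lambda>y. frechet_derivative \<Psi> (at y) v) differentiable (at x)"
    "continuous_on UNIV (\<lambda>x. hessian \<Psi> x v w)"
  using assms unfolding hessian_def numeral_2_eq_2 by auto

lemma hessian_derivative:
  assumes "class_C 2 \<Psi>"
  shows "((\<lambda>y. frechet_derivative \<Psi> (at y) v) has_derivative (\<lambda>w. hessian \<Psi> x v w)) (at x)"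
  using class_C_2D(2)[OF assms] unfolding hessian_def frechet_derivative_works by simp

lemma hessian_linear_right: "class_C 2 \<Psi> \<Longrightarrow> linear (\<lambda>w. hessian \<Psi> x v w)"
  using hessian_derivative has_derivative_linear by blast

lemma hessian_linear_left:
  assumes "class_C 2 \<Psi>"
  shows "linear (\<lambda>v. hessian \<Psi> x v w)"
proof -
  have lin: "linear (frechet_derivative \<Psi> (at y))" for y
    using class_C_2D(1)[OF assms, of y] frechet_derivative_works has_derivative_linear by blast
  show ?thesis
  proof (rule linearI)
    fix v1 v2
    have "((\<lambda>y. frechet_derivative \<Psi> (at y) (v1 + v2)) has_derivative (\<lambda>w. hessian \<Psi> x v1 w + hessian \<Psi> x v2 w)) (at x)"
      unfolding linear_add[OF lin] by (intro has_derivative_add hessian_derivative assms)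
    from has_derivative_unique[OF this hessian_derivative[OF assms]]
    show "hessian \<Psi> x (v1 + v2) w = hessian \<Psi> x v1 w + hessian \<Psi> x v2 w" by metis
  next
    fix c v
    have "((\<lambda>y. frechet_derivative \<Psi> (at y) (c *\<^sub>R v)) has_derivative (\<lambda>w. c *\<^sub>R hessian \<Psi> x v w)) (at x)"
      unfolding linear_cmul[OF lin] by (intro has_derivative_scaleR_right hessian_derivative assms)
    from has_derivative_unique[OF this hessian_derivative[OF assms]]
    show "hessian \<Psi> x (c *\<^sub>R v) w = c *\<^sub>R hessian \<Psi> x v w" by metis
  qed
qed

lemma line_derivative:
  assumes "(f has_derivative f') (at (x + t *\<^sub>R v))"
  shows "((\<lambda>s. f (x + s *\<^sub>R v)) has_real_derivative f' v) (at t)"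
proof -
  have "((\<lambda>s. x + s *\<^sub>R v) has_derivative (\<lambda>s. s *\<^sub>R v)) (at t)"
    by (auto intro!: derivative_eq_intros)
  from has_derivative_compose[OF this assms]
  have "((\<lambda>s. f (x + s *\<^sub>R v)) has_derivative (\<lambda>s. f' (s *\<^sub>R v))) (at t)" .
  moreover have "f' (s *\<^sub>R v) = f' v * s" for s
    using linear_cmul[OF has_derivative_linear[OF assms]] by simp
  ultimately show ?thesis by (simp add: has_field_derivative_def)
qed

text \<open>Symmetry: a second difference quotient is, by the mean value theorem, a value of either mixed
  second derivative at a nearby point.\<close>

lemma second_difference:
  fixes \<Psi> :: "'a::euclidean_space \<Rightarrow> real"
  assumes C2: "class_C 2 \<Psi>" and t: "t > 0"
  obtains y where "norm (y - x) \<le> t * (norm v + norm w)"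
    "\<Psi> (x + t *\<^sub>R v + t *\<^sub>R w) - \<Psi> (x + t *\<^sub>R v) - \<Psi> (x + t *\<^sub>R w) + \<Psi> x = t\<^sup>2 * hessian \<Psi> y v w"
proof -
  let ?D = "\<lambda>y. frechet_derivative \<Psi> (at y)"
  have D: "(\<Psi> has_derivative ?D y) (at y)" for y
    using class_C_2D(1)[OF C2] frechet_derivative_works by blast
  define g where "g s = \<Psi> ((x + t *\<^sub>R w) + s *\<^sub>R v) - \<Psi> (x + s *\<^sub>R v)" for s
  have "\<exists>z>0. z < t \<and> g t - g 0 = (t - 0) * (?D ((x + t *\<^sub>R w) + z *\<^sub>R v) v - ?D (x + z *\<^sub>R v) v)"
    unfolding g_def by (rule MVT2[OF t]) (rule DERIV_diff[OF line_derivative[OF D] line_derivative[OF D]])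
  then obtain z where z: "0 < z" "z < t" "g t - g 0 = t * (?D ((x + t *\<^sub>R w) + z *\<^sub>R v) v - ?D (x + z *\<^sub>R v) v)"
    by auto
  define h where "h s = ?D ((x + z *\<^sub>R v) + s *\<^sub>R w) v" for s
  have "\<exists>q>0. q < t \<and> h t - h 0 = (t - 0) * hessian \<Psi> ((x + z *\<^sub>R v) + q *\<^sub>R w) v w"
    unfolding h_def by (rule MVT2[OF t]) (rule line_derivative[OF hessian_derivative[OF C2]])
  then obtain q where q: "0 < q" "q < t" "h t - h 0 = t * hessian \<Psi> ((x + z *\<^sub>R v) + q *\<^sub>R w) v w" by auto
  let ?y = "(x + z *\<^sub>R v) + q *\<^sub>R w"
  have "norm (?y - x) \<le> z * norm v + q * norm w"
    using norm_triangle_ineq[of "z *\<^sub>R v" "q *\<^sub>R w"] z q by (simp add: add.assoc)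
  also have "\<dots> \<le> t * (norm v + norm w)"
    using z q mult_right_mono[of z t "norm v"] mult_right_mono[of q t "norm w"] by (simp add: algebra_simps)
  finally have "norm (?y - x) \<le> t * (norm v + norm w)" .
  moreover have "\<Psi> (x + t *\<^sub>R v + t *\<^sub>R w) - \<Psi> (x + t *\<^sub>R v) - \<Psi> (x + t *\<^sub>R w) + \<Psi> x = g t - g 0"
    by (simp add: g_def algebra_simps)
  moreover have "g t - g 0 = t * (h t - h 0)" unfolding z(3) h_def by (simp add: algebra_simps)
  ultimately show ?thesis using that[of ?y] q(3) by (simp add: power2_eq_square)
qed

lemma hessian_symmetric:
  fixes \<Psi> :: "'a::euclidean_space \<Rightarrow> real"
  assumes C2: "class_C 2 \<Psi>"
  shows "hessian \<Psi> x v w = hessian \<Psi> x w v"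
proof -
  define t where "t n = inverse (real (Suc n))" for n
  have t: "t n > 0" for n by (simp add: t_def)
  have lim0: "(\<lambda>n. t n * (norm v + norm w)) \<longlonglongrightarrow> 0"
    using tendsto_mult_left_zero[OF LIMSEQ_inverse_real_of_nat] by (simp add: t_def)
  define S where "S n = (\<Psi> (x + t n *\<^sub>R v + t n *\<^sub>R w) - \<Psi> (x + t n *\<^sub>R v) - \<Psi> (x + t n *\<^sub>R w) + \<Psi> x) / (t n)\<^sup>2" for n
  have conv: "S \<longlonglongrightarrow> hessian \<Psi> x a b"
    if y: "\<And>n. norm (y n - x) \<le> t n * (norm v + norm w)" and S: "\<And>n. S n = hessian \<Psi> (y n) a b" for y a b
  proof -
    have "(\<lambda>n. y n - x) \<longlonglongrightarrow> 0"
      by (rule Lim_null_comparison[OF always_eventually lim0]) (use y in auto)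
    then have "y \<longlonglongrightarrow> x" by (rule LIM_zero_cancel)
    moreover have "isCont (\<lambda>x. hessian \<Psi> x a b) x"
      using class_C_2D(3)[OF C2] by (simp add: continuous_on_eq_continuous_at)
    ultimately show ?thesis using isCont_tendsto_compose unfolding S[abs_def] by blast
  qed
  have "\<forall>n. \<exists>y. norm (y - x) \<le> t n * (norm v + norm w) \<and> S n = hessian \<Psi> y v w"
  proof
    fix n show "\<exists>y. norm (y - x) \<le> t n * (norm v + norm w) \<and> S n = hessian \<Psi> y v w"
      by (rule second_difference[OF C2 t[of n], where x=x and v=v and w=w]) (use t[of n] in \<open>auto simp: S_def\<close>)
  qed
  from choice[OF this] obtain y where "\<And>n. norm (y n - x) \<le> t n * (norm v + norm w)" "\<And>n. S n = hessian \<Psi> (y n) v w"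
    by blast
  from conv[OF this] have 1: "S \<longlonglongrightarrow> hessian \<Psi> x v w" .
  have "\<forall>n. \<exists>y. norm (y - x) \<le> t n * (norm v + norm w) \<and> S n = hessian \<Psi> y w v"
  proof
    fix n show "\<exists>y. norm (y - x) \<le> t n * (norm v + norm w) \<and> S n = hessian \<Psi> y w v"
      by (rule second_difference[OF C2 t[of n], where x=x and v=w and w=v])
        (use t[of n] in \<open>auto simp: S_def algebra_simps\<close>)
  qed
  from choice[OF this] obtain y where "\<And>n. norm (y n - x) \<le> t n * (norm v + norm w)" "\<And>n. S n = hessian \<Psi> (y n) w v"
    by blast
  from conv[OF this] have "S \<longlonglongrightarrow> hessian \<Psi> x w v" .
  with 1 show ?thesis by (rule LIMSEQ_unique)
qed

lemma convex_second_derivative_nonneg: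
  fixes k :: "real \<Rightarrow> real"
  assumes k: "convex_on UNIV k" and d: "\<And>t. (k has_real_derivative k' t) (at t)"
    and d2: "(k' has_real_derivative d) (at 0)"
  shows "d \<ge> 0"
proof -
  have tang: "k y - k z \<ge> k' z * (y - z)" for y z
    by (rule convex_on_imp_above_tangent[OF k]) (auto intro: d)
  have mono: "(k' h - k' 0) / h \<ge> 0" for h
  proof -
    have "0 \<le> (k' h - k' 0) * h" using tang[of h 0] tang[of 0 h] by (simp add: algebra_simps)
    then show ?thesis by (simp add: zero_le_divide_iff zero_le_mult_iff)
  qed
  have "((\<lambda>h. (k' h - k' 0) / h) \<longlongrightarrow> d) (at 0)" using d2 by (simp add: has_field_derivative_iff)
  then show ?thesis by (rule tendsto_lowerbound) (auto intro: always_eventually mono)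
qed

lemma Psi_kappa_line:
  fixes x \<xi> :: "'a::euclidean_space"
  assumes \<kappa>: "\<kappa> > 0" and p: "p > 2"
  defines "b \<equiv> \<lambda>t. \<kappa>\<^sup>2 + (norm (x + t *\<^sub>R \<xi>))\<^sup>2"
  defines "q' \<equiv> \<lambda>t. b t powr (p / 2 - 1) * (x \<bullet> \<xi> + t * (\<xi> \<bullet> \<xi>))"
  shows "((\<lambda>t. Psi_kappa p \<kappa> (x + t *\<^sub>R \<xi>)) has_real_derivative q' t) (at t)"
    and "(q' has_real_derivative (b 0 powr (p / 2 - 1) * (norm \<xi>)\<^sup>2 + (p - 2) * b 0 powr (p / 2 - 2) * (x \<bullet> \<xi>)\<^sup>2)) (at 0)"
proof -
  have b_eq: "b = (\<lambda>t. \<kappa>\<^sup>2 + (x \<bullet> x + 2 * t * (x \<bullet> \<xi>) + t\<^sup>2 * (\<xi> \<bullet> \<xi>)))"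
  proof
    fix t
    have "(norm (x + t *\<^sub>R \<xi>))\<^sup>2 = x \<bullet> x + 2 * t * (x \<bullet> \<xi>) + t\<^sup>2 * (\<xi> \<bullet> \<xi>)"
      unfolding power2_norm_eq_inner
      by (simp add: inner_add_left inner_add_right inner_commute[of \<xi> x] power2_eq_square algebra_simps)
    then show "b t = \<kappa>\<^sup>2 + (x \<bullet> x + 2 * t * (x \<bullet> \<xi>) + t\<^sup>2 * (\<xi> \<bullet> \<xi>))" by (simp add: b_def)
  qed
  have pos: "b t > 0" for t using \<kappa> by (simp add: b_def add_pos_nonneg)
  have db: "(b has_real_derivative 2 * (x \<bullet> \<xi> + t * (\<xi> \<bullet> \<xi>))) (at t)" for t
    unfolding b_eq by (auto intro!: derivative_eq_intros)
  have dpow: "((\<lambda>t. b t powr c) has_real_derivative c * b t powr (c - 1) * (2 * (x \<bullet> \<xi> + t * (\<xi> \<bullet> \<xi>)))) (at t)" for c t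
    using DERIV_fun_powr[OF db pos, of c t] by (simp add: algebra_simps)
  have "((\<lambda>t. (1 / p) * (b t powr (p / 2) - \<kappa>\<^sup>2)) has_real_derivative
      (1 / p) * ((p / 2) * b t powr (p / 2 - 1) * (2 * (x \<bullet> \<xi> + t * (\<xi> \<bullet> \<xi>))) - 0)) (at t)"
    by (intro DERIV_cmult DERIV_diff dpow DERIV_const)
  also have "(1 / p) * ((p / 2) * b t powr (p / 2 - 1) * (2 * (x \<bullet> \<xi> + t * (\<xi> \<bullet> \<xi>))) - 0) = q' t"
    using p by (simp add: q'_def)
  finally show "((\<lambda>t. Psi_kappa p \<kappa> (x + t *\<^sub>R \<xi>)) has_real_derivative q' t) (at t)"
    by (simp add: Psi_kappa_def b_def)
  have dl: "((\<lambda>t. x \<bullet> \<xi> + t * (\<xi> \<bullet> \<xi>)) has_real_derivative \<xi> \<bullet> \<xi>) (at 0)"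
    by (auto intro!: derivative_eq_intros)
  have "(q' has_real_derivative
      ((p / 2 - 1) * b 0 powr (p / 2 - 1 - 1) * (2 * (x \<bullet> \<xi> + 0 * (\<xi> \<bullet> \<xi>)))) * (x \<bullet> \<xi> + 0 * (\<xi> \<bullet> \<xi>))
      + (\<xi> \<bullet> \<xi>) * b 0 powr (p / 2 - 1)) (at 0)"
    unfolding q'_def by (rule DERIV_mult[OF dpow dl])
  then show "(q' has_real_derivative (b 0 powr (p / 2 - 1) * (norm \<xi>)\<^sup>2 + (p - 2) * b 0 powr (p / 2 - 2) * (x \<bullet> \<xi>)\<^sup>2)) (at 0)"
    by (rule DERIV_cong) (simp add: power2_norm_eq_inner power2_eq_square[of "x \<bullet> \<xi>"] algebra_simps)
qed

lemma convex_on_line: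
  assumes "convex_on UNIV (F :: 'a::euclidean_space \<Rightarrow> real)"
  shows "convex_on UNIV (\<lambda>t. F (x + t *\<^sub>R \<xi>))"
proof (rule convex_onI)
  fix s u v :: real assume s: "0 < s" "s < 1"
  have "x + ((1 - s) *\<^sub>R u + s *\<^sub>R v) *\<^sub>R \<xi> = (1 - s) *\<^sub>R (x + u *\<^sub>R \<xi>) + s *\<^sub>R (x + v *\<^sub>R \<xi>)"
    by (simp add: algebra_simps)
  then show "F (x + ((1 - s) *\<^sub>R u + s *\<^sub>R v) *\<^sub>R \<xi>) \<le> (1 - s) * F (x + u *\<^sub>R \<xi>) + s * F (x + v *\<^sub>R \<xi>)"
    using convex_onD[OF assms, of s "x + u *\<^sub>R \<xi>" "x + v *\<^sub>R \<xi>"] s by simp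
qed auto

text \<open>The two convexity hypotheses, differentiated twice along lines.\<close>

lemma hessian_bounds:
  fixes \<Psi> :: "'a::euclidean_space \<Rightarrow> real"
  assumes C2: "class_C 2 \<Psi>" and \<kappa>: "\<kappa> > 0" and p: "p > 2" and \<mu>: "\<mu>1 > 0" "\<mu>2 > 0"
    and c1: "convex_on UNIV (\<lambda>x. \<Psi> x - \<mu>1 * Psi_kappa p \<kappa> x)"
    and c2: "convex_on UNIV (\<lambda>x. \<mu>2 * Psi_kappa p \<kappa> x - \<Psi> x)"
  shows "\<mu>1 * (\<kappa>\<^sup>2 + (norm x)\<^sup>2) powr (p / 2 - 1) * (norm \<xi>)\<^sup>2 \<le> hessian \<Psi> x \<xi> \<xi>"
    and "hessian \<Psi> x \<xi> \<xi> \<le> \<mu>2 * (p - 1) * (\<kappa>\<^sup>2 + (norm x)\<^sup>2) powr (p / 2 - 1) * (norm \<xi>)\<^sup>2"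
proof -
  let ?b = "\<kappa>\<^sup>2 + (norm x)\<^sup>2"
  let ?q = "?b powr (p / 2 - 1) * (norm \<xi>)\<^sup>2 + (p - 2) * ?b powr (p / 2 - 2) * (x \<bullet> \<xi>)\<^sup>2"
  let ?D = "\<lambda>t. frechet_derivative \<Psi> (at (x + t *\<^sub>R \<xi>)) \<xi>"
  note line = Psi_kappa_line[OF \<kappa> p, of x \<xi>]
  have b: "?b > 0" using \<kappa> by (simp add: add_pos_nonneg)
  have d: "((\<lambda>t. \<Psi> (x + t *\<^sub>R \<xi>)) has_real_derivative ?D t) (at t)" for t
    by (rule line_derivative) (use class_C_2D(1)[OF C2] frechet_derivative_works in blast)
  have dd: "(?D has_real_derivative hessian \<Psi> x \<xi> \<xi>) (at 0)"
    by (rule line_derivative[where f="\<lambda>y. frechet_derivative \<Psi> (at y) \<xi>"]) (use hessian_derivative[OF C2, of \<xi> x] in simp)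
  have "0 \<le> hessian \<Psi> x \<xi> \<xi> - \<mu>1 * ?q"
    by (rule convex_second_derivative_nonneg[OF convex_on_line[OF c1, of x \<xi>]
          DERIV_diff[OF d DERIV_cmult[OF line(1)]]])
      (use DERIV_diff[OF dd DERIV_cmult[OF line(2), of \<mu>1]] in simp)
  moreover have "\<mu>1 * ?b powr (p / 2 - 1) * (norm \<xi>)\<^sup>2 \<le> \<mu>1 * ?q"
  proof -
    have "0 \<le> (p - 2) * ?b powr (p / 2 - 2) * (x \<bullet> \<xi>)\<^sup>2" using p by simp
    then have "?b powr (p / 2 - 1) * (norm \<xi>)\<^sup>2 \<le> ?q" by linarith
    then show ?thesis using \<mu>(1) unfolding mult.assoc[of \<mu>1] by (intro mult_left_mono) auto
  qed
  ultimately show "\<mu>1 * ?b powr (p / 2 - 1) * (norm \<xi>)\<^sup>2 \<le> hessian \<Psi> x \<xi> \<xi>" by linarith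
  have "0 \<le> \<mu>2 * ?q - hessian \<Psi> x \<xi> \<xi>"
    by (rule convex_second_derivative_nonneg[OF convex_on_line[OF c2, of x \<xi>]
          DERIV_diff[OF DERIV_cmult[OF line(1)] d]])
      (use DERIV_diff[OF DERIV_cmult[OF line(2), of \<mu>2] dd] in simp)
  moreover have "?q \<le> (p - 1) * ?b powr (p / 2 - 1) * (norm \<xi>)\<^sup>2"
  proof -
    have "(x \<bullet> \<xi>)\<^sup>2 \<le> (norm x * norm \<xi>)\<^sup>2"
      using Cauchy_Schwarz_ineq2[of x \<xi>] by (metis abs_ge_zero power2_abs power_mono)
    also have "\<dots> \<le> ?b * (norm \<xi>)\<^sup>2" by (simp add: power_mult_distrib mult_right_mono)
    finally have "?b powr (p / 2 - 2) * (x \<bullet> \<xi>)\<^sup>2 \<le> ?b powr (p / 2 - 2) * (?b * (norm \<xi>)\<^sup>2)"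
      by (intro mult_left_mono) auto
    also have "\<dots> = ?b powr (p / 2 - 1) * (norm \<xi>)\<^sup>2"
    proof -
      have "?b powr (p / 2 - 1) = ?b powr (p / 2 - 2) * ?b powr 1" by (subst powr_add[symmetric]) simp
      also have "?b powr 1 = ?b" using b by simp
      finally show ?thesis by (simp only: mult.assoc)
    qed
    finally have "(p - 2) * (?b powr (p / 2 - 2) * (x \<bullet> \<xi>)\<^sup>2) \<le> (p - 2) * (?b powr (p / 2 - 1) * (norm \<xi>)\<^sup>2)"
      using p by (intro mult_left_mono) auto
    then show ?thesis by (simp add: algebra_simps)
  qed
  then have "\<mu>2 * ?q \<le> \<mu>2 * ((p - 1) * ?b powr (p / 2 - 1) * (norm \<xi>)\<^sup>2)"
    using \<mu>(2) by (intro mult_left_mono) auto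
  ultimately show "hessian \<Psi> x \<xi> \<xi> \<le> \<mu>2 * (p - 1) * ?b powr (p / 2 - 1) * (norm \<xi>)\<^sup>2"
    by (simp add: mult.assoc)
qed

lemma hessian_sum:
  fixes \<Psi> :: "'a::euclidean_space \<Rightarrow> real"
  assumes C2: "class_C 2 \<Psi>"
  shows "hessian \<Psi> x v w = (\<Sum>i\<in>Basis. \<Sum>j\<in>Basis. (v \<bullet> i) * (w \<bullet> j) * hessian \<Psi> x i j)"
  using hessian_linear_left[OF C2] hessian_linear_right[OF C2]
  by (intro bilinear_sum_Basis) (auto simp: bilinear_def)

lemma hessian_continuous_at:
  fixes \<Psi> :: "'a::euclidean_space \<Rightarrow> real"
  assumes C2: "class_C 2 \<Psi>" and \<epsilon>: "\<epsilon> > 0"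
  obtains r where "r > 0" "\<And>x \<xi>. norm x \<le> r \<Longrightarrow> \<bar>hessian \<Psi> x \<xi> \<xi> - hessian \<Psi> 0 \<xi> \<xi>\<bar> \<le> \<epsilon> * (norm \<xi>)\<^sup>2"
proof -
  define F where "F x = (\<Sum>i\<in>Basis. \<Sum>j\<in>Basis. \<bar>hessian \<Psi> x i j - hessian \<Psi> 0 i j\<bar>)" for x
  have "continuous_on UNIV F"
    unfolding F_def by (intro continuous_intros class_C_2D(3)[OF C2])
  then have "isCont F 0" by (simp add: continuous_on_eq_continuous_at)
  then obtain r where r: "r > 0" "\<And>x. dist x 0 < r \<Longrightarrow> dist (F x) (F 0) < \<epsilon>"
    using \<epsilon> unfolding continuous_at_eps_delta by blast
  have F0: "F 0 = 0" by (simp add: F_def)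
  have "\<bar>hessian \<Psi> x \<xi> \<xi> - hessian \<Psi> 0 \<xi> \<xi>\<bar> \<le> \<epsilon> * (norm \<xi>)\<^sup>2" if x: "norm x \<le> r / 2" for x \<xi>
  proof -
    have "\<bar>hessian \<Psi> x \<xi> \<xi> - hessian \<Psi> 0 \<xi> \<xi>\<bar>
      = \<bar>\<Sum>i\<in>Basis. \<Sum>j\<in>Basis. (\<xi> \<bullet> i) * (\<xi> \<bullet> j) * (hessian \<Psi> x i j - hessian \<Psi> 0 i j)\<bar>"
      unfolding hessian_sum[OF C2, of x \<xi> \<xi>] hessian_sum[OF C2, of 0 \<xi> \<xi>]
      by (simp add: sum_subtractf[symmetric] right_diff_distrib)
    also have "\<dots> \<le> (\<Sum>i\<in>Basis. \<Sum>j\<in>Basis. \<bar>(\<xi> \<bullet> i) * (\<xi> \<bullet> j) * (hessian \<Psi> x i j - hessian \<Psi> 0 i j)\<bar>)"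
      by (rule order_trans[OF sum_abs sum_mono[OF sum_abs]])
    also have "\<dots> \<le> (\<Sum>i\<in>Basis. \<Sum>j\<in>Basis. (norm \<xi>)\<^sup>2 * \<bar>hessian \<Psi> x i j - hessian \<Psi> 0 i j\<bar>)"
      by (intro sum_mono) (auto simp: abs_mult power2_eq_square intro!: mult_right_mono mult_mono Basis_le_norm)
    also have "\<dots> = F x * (norm \<xi>)\<^sup>2"
      by (simp add: F_def sum_distrib_right sum_distrib_left mult.commute)
    also have "\<dots> \<le> \<epsilon> * (norm \<xi>)\<^sup>2"
      using r(2)[of x] x r(1) F0 by (intro mult_right_mono) (auto simp: dist_norm)
    finally show ?thesis .
  qed
  with r(1) show ?thesis using that[of "r / 2"] by simp
qed

text \<open>By continuity the Hessian at a small gradient is almost that at \<open>0\<close>; elsewhere its uniform lower bound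
  saves a fixed fraction of the latter. A share of the Hessian, set aside in both cases, bounds the
  degenerate term.\<close>

lemma hessian_lower:
  fixes \<Psi> :: "'a::euclidean_space \<Rightarrow> real"
  assumes C2: "class_C 2 \<Psi>" and \<kappa>: "\<kappa> > 0" and p: "p > 2" and \<mu>: "\<mu>1 > 0"
    and low: "\<And>x \<xi>. \<mu>1 * (\<kappa>\<^sup>2 + (norm x)\<^sup>2) powr (p / 2 - 1) * (norm \<xi>)\<^sup>2 \<le> hessian \<Psi> x \<xi> \<xi>"
    and up: "\<And>\<xi>. hessian \<Psi> 0 \<xi> \<xi> \<le> Lam * (norm \<xi>)\<^sup>2" and Lam: "Lam > 0"
    and \<theta>: "\<theta> \<le> \<mu>1 * \<kappa> powr (p - 2) / (2 * Lam)" "\<theta> \<ge> 0" and \<eta>: "0 < \<eta>" "\<eta> \<le> 1/2"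
  obtains r where "r > 0" "\<And>x \<xi>. (if norm x \<le> r then 1 - \<eta> else \<theta>) * hessian \<Psi> 0 \<xi> \<xi>
      + \<eta> / 2 * \<mu>1 * norm x powr (p - 2) * (norm \<xi>)\<^sup>2 \<le> hessian \<Psi> x \<xi> \<xi>"
proof -
  define lam where "lam = \<mu>1 * \<kappa> powr (p - 2)"
  have lam: "lam > 0" using \<mu> \<kappa> by (simp add: lam_def)
  have e: "(\<kappa>\<^sup>2) powr (p / 2 - 1) = \<kappa> powr (p - 2)" "((norm x)\<^sup>2) powr (p / 2 - 1) = norm x powr (p - 2)" for x :: 'a
  proof -
    have *: "(y\<^sup>2) powr (p / 2 - 1) = y powr (p - 2)" if "y \<ge> 0" for y :: real
    proof -
      have "(y\<^sup>2) powr (p / 2 - 1) = (y powr 2) powr (p / 2 - 1)" using that by simp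
      also have "\<dots> = y powr (2 * (p / 2 - 1))" by (simp only: powr_powr)
      finally show ?thesis by simp
    qed
    show "(\<kappa>\<^sup>2) powr (p / 2 - 1) = \<kappa> powr (p - 2)" "((norm x)\<^sup>2) powr (p / 2 - 1) = norm x powr (p - 2)"
      using * \<kappa> by auto
  qed
  have lowk: "lam * (norm \<xi>)\<^sup>2 \<le> hessian \<Psi> x \<xi> \<xi>" and lowx: "\<mu>1 * norm x powr (p - 2) * (norm \<xi>)\<^sup>2 \<le> hessian \<Psi> x \<xi> \<xi>" for x \<xi>
  proof -
    have "(\<kappa>\<^sup>2) powr (p / 2 - 1) \<le> (\<kappa>\<^sup>2 + (norm x)\<^sup>2) powr (p / 2 - 1)"
      "((norm x)\<^sup>2) powr (p / 2 - 1) \<le> (\<kappa>\<^sup>2 + (norm x)\<^sup>2) powr (p / 2 - 1)"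
      using p by (auto intro!: powr_mono2)
    then have "\<mu>1 * \<kappa> powr (p - 2) * (norm \<xi>)\<^sup>2 \<le> \<mu>1 * (\<kappa>\<^sup>2 + (norm x)\<^sup>2) powr (p / 2 - 1) * (norm \<xi>)\<^sup>2"
      "\<mu>1 * norm x powr (p - 2) * (norm \<xi>)\<^sup>2 \<le> \<mu>1 * (\<kappa>\<^sup>2 + (norm x)\<^sup>2) powr (p / 2 - 1) * (norm \<xi>)\<^sup>2"
      unfolding e using \<mu> by (auto intro!: mult_right_mono mult_left_mono)
    then show "lam * (norm \<xi>)\<^sup>2 \<le> hessian \<Psi> x \<xi> \<xi>" "\<mu>1 * norm x powr (p - 2) * (norm \<xi>)\<^sup>2 \<le> hessian \<Psi> x \<xi> \<xi>"
      using low[of x \<xi>] unfolding lam_def by linarith+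
  qed
  obtain r where r: "r > 0" "\<And>x \<xi>. norm x \<le> r \<Longrightarrow> \<bar>hessian \<Psi> x \<xi> \<xi> - hessian \<Psi> 0 \<xi> \<xi>\<bar> \<le> (\<eta> / 2 * lam) * (norm \<xi>)\<^sup>2"
    using hessian_continuous_at[OF C2, of "\<eta> / 2 * lam"] lam \<eta> by auto
  have "(if norm x \<le> r then 1 - \<eta> else \<theta>) * hessian \<Psi> 0 \<xi> \<xi>
      + \<eta> / 2 * \<mu>1 * norm x powr (p - 2) * (norm \<xi>)\<^sup>2 \<le> hessian \<Psi> x \<xi> \<xi>" for x \<xi>
  proof -
    define H where "H = hessian \<Psi> x \<xi> \<xi>"
    define A where "A = hessian \<Psi> 0 \<xi> \<xi>"
    define n where "n = \<mu>1 * norm x powr (p - 2) * (norm \<xi>)\<^sup>2"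
    have nH: "n \<le> H" unfolding n_def H_def by (rule lowx)
    have A: "lam * (norm \<xi>)\<^sup>2 \<le> A" "A \<le> Lam * (norm \<xi>)\<^sup>2" "lam * (norm \<xi>)\<^sup>2 \<le> H"
      unfolding A_def H_def by (rule lowk up)+
    have A0: "A \<ge> 0" using A(1) lam by (smt (verit) mult_nonneg_nonneg zero_le_power2)
    have n0: "n \<ge> 0" using \<mu> by (simp add: n_def)
    have "(if norm x \<le> r then 1 - \<eta> else \<theta>) * A + \<eta> / 2 * n \<le> H"
    proof (cases "norm x \<le> r")
      case True
      have "\<bar>H - A\<bar> \<le> (\<eta> / 2 * lam) * (norm \<xi>)\<^sup>2" using r(2)[OF True, of \<xi>] by (simp add: H_def A_def)
      also have "\<dots> \<le> \<eta> / 2 * A" using A(1) \<eta> by (simp add: mult.assoc)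
      finally have "A - H \<le> \<eta> / 2 * A" by linarith
      then have HA: "(1 - \<eta> / 2) * A \<le> H" by (simp add: left_diff_distrib)
      have "(1 - \<eta>) * A \<le> (1 - \<eta> / 2) * ((1 - \<eta> / 2) * A)"
      proof -
        have "1 - \<eta> \<le> (1 - \<eta> / 2) * (1 - \<eta> / 2)" by (simp add: algebra_simps)
        then show ?thesis using A0 unfolding mult.assoc[symmetric] by (rule mult_right_mono)
      qed
      also have "\<dots> \<le> (1 - \<eta> / 2) * H" using HA \<eta> by (intro mult_left_mono) auto
      finally have "(1 - \<eta>) * A + \<eta> / 2 * n \<le> (1 - \<eta> / 2) * H + \<eta> / 2 * H"
        using nH \<eta> by (intro add_mono mult_left_mono) auto
      then show ?thesis using True by (simp add: algebra_simps)
    next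
      case False
      have "\<theta> * A \<le> \<theta> * (Lam * (norm \<xi>)\<^sup>2)" using A(2) \<theta>(2) by (rule mult_left_mono)
      also have "\<dots> \<le> lam / (2 * Lam) * (Lam * (norm \<xi>)\<^sup>2)"
        using \<theta>(1) Lam by (intro mult_right_mono) (auto simp: lam_def)
      also have "\<dots> = lam * (norm \<xi>)\<^sup>2 / 2" using Lam by simp
      also have "\<dots> \<le> H / 2" using A(3) by simp
      finally have "\<theta> * A \<le> H / 2" .
      moreover have "\<eta> / 2 * n \<le> H / 2" using nH n0 \<eta> mult_right_mono[of \<eta> 1 n] by simp
      ultimately show ?thesis using False by simp
    qed
    then show ?thesis by (simp add: H_def A_def n_def mult.assoc)
  qed
  with r(1) that show ?thesis by blast
qed

section \<open>Superposition operators\<close>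

context bounded_open
begin

lemma W1_norm_less:
  assumes u: "u \<in> W10 p \<Omega>" and p: "1 \<le> p" and \<delta>: "W1_norm p \<Omega> u < \<delta>"
  shows "(\<integral>x. norm (u x) powr p \<partial>M) < \<delta> powr p" "(\<integral>x. norm (wgrad \<Omega> u x) powr p \<partial>M) < \<delta> powr p"
proof -
  let ?a = "\<integral>x. norm (u x) powr p \<partial>M" and ?b = "\<integral>x. norm (wgrad \<Omega> u x) powr p \<partial>M"
  have ab: "?a \<ge> 0" "?b \<ge> 0" by (auto intro: integral_nonneg_AE)
  have "((?a + ?b) powr (1 / p)) powr p < \<delta> powr p"
    using \<delta> p by (intro powr_less_mono2) (auto simp: W1_norm_def)
  then have "?a + ?b < \<delta> powr p" using p ab by (simp add: powr_powr)
  with ab show "?a < \<delta> powr p" "?b < \<delta> powr p" by linarith+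
qed

lemma W1_norm_zero: "1 \<le> p \<Longrightarrow> W1_norm p \<Omega> (\<lambda>_. 0) = 0"
proof -
  assume p: "1 \<le> p"
  have "(\<integral>x. norm (wgrad \<Omega> (\<lambda>_. 0) x) powr p \<partial>M) = (\<integral>x. norm (0::'a) powr p \<partial>M)"
    by (rule norm_AE_cong) (use W10_zero[OF p] W10_Lp[OF W10_zero(1)[OF p] p] LpD(1) in auto)
  then show ?thesis using p by (simp add: W1_norm_def)
qed

text \<open>Uniform smallness of an integral near \<open>u = 0\<close>: along any sequence tending to \<open>0\<close>, a
  subsequence converges almost everywhere with its gradients, and dominated convergence applies.\<close>

lemma nemytskii_small:
  fixes \<Phi> :: "'a \<Rightarrow> real \<Rightarrow> 'a \<Rightarrow> real"
  assumes p: "1 \<le> p" and h: "integrable M h" and bound: "\<And>x s \<xi>. \<bar>\<Phi> x s \<xi>\<bar> \<le> h x"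
    and meas: "\<And>u. u \<in> W10 p \<Omega> \<Longrightarrow> (\<lambda>x. \<Phi> x (u x) (wgrad \<Omega> u x)) \<in> borel_measurable M"
    and cont: "AE x in M. \<forall>e>0. \<exists>d>0. \<forall>s \<xi>. \<bar>s\<bar> < d \<and> norm \<xi> < d \<longrightarrow> \<bar>\<Phi> x s \<xi>\<bar> < e"
    and \<omega>: "\<omega> > 0"
  shows "\<exists>\<delta>>0. \<forall>u\<in>W10 p \<Omega>. W1_norm p \<Omega> u < \<delta> \<longrightarrow> \<bar>\<integral>x. \<Phi> x (u x) (wgrad \<Omega> u x) \<partial>M\<bar> < \<omega>"
proof (rule ccontr)
  assume neg: "\<not> ?thesis"
  define t where "t k = inverse (real (Suc k))" for k
  have t: "t k > 0" for k by (simp add: t_def)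
  have "\<forall>k. \<exists>u. u \<in> W10 p \<Omega> \<and> W1_norm p \<Omega> u < t k \<and> \<omega> \<le> \<bar>\<integral>x. \<Phi> x (u x) (wgrad \<Omega> u x) \<partial>M\<bar>"
    using neg t by (meson not_le)
  from choice[OF this] obtain u where u: "\<And>k. u k \<in> W10 p \<Omega>" "\<And>k. W1_norm p \<Omega> (u k) < t k"
    "\<And>k. \<omega> \<le> \<bar>\<integral>x. \<Phi> x (u k x) (wgrad \<Omega> (u k) x) \<partial>M\<bar>" by blast
  have "(\<lambda>k. t k powr p) \<longlonglongrightarrow> 0 powr p"
    unfolding t_def using p by (intro tendsto_powr' LIMSEQ_inverse_real_of_nat tendsto_const) auto
  then have tp: "(\<lambda>k. t k powr p) \<longlonglongrightarrow> 0" using p by simp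
  have L: "u k \<in> Lp \<Omega> p" "wgrad \<Omega> (u k) \<in> Lp \<Omega> p" for k using W10_Lp[OF u(1) p] by auto
  have c1: "(\<lambda>k. \<integral>x. norm (u k x) powr p \<partial>M) \<longlonglongrightarrow> 0"
    by (rule Lim_null_comparison[OF always_eventually tp])
      (use W1_norm_less(1)[OF u(1) p u(2)] in \<open>auto intro!: less_imp_le simp: integral_nonneg_AE\<close>)
  have c2: "(\<lambda>k. \<integral>x. norm (wgrad \<Omega> (u k) x) powr p \<partial>M) \<longlonglongrightarrow> 0"
    by (rule Lim_null_comparison[OF always_eventually tp])
      (use W1_norm_less(2)[OF u(1) p u(2)] in \<open>auto intro!: less_imp_le simp: integral_nonneg_AE\<close>)
  have p0: "0 < p" using p by simp
  obtain r1 where r1: "strict_mono r1" "AE x in M. (\<lambda>k. u (r1 k) x) \<longlonglongrightarrow> 0"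
    by (rule Lp_conv_AE_subseq[OF L(1) p0 c1])
  have c2': "(\<lambda>k. \<integral>x. norm (wgrad \<Omega> (u (r1 k)) x) powr p \<partial>M) \<longlonglongrightarrow> 0"
    using LIMSEQ_subseq_LIMSEQ[OF c2 r1(1)] by (simp add: o_def)
  obtain r2 where r2: "strict_mono r2" "AE x in M. (\<lambda>k. wgrad \<Omega> (u (r1 (r2 k))) x) \<longlonglongrightarrow> 0"
    by (rule Lp_conv_AE_subseq[OF L(2) p0 c2'])
  define w where "w k = u (r1 (r2 k))" for k
  have "(\<lambda>k. \<integral>x. \<Phi> x (w k x) (wgrad \<Omega> (w k) x) \<partial>M) \<longlonglongrightarrow> (\<integral>x. 0 \<partial>M)"
  proof (rule integral_dominated_convergence[where w=h])
    show "AE x in M. (\<lambda>k. \<Phi> x (w k x) (wgrad \<Omega> (w k) x)) \<longlonglongrightarrow> 0"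
      using cont r1(2) r2(2)
    proof eventually_elim
      case (elim x)
      have "(\<lambda>k. w k x) \<longlonglongrightarrow> 0" unfolding w_def
        using LIMSEQ_subseq_LIMSEQ[OF elim(2) r2(1)] by (simp add: o_def)
      moreover have "(\<lambda>k. wgrad \<Omega> (w k) x) \<longlonglongrightarrow> 0" unfolding w_def by (rule elim(3))
      ultimately show ?case
      proof (intro tendstoI)
        fix e :: real assume "e > 0"
        then obtain d where d: "d > 0" "\<And>s \<xi>. \<bar>s\<bar> < d \<Longrightarrow> norm \<xi> < d \<Longrightarrow> \<bar>\<Phi> x s \<xi>\<bar> < e"
          using elim(1) by blast
        assume "(\<lambda>k. w k x) \<longlonglongrightarrow> 0" "(\<lambda>k. wgrad \<Omega> (w k) x) \<longlonglongrightarrow> 0"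
        from tendstoD[OF this(1) d(1)] tendstoD[OF this(2) d(1)]
        show "\<forall>\<^sub>F k in sequentially. dist (\<Phi> x (w k x) (wgrad \<Omega> (w k) x)) 0 < e"
          by eventually_elim (use d(2) in auto)
      qed
    qed
    show "AE x in M. norm (\<Phi> x (w k x) (wgrad \<Omega> (w k) x)) \<le> h x" for k using bound by auto
    show "(\<lambda>x. \<Phi> x (w k x) (wgrad \<Omega> (w k) x)) \<in> borel_measurable M" for k
      unfolding w_def by (rule meas[OF u(1)])
  qed (use h in auto)
  then have "(\<lambda>k. \<bar>\<integral>x. \<Phi> x (w k x) (wgrad \<Omega> (w k) x) \<partial>M\<bar>) \<longlonglongrightarrow> 0"
    using tendsto_rabs by fastforce
  then have "\<omega> \<le> 0"
    by (rule LIMSEQ_le_const) (use u(3) in \<open>auto simp: w_def\<close>)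
  with \<omega> show False by simp
qed

text \<open>Approximate the argument by functions with countably many values.\<close>

lemma caratheodory_measurable:
  fixes f :: "'a \<Rightarrow> real \<Rightarrow> real"
  assumes f: "\<And>s. (\<lambda>x. f x s) \<in> borel_measurable M" and cont: "AE x in M. continuous_on UNIV (f x)"
    and u: "u \<in> borel_measurable M"
  shows "(\<lambda>x. f x (u x)) \<in> borel_measurable M"
proof -
  note [measurable] = f u
  define s where "s n x = real_of_int \<lfloor>real (Suc n) * u x\<rfloor> / real (Suc n)" for n x
  have ms: "(\<lambda>x. f x (s n x)) \<in> borel_measurable M" for n
  proof -
    have "(\<lambda>x. f x (real_of_int \<lfloor>real (Suc n) * u x\<rfloor> / real (Suc n))) \<in> borel_measurable M"
      by (rule measurable_compose_countable[where f="\<lambda>i x. f x (real_of_int i / real (Suc n))" and g="\<lambda>x. \<lfloor>real (Suc n) * u x\<rfloor>"])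
        simp_all
    then show ?thesis by (simp add: s_def)
  qed
  have slim: "(\<lambda>n. s n x) \<longlonglongrightarrow> u x" for x
  proof (rule LIM_zero_cancel, rule Lim_null_comparison[OF always_eventually LIMSEQ_inverse_real_of_nat], rule allI)
    fix n
    have "\<bar>real_of_int \<lfloor>real (Suc n) * u x\<rfloor> - real (Suc n) * u x\<bar> \<le> 1" by linarith
    then have "\<bar>real_of_int \<lfloor>real (Suc n) * u x\<rfloor> - real (Suc n) * u x\<bar> / real (Suc n) \<le> 1 / real (Suc n)"
      by (intro divide_right_mono) auto
    moreover have "s n x - u x = (real_of_int \<lfloor>real (Suc n) * u x\<rfloor> - real (Suc n) * u x) / real (Suc n)"
      by (simp add: s_def diff_divide_distrib)
    ultimately show "norm (s n x - u x) \<le> inverse (real (Suc n))"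
      by (simp add: abs_divide inverse_eq_divide)
  qed
  have "(\<lambda>x. lim (\<lambda>n. f x (s n x))) \<in> borel_measurable M" using ms by measurable
  moreover have "AE x in M. lim (\<lambda>n. f x (s n x)) = f x (u x)"
    using cont
  proof eventually_elim
    case (elim x)
    have "(\<lambda>n. f x (s n x)) \<longlonglongrightarrow> f x (u x)"
      using elim slim[of x] by (auto intro: continuous_on_tendsto_compose)
    then show ?case by (rule limI)
  qed
  ultimately show ?thesis by (rule measurable_AE_eq)
qed

lemma class_C_1_real:
  assumes "class_C 1 (g :: real \<Rightarrow> real)"
  shows "(g has_real_derivative deriv g s) (at s)" "continuous_on UNIV (deriv g)"
proof -
  have d: "g differentiable (at s)" for s using assms by simp
  then have r: "(g has_real_derivative deriv g s) (at s)" for s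
    using DERIV_deriv_iff_real_differentiable by blast
  then show "(g has_real_derivative deriv g s) (at s)" .
  have "frechet_derivative g (at s) 1 = deriv g s" for s
    using frechet_derivative_eqI[OF r[unfolded has_field_derivative_def]] by simp
  moreover have "continuous_on UNIV (\<lambda>s. frechet_derivative g (at s) 1)" using assms by simp
  ultimately show "continuous_on UNIV (deriv g)" by simp
qed

lemma deriv_measurable:
  fixes g :: "'a \<Rightarrow> real \<Rightarrow> real"
  assumes g: "\<And>s. (\<lambda>x. g x s) \<in> borel_measurable M" and C1: "AE x in M. class_C 1 (g x)"
    and u: "u \<in> borel_measurable M"
  shows "(\<lambda>x. deriv (g x) (u x)) \<in> borel_measurable M"
proof (rule caratheodory_measurable[OF _ _ u])
  show "AE x in M. continuous_on UNIV (deriv (g x))"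
    using C1 by eventually_elim (rule class_C_1_real(2))
  fix s
  define q where "q n x = (g x (s + inverse (real (Suc n))) - g x s) / inverse (real (Suc n))" for n x
  have "q n \<in> borel_measurable M" for n unfolding q_def[abs_def] using g by measurable
  then have "(\<lambda>x. lim (\<lambda>n. q n x)) \<in> borel_measurable M" by measurable
  moreover have "AE x in M. lim (\<lambda>n. q n x) = deriv (g x) s"
    using C1
  proof eventually_elim
    case (elim x)
    have D: "((\<lambda>h. (g x (s + h) - g x s) / h) \<longlongrightarrow> deriv (g x) s) (at 0)"
      using class_C_1_real(1)[OF elim] by (simp add: DERIV_def)
    have "filterlim (\<lambda>n. inverse (real (Suc n))) (at 0) sequentially"
      unfolding filterlim_at using LIMSEQ_inverse_real_of_nat by auto
    from filterlim_compose[OF D this] show ?case unfolding q_def by (rule limI)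
  qed
  ultimately show "(\<lambda>x. deriv (g x) s) \<in> borel_measurable M" by (rule measurable_AE_eq)
qed

end

lemma powr_mixed_le:
  fixes a b r :: real
  assumes "a \<ge> 0" "b \<ge> 0" "r > 2"
  shows "a powr (r - 2) * b\<^sup>2 \<le> a powr r + b powr r"
proof -
  define m where "m = max a b"
  have "m \<ge> 0" "a \<le> m" "b \<le> m" using assms by (auto simp: m_def)
  then have "a powr (r - 2) * b\<^sup>2 \<le> m powr (r - 2) * m\<^sup>2"
    using assms by (intro mult_mono powr_mono2 power_mono) auto
  also have "\<dots> = m powr r"
    using \<open>m \<ge> 0\<close> assms powr_add[of m "r - 2" 2] by simp
  also have "\<dots> \<le> a powr r + b powr r" by (auto simp: m_def max_def)
  finally show ?thesis .
qed

text \<open>With \<open>\<xi> = \<nabla>u\<close> and \<open>\<zeta> = \<nabla>u\<^sup>-\<close>: where the gradient of \<open>u\<^sup>+\<close> exceeds twice that of \<open>u\<^sup>-\<close>, it is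
  comparable with the gradient of \<open>u\<close>.\<close>

lemma norm_powr_split:
  fixes \<xi> \<zeta> :: "'a::real_normed_vector"
  assumes "p > 2"
  shows "norm (\<xi> - \<zeta>) powr p \<le> 2 powr (p - 2) * (norm \<xi> powr (p - 2) * (norm (\<xi> - \<zeta>))\<^sup>2) + 2 powr p * norm \<zeta> powr p"
proof (cases "norm \<zeta> \<le> norm (\<xi> - \<zeta>) / 2")
  case True
  have "norm (\<xi> - \<zeta>) \<le> norm \<xi> + norm \<zeta>" by (rule norm_triangle_ineq4)
  then have "norm (\<xi> - \<zeta>) \<le> 2 * norm \<xi>" using True by linarith
  then have "norm (\<xi> - \<zeta>) powr (p - 2) \<le> (2 * norm \<xi>) powr (p - 2)"
    using assms by (intro powr_mono2) auto
  also have "\<dots> = 2 powr (p - 2) * norm \<xi> powr (p - 2)" by (simp add: powr_mult)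
  finally have "norm (\<xi> - \<zeta>) powr (p - 2) * (norm (\<xi> - \<zeta>))\<^sup>2 \<le> 2 powr (p - 2) * norm \<xi> powr (p - 2) * (norm (\<xi> - \<zeta>))\<^sup>2"
    by (intro mult_right_mono) auto
  moreover have "norm (\<xi> - \<zeta>) powr (p - 2) * (norm (\<xi> - \<zeta>))\<^sup>2 = norm (\<xi> - \<zeta>) powr p"
    using powr_add[of "norm (\<xi> - \<zeta>)" "p - 2" 2] by simp
  moreover have "2 powr p * norm \<zeta> powr p \<ge> 0" by simp
  ultimately show ?thesis by (simp only: mult.assoc)
next
  case False
  then have "norm (\<xi> - \<zeta>) powr p \<le> (2 * norm \<zeta>) powr p" using assms by (intro powr_mono2) auto
  also have "\<dots> = 2 powr p * norm \<zeta> powr p" by (simp add: powr_mult)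
  finally show ?thesis by (simp add: add_increasing)
qed

lemma powr_growth_le:
  fixes s q r :: real
  assumes "s \<ge> 0" "0 \<le> q" "q \<le> r"
  shows "s powr q \<le> 1 + s powr r"
proof (cases "s \<le> 1")
  case True
  then have "s powr q \<le> 1" using assms by (intro powr_le1) auto
  then show ?thesis by (simp add: add_increasing2)
next
  case False
  then have "s powr q \<le> s powr r" using assms by (intro powr_mono) auto
  then show ?thesis by simp
qed

text \<open>The last inequality is the form in which Sobolev's inequality was stated; for \<open>p < n\<close> it says that \<open>r\<close> is
  below the critical exponent.\<close>

lemma subcritical_exponent:
  assumes n: "real n \<ge> p" and p: "p > 2" and q: "q \<ge> 0" "ereal q < sobolev_exponent (real n) p - 2"
  obtains r where "r > p" "q \<le> r - 2" "real n * ((r - p) / p) < r"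
proof (cases "p < n")
  case True
  define P where "P = real n * p / (real n - p)"
  have "ereal q < ereal P - ereal 2" using q(2) True by (simp add: sobolev_exponent_def P_def)
  then have qP: "q + 2 < P" by simp
  have pP: "p < P" using True p by (simp add: P_def field_simps)
  obtain r where r: "max (q + 2) p < r" "r < P" using dense[of "max (q + 2) p" P] qP pP by auto
  have "r * (real n - p) < real n * p" using r(2) True by (simp add: P_def field_simps)
  then have "real n * ((r - p) / p) < r" using p by (simp add: field_simps)
  then show ?thesis by (intro that[of r]) (use r in auto)
next
  case False
  with n have "p = real n" by simp
  define r where "r = max (q + 2) p + 1"
  have "r > p" "q \<le> r - 2" by (auto simp: r_def)
  moreover have "real n * ((r - p) / p) < r" using \<open>p = real n\<close> p by simp
  ultimately show ?thesis using that by blast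
qed

section \<open>Small potentials and finite-dimensional subspaces\<close>

context elliptic
begin

lemma ipA_AE_cong:
  assumes u: "u \<in> V" and v: "v \<in> V" and ae: "AE x in M. u x = v x"
  shows "ipA (\<lambda>x. u x - v x) (\<lambda>x. u x - v x) = 0"
  using ipA_0_iff[OF diff_V[OF u v]] ae by (simp add: eq_ae_def)

lemma ipA_null_cong:
  assumes u: "u \<in> V" and v: "v \<in> V" and z: "ipA (\<lambda>x. u x - v x) (\<lambda>x. u x - v x) = 0"
  shows "w \<in> V \<Longrightarrow> ipA u w = ipA v w" "ipA u u = ipA v v"
proof -
  show *: "ipA u w = ipA v w" if "w \<in> V" for w
    using psd_null[OF psd_ip diff_V[OF u v] that z] bil_diff_left[OF bil_ip u v that] by simp
  show "ipA u u = ipA v v"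
    using *[OF u] *[OF v] bil_sym[OF bil_ip u v] by simp
qed

text \<open>A bounded potential with small integral is small relative to the energy: Sobolev's inequality
  with an exponent larger than \<open>2\<close> controls the part of \<open>v\<^sup>2\<close> above a high level.\<close>

lemma potential_small:
  assumes Mb: "Mb > 0" and \<epsilon>: "\<epsilon> > 0"
  obtains \<omega> where "\<omega> > 0" "\<And>b v. b \<in> borel_measurable M \<Longrightarrow> (\<And>x. 0 \<le> b x) \<Longrightarrow> (\<And>x. b x \<le> Mb) \<Longrightarrow>
    (\<integral>x. b x \<partial>M) < \<omega> \<Longrightarrow> v \<in> V \<Longrightarrow> (\<integral>x. b x * (v x)\<^sup>2 \<partial>M) \<le> \<epsilon> * ipA v v"
proof -
  define \<rho> where "\<rho> = 1 / (2 * real DIM('a))"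
  have \<rho>: "\<rho> > 0" by (simp add: \<rho>_def)
  define r where "r = 2 + 2 * \<rho>"
  have sub: "DIM('a) * ((r - 2) / 2) < r" using \<rho> by (simp add: r_def \<rho>_def add_pos_pos)
  have r2: "1 \<le> (2::real)" "2 \<le> r" using \<rho> by (auto simp: r_def)
  obtain C where C: "C > 0" "\<And>u U. sob 2 u U \<Longrightarrow>
     u \<in> Lp \<Omega> r \<and> (\<integral>x. norm (u x) powr r \<partial>M) \<le> C * (\<integral>x. norm (U x) powr 2 \<partial>M) powr (r / 2)"
    using sobolev[OF r2 sub] by metis
  define C' where "C' = C * lam powr (- r / 2)"
  have C': "C' > 0" using C(1) lam by (simp add: C'_def)
  define K where "K = 2 * Mb * C' / \<epsilon> + 1"
  have K: "K > 0" "Mb * C' / K \<le> \<epsilon> / 2"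
  proof -
    show "K > 0" using Mb C' \<epsilon> by (simp add: K_def add_pos_pos)
    have "Mb * C' \<le> K * (\<epsilon> / 2)" using \<epsilon> by (simp add: K_def field_simps)
    then show "Mb * C' / K \<le> \<epsilon> / 2" using \<open>K > 0\<close> by (simp add: field_simps)
  qed
  define T where "T = K powr (1 / \<rho>)"
  have T: "T > 0" "T powr (- \<rho>) = 1 / K" using K \<rho> by (auto simp: T_def powr_powr powr_minus_divide)
  define \<omega> where "\<omega> = \<epsilon> / (2 * T)"
  have "(\<integral>x. b x * (v x)\<^sup>2 \<partial>M) \<le> \<epsilon> * ipA v v"
    if b[measurable]: "b \<in> borel_measurable M" and b0: "\<And>x. 0 \<le> b x" and bM: "\<And>x. b x \<le> Mb"
      and small: "(\<integral>x. b x \<partial>M) < \<omega>" and v: "v \<in> V" for b v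
  proof (cases "ipA v v = 0")
    case True
    then have "AE x in M. v x = 0" using ipA_0_iff[OF v] by (simp add: eq_ae_def)
    then have "AE x in M. b x * (v x)\<^sup>2 = 0" by eventually_elim simp
    then have "(\<integral>x. b x * (v x)\<^sup>2 \<partial>M) = 0" by (rule integral_eq_zero_AE)
    then show ?thesis by (simp add: True)
  next
    case False
    define s where "s = nrm v"
    have s: "s > 0" "s\<^sup>2 = ipA v v"
      using False psd_nonneg[OF psd_ip v] nrm_sq[OF v] by (auto simp: s_def nrm_def)
    note vL = V_Lp[OF v]
    note [measurable] = Lp2_D(1)[OF vL(1)]
    have vr: "v \<in> Lp \<Omega> r" "(\<integral>x. norm (v x) powr r \<partial>M) \<le> C' * s powr r"
    proof -
      show "v \<in> Lp \<Omega> r" using C(2)[OF V_sob[OF v]] by simp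
      have "(\<integral>x. norm (wgrad \<Omega> v x) powr 2 \<partial>M) \<le> s\<^sup>2 / lam"
        using ipA_low[OF v] lam s(2) by (simp add: field_simps)
      then have "(\<integral>x. norm (wgrad \<Omega> v x) powr 2 \<partial>M) powr (r / 2) \<le> (s\<^sup>2 / lam) powr (r / 2)"
        using r2 by (intro powr_mono2) (auto intro: integral_nonneg_AE)
      also have "\<dots> = (s powr 2) powr (r / 2) * lam powr (- r / 2)"
        using s(1) lam by (simp add: powr_divide powr_minus_divide)
      also have "\<dots> = s powr r * lam powr (- r / 2)" by (simp add: powr_powr)
      finally have "C * (\<integral>x. norm (wgrad \<Omega> v x) powr 2 \<partial>M) powr (r / 2) \<le> C * (s powr r * lam powr (- r / 2))"
        using C(1) by (intro mult_left_mono) auto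
      then show "(\<integral>x. norm (v x) powr r \<partial>M) \<le> C' * s powr r"
        using C(2)[OF V_sob[OF v]] by (simp add: C'_def mult.assoc mult.commute mult.left_commute)
    qed
    have pt: "y\<^sup>2 \<le> T * s\<^sup>2 + (T powr (- \<rho>) * s powr (2 - r)) * \<bar>y\<bar> powr r" for y :: real
    proof (cases "y\<^sup>2 \<le> T * s\<^sup>2")
      case True
      have "0 \<le> (T powr (- \<rho>) * s powr (2 - r)) * \<bar>y\<bar> powr r" by simp
      with True show ?thesis by linarith
    next
      case False
      then have "(T * s\<^sup>2) powr \<rho> \<le> (y\<^sup>2) powr \<rho>"
        using T(1) \<rho> by (intro powr_mono2) auto
      also have "(y\<^sup>2) powr \<rho> = (\<bar>y\<bar> powr 2) powr \<rho>" by simp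
      also have "\<dots> = \<bar>y\<bar> powr (r - 2)" by (simp only: powr_powr) (simp add: r_def)
      also have "(T * s\<^sup>2) powr \<rho> = T powr \<rho> * s powr (r - 2)"
      proof -
        have "(s\<^sup>2) powr \<rho> = (s powr 2) powr \<rho>" using s(1) by simp
        also have "\<dots> = s powr (r - 2)" by (simp only: powr_powr) (simp add: r_def)
        finally show ?thesis using T(1) by (simp add: powr_mult)
      qed
      finally have le: "T powr \<rho> * s powr (r - 2) \<le> \<bar>y\<bar> powr (r - 2)" .
      have "y\<^sup>2 = (T powr (- \<rho>) * s powr (2 - r)) * ((T powr \<rho> * s powr (r - 2)) * y\<^sup>2)"
        using T(1) s(1) by (simp add: powr_minus powr_diff field_simps)
      also have "\<dots> \<le> (T powr (- \<rho>) * s powr (2 - r)) * (\<bar>y\<bar> powr (r - 2) * y\<^sup>2)"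
        by (intro mult_left_mono mult_right_mono le) auto
      also have "\<bar>y\<bar> powr (r - 2) * y\<^sup>2 = \<bar>y\<bar> powr r"
        using powr_add[of "\<bar>y\<bar>" "r - 2" 2] by simp
      finally show ?thesis using T(1) by (simp add: add_increasing)
    qed
    let ?q = "T powr (- \<rho>) * s powr (2 - r)"
    have ib: "integrable M b" by (rule bounded_integrable_M[where B=Mb]) (use b0 bM in auto)
    have iv: "integrable M (\<lambda>x. \<bar>v x\<bar> powr r)" using LpD(2)[OF vr(1)] by simp
    have "(\<integral>x. b x * (v x)\<^sup>2 \<partial>M) \<le> (\<integral>x. T * s\<^sup>2 * b x + Mb * ?q * \<bar>v x\<bar> powr r \<partial>M)"
    proof (rule integral_mono)
      show "integrable M (\<lambda>x. b x * (v x)\<^sup>2)"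
      proof (rule Bochner_Integration.integrable_bound)
        show "integrable M (\<lambda>x. Mb * (v x)\<^sup>2)" using Lp2_D(2)[OF vL(1)] by simp
        show "AE x in M. norm (b x * (v x)\<^sup>2) \<le> norm (Mb * (v x)\<^sup>2)"
          using b0 bM Mb by (intro AE_I2) (auto simp: abs_mult intro!: mult_right_mono)
      qed simp
      show "integrable M (\<lambda>x. T * s\<^sup>2 * b x + Mb * ?q * \<bar>v x\<bar> powr r)"
        using ib iv by (intro Bochner_Integration.integrable_add integrable_mult_right)
      fix x
      have "b x * (v x)\<^sup>2 \<le> b x * (T * s\<^sup>2 + ?q * \<bar>v x\<bar> powr r)" by (intro mult_left_mono pt b0)
      also have "\<dots> = T * s\<^sup>2 * b x + b x * (?q * \<bar>v x\<bar> powr r)" by (simp add: algebra_simps)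
      also have "\<dots> \<le> T * s\<^sup>2 * b x + Mb * (?q * \<bar>v x\<bar> powr r)"
        by (intro add_left_mono mult_right_mono bM) auto
      finally show "b x * (v x)\<^sup>2 \<le> T * s\<^sup>2 * b x + Mb * ?q * \<bar>v x\<bar> powr r" by (simp only: mult.assoc)
    qed
    also have "\<dots> = T * s\<^sup>2 * (\<integral>x. b x \<partial>M) + Mb * ?q * (\<integral>x. \<bar>v x\<bar> powr r \<partial>M)"
      using ib iv by simp
    also have "\<dots> \<le> T * s\<^sup>2 * \<omega> + Mb * ?q * (C' * s powr r)"
      using small vr(2) T Mb K(1) by (intro add_mono mult_left_mono) auto
    also have "T * s\<^sup>2 * \<omega> = \<epsilon> / 2 * s\<^sup>2" using T by (simp add: \<omega>_def)
    also have "Mb * ?q * (C' * s powr r) = Mb * C' / K * s\<^sup>2"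
    proof -
      have "s powr (2 - r) * s powr r = s\<^sup>2" using s(1) by (simp add: powr_add[symmetric])
      then show ?thesis by (simp add: T(2) mult.assoc mult.commute mult.left_commute)
    qed
    also have "\<epsilon> / 2 * s\<^sup>2 + Mb * C' / K * s\<^sup>2 \<le> \<epsilon> / 2 * s\<^sup>2 + \<epsilon> / 2 * s\<^sup>2"
      by (intro add_left_mono mult_right_mono K(2)) auto
    finally show ?thesis by (simp add: s(2))
  qed
  moreover have "\<omega> > 0" using \<epsilon> T by (simp add: \<omega>_def)
  ultimately show ?thesis using that by blast
qed

text \<open>On an orthonormal family in such a subspace the diagonal of \<open>ka\<close> is at least \<open>1\<close>; compactness bounds
  the number of its members.\<close>

lemma finite_dim_subspace:
  assumes YV: "Y \<subseteq> V" and combo: "\<And>u v s t. u \<in> Y \<Longrightarrow> v \<in> Y \<Longrightarrow> (\<lambda>x. s * u x + t * v x) \<in> Y"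
    and zero: "(\<lambda>_. 0) \<in> Y" and dom: "\<And>y. y \<in> Y \<Longrightarrow> ipA y y \<le> ka y y"
  obtains N e where "onfam N e" "\<And>i. i < N \<Longrightarrow> e i \<in> Y"
    "\<And>s. s \<in> Y \<Longrightarrow> ipA (\<lambda>x. s x - (\<Sum>i<N. ipA s (e i) * e i x)) (\<lambda>x. s x - (\<Sum>i<N. ipA s (e i) * e i x)) = 0"
proof -
  obtain N0 where N0: "\<forall>N e. onfam N e \<longrightarrow> (\<forall>i<N. 1 \<le> \<bar>ka (e i) (e i)\<bar>) \<longrightarrow> N \<le> N0"
    using compact_k[of 1] by auto
  interpret Y: fspace Y by unfold_locales (use zero combo in auto)
  show ?thesis
  proof (rule maximal_onfam[OF YV])
    fix N e assume e: "onfam N e" "\<And>i. i < N \<Longrightarrow> e i \<in> Y"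
    have "1 \<le> \<bar>ka (e i) (e i)\<bar>" if "i < N" for i
      using dom[OF e(2)[OF that]] e(1) that by (simp add: onfam_def)
    then show "N \<le> N0" using N0 e(1) by blast
  next
    fix N :: nat and e s and a :: real
    assume e: "\<And>i. i < N \<Longrightarrow> e i \<in> Y" and s: "s \<in> Y"
    show "(\<lambda>x. a * (s x - (\<Sum>i<N. ipA s (e i) * e i x))) \<in> Y"
    proof -
      have *: "(\<lambda>x. \<Sum>i<N. ipA s (e i) * e i x) \<in> Y" by (rule Y.sum_V) (rule e)
      show ?thesis by (rule Y.scale_V) (rule Y.diff_V[OF s *])
    qed
  qed (rule that)
qed

end

section \<open>The second differential\<close>

text \<open>The growth exponent of \<open>g\<close> enters through an exponent \<open>r > p\<close> in the range of Sobolev's inequality with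
  \<open>q + 2 \<le> r\<close>.\<close>

locale quasilinear = bounded_open \<Omega> for \<Omega> :: "'a::euclidean_space set" +
  fixes p \<kappa> \<mu>1 \<mu>2 Cg q r :: real and \<Psi> :: "'a \<Rightarrow> real" and g :: "'a \<Rightarrow> real \<Rightarrow> real"
  assumes p2: "2 < p" and C2: "class_C 2 \<Psi>" and \<kappa>: "\<kappa> > 0" and \<mu>: "\<mu>1 > 0" "\<mu>2 > 0"
    and convex1: "convex_on UNIV (\<lambda>x. \<Psi> x - \<mu>1 * Psi_kappa p \<kappa> x)"
    and convex2: "convex_on UNIV (\<lambda>x. \<mu>2 * Psi_kappa p \<kappa> x - \<Psi> x)"
    and g_meas: "\<And>s. (\<lambda>x. g x s) \<in> borel_measurable (lebesgue_on \<Omega>)"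
    and g_C1: "AE x in lebesgue_on \<Omega>. class_C 1 (g x)"
    and Cg: "Cg > 0" and q0: "q \<ge> 0"
    and growth: "AE x in lebesgue_on \<Omega>. \<forall>s. \<bar>deriv (g x) s\<bar> \<le> Cg * (1 + \<bar>s\<bar> powr q)"
    and rp: "p < r" and qr: "q \<le> r - 2" and sub_r: "real DIM('a) * ((r - p) / p) < r"
begin

definition lam where "lam = \<mu>1 * \<kappa> powr (p - 2)"
definition Lam where "Lam = \<mu>2 * (p - 1) * \<kappa> powr (p - 2)"

lemma kappa_powr: "(\<kappa>\<^sup>2 + (norm (0::'a))\<^sup>2) powr (p / 2 - 1) = \<kappa> powr (p - 2)"
proof -
  have "(\<kappa>\<^sup>2) powr (p / 2 - 1) = (\<kappa> powr 2) powr (p / 2 - 1)" using \<kappa> by simp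
  also have "\<dots> = \<kappa> powr (2 * (p / 2 - 1))" by (simp only: powr_powr)
  finally show ?thesis by simp
qed

lemma lam_pos: "lam > 0" and Lam_pos: "Lam > 0"
  using \<mu> \<kappa> p2 by (auto simp: lam_def Lam_def)

lemma hess_low: "\<mu>1 * (\<kappa>\<^sup>2 + (norm x)\<^sup>2) powr (p / 2 - 1) * (norm \<xi>)\<^sup>2 \<le> hessian \<Psi> x \<xi> \<xi>"
  and hess_up: "hessian \<Psi> x \<xi> \<xi> \<le> \<mu>2 * (p - 1) * (\<kappa>\<^sup>2 + (norm x)\<^sup>2) powr (p / 2 - 1) * (norm \<xi>)\<^sup>2"
  using hessian_bounds[OF C2 \<kappa> p2 \<mu> convex1 convex2] by auto

sublocale elliptic \<Omega> "hessian \<Psi> 0" "\<lambda>x. deriv (g x) 0" lam Lam Cg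
proof
  show "hessian \<Psi> 0 (s *\<^sub>R x + t *\<^sub>R y) z = s * hessian \<Psi> 0 x z + t * hessian \<Psi> 0 y z" for s t x y z
    by (simp only: linear_add[OF hessian_linear_left[OF C2]] linear_cmul[OF hessian_linear_left[OF C2]] real_scaleR_def)
  show "hessian \<Psi> 0 x y = hessian \<Psi> 0 y x" for x y by (rule hessian_symmetric[OF C2])
  show "lam * (norm x)\<^sup>2 \<le> hessian \<Psi> 0 x x" "hessian \<Psi> 0 x x \<le> Lam * (norm x)\<^sup>2" for x
    using hess_low[of 0 x] hess_up[of 0 x] unfolding kappa_powr by (simp_all add: lam_def Lam_def)
  show "(\<lambda>x. deriv (g x) 0) \<in> borel_measurable M"
    using deriv_measurable[OF g_meas g_C1, of "\<lambda>_. 0"] by simp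
  show "AE x in M. \<bar>deriv (g x) 0\<bar> \<le> Cg"
    using growth
  proof eventually_elim
    case (elim x)
    from elim[rule_format, of 0] show ?case by simp
  qed
qed (use lam_pos Cg in auto)

lemma hess_measurable:
  assumes [measurable]: "U \<in> borel_measurable N" "W \<in> borel_measurable N" "Z \<in> borel_measurable N"
  shows "(\<lambda>x. hessian \<Psi> (U x) (W x) (Z x)) \<in> borel_measurable N"
proof -
  have [measurable]: "(\<lambda>x. hessian \<Psi> (U x) i j) \<in> borel_measurable N" for i j
    by (rule measurable_compose[OF assms(1) borel_measurable_continuous_onI[OF class_C_2D(3)[OF C2]]])
  show ?thesis unfolding hessian_sum[OF C2, of _ "W _" "Z _"] by measurable
qed

lemma W10_p_V: "u \<in> W10 p \<Omega> \<Longrightarrow> u \<in> V"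
  using W10_mono[of u p 2] p2 by (simp add: V_def)

lemma W10_p_Lp: "u \<in> W10 p \<Omega> \<Longrightarrow> u \<in> Lp \<Omega> p" "u \<in> W10 p \<Omega> \<Longrightarrow> wgrad \<Omega> u \<in> Lp \<Omega> p"
  using W10_Lp[of u p] p2 by auto

lemma W10_p_Lr:
  obtains C where "C > 0" "\<And>u. u \<in> W10 p \<Omega> \<Longrightarrow>
    u \<in> Lp \<Omega> r \<and> (\<integral>x. \<bar>u x\<bar> powr r \<partial>M) \<le> C * (\<integral>x. norm (wgrad \<Omega> u x) powr p \<partial>M) powr (r / p)"
proof -
  have "1 \<le> p" "p \<le> r" using p2 rp by auto
  from sobolev[OF this sub_r] obtain C where C: "C > 0" "\<And>u U. sob p u U \<Longrightarrow>
     u \<in> Lp \<Omega> r \<and> (\<integral>x. norm (u x) powr r \<partial>M) \<le> C * (\<integral>x. norm (U x) powr p \<partial>M) powr (r / p)" by metis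
  have "u \<in> Lp \<Omega> r \<and> (\<integral>x. \<bar>u x\<bar> powr r \<partial>M) \<le> C * (\<integral>x. norm (wgrad \<Omega> u x) powr p \<partial>M) powr (r / p)"
    if "u \<in> W10 p \<Omega>" for u using C(2)[OF W10_sob[OF that \<open>1 \<le> p\<close>]] by simp
  with C(1) that show ?thesis by blast
qed

lemma mixed_integrable:
  fixes F :: "'a \<Rightarrow> 'b::euclidean_space" and G :: "'a \<Rightarrow> 'c::euclidean_space"
  assumes t: "t > 2" and F: "F \<in> Lp \<Omega> t" and G: "G \<in> Lp \<Omega> t"
  shows "integrable M (\<lambda>x. norm (F x) powr (t - 2) * (norm (G x))\<^sup>2)"
    and "(\<integral>x. norm (F x) powr (t - 2) * (norm (G x))\<^sup>2 \<partial>M) \<le> (\<integral>x. norm (F x) powr t \<partial>M) + (\<integral>x. norm (G x) powr t \<partial>M)"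
proof -
  note [measurable] = LpD(1)[OF F] LpD(1)[OF G]
  have i: "integrable M (\<lambda>x. norm (F x) powr t + norm (G x) powr t)" using LpD(2)[OF F] LpD(2)[OF G] by simp
  have pt: "norm (F x) powr (t - 2) * (norm (G x))\<^sup>2 \<le> norm (F x) powr t + norm (G x) powr t" for x
    by (rule powr_mixed_le) (use t in auto)
  show 1: "integrable M (\<lambda>x. norm (F x) powr (t - 2) * (norm (G x))\<^sup>2)"
    by (rule Bochner_Integration.integrable_bound[OF i]) (use pt in \<open>auto intro!: AE_I2\<close>)
  have "(\<integral>x. norm (F x) powr (t - 2) * (norm (G x))\<^sup>2 \<partial>M) \<le> (\<integral>x. norm (F x) powr t + norm (G x) powr t \<partial>M)"
    by (rule integral_mono[OF 1 i pt])
  then show "(\<integral>x. norm (F x) powr (t - 2) * (norm (G x))\<^sup>2 \<partial>M) \<le> (\<integral>x. norm (F x) powr t \<partial>M) + (\<integral>x. norm (G x) powr t \<partial>M)"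
    using LpD(2)[OF F] LpD(2)[OF G] by simp
qed

lemma hess_integrable:
  assumes u: "u \<in> W10 p \<Omega>" and v: "v \<in> W10 p \<Omega>"
  shows "integrable M (\<lambda>x. hessian \<Psi> (wgrad \<Omega> u x) (wgrad \<Omega> v x) (wgrad \<Omega> v x))"
proof (rule Bochner_Integration.integrable_bound)
  define K where "K = \<mu>2 * (p - 1) * 2 powr (p / 2 - 1)"
  have K: "K \<ge> 0" using \<mu> p2 by (simp add: K_def)
  let ?b = "\<lambda>x. K * (\<kappa> powr (p - 2) * (norm (wgrad \<Omega> v x))\<^sup>2 + norm (wgrad \<Omega> u x) powr (p - 2) * (norm (wgrad \<Omega> v x))\<^sup>2)"
  show "integrable M ?b"
    using mixed_integrable(1)[OF p2 W10_p_Lp(2)[OF u] W10_p_Lp(2)[OF v]] Lp2_D(2)[OF V_Lp(2)[OF W10_p_V[OF v]]]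
    by (intro integrable_mult_right Bochner_Integration.integrable_add)
  show "(\<lambda>x. hessian \<Psi> (wgrad \<Omega> u x) (wgrad \<Omega> v x) (wgrad \<Omega> v x)) \<in> borel_measurable M"
    using LpD(1)[OF W10_p_Lp(2)[OF u]] LpD(1)[OF W10_p_Lp(2)[OF v]] by (intro hess_measurable)
  show "AE x in M. norm (hessian \<Psi> (wgrad \<Omega> u x) (wgrad \<Omega> v x) (wgrad \<Omega> v x)) \<le> norm (?b x)"
  proof (rule AE_I2)
    fix x
    let ?U = "norm (wgrad \<Omega> u x)" and ?W = "norm (wgrad \<Omega> v x)"
    define m where "m = max \<kappa> ?U"
    have m: "m > 0" "\<kappa> \<le> m" "?U \<le> m" using \<kappa> by (auto simp: m_def)
    have "\<kappa>\<^sup>2 \<le> m\<^sup>2" "?U\<^sup>2 \<le> m\<^sup>2" using m \<kappa> by (auto intro!: power_mono simp: less_imp_le)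
    then have "\<kappa>\<^sup>2 + ?U\<^sup>2 \<le> 2 * m\<^sup>2" by linarith
    then have "(\<kappa>\<^sup>2 + ?U\<^sup>2) powr (p / 2 - 1) \<le> (2 * m\<^sup>2) powr (p / 2 - 1)"
      using p2 by (intro powr_mono2) auto
    also have "\<dots> = 2 powr (p / 2 - 1) * (m powr 2) powr (p / 2 - 1)" using m by (simp add: powr_mult)
    also have "(m powr 2) powr (p / 2 - 1) = m powr (p - 2)" by (simp only: powr_powr) simp
    also have "m powr (p - 2) \<le> \<kappa> powr (p - 2) + ?U powr (p - 2)" by (auto simp: m_def max_def)
    finally have "(\<kappa>\<^sup>2 + ?U\<^sup>2) powr (p / 2 - 1) \<le> 2 powr (p / 2 - 1) * (\<kappa> powr (p - 2) + ?U powr (p - 2))"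
      by simp
    then have "\<mu>2 * (p - 1) * (\<kappa>\<^sup>2 + ?U\<^sup>2) powr (p / 2 - 1) * ?W\<^sup>2
        \<le> \<mu>2 * (p - 1) * (2 powr (p / 2 - 1) * (\<kappa> powr (p - 2) + ?U powr (p - 2))) * ?W\<^sup>2"
      using \<mu> p2 by (intro mult_right_mono mult_left_mono) auto
    also have "\<dots> = ?b x" by (simp add: K_def algebra_simps)
    finally have "hessian \<Psi> (wgrad \<Omega> u x) (wgrad \<Omega> v x) (wgrad \<Omega> v x) \<le> ?b x"
      using hess_up[of "wgrad \<Omega> u x" "wgrad \<Omega> v x"] by linarith
    moreover have "0 \<le> hessian \<Psi> (wgrad \<Omega> u x) (wgrad \<Omega> v x) (wgrad \<Omega> v x)"
    proof -
      have "0 \<le> \<mu>1 * (\<kappa>\<^sup>2 + ?U\<^sup>2) powr (p / 2 - 1) * ?W\<^sup>2" using \<mu> by simp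
      also note hess_low[of "wgrad \<Omega> u x" "wgrad \<Omega> v x"]
      finally show ?thesis .
    qed
    ultimately show "norm (hessian \<Psi> (wgrad \<Omega> u x) (wgrad \<Omega> v x) (wgrad \<Omega> v x)) \<le> norm (?b x)" by simp
  qed
qed

definition Mb where "Mb = 4 * Cg"

text \<open>The truncation is bounded and tends to \<open>0\<close> with \<open>s\<close>; what exceeds it is of order \<open>\<bar>s\<bar>\<^sup>r\<^sup>-\<^sup>2\<close>.\<close>

definition b1 :: "'a \<Rightarrow> real \<Rightarrow> real" where
  "b1 x s = min \<bar>deriv (g x) s - deriv (g x) 0\<bar> Mb"

lemma Mb_pos: "Mb > 0" using Cg by (simp add: Mb_def)

lemma b1_bounds: "0 \<le> b1 x s" "b1 x s \<le> Mb"
  using Mb_pos by (auto simp: b1_def)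

lemma b1_measurable:
  assumes "u \<in> borel_measurable M" shows "(\<lambda>x. b1 x (u x)) \<in> borel_measurable M"
proof -
  note [measurable] = deriv_measurable[OF g_meas g_C1 assms]
  show ?thesis unfolding b1_def by measurable
qed

lemma b1_growth: "AE x in M. \<forall>s. \<bar>deriv (g x) s - deriv (g x) 0\<bar> \<le> b1 x s + Mb * \<bar>s\<bar> powr (r - 2)"
  using growth
proof eventually_elim
  case (elim x)
  show ?case
  proof
    fix s
    have "\<bar>s\<bar> powr q \<le> 1 + \<bar>s\<bar> powr (r - 2)" by (rule powr_growth_le) (use q0 qr in auto)
    then have "Cg * (1 + \<bar>s\<bar> powr q) \<le> Cg * (2 + \<bar>s\<bar> powr (r - 2))" using Cg by (intro mult_left_mono) auto
    moreover have "\<bar>deriv (g x) 0\<bar> \<le> Cg" using elim[rule_format, of 0] by simp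
    moreover have "\<bar>deriv (g x) s\<bar> \<le> Cg * (1 + \<bar>s\<bar> powr q)" using elim by blast
    ultimately have "\<bar>deriv (g x) s - deriv (g x) 0\<bar> \<le> Cg * (2 + \<bar>s\<bar> powr (r - 2)) + Cg" by linarith
    also have "\<dots> \<le> Mb + Mb * \<bar>s\<bar> powr (r - 2)"
      using Cg by (simp add: Mb_def algebra_simps mult_left_mono)
    finally show "\<bar>deriv (g x) s - deriv (g x) 0\<bar> \<le> b1 x s + Mb * \<bar>s\<bar> powr (r - 2)"
      using Mb_pos by (auto simp: b1_def min_def)
  qed
qed

lemma perturbation_integrable:
  assumes u: "u \<in> W10 p \<Omega>" and v: "v \<in> W10 p \<Omega>"
  shows "integrable M (\<lambda>x. (deriv (g x) (u x) - deriv (g x) 0) * v x * v x)"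
    and "(\<integral>x. (deriv (g x) (u x) - deriv (g x) 0) * v x * v x \<partial>M)
      \<le> (\<integral>x. b1 x (u x) * (v x)\<^sup>2 \<partial>M) + Mb * ((\<integral>x. \<bar>u x\<bar> powr r \<partial>M) + (\<integral>x. \<bar>v x\<bar> powr r \<partial>M))"
proof -
  obtain C where C: "C > 0" "\<And>u. u \<in> W10 p \<Omega> \<Longrightarrow>
    u \<in> Lp \<Omega> r \<and> (\<integral>x. \<bar>u x\<bar> powr r \<partial>M) \<le> C * (\<integral>x. norm (wgrad \<Omega> u x) powr p \<partial>M) powr (r / p)"
    using W10_p_Lr by blast
  have L: "u \<in> Lp \<Omega> r" "v \<in> Lp \<Omega> r" using C(2) u v by auto
  have r2: "r > 2" using p2 rp by simp
  note [measurable] = LpD(1)[OF L(1)] LpD(1)[OF L(2)] b1_measurable[OF LpD(1)[OF L(1)]]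
    deriv_measurable[OF g_meas g_C1 LpD(1)[OF L(1)]] deriv_measurable[OF g_meas g_C1, of "\<lambda>_. 0", simplified]
  have i1: "integrable M (\<lambda>x. b1 x (u x) * (v x)\<^sup>2)"
  proof (rule Bochner_Integration.integrable_bound)
    show "integrable M (\<lambda>x. Mb * (v x)\<^sup>2)" using Lp2_D(2)[OF V_Lp(1)[OF W10_p_V[OF v]]] by simp
    show "AE x in M. norm (b1 x (u x) * (v x)\<^sup>2) \<le> norm (Mb * (v x)\<^sup>2)"
      using b1_bounds Mb_pos by (intro AE_I2) (auto simp: abs_mult intro!: mult_right_mono)
  qed measurable
  have i2: "integrable M (\<lambda>x. \<bar>u x\<bar> powr (r - 2) * (v x)\<^sup>2)"
    and e2: "(\<integral>x. \<bar>u x\<bar> powr (r - 2) * (v x)\<^sup>2 \<partial>M) \<le> (\<integral>x. \<bar>u x\<bar> powr r \<partial>M) + (\<integral>x. \<bar>v x\<bar> powr r \<partial>M)"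
    using mixed_integrable[OF r2 L] by simp_all
  have i: "integrable M (\<lambda>x. b1 x (u x) * (v x)\<^sup>2 + Mb * (\<bar>u x\<bar> powr (r - 2) * (v x)\<^sup>2))"
    by (intro Bochner_Integration.integrable_add integrable_mult_right i1 i2)
  have pt: "AE x in M. \<bar>(deriv (g x) (u x) - deriv (g x) 0) * v x * v x\<bar>
      \<le> b1 x (u x) * (v x)\<^sup>2 + Mb * (\<bar>u x\<bar> powr (r - 2) * (v x)\<^sup>2)"
    using b1_growth
  proof eventually_elim
    case (elim x)
    have "\<bar>(deriv (g x) (u x) - deriv (g x) 0) * v x * v x\<bar> = \<bar>deriv (g x) (u x) - deriv (g x) 0\<bar> * (v x)\<^sup>2"
      by (simp add: abs_mult power2_eq_square)
    also have "\<dots> \<le> (b1 x (u x) + Mb * \<bar>u x\<bar> powr (r - 2)) * (v x)\<^sup>2"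
      using elim by (intro mult_right_mono) auto
    finally show ?case by (simp add: algebra_simps)
  qed
  show i0: "integrable M (\<lambda>x. (deriv (g x) (u x) - deriv (g x) 0) * v x * v x)"
    by (rule Bochner_Integration.integrable_bound[OF i], measurable) (use pt in \<open>eventually_elim, auto\<close>)
  have "(\<integral>x. (deriv (g x) (u x) - deriv (g x) 0) * v x * v x \<partial>M)
      \<le> (\<integral>x. b1 x (u x) * (v x)\<^sup>2 + Mb * (\<bar>u x\<bar> powr (r - 2) * (v x)\<^sup>2) \<partial>M)"
    by (rule integral_mono_AE[OF i0 i]) (use pt in \<open>eventually_elim, auto\<close>)
  also have "\<dots> = (\<integral>x. b1 x (u x) * (v x)\<^sup>2 \<partial>M) + Mb * (\<integral>x. \<bar>u x\<bar> powr (r - 2) * (v x)\<^sup>2 \<partial>M)"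
    using i1 i2 by simp
  also have "\<dots> \<le> (\<integral>x. b1 x (u x) * (v x)\<^sup>2 \<partial>M) + Mb * ((\<integral>x. \<bar>u x\<bar> powr r \<partial>M) + (\<integral>x. \<bar>v x\<bar> powr r \<partial>M))"
    using e2 Mb_pos by (intro add_left_mono mult_left_mono) auto
  finally show "(\<integral>x. (deriv (g x) (u x) - deriv (g x) 0) * v x * v x \<partial>M)
      \<le> (\<integral>x. b1 x (u x) * (v x)\<^sup>2 \<partial>M) + Mb * ((\<integral>x. \<bar>u x\<bar> powr r \<partial>M) + (\<integral>x. \<bar>v x\<bar> powr r \<partial>M))" .
qed

lemma d2_zero:
  assumes v: "v \<in> V" and w: "w \<in> V"
  shows "d2_functional \<Omega> \<Psi> g (\<lambda>_. 0) v w = ipA v w - ka v w"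
proof -
  note m = Lp2_D(1)[OF V_Lp(2)[OF v]] Lp2_D(1)[OF V_Lp(2)[OF w]]
  have m0: "wgrad \<Omega> (\<lambda>_. 0) \<in> borel_measurable M" by (rule Lp2_D(1)[OF V_Lp(2)[OF zero_V]])
  have "(\<integral>x. hessian \<Psi> (wgrad \<Omega> (\<lambda>_. 0) x) (wgrad \<Omega> v x) (wgrad \<Omega> w x) \<partial>M) = ipA v w"
    unfolding ipA_def
  proof (rule integral_cong_AE)
    show "AE x in M. hessian \<Psi> (wgrad \<Omega> (\<lambda>_. 0) x) (wgrad \<Omega> v x) (wgrad \<Omega> w x) = hessian \<Psi> 0 (wgrad \<Omega> v x) (wgrad \<Omega> w x)"
    proof -
      have "AE x in M. wgrad \<Omega> (\<lambda>_. 0) x = 0" by (rule W10_zero(2)[of 2]) simp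
      then show ?thesis by eventually_elim simp
    qed
  qed (intro hess_measurable m m0 borel_measurable_const)+
  then show ?thesis by (simp add: d2_functional_def ka_def)
qed

lemma H_inner_eq: "H_inner \<Omega> \<Psi> = ipA"
  by (simp add: fun_eq_iff H_inner_def ipA_def)

lemma H_norm_eq: "H_norm \<Omega> \<Psi> = nrm"
  by (simp add: fun_eq_iff H_norm_def H_inner_eq nrm_def)

lemma H_space_eq: "H_space \<Omega> = V"
  by (simp add: H_space_def V_def)

lemma H_closed_span_eq: "H_closed_span \<Omega> \<Psi> E = cspan E"
  by (simp add: H_closed_span_def cspan_def H_norm_eq H_space_eq)

text \<open>An eigenvector of the operator \<open>H\<close> satisfies the weak eigenvalue equation of the form \<open>ip - k\<close>, since the
  Riesz representative exists.\<close>

lemma H_eigenvector_eig: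
  assumes v: "H_eigenvector \<Omega> \<Psi> g l v"
  shows "eig l v"
proof -
  have vV: "v \<in> V" and ne: "\<not> eq_ae \<Omega> v (\<lambda>_. 0)" and ae: "eq_ae \<Omega> (H_operator \<Omega> \<Psi> g v) (\<lambda>x. l * v x)"
    using v by (auto simp: H_eigenvector_def H_space_eq)
  define z where "z = H_operator \<Omega> \<Psi> g v"
  have "\<exists>z. z \<in> V \<and> (\<forall>w\<in>V. ipA z w = d2_functional \<Omega> \<Psi> g (\<lambda>_. 0) v w)"
    using riesz_form[OF vV] d2_zero[OF vV] by auto
  from someI_ex[OF this] have z: "z \<in> V" "\<And>w. w \<in> V \<Longrightarrow> ipA z w = d2_functional \<Omega> \<Psi> g (\<lambda>_. 0) v w"
    by (auto simp: z_def H_operator_def H_space_eq H_inner_eq)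
  have zl: "ipA (\<lambda>x. z x - l * v x) (\<lambda>x. z x - l * v x) = 0"
    by (rule ipA_AE_cong[OF z(1) scale_V[OF vV]]) (use ae in \<open>simp add: z_def eq_ae_def\<close>)
  have "ka v w = (1 - l) * ipA v w" if w: "w \<in> V" for w
  proof -
    have "ipA v w - ka v w = ipA z w" using z(2)[OF w] d2_zero[OF vV w] by simp
    also have "\<dots> = ipA (\<lambda>x. l * v x) w" by (rule ipA_null_cong(1)[OF z(1) scale_V[OF vV] zl w])
    also have "\<dots> = l * ipA v w" using bil_left[OF bil_ip vV vV w, of l 0] by simp
    finally show ?thesis by (simp add: algebra_simps)
  qed
  then show ?thesis using vV ne ipA_0_iff[OF vV] by (simp add: eig_def)
qed

lemma cspan_mono: "E \<subseteq> F \<Longrightarrow> cspan E \<subseteq> cspan F"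
  unfolding cspan_def by (safe, blast)

lemma X_plus_cspan: "X_plus p \<Omega> \<Psi> g \<subseteq> cspan pos_eig"
  unfolding X_plus_def H_plus_def H_closed_span_eq
  using cspan_mono[of "{v. \<exists>l>0. H_eigenvector \<Omega> \<Psi> g l v}" pos_eig] H_eigenvector_eig
  by (auto simp: pos_eig_def)

lemma X_plus_minus_orthogonal:
  assumes "v \<in> X_plus p \<Omega> \<Psi> g" "w \<in> X_minus \<Omega> \<Psi> g"
  shows "ipA v w = 0"
proof (rule cspan_orthogonal[OF pos_eig_V])
  let ?E = "{v. \<exists>l<0. H_eigenvector \<Omega> \<Psi> g l v}"
  show "?E \<subseteq> V" using H_eigenvector_eig eig_V by auto
  show "v \<in> cspan pos_eig" using assms(1) X_plus_cspan by auto
  show "w \<in> cspan ?E" using assms(2) by (simp add: X_minus_def H_minus_def H_closed_span_eq)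
  fix e f assume "e \<in> pos_eig" "f \<in> ?E"
  then obtain l l' where "l > 0" "eig l e" "l' < 0" "eig l' f"
    using H_eigenvector_eig by (auto simp: pos_eig_def)
  then show "ipA e f = 0" by (intro eig_orthogonal[of l e l' f]) auto
qed

lemma X_minus_V: "X_minus \<Omega> \<Psi> g \<subseteq> V"
  by (auto simp: X_minus_def H_minus_def H_closed_span_eq cspan_V)

lemma X_minus_combo:
  assumes "u \<in> X_minus \<Omega> \<Psi> g" "v \<in> X_minus \<Omega> \<Psi> g"
  shows "(\<lambda>x. s * u x + t * v x) \<in> X_minus \<Omega> \<Psi> g"
  using assms cspan_combo[of "{v. \<exists>l<0. H_eigenvector \<Omega> \<Psi> g l v}" u v s t] H_eigenvector_eig eig_V
  unfolding X_minus_def H_minus_def H_closed_span_eq by auto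

lemma X_minus_null: "u \<in> V \<Longrightarrow> ipA u u = 0 \<Longrightarrow> u \<in> X_minus \<Omega> \<Psi> g"
  unfolding X_minus_def H_minus_def H_closed_span_eq by (rule cspan_null)

end

section \<open>Lower bounds for the second differential near the origin\<close>

lemma powr_absorb:
  assumes "G \<ge> 0" "k > 0" "t > 1"
  obtains \<rho> :: real where "\<rho> > 0" "\<And>D. 0 \<le> D \<Longrightarrow> D \<le> \<rho> \<Longrightarrow> G * D powr t \<le> k * D"
proof -
  define \<rho> where "\<rho> = (k / (G + 1)) powr (1 / (t - 1))"
  have \<rho>: "\<rho> > 0" "\<rho> powr (t - 1) = k / (G + 1)" using assms by (auto simp: \<rho>_def powr_powr)
  have "G * D powr t \<le> k * D" if "0 \<le> D" "D \<le> \<rho>" for D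
  proof (cases "D = 0")
    case False
    then have D: "D > 0" using that by simp
    have "D powr (t - 1) \<le> k / (G + 1)"
      using powr_mono2[of "t - 1" D \<rho>] that assms(3) \<rho>(2) by simp
    then have "G * D powr (t - 1) \<le> G * (k / (G + 1))" using assms by (intro mult_left_mono) auto
    also have "\<dots> \<le> k" using assms by (simp add: field_simps)
    finally have "G * D powr (t - 1) * D \<le> k * D" using D by (intro mult_right_mono) auto
    moreover have "D powr t = D powr (t - 1) * D" using powr_add[of D "t - 1" 1] D by simp
    ultimately show ?thesis by (simp only: mult.assoc)
  qed simp
  with \<rho>(1) that show ?thesis by blast
qed

context quasilinear
begin

text \<open>The weight of the loss: beyond the level \<open>\<rho>\<close> only a fraction of the Hessian at \<open>0\<close> remains.\<close>

definition steep :: "real \<Rightarrow> ('a \<Rightarrow> real) \<Rightarrow> 'a \<Rightarrow> real" where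
  "steep \<rho> u x = (if norm (wgrad \<Omega> u x) \<le> \<rho> then 0 else 1)"

lemma steep_measurable: "u \<in> W10 p \<Omega> \<Longrightarrow> steep \<rho> u \<in> borel_measurable M"
proof -
  assume u: "u \<in> W10 p \<Omega>"
  note [measurable] = LpD(1)[OF W10_p_Lp(2)[OF u]]
  show ?thesis unfolding steep_def[abs_def] by measurable
qed

lemma steep_psd: "u \<in> W10 p \<Omega> \<Longrightarrow> psd (form (steep \<rho> u))"
  by (rule form_psd[where B=1]) (auto simp: steep_measurable, auto simp: steep_def)

lemma steep_le: "u \<in> W10 p \<Omega> \<Longrightarrow> v \<in> V \<Longrightarrow> form (steep \<rho> u) v v \<le> ipA v v"
  unfolding ipA_form by (rule form_mono[where B=1]) (auto simp: steep_measurable, auto simp: steep_def)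

lemma hessian_integral_low:
  assumes low: "\<And>x \<xi>. (if norm x \<le> \<rho> then 1 - \<eta> else \<theta>) * hessian \<Psi> 0 \<xi> \<xi>
      + k1 * norm x powr (p - 2) * (norm \<xi>)\<^sup>2 \<le> hessian \<Psi> x \<xi> \<xi>"
    and u: "u \<in> W10 p \<Omega>" and v: "v \<in> W10 p \<Omega>"
  shows "(1 - \<eta>) * ipA v v - (1 - \<eta> - \<theta>) * form (steep \<rho> u) v v
     + k1 * (\<integral>x. norm (wgrad \<Omega> u x) powr (p - 2) * (norm (wgrad \<Omega> v x))\<^sup>2 \<partial>M)
     \<le> (\<integral>x. hessian \<Psi> (wgrad \<Omega> u x) (wgrad \<Omega> v x) (wgrad \<Omega> v x) \<partial>M)"
proof -
  note vL = V_Lp(2)[OF W10_p_V[OF v]]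
  let ?A = "\<lambda>x. hessian \<Psi> 0 (wgrad \<Omega> v x) (wgrad \<Omega> v x)"
  let ?P = "\<lambda>x. norm (wgrad \<Omega> u x) powr (p - 2) * (norm (wgrad \<Omega> v x))\<^sup>2"
  have i1: "integrable M ?A" by (rule A_integrable[OF vL vL])
  have i2: "integrable M (\<lambda>x. steep \<rho> u x * ?A x)"
    by (rule form_integrable[OF vL vL steep_measurable[OF u], where B=1]) (simp add: steep_def)
  have i3: "integrable M ?P" by (rule mixed_integrable(1)[OF p2 W10_p_Lp(2)[OF u] W10_p_Lp(2)[OF v]])
  have "(\<integral>x. (1 - \<eta>) * ?A x - (1 - \<eta> - \<theta>) * (steep \<rho> u x * ?A x) + k1 * ?P x \<partial>M)
     \<le> (\<integral>x. hessian \<Psi> (wgrad \<Omega> u x) (wgrad \<Omega> v x) (wgrad \<Omega> v x) \<partial>M)"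
  proof (rule integral_mono)
    show "integrable M (\<lambda>x. (1 - \<eta>) * ?A x - (1 - \<eta> - \<theta>) * (steep \<rho> u x * ?A x) + k1 * ?P x)"
      by (intro Bochner_Integration.integrable_add Bochner_Integration.integrable_diff integrable_mult_right i1 i2 i3)
    show "integrable M (\<lambda>x. hessian \<Psi> (wgrad \<Omega> u x) (wgrad \<Omega> v x) (wgrad \<Omega> v x))"
      by (rule hess_integrable[OF u v])
    fix x
    show "(1 - \<eta>) * ?A x - (1 - \<eta> - \<theta>) * (steep \<rho> u x * ?A x) + k1 * ?P x
       \<le> hessian \<Psi> (wgrad \<Omega> u x) (wgrad \<Omega> v x) (wgrad \<Omega> v x)"
      using low[of "wgrad \<Omega> u x" "wgrad \<Omega> v x"] by (simp add: steep_def algebra_simps split: if_splits)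
  qed
  then show ?thesis using i1 i2 i3 by (simp add: ipA_def form_def)
qed

lemma d2_split:
  assumes u: "u \<in> W10 p \<Omega>" and v: "v \<in> W10 p \<Omega>"
  shows "d2_functional \<Omega> \<Psi> g u v v = (\<integral>x. hessian \<Psi> (wgrad \<Omega> u x) (wgrad \<Omega> v x) (wgrad \<Omega> v x) \<partial>M)
    - ka v v - (\<integral>x. (deriv (g x) (u x) - deriv (g x) 0) * v x * v x \<partial>M)"
proof -
  have "(\<integral>x. deriv (g x) (u x) * v x * v x \<partial>M)
    = (\<integral>x. deriv (g x) 0 * v x * v x + (deriv (g x) (u x) - deriv (g x) 0) * v x * v x \<partial>M)"
    by (simp add: algebra_simps)
  also have "\<dots> = ka v v + (\<integral>x. (deriv (g x) (u x) - deriv (g x) 0) * v x * v x \<partial>M)"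
    unfolding ka_def
    by (rule Bochner_Integration.integral_add[OF ka_integrable perturbation_integrable(1)[OF u v]])
      (use V_Lp(1)[OF W10_p_V[OF v]] in auto)
  finally show ?thesis by (simp add: d2_functional_def)
qed

text \<open>The energy of a fixed function on the steep set of \<open>u\<close> tends to \<open>0\<close> with \<open>u\<close>, because
  this set shrinks in measure.\<close>

lemma steep_small:
  assumes e: "\<And>i. i < N \<Longrightarrow> e i \<in> V" and \<rho>: "\<rho> > 0" and \<omega>: "\<omega> > 0"
  obtains \<delta> where "\<delta> > 0" "\<And>u i. u \<in> W10 p \<Omega> \<Longrightarrow> W1_norm p \<Omega> u < \<delta> \<Longrightarrow> i < (N::nat) \<Longrightarrow> form (steep \<rho> u) (e i) (e i) \<le> \<omega>"
proof -
  define S where "S x = (\<Sum>i<N. hessian \<Psi> 0 (wgrad \<Omega> (e i) x) (wgrad \<Omega> (e i) x))" for x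
  define \<Phi> where "\<Phi> x s \<xi> = (if norm \<xi> \<le> \<rho> then 0 else S x)" for x and s :: real and \<xi> :: 'a
  have S0: "0 \<le> S x" for x by (simp add: S_def sum_nonneg A_nonneg)
  have Si: "integrable M S" unfolding S_def[abs_def]
    by (intro Bochner_Integration.integrable_sum A_integrable V_Lp(2) e) auto
  have "\<exists>\<delta>>0. \<forall>u\<in>W10 p \<Omega>. W1_norm p \<Omega> u < \<delta> \<longrightarrow> \<bar>\<integral>x. \<Phi> x (u x) (wgrad \<Omega> u x) \<partial>M\<bar> < \<omega>"
  proof (rule nemytskii_small[OF _ Si])
    show "1 \<le> p" using p2 by simp
    show "\<bar>\<Phi> x s \<xi>\<bar> \<le> S x" for x s \<xi> using S0[of x] by (simp add: \<Phi>_def)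
    show "(\<lambda>x. \<Phi> x (u x) (wgrad \<Omega> u x)) \<in> borel_measurable M" if u: "u \<in> W10 p \<Omega>" for u
    proof -
      note [measurable] = LpD(1)[OF W10_p_Lp(2)[OF u]] borel_measurable_integrable[OF Si]
      show ?thesis unfolding \<Phi>_def by measurable
    qed
    show "AE x in M. \<forall>e>0. \<exists>d>0. \<forall>s \<xi>. \<bar>s\<bar> < d \<and> norm \<xi> < d \<longrightarrow> \<bar>\<Phi> x s \<xi>\<bar> < e"
      by (intro AE_I2 allI impI exI[of _ \<rho>]) (auto simp: \<Phi>_def \<rho>)
  qed (rule \<omega>)
  then obtain \<delta> where \<delta>: "\<delta> > 0" "\<And>u. u \<in> W10 p \<Omega> \<Longrightarrow> W1_norm p \<Omega> u < \<delta> \<Longrightarrow> \<bar>\<integral>x. \<Phi> x (u x) (wgrad \<Omega> u x) \<partial>M\<bar> < \<omega>"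
    by blast
  have "form (steep \<rho> u) (e i) (e i) \<le> \<omega>" if u: "u \<in> W10 p \<Omega>" "W1_norm p \<Omega> u < \<delta>" and i: "i < N" for u i
  proof -
    note [measurable] = LpD(1)[OF W10_p_Lp(2)[OF u(1)]] borel_measurable_integrable[OF Si]
    have "form (steep \<rho> u) (e i) (e i) \<le> (\<integral>x. \<Phi> x (u x) (wgrad \<Omega> u x) \<partial>M)"
      unfolding form_def
    proof (rule integral_mono)
      show "integrable M (\<lambda>x. steep \<rho> u x * hessian \<Psi> 0 (wgrad \<Omega> (e i) x) (wgrad \<Omega> (e i) x))"
        by (rule form_integrable[OF V_Lp(2)[OF e[OF i]] V_Lp(2)[OF e[OF i]] steep_measurable[OF u(1)], where B=1])
          (simp add: steep_def)
      show "integrable M (\<lambda>x. \<Phi> x (u x) (wgrad \<Omega> u x))"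
        by (rule Bochner_Integration.integrable_bound[OF Si], unfold \<Phi>_def, measurable)
      fix x
      have "hessian \<Psi> 0 (wgrad \<Omega> (e i) x) (wgrad \<Omega> (e i) x) \<le> S x"
        unfolding S_def by (rule member_le_sum) (use i A_nonneg in auto)
      then show "steep \<rho> u x * hessian \<Psi> 0 (wgrad \<Omega> (e i) x) (wgrad \<Omega> (e i) x) \<le> \<Phi> x (u x) (wgrad \<Omega> u x)"
        by (simp add: steep_def \<Phi>_def)
    qed
    also have "\<dots> < \<omega>" using \<delta>(2)[OF u] by linarith
    finally show ?thesis by simp
  qed
  with \<delta>(1) that show ?thesis by blast
qed

text \<open>Continuity of \<open>\<partial>\<^sub>s g(x,_)\<close> at \<open>0\<close> for almost every \<open>x\<close>, integrated by dominated convergence.\<close>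

lemma b1_small:
  assumes \<omega>: "\<omega> > 0"
  obtains \<delta> where "\<delta> > 0" "\<And>u. u \<in> W10 p \<Omega> \<Longrightarrow> W1_norm p \<Omega> u < \<delta> \<Longrightarrow> (\<integral>x. b1 x (u x) \<partial>M) < \<omega>"
proof -
  have "\<exists>\<delta>>0. \<forall>u\<in>W10 p \<Omega>. W1_norm p \<Omega> u < \<delta> \<longrightarrow> \<bar>\<integral>x. (\<lambda>x s \<xi>. b1 x s) x (u x) (wgrad \<Omega> u x) \<partial>M\<bar> < \<omega>"
  proof (rule nemytskii_small[where h="\<lambda>_. Mb"])
    show "1 \<le> p" using p2 by simp
    show "integrable M (\<lambda>_. Mb)" by (rule bounded_integrable_M[where B="\<bar>Mb\<bar>"]) auto
    show "\<bar>b1 x s\<bar> \<le> Mb" for x s using b1_bounds[of x s] by simp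
    show "(\<lambda>x. b1 x (u x)) \<in> borel_measurable M" if "u \<in> W10 p \<Omega>" for u
      by (rule b1_measurable[OF LpD(1)[OF W10_p_Lp(1)[OF that]]])
    show "AE x in M. \<forall>e>0. \<exists>d>0. \<forall>s (\<xi>::'a). \<bar>s\<bar> < d \<and> norm \<xi> < d \<longrightarrow> \<bar>b1 x s\<bar> < e"
      using g_C1
    proof eventually_elim
      case (elim x)
      have "isCont (deriv (g x)) 0"
        using class_C_1_real(2)[OF elim] by (simp add: continuous_on_eq_continuous_at)
      then have *: "\<exists>d>0. \<forall>s. \<bar>s\<bar> < d \<longrightarrow> \<bar>deriv (g x) s - deriv (g x) 0\<bar> < e" if "e > 0" for e
        using that unfolding continuous_at_eps_delta by (auto simp: dist_real_def)
      show ?case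
      proof (intro allI impI)
        fix e :: real assume "e > 0"
        from *[OF this] obtain d where "d > 0" "\<And>s. \<bar>s\<bar> < d \<Longrightarrow> \<bar>deriv (g x) s - deriv (g x) 0\<bar> < e" by blast
        then show "\<exists>d>0. \<forall>s (\<xi>::'a). \<bar>s\<bar> < d \<and> norm \<xi> < d \<longrightarrow> \<bar>b1 x s\<bar> < e"
          using b1_bounds(1)[of x] by (intro exI[of _ d]) (auto simp: b1_def intro: min.strict_coboundedI1)
      qed
    qed
  qed (rule \<omega>)
  then obtain \<delta> where d: "\<delta> > 0" and "\<forall>u\<in>W10 p \<Omega>. W1_norm p \<Omega> u < \<delta> \<longrightarrow> \<bar>\<integral>x. b1 x (u x) \<partial>M\<bar> < \<omega>" by auto
  then have "\<And>u. u \<in> W10 p \<Omega> \<Longrightarrow> W1_norm p \<Omega> u < \<delta> \<Longrightarrow> (\<integral>x. b1 x (u x) \<partial>M) < \<omega>"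
    by (meson abs_less_iff)
  with d that show ?thesis by blast
qed

text \<open>Coercivity on the positive space. The degenerate weight \<open>\<bar>\<nabla>u\<bar>\<^sup>p\<^sup>-\<^sup>2\<close> gains a term that
  the quadratic form at the origin does not see; it serves to absorb the superquadratic terms on
  the right.\<close>

lemma d2_low_plus:
  obtains c1 k1 \<delta> where "c1 > 0" "k1 > 0" "\<delta> > 0"
    "\<And>u v. u \<in> W10 p \<Omega> \<Longrightarrow> W1_norm p \<Omega> u < \<delta> \<Longrightarrow> v \<in> X_plus p \<Omega> \<Psi> g \<Longrightarrow>
      c1 * ipA v v + k1 * (\<integral>x. norm (wgrad \<Omega> u x) powr (p - 2) * (norm (wgrad \<Omega> v x))\<^sup>2 \<partial>M)
       \<le> d2_functional \<Omega> \<Psi> g u v v + Mb * ((\<integral>x. \<bar>u x\<bar> powr r \<partial>M) + (\<integral>x. \<bar>v x\<bar> powr r \<partial>M))"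
proof -
  \<comment> \<open>Half of the fraction of the Hessian at \<open>0\<close> that the uniform lower bound \<open>lam\<close> leaves at any gradient.\<close>
  define \<theta> where "\<theta> = min (1/2) (lam / (2 * Lam))"
  have \<theta>: "0 < \<theta>" "\<theta> \<le> 1/2" "\<theta> \<le> \<mu>1 * \<kappa> powr (p - 2) / (2 * Lam)"
    using lam_pos Lam_pos by (auto simp: \<theta>_def lam_def)
  obtain \<eta> c2 \<omega> N e where \<eta>: "0 < \<eta>" "\<eta> \<le> 1/2" and c2: "c2 > 0" and \<omega>: "\<omega> > 0"
    and e: "\<And>i. i < (N::nat) \<Longrightarrow> e i \<in> V"
    and coer: "\<And>E v. psd E \<Longrightarrow> (\<And>v. v \<in> V \<Longrightarrow> E v v \<le> ipA v v) \<Longrightarrow> (\<And>i. i < N \<Longrightarrow> E (e i) (e i) \<le> \<omega>) \<Longrightarrow>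
      v \<in> cspan pos_eig \<Longrightarrow> c2 * ipA v v \<le> (1 - \<eta>) * ipA v v - (1 - \<eta> - \<theta>) * E v v - ka v v"
    using spectral_coercive[OF \<theta>(1,2)] by metis
  have up: "hessian \<Psi> 0 \<xi> \<xi> \<le> Lam * (norm \<xi>)\<^sup>2" for \<xi> by (rule A_up)
  obtain \<rho> where \<rho>: "\<rho> > 0" and low: "\<And>x \<xi>. (if norm x \<le> \<rho> then 1 - \<eta> else \<theta>) * hessian \<Psi> 0 \<xi> \<xi>
      + \<eta> / 2 * \<mu>1 * norm x powr (p - 2) * (norm \<xi>)\<^sup>2 \<le> hessian \<Psi> x \<xi> \<xi>"
    using hessian_lower[OF C2 \<kappa> p2 \<mu>(1) hess_low up Lam_pos \<theta>(3) less_imp_le[OF \<theta>(1)] \<eta>] by metis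
  obtain \<delta>1 where \<delta>1: "\<delta>1 > 0" "\<And>u i. u \<in> W10 p \<Omega> \<Longrightarrow> W1_norm p \<Omega> u < \<delta>1 \<Longrightarrow> i < N \<Longrightarrow> form (steep \<rho> u) (e i) (e i) \<le> \<omega>"
    by (rule steep_small[of N e \<rho> \<omega>]) (use e \<rho> \<omega> in blast)+
  have c2': "c2 / 2 > 0" using c2 by simp
  obtain \<omega>2 where \<omega>2: "\<omega>2 > 0" "\<And>b v. b \<in> borel_measurable M \<Longrightarrow> (\<And>x. 0 \<le> b x) \<Longrightarrow> (\<And>x. b x \<le> Mb) \<Longrightarrow>
    (\<integral>x. b x \<partial>M) < \<omega>2 \<Longrightarrow> v \<in> V \<Longrightarrow> (\<integral>x. b x * (v x)\<^sup>2 \<partial>M) \<le> c2 / 2 * ipA v v"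
    using potential_small[OF Mb_pos c2'] by blast
  obtain \<delta>2 where \<delta>2: "\<delta>2 > 0" "\<And>u. u \<in> W10 p \<Omega> \<Longrightarrow> W1_norm p \<Omega> u < \<delta>2 \<Longrightarrow> (\<integral>x. b1 x (u x) \<partial>M) < \<omega>2"
    using b1_small[OF \<omega>2(1)] by blast
  show ?thesis
  proof (rule that[of "c2 / 2" "\<eta> / 2 * \<mu>1" "min \<delta>1 \<delta>2"])
    show "c2 / 2 > 0" by (rule c2')
    show "\<eta> / 2 * \<mu>1 > 0" using \<eta> \<mu> by simp
    show "min \<delta>1 \<delta>2 > 0" using \<delta>1 \<delta>2 by simp
    fix u v assume u: "u \<in> W10 p \<Omega>" "W1_norm p \<Omega> u < min \<delta>1 \<delta>2" and v: "v \<in> X_plus p \<Omega> \<Psi> g"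
    have vW: "v \<in> W10 p \<Omega>" using v by (simp add: X_plus_def)
    have vc: "v \<in> cspan pos_eig" using v X_plus_cspan by auto
    have 1: "c2 * ipA v v \<le> (1 - \<eta>) * ipA v v - (1 - \<eta> - \<theta>) * form (steep \<rho> u) v v - ka v v"
      by (rule coer[OF steep_psd[OF u(1)] steep_le[OF u(1)] \<delta>1(2)[OF u(1)] vc]) (use u(2) in auto)
    have 2: "(\<integral>x. b1 x (u x) * (v x)\<^sup>2 \<partial>M) \<le> c2 / 2 * ipA v v"
      by (rule \<omega>2(2)[OF b1_measurable[OF LpD(1)[OF W10_p_Lp(1)[OF u(1)]]]])
        (use b1_bounds \<delta>2(2)[OF u(1)] u(2) W10_p_V[OF vW] in auto)
    show "c2 / 2 * ipA v v + \<eta> / 2 * \<mu>1 * (\<integral>x. norm (wgrad \<Omega> u x) powr (p - 2) * (norm (wgrad \<Omega> v x))\<^sup>2 \<partial>M)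
       \<le> d2_functional \<Omega> \<Psi> g u v v + Mb * ((\<integral>x. \<bar>u x\<bar> powr r \<partial>M) + (\<integral>x. \<bar>v x\<bar> powr r \<partial>M))"
      using hessian_integral_low[OF low u(1) vW] d2_split[OF u(1) vW] perturbation_integrable(2)[OF u(1) vW] 1 2
      by (simp add: algebra_simps)
  qed
qed

text \<open>The negative space is finite dimensional, so that all norms on it are equivalent.\<close>

lemma X_minus_norms:
  assumes Nm: "norm_on \<Omega> (X_minus \<Omega> \<Psi> g) Nm"
    and dom: "\<And>v. v \<in> X_minus \<Omega> \<Psi> g \<Longrightarrow> ipA v v \<le> ka v v"
  obtains d K1 K2 where "d > 0" "K1 \<ge> 0" "K2 \<ge> 0"
    "\<And>w. w \<in> X_minus \<Omega> \<Psi> g \<Longrightarrow> w \<in> W10 p \<Omega> \<Longrightarrow> d * (nrm w)\<^sup>2 \<le> (Nm w)\<^sup>2"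
    "\<And>w. w \<in> X_minus \<Omega> \<Psi> g \<Longrightarrow> w \<in> W10 p \<Omega> \<Longrightarrow> (\<integral>x. norm (wgrad \<Omega> w x) powr p \<partial>M) \<le> K1 * nrm w powr p"
    "\<And>w. w \<in> X_minus \<Omega> \<Psi> g \<Longrightarrow> w \<in> W10 p \<Omega> \<Longrightarrow> (\<integral>x. \<bar>w x\<bar> powr r \<partial>M) \<le> K2 * nrm w powr r"
proof -
  \<comment> \<open>The negative components of functions in \<open>W10 p \<Omega>\<close> lie here, and integrals of \<open>p\<close>-th powers of gradients are
    finite.\<close>
  define Y where "Y = X_minus \<Omega> \<Psi> g \<inter> W10 p \<Omega>"
  have p1: "1 \<le> p" using p2 by simp
  have YX: "y \<in> X_minus \<Omega> \<Psi> g" "y \<in> W10 p \<Omega>" "y \<in> V" if "y \<in> Y" for y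
    using that W10_p_V by (auto simp: Y_def)
  have YV: "Y \<subseteq> V" using YX by auto
  have zV: "(\<lambda>_. 0) \<in> V" by (rule zero_V)
  have zX: "(\<lambda>_. 0) \<in> X_minus \<Omega> \<Psi> g" by (rule X_minus_null[OF zV bil_zero[OF bil_ip zV]])
  have zY: "(\<lambda>_. 0) \<in> Y" using zX W10_zero(1)[OF p1] by (simp add: Y_def)
  have cY: "(\<lambda>x. s * u x + t * v x) \<in> Y" if "u \<in> Y" "v \<in> Y" for u v s t
    using X_minus_combo W10_combo(1)[OF p1] that by (simp add: Y_def)
  interpret Y: fspace Y by unfold_locales (use zY cY in auto)
  obtain N f where f: "onfam N f" "\<And>i. i < N \<Longrightarrow> f i \<in> Y"
    and span: "\<And>s. s \<in> Y \<Longrightarrow> ipA (\<lambda>x. s x - (\<Sum>i<N. ipA s (f i) * f i x)) (\<lambda>x. s x - (\<Sum>i<N. ipA s (f i) * f i x)) = 0"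
  proof (rule finite_dim_subspace[OF YV _ zY])
    show "(\<lambda>x. s * u x + t * v x) \<in> Y" if "u \<in> Y" "v \<in> Y" for u v s t by (rule cY[OF that])
    show "ipA y y \<le> ka y y" if "y \<in> Y" for y by (rule dom[OF YX(1)[OF that]])
  qed (rule that)
  have sY: "(\<lambda>x. \<Sum>i<N. c i * f i x) \<in> Y" for c by (rule Y.sum_V) (rule f(2))
  have N0: "Nm v \<ge> 0" "Nm v = 0 \<longleftrightarrow> eq_ae \<Omega> v (\<lambda>_. 0)" "Nm (\<lambda>x. a * v x) = \<bar>a\<bar> * Nm v" if "v \<in> X_minus \<Omega> \<Psi> g" for v a
    using Nm that unfolding norm_on_def by blast+
  have Nt: "Nm (\<lambda>x. v x + w x) \<le> Nm v + Nm w" if "v \<in> X_minus \<Omega> \<Psi> g" "w \<in> X_minus \<Omega> \<Psi> g" for v w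
    using Nm that unfolding norm_on_def by blast
  obtain d where d: "d > 0" "\<And>c. d * (\<Sum>i<N. (c i)\<^sup>2) \<le> (Nm (\<lambda>x. \<Sum>i<N. c i * f i x))\<^sup>2"
  proof (rule finite_dim_norm_lower_bound[OF f(1), of Nm])
    fix c :: "nat \<Rightarrow> real" assume "Nm (\<lambda>x. \<Sum>i<N. c i * f i x) = 0"
    then show "ipA (\<lambda>x. \<Sum>i<N. c i * f i x) (\<lambda>x. \<Sum>i<N. c i * f i x) = 0"
      using N0(2)[OF YX(1)[OF sY]] ipA_0_iff[OF YX(3)[OF sY]] by simp
  qed (use N0(1,3)[OF YX(1)[OF sY]] Nt[OF YX(1)[OF sY] YX(1)[OF sY]] that in auto)
  have grad_sum: "AE x in M. wgrad \<Omega> (\<lambda>x. \<Sum>i<m. c i * f i x) x = (\<Sum>i<m. c i *\<^sub>R wgrad \<Omega> (f i) x)" if "m \<le> N" for m c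
    using that
  proof (induction m)
    case 0
    then show ?case using W10_zero(2)[OF p1] by simp
  next
    case (Suc m)
    have "(\<lambda>x. \<Sum>i<m. c i * f i x) \<in> Y" by (rule Y.sum_V) (use f(2) Suc in auto)
    from W10_combo(2)[OF p1 YX(2)[OF this] YX(2)[OF f(2)], of m 1 "c m"] Suc
    have "AE x in M. wgrad \<Omega> (\<lambda>x. (\<Sum>i<m. c i * f i x) + c m * f m x) x
        = wgrad \<Omega> (\<lambda>x. \<Sum>i<m. c i * f i x) x + c m *\<^sub>R wgrad \<Omega> (f m) x" by simp
    moreover have "AE x in M. wgrad \<Omega> (\<lambda>x. \<Sum>i<m. c i * f i x) x = (\<Sum>i<m. c i *\<^sub>R wgrad \<Omega> (f i) x)"
      using Suc by simp
    ultimately show ?case unfolding sum.lessThan_Suc by eventually_elim simp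
  qed
  define F1 where "F1 x = (\<Sum>i<N. norm (wgrad \<Omega> (f i) x))" for x
  define F2 where "F2 x = (\<Sum>i<N. \<bar>f i x\<bar>)" for x
  obtain Cr where Cr: "\<And>u. u \<in> W10 p \<Omega> \<Longrightarrow> u \<in> Lp \<Omega> r" using W10_p_Lr by blast
  have "(\<lambda>x. \<Sum>i<m. norm (wgrad \<Omega> (f i) x)) \<in> Lp \<Omega> p" if "m \<le> N" for m
    using that
  proof (induction m)
    case (Suc m)
    have "(\<lambda>x. norm (wgrad \<Omega> (f m) x)) \<in> Lp \<Omega> p"
      using LpD[OF W10_p_Lp(2)[OF YX(2)[OF f(2)[of m]]]] Suc by (intro LpI) auto
    then show ?case using Suc p2 by (simp add: Lp_add)
  qed (auto intro!: LpI)
  from this[OF order_refl] have F1: "F1 \<in> Lp \<Omega> p" by (simp add: F1_def[abs_def])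
  have "(\<lambda>x. \<Sum>i<m. \<bar>f i x\<bar>) \<in> Lp \<Omega> r" if "m \<le> N" for m
    using that
  proof (induction m)
    case (Suc m)
    have "(\<lambda>x. \<bar>f m x\<bar>) \<in> Lp \<Omega> r"
      using LpD[OF Cr[OF YX(2)[OF f(2)[of m]]]] Suc by (intro LpI) auto
    then show ?case using Suc p2 rp by (simp add: Lp_add)
  qed (auto intro!: LpI)
  from this[OF order_refl] have F2: "F2 \<in> Lp \<Omega> r" by (simp add: F2_def[abs_def])
  have F0: "F1 x \<ge> 0" "F2 x \<ge> 0" for x by (auto simp: F1_def F2_def sum_nonneg)
  show ?thesis
  proof (rule that[of d "\<integral>x. F1 x powr p \<partial>M" "\<integral>x. F2 x powr r \<partial>M"])
    show "d > 0" by (rule d(1))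
    show "(\<integral>x. F1 x powr p \<partial>M) \<ge> 0" "(\<integral>x. F2 x powr r \<partial>M) \<ge> 0" by (auto intro: integral_nonneg_AE)
    fix w assume "w \<in> X_minus \<Omega> \<Psi> g" "w \<in> W10 p \<Omega>"
    then have w: "w \<in> Y" by (simp add: Y_def)
    note wX = YX[OF w]
    define c where "c i = ipA w (f i)" for i
    define y where "y x = (\<Sum>i<N. c i * f i x)" for x
    have y: "y \<in> Y" unfolding y_def[abs_def] by (rule sY)
    have null: "ipA (\<lambda>x. w x - y x) (\<lambda>x. w x - y x) = 0" using span[OF w] by (simp add: y_def c_def)
    have ae: "AE x in M. w x = y x"
      using null ipA_0_iff[OF diff_V[OF wX(3) YX(3)[OF y]]] by (simp add: eq_ae_def)
    have sq: "(nrm w)\<^sup>2 = (\<Sum>i<N. (c i)\<^sup>2)"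
      using nrm_sq[OF wX(3)] ipA_null_cong(2)[OF wX(3) YX(3)[OF y] null] onfam_sum_ip[OF f(1), of c]
      by (simp add: y_def[abs_def])
    have s0: "nrm w \<ge> 0" by (rule nrm_nonneg[OF wX(3)])
    have c: "\<bar>c i\<bar> \<le> nrm w" if "i < N" for i
    proof -
      have "(c i)\<^sup>2 \<le> (nrm w)\<^sup>2" unfolding sq by (rule member_le_sum) (use that in auto)
      then show ?thesis using s0 abs_le_square_iff[of "c i" "nrm w"] by simp
    qed
    show "d * (nrm w)\<^sup>2 \<le> (Nm w)\<^sup>2"
    proof -
      have z: "(\<lambda>x. y x - w x) \<in> X_minus \<Omega> \<Psi> g" by (rule YX(1)[OF Y.diff_V[OF y w]])
      have "Nm (\<lambda>x. y x - w x) = 0"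
        unfolding N0(2)[OF z] eq_ae_def using ae by eventually_elim simp
      then have "Nm y \<le> Nm w" using Nt[OF wX(1) z] by simp
      then have "(Nm y)\<^sup>2 \<le> (Nm w)\<^sup>2" using N0(1)[OF YX(1)[OF y]] by (intro power_mono)
      then show ?thesis using d(2)[of c] by (simp add: sq y_def[abs_def])
    qed
    show "(\<integral>x. norm (wgrad \<Omega> w x) powr p \<partial>M) \<le> (\<integral>x. F1 x powr p \<partial>M) * nrm w powr p"
    proof -
      have "AE x in M. wgrad \<Omega> w x = wgrad \<Omega> y x"
        using W10_AE_cong(2)[OF p1 YX(2)[OF y], of w] ae by (auto simp: eq_commute)
      then have "AE x in M. norm (wgrad \<Omega> w x) powr p \<le> F1 x powr p * nrm w powr p"
        using grad_sum[OF order_refl, of c, folded y_def[abs_def]]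
      proof eventually_elim
        case (elim x)
        have "norm (wgrad \<Omega> w x) \<le> (\<Sum>i<N. norm (c i *\<^sub>R wgrad \<Omega> (f i) x))" unfolding elim by (rule norm_sum)
        also have "\<dots> \<le> (\<Sum>i<N. nrm w * norm (wgrad \<Omega> (f i) x))"
          by (intro sum_mono) (auto intro!: mult_right_mono c)
        also have "\<dots> = F1 x * nrm w" by (simp add: F1_def sum_distrib_left mult.commute)
        finally have "norm (wgrad \<Omega> w x) powr p \<le> (F1 x * nrm w) powr p" using p2 by (intro powr_mono2) auto
        then show ?case using F0 s0 by (simp add: powr_mult)
      qed
      then have "(\<integral>x. norm (wgrad \<Omega> w x) powr p \<partial>M) \<le> (\<integral>x. F1 x powr p * nrm w powr p \<partial>M)"
        using LpD(2)[OF W10_p_Lp(2)[OF wX(2)]] LpD(2)[OF F1] F0 by (intro integral_mono_AE) auto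
      then show ?thesis by simp
    qed
    show "(\<integral>x. \<bar>w x\<bar> powr r \<partial>M) \<le> (\<integral>x. F2 x powr r \<partial>M) * nrm w powr r"
    proof -
      have "AE x in M. \<bar>w x\<bar> powr r \<le> F2 x powr r * nrm w powr r"
        using ae
      proof eventually_elim
        case (elim x)
        have "\<bar>w x\<bar> \<le> (\<Sum>i<N. \<bar>c i * f i x\<bar>)" unfolding elim y_def by (rule sum_abs)
        also have "\<dots> \<le> (\<Sum>i<N. nrm w * \<bar>f i x\<bar>)"
          by (intro sum_mono) (auto simp: abs_mult intro!: mult_right_mono c)
        also have "\<dots> = F2 x * nrm w" by (simp add: F2_def sum_distrib_left mult.commute)
        finally have "\<bar>w x\<bar> powr r \<le> (F2 x * nrm w) powr r" using p2 rp by (intro powr_mono2) auto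
        then show ?case using F0 s0 by (simp add: powr_mult)
      qed
      then have "(\<integral>x. \<bar>w x\<bar> powr r \<partial>M) \<le> (\<integral>x. F2 x powr r * nrm w powr r \<partial>M)"
        using LpD(2)[OF Cr[OF wX(2)]] LpD(2)[OF F2] F0 by (intro integral_mono_AE) auto
      then show ?thesis by simp
    qed
  qed
qed

lemma ipA_small:
  assumes "\<epsilon> > 0"
  obtains \<delta> where "\<delta> > 0" "\<And>u. u \<in> W10 p \<Omega> \<Longrightarrow> W1_norm p \<Omega> u < \<delta> \<Longrightarrow> ipA u u \<le> \<epsilon>"
proof -
  define m where "m = measure M \<Omega> + 1"
  have m: "m > 0" by (simp add: m_def add_nonneg_pos)
  define \<eta> where "\<eta> = sqrt (\<epsilon> / (2 * Lam * m))"
  have \<eta>: "\<eta> > 0" "\<eta>\<^sup>2 = \<epsilon> / (2 * Lam * m)" using assms Lam_pos m by (auto simp: \<eta>_def)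
  define \<delta> where "\<delta> = (\<epsilon> / (2 * Lam * \<eta> powr (2 - p))) powr (1 / p)"
  have \<delta>: "\<delta> > 0" "\<delta> powr p = \<epsilon> / (2 * Lam * \<eta> powr (2 - p))"
    using assms Lam_pos \<eta> p2 by (auto simp: \<delta>_def powr_powr)
  have "ipA u u \<le> \<epsilon>" if u: "u \<in> W10 p \<Omega>" "W1_norm p \<Omega> u < \<delta>" for u
  proof -
    have p1: "1 \<le> p" using p2 by simp
    note uL = LpD(2)[OF W10_p_Lp(2)[OF u(1)]]
    have ci: "integrable M (\<lambda>_. \<eta>\<^sup>2)" by (rule bounded_integrable_M[where B="\<eta>\<^sup>2"]) auto
    have "(\<integral>x. (norm (wgrad \<Omega> u x))\<^sup>2 \<partial>M) \<le> (\<integral>x. \<eta>\<^sup>2 + \<eta> powr (2 - p) * norm (wgrad \<Omega> u x) powr p \<partial>M)"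
    proof (rule integral_mono)
      show "integrable M (\<lambda>x. (norm (wgrad \<Omega> u x))\<^sup>2)" by (rule Lp2_D(2)[OF V_Lp(2)[OF W10_p_V[OF u(1)]]])
      show "integrable M (\<lambda>x. \<eta>\<^sup>2 + \<eta> powr (2 - p) * norm (wgrad \<Omega> u x) powr p)"
        by (intro Bochner_Integration.integrable_add ci integrable_mult_right uL)
      fix x
      show "(norm (wgrad \<Omega> u x))\<^sup>2 \<le> \<eta>\<^sup>2 + \<eta> powr (2 - p) * norm (wgrad \<Omega> u x) powr p"
        using powr_le_interp[of "norm (wgrad \<Omega> u x)" 2 p \<eta>] p2 \<eta>(1) by simp
    qed
    also have "\<dots> = \<eta>\<^sup>2 * measure M \<Omega> + \<eta> powr (2 - p) * (\<integral>x. norm (wgrad \<Omega> u x) powr p \<partial>M)"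
      using ci uL by (simp add: mult.commute)
    also have "\<dots> \<le> \<eta>\<^sup>2 * m + \<eta> powr (2 - p) * \<delta> powr p"
      using W1_norm_less(2)[OF u(1) p1 u(2)] by (intro add_mono mult_left_mono) (auto simp: m_def)
    also have "\<dots> = \<epsilon> / Lam"
      using \<eta>(1) Lam_pos m assms by (simp add: \<eta>(2) \<delta>(2) field_simps)
    finally have "Lam * (\<integral>x. (norm (wgrad \<Omega> u x))\<^sup>2 \<partial>M) \<le> \<epsilon>" using Lam_pos by (simp add: field_simps)
    then show ?thesis using ipA_up[OF W10_p_V[OF u(1)]] by linarith
  qed
  with \<delta>(1) that show ?thesis by blast
qed

text \<open>With \<open>D = \<integral>\<bar>\<nabla>v\<bar>\<^sup>p\<close> for the positive component \<open>v\<close>, the degenerate term is at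
  least a multiple of \<open>D\<close> up to powers of the negative component, and the growth terms of \<open>g\<close> are
  at most a multiple of \<open>D powr (r / p)\<close>, which \<open>D\<close> absorbs near the origin. The powers of the
  negative component have exponents above \<open>2\<close> and are absorbed by its square.\<close>

lemma d2_low:
  assumes Nm: "norm_on \<Omega> (X_minus \<Omega> \<Psi> g) Nm" and c: "c > 0" and rr: "rr > 0"
    and neg: "\<And>u v. u \<in> W10 p \<Omega> \<Longrightarrow> W1_norm p \<Omega> u < rr \<Longrightarrow> v \<in> X_minus \<Omega> \<Psi> g \<Longrightarrow>
      d2_functional \<Omega> \<Psi> g u v v \<le> - 2 * c * (Nm v)\<^sup>2"
  shows "\<exists>\<delta>>0. \<exists>c1>0. \<forall>u\<in>W10 p \<Omega>. W1_norm p \<Omega> u < \<delta> \<longrightarrow>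
          (\<forall>um\<in>X_minus \<Omega> \<Psi> g. \<forall>up\<in>X_plus p \<Omega> \<Psi> g. eq_ae \<Omega> u (\<lambda>x. um x + up x) \<longrightarrow>
             d2_functional \<Omega> \<Psi> g u up up \<ge> c1 * (H_norm \<Omega> \<Psi> up)\<^sup>2 - c * (Nm um)\<^sup>2)"
proof -
  have p1: "1 \<le> p" using p2 by simp
  have dom: "ipA v v \<le> ka v v" if v: "v \<in> X_minus \<Omega> \<Psi> g" for v
  proof -
    have vV: "v \<in> V" using v X_minus_V by auto
    have "d2_functional \<Omega> \<Psi> g (\<lambda>_. 0) v v \<le> - 2 * c * (Nm v)\<^sup>2"
      by (rule neg[OF W10_zero(1)[OF p1] _ v]) (simp add: W1_norm_zero[OF p1] rr)
    moreover have "- 2 * c * (Nm v)\<^sup>2 \<le> 0" using c by simp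
    ultimately show ?thesis using d2_zero[OF vV vV] by linarith
  qed
  obtain d K1 K2 where d: "d > 0" and K: "K1 \<ge> 0" "K2 \<ge> 0"
    and Nm_low: "\<And>w. w \<in> X_minus \<Omega> \<Psi> g \<Longrightarrow> w \<in> W10 p \<Omega> \<Longrightarrow> d * (nrm w)\<^sup>2 \<le> (Nm w)\<^sup>2"
    and Dm: "\<And>w. w \<in> X_minus \<Omega> \<Psi> g \<Longrightarrow> w \<in> W10 p \<Omega> \<Longrightarrow> (\<integral>x. norm (wgrad \<Omega> w x) powr p \<partial>M) \<le> K1 * nrm w powr p"
    and Rm: "\<And>w. w \<in> X_minus \<Omega> \<Psi> g \<Longrightarrow> w \<in> W10 p \<Omega> \<Longrightarrow> (\<integral>x. \<bar>w x\<bar> powr r \<partial>M) \<le> K2 * nrm w powr r"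
    using X_minus_norms[OF Nm dom] by blast
  obtain c1 k1 \<delta>1 where c1: "c1 > 0" and k1: "k1 > 0" and \<delta>1: "\<delta>1 > 0"
    and coer: "\<And>u v. u \<in> W10 p \<Omega> \<Longrightarrow> W1_norm p \<Omega> u < \<delta>1 \<Longrightarrow> v \<in> X_plus p \<Omega> \<Psi> g \<Longrightarrow>
      c1 * ipA v v + k1 * (\<integral>x. norm (wgrad \<Omega> u x) powr (p - 2) * (norm (wgrad \<Omega> v x))\<^sup>2 \<partial>M)
       \<le> d2_functional \<Omega> \<Psi> g u v v + Mb * ((\<integral>x. \<bar>u x\<bar> powr r \<partial>M) + (\<integral>x. \<bar>v x\<bar> powr r \<partial>M))"
    using d2_low_plus by blast
  obtain Cr where Cr: "Cr > 0" "\<And>u. u \<in> W10 p \<Omega> \<Longrightarrow>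
    u \<in> Lp \<Omega> r \<and> (\<integral>x. \<bar>u x\<bar> powr r \<partial>M) \<le> Cr * (\<integral>x. norm (wgrad \<Omega> u x) powr p \<partial>M) powr (r / p)"
    using W10_p_Lr by blast
  define k2 where "k2 = k1 / 2 powr (p - 2)"
  have k2: "k2 > 0" using k1 by (simp add: k2_def)
  define G where "G = Mb * (2 powr r + 1) * Cr"
  have G: "G \<ge> 0" using Mb_pos Cr(1) by (simp add: G_def)
  define K5 where "K5 = k2 * 2 powr p * K1"
  define K6 where "K6 = Mb * 2 powr r * K2"
  have K56: "K5 \<ge> 0" "K6 \<ge> 0" using k2 K Mb_pos by (auto simp: K5_def K6_def)
  have rp1: "r / p > 1" "p / 2 > 1" "r / 2 > 1" using p2 rp by auto
  have cd: "c * d / 2 > 0" using c d by simp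
  obtain \<rho>1 where \<rho>1: "\<rho>1 > 0" "\<And>D. 0 \<le> D \<Longrightarrow> D \<le> \<rho>1 \<Longrightarrow> G * D powr (r / p) \<le> k2 * D"
    using powr_absorb[OF G k2 rp1(1)] by blast
  obtain \<rho>2 where \<rho>2: "\<rho>2 > 0" "\<And>D. 0 \<le> D \<Longrightarrow> D \<le> \<rho>2 \<Longrightarrow> K5 * D powr (p / 2) \<le> c * d / 2 * D"
    using powr_absorb[OF K56(1) cd rp1(2)] by blast
  obtain \<rho>3 where \<rho>3: "\<rho>3 > 0" "\<And>D. 0 \<le> D \<Longrightarrow> D \<le> \<rho>3 \<Longrightarrow> K6 * D powr (r / 2) \<le> c * d / 2 * D"
    using powr_absorb[OF K56(2) cd rp1(3)] by blast
  obtain \<rho>4 where \<rho>4: "\<rho>4 > 0" "\<And>D. 0 \<le> D \<Longrightarrow> D \<le> \<rho>4 \<Longrightarrow> K1 * D powr (p / 2) \<le> 1 * D"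
    using powr_absorb[OF K(1) zero_less_one rp1(2)] by blast
  define \<tau> where "\<tau> = \<rho>1 / (2 * 2 powr p)"
  have \<tau>: "\<tau> > 0" "2 powr p * (\<tau> + \<tau>) = \<rho>1" using \<rho>1 by (auto simp: \<tau>_def)
  define \<epsilon> where "\<epsilon> = Min {\<rho>2, \<rho>3, \<rho>4, \<tau>}"
  have \<epsilon>: "\<epsilon> > 0" "\<epsilon> \<le> \<rho>2" "\<epsilon> \<le> \<rho>3" "\<epsilon> \<le> \<rho>4" "\<epsilon> \<le> \<tau>"
    using \<rho>2(1) \<rho>3(1) \<rho>4(1) \<tau>(1) by (auto simp: \<epsilon>_def)
  obtain \<delta>2 where \<delta>2: "\<delta>2 > 0" "\<And>u. u \<in> W10 p \<Omega> \<Longrightarrow> W1_norm p \<Omega> u < \<delta>2 \<Longrightarrow> ipA u u \<le> \<epsilon>"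
    using ipA_small[OF \<epsilon>(1)] by blast
  define \<delta>3 where "\<delta>3 = \<tau> powr (1 / p)"
  have \<delta>3: "\<delta>3 > 0" "\<delta>3 powr p = \<tau>" using \<tau>(1) p2 by (auto simp: \<delta>3_def powr_powr)
  define \<delta> where "\<delta> = Min {\<delta>1, \<delta>2, \<delta>3}"
  have \<delta>: "\<delta> > 0" "\<delta> \<le> \<delta>1" "\<delta> \<le> \<delta>2" "\<delta> \<le> \<delta>3" using \<delta>1 \<delta>2(1) \<delta>3(1) by (auto simp: \<delta>_def)
  have "c1 * (H_norm \<Omega> \<Psi> up)\<^sup>2 - c * (Nm um)\<^sup>2 \<le> d2_functional \<Omega> \<Psi> g u up up"
    if u: "u \<in> W10 p \<Omega>" "W1_norm p \<Omega> u < \<delta>" and um: "um \<in> X_minus \<Omega> \<Psi> g"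
      and up: "up \<in> X_plus p \<Omega> \<Psi> g" and eq: "eq_ae \<Omega> u (\<lambda>x. um x + up x)" for u um up
  proof -
    have upW: "up \<in> W10 p \<Omega>" using up by (simp add: X_plus_def)
    have ae: "AE x in M. u x = um x + up x" using eq by (simp add: eq_ae_def)
    have dW: "(\<lambda>x. u x - up x) \<in> W10 p \<Omega>"
      and dg: "AE x in M. wgrad \<Omega> (\<lambda>x. u x - up x) x = wgrad \<Omega> u x - wgrad \<Omega> up x"
      using W10_combo[OF p1 u(1) upW, of 1 "-1"] by simp_all
    have ae': "AE x in M. u x - up x = um x" using ae by eventually_elim simp
    have umW: "um \<in> W10 p \<Omega>" by (rule W10_AE_cong(1)[OF p1 dW ae'])
    have gr: "AE x in M. wgrad \<Omega> up x = wgrad \<Omega> u x - wgrad \<Omega> um x"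
      using W10_AE_cong(2)[OF p1 dW ae'] dg by eventually_elim simp
    note V = W10_p_V[OF u(1)] W10_p_V[OF umW] W10_p_V[OF upW]
    let ?s2 = "ipA um um"
    have s2: "?s2 \<ge> 0" by (rule psd_nonneg[OF psd_ip V(2)])
    have s2\<epsilon>: "?s2 \<le> \<epsilon>"
    proof -
      have sumV: "(\<lambda>x. um x + up x) \<in> V" by (rule add_V[OF V(2,3)])
      have "ipA (\<lambda>x. u x - (um x + up x)) (\<lambda>x. u x - (um x + up x)) = 0"
        by (rule ipA_AE_cong[OF V(1) sumV ae])
      then have "ipA u u = ipA (\<lambda>x. um x + up x) (\<lambda>x. um x + up x)" by (rule ipA_null_cong(2)[OF V(1) sumV])
      also have "\<dots> = ?s2 + ipA up up"
        using bil_quadratic[OF bil_ip V(2,3), of 1 1] X_plus_minus_orthogonal[OF up um] bil_sym[OF bil_ip V(2,3)] by simp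
      finally have "?s2 \<le> ipA u u" using psd_nonneg[OF psd_ip V(3)] by simp
      then show ?thesis using \<delta>2(2)[OF u(1)] u(2) \<delta>(3) by linarith
    qed
    have nrm_pow: "nrm um powr t = ?s2 powr (t / 2)" for t
      using s2 by (simp add: nrm_def powr_half_sqrt[symmetric] powr_powr)
    let ?P = "\<integral>x. norm (wgrad \<Omega> u x) powr (p - 2) * (norm (wgrad \<Omega> up x))\<^sup>2 \<partial>M"
    let ?D = "\<integral>x. norm (wgrad \<Omega> up x) powr p \<partial>M"
    let ?Dm = "\<integral>x. norm (wgrad \<Omega> um x) powr p \<partial>M"
    let ?Ru = "\<integral>x. \<bar>u x\<bar> powr r \<partial>M" and ?Rm = "\<integral>x. \<bar>um x\<bar> powr r \<partial>M" and ?Rp = "\<integral>x. \<bar>up x\<bar> powr r \<partial>M"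
    note gL = W10_p_Lp(2)[OF u(1)] W10_p_Lp(2)[OF umW] W10_p_Lp(2)[OF upW]
    have Dm1: "?Dm \<le> K1 * ?s2 powr (p / 2)" using Dm[OF um umW] by (simp only: nrm_pow)
    have D0: "?D \<ge> 0" by (auto intro: integral_nonneg_AE)
    have DP: "?D \<le> 2 powr (p - 2) * ?P + 2 powr p * ?Dm"
    proof -
      have iP: "integrable M (\<lambda>x. norm (wgrad \<Omega> u x) powr (p - 2) * (norm (wgrad \<Omega> up x))\<^sup>2)"
        by (rule mixed_integrable(1)[OF p2 gL(1,3)])
      note iD = LpD(2)[OF gL(2)]
      have "?D \<le> (\<integral>x. 2 powr (p - 2) * (norm (wgrad \<Omega> u x) powr (p - 2) * (norm (wgrad \<Omega> up x))\<^sup>2)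
          + 2 powr p * norm (wgrad \<Omega> um x) powr p \<partial>M)"
      proof (rule integral_mono_AE)
        show "AE x in M. norm (wgrad \<Omega> up x) powr p \<le> 2 powr (p - 2) * (norm (wgrad \<Omega> u x) powr (p - 2) * (norm (wgrad \<Omega> up x))\<^sup>2)
          + 2 powr p * norm (wgrad \<Omega> um x) powr p"
          using gr
        proof eventually_elim
          case (elim x)
          show ?case unfolding elim by (rule norm_powr_split[OF p2])
        qed
      qed (use LpD(2)[OF gL(3)] iP iD in auto)
      then show ?thesis using iP iD by simp
    qed
    have D\<rho>: "?D \<le> \<rho>1"
    proof -
      have "(\<integral>x. norm (wgrad \<Omega> u x + - wgrad \<Omega> um x) powr p \<partial>M)
         \<le> 2 powr p * ((\<integral>x. norm (wgrad \<Omega> u x) powr p \<partial>M) + (\<integral>x. norm (- wgrad \<Omega> um x) powr p \<partial>M))"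
        by (rule Lp_add(2)) (use p2 gL Lp_scale[OF gL(2), of "-1"] in auto)
      moreover have "?D = (\<integral>x. norm (wgrad \<Omega> u x + - wgrad \<Omega> um x) powr p \<partial>M)"
        by (rule norm_AE_cong) (use gr LpD(1)[OF gL(3)] in auto)
      ultimately have "?D \<le> 2 powr p * ((\<integral>x. norm (wgrad \<Omega> u x) powr p \<partial>M) + ?Dm)" by simp
      also have "\<dots> \<le> 2 powr p * (\<tau> + \<tau>)"
      proof (intro mult_left_mono add_mono)
        show "(\<integral>x. norm (wgrad \<Omega> u x) powr p \<partial>M) \<le> \<tau>"
          using W1_norm_less(2)[OF u(1) p1, of \<delta>3] u(2) \<delta>(4) \<delta>3(2) by simp
        show "?Dm \<le> \<tau>" using Dm1 \<rho>4(2)[OF s2] s2\<epsilon> \<epsilon> by linarith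
      qed simp
      finally show ?thesis by (simp only: \<tau>(2))
    qed
    have Rp: "?Rp \<le> Cr * ?D powr (r / p)" using Cr(2)[OF upW] by simp
    have Rm1: "?Rm \<le> K2 * ?s2 powr (r / 2)" using Rm[OF um umW] by (simp only: nrm_pow)
    have Ru: "?Ru \<le> 2 powr r * (?Rm + ?Rp)"
    proof -
      have "?Ru = (\<integral>x. norm (u x) powr r \<partial>M)" by simp
      also have "\<dots> = (\<integral>x. norm (um x + up x) powr r \<partial>M)"
        by (rule norm_AE_cong[OF ae]) (rule LpD(1)[OF W10_p_Lp(1)[OF u(1)]])
      also have "\<dots> \<le> 2 powr r * ((\<integral>x. norm (um x) powr r \<partial>M) + (\<integral>x. norm (up x) powr r \<partial>M))"
        by (rule Lp_add(2)) (use p2 rp Cr(2)[OF umW] Cr(2)[OF upW] in auto)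
      finally show ?thesis by simp
    qed
    have growth: "Mb * (?Ru + ?Rp) \<le> k2 * ?D + c * d / 2 * ?s2"
    proof -
      have "Mb * (?Ru + ?Rp) \<le> Mb * (2 powr r * (?Rm + ?Rp) + ?Rp)"
        using Ru Mb_pos by (intro mult_left_mono add_right_mono) auto
      also have "\<dots> = Mb * (2 powr r + 1) * ?Rp + Mb * 2 powr r * ?Rm" by (simp add: algebra_simps)
      also have "\<dots> \<le> Mb * (2 powr r + 1) * (Cr * ?D powr (r / p)) + Mb * 2 powr r * (K2 * ?s2 powr (r / 2))"
        using Rp Rm1 Mb_pos by (intro add_mono mult_left_mono) auto
      also have "\<dots> = G * ?D powr (r / p) + K6 * ?s2 powr (r / 2)" by (simp add: G_def K6_def)
      also have "\<dots> \<le> k2 * ?D + c * d / 2 * ?s2"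
        using \<rho>1(2)[OF D0 D\<rho>] \<rho>3(2)[OF s2] s2\<epsilon> \<epsilon>(3) by (intro add_mono) auto
      finally show ?thesis .
    qed
    have gain: "k2 * ?D - c * d / 2 * ?s2 \<le> k1 * ?P"
    proof -
      have "k2 * ?D \<le> k2 * (2 powr (p - 2) * ?P + 2 powr p * ?Dm)" using DP k2 by (intro mult_left_mono) auto
      also have "\<dots> = k1 * ?P + k2 * 2 powr p * ?Dm" by (simp add: k2_def field_simps)
      also have "k2 * 2 powr p * ?Dm \<le> k2 * 2 powr p * (K1 * ?s2 powr (p / 2))"
        using Dm1 k2 by (intro mult_left_mono) auto
      also have "\<dots> = K5 * ?s2 powr (p / 2)" by (simp add: K5_def)
      also have "\<dots> \<le> c * d / 2 * ?s2" using \<rho>2(2)[OF s2] s2\<epsilon> \<epsilon>(2) by linarith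
      finally show ?thesis by linarith
    qed
    have "c * (d * ?s2) \<le> c * (Nm um)\<^sup>2"
      using Nm_low[OF um umW] c by (intro mult_left_mono) (auto simp: nrm_sq[OF V(2)])
    moreover have "c1 * ipA up up + k1 * ?P \<le> d2_functional \<Omega> \<Psi> g u up up + Mb * (?Ru + ?Rp)"
      by (rule coer[OF u(1) _ up]) (use u(2) \<delta>(2) in linarith)
    moreover have "(H_norm \<Omega> \<Psi> up)\<^sup>2 = ipA up up" by (simp add: H_norm_eq nrm_sq[OF V(3)])
    ultimately show ?thesis using growth gain by (simp add: algebra_simps)
  qed
  with \<delta>(1) c1 show ?thesis by blast
qed

end

text \<open>The exponent \<open>q + 2\<close> of the lower order term is subcritical, hence may be enlarged to some
  \<open>r > p\<close> that is still in the range of Sobolev's inequality.\<close>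

theorem lemma3p5:
  fixes \<Omega> :: "(real ^ 'n) set" and p :: real and \<Psi> :: "real ^ 'n \<Rightarrow> real"
    and g :: "real ^ 'n \<Rightarrow> real \<Rightarrow> real" and c :: real
    and normXm :: "(real ^ 'n \<Rightarrow> real) \<Rightarrow> real"
  defines "X \<equiv> W10 p \<Omega>"
    and "normX \<equiv> W1_norm p \<Omega>"
    and "f \<equiv> functional \<Omega> \<Psi> g"
    and "d2f \<equiv> d2_functional \<Omega> \<Psi> g"
  assumes "open \<Omega>" and "bounded \<Omega>" and "C1_boundary \<Omega>"
    and "2 < p" and "p \<le> real CARD('n)"
    and "class_C 2 \<Psi>" and "\<Psi> 0 = 0" and "(\<Psi> has_derivative (\<lambda>_. 0)) (at 0)"
    and "\<And>s. (\<lambda>x. g x s) \<in> borel_measurable (lebesgue_on \<Omega>)"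
    and "AE x in lebesgue_on \<Omega>. class_C 1 (g x)"
    and Psi: "\<exists>\<kappa>>0. \<exists>\<mu>1>0. \<exists>\<mu>2>0.
          convex_on UNIV (\<lambda>x. \<Psi> x - \<mu>1 * Psi_kappa p \<kappa> x) \<and>
          convex_on UNIV (\<lambda>x. \<mu>2 * Psi_kappa p \<kappa> x - \<Psi> x)"
    and g: "\<exists>C>0. \<exists>q\<ge>0. ereal q < sobolev_exponent (real CARD('n)) p - 2 \<and>
          (AE x in lebesgue_on \<Omega>. \<forall>s. \<bar>deriv (g x) s\<bar> \<le> C * (1 + \<bar>s\<bar> powr q))"
    and real_valued: "\<And>u. u \<in> X \<Longrightarrow> integrable (lebesgue_on \<Omega>) (\<lambda>x. \<Psi> (wgrad \<Omega> u x)) \<and>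
          integrable (lebesgue_on \<Omega>) (\<lambda>x. primitive g x (u x))"
    and C2: "C2_functional X normX f d2f"
    and critical: "critical_point X normX f (\<lambda>_. 0)"
    and injective: "\<And>v v'. v \<in> X \<Longrightarrow> v' \<in> X \<Longrightarrow>
          (\<forall>w\<in>X. d2f (\<lambda>_. 0) v w = d2f (\<lambda>_. 0) v' w) \<Longrightarrow> eq_ae \<Omega> v v'"
    and "norm_on \<Omega> (X_minus \<Omega> \<Psi> g) normXm"
    and "0 < c"
    and "\<exists>r>0. \<forall>u\<in>X. normX u < r \<longrightarrow>
          (\<forall>v\<in>X_minus \<Omega> \<Psi> g. d2f u v v \<le> - 2 * c * (normXm v)\<^sup>2)"
  shows "\<exists>\<delta>>0. \<exists>c1>0. \<forall>u\<in>X. normX u < \<delta> \<longrightarrow>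
          (\<forall>um\<in>X_minus \<Omega> \<Psi> g. \<forall>up\<in>X_plus p \<Omega> \<Psi> g. eq_ae \<Omega> u (\<lambda>x. um x + up x) \<longrightarrow>
             d2f u up up \<ge> c1 * (H_norm \<Omega> \<Psi> up)\<^sup>2 - c * (normXm um)\<^sup>2)"
proof -
  obtain \<kappa> \<mu>1 \<mu>2 where \<kappa>: "\<kappa> > 0" "\<mu>1 > 0" "\<mu>2 > 0"
    "convex_on UNIV (\<lambda>x. \<Psi> x - \<mu>1 * Psi_kappa p \<kappa> x)" "convex_on UNIV (\<lambda>x. \<mu>2 * Psi_kappa p \<kappa> x - \<Psi> x)"
    using Psi by blast
  obtain C q where C: "C > 0" "q \<ge> 0" "ereal q < sobolev_exponent (real CARD('n)) p - 2"
    "AE x in lebesgue_on \<Omega>. \<forall>s. \<bar>deriv (g x) s\<bar> \<le> C * (1 + \<bar>s\<bar> powr q)"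
    using g by blast
  obtain r where r: "r > p" "q \<le> r - 2" "real CARD('n) * ((r - p) / p) < r"
    using subcritical_exponent[OF \<open>p \<le> real CARD('n)\<close> \<open>2 < p\<close> C(2,3)] by blast
  interpret quasilinear \<Omega> p \<kappa> \<mu>1 \<mu>2 C q r \<Psi> g
    by unfold_locales (use assms \<kappa> C r in \<open>simp_all\<close>)
  obtain rr where rr: "rr > 0" "\<forall>u\<in>W10 p \<Omega>. W1_norm p \<Omega> u < rr \<longrightarrow>
      (\<forall>v\<in>X_minus \<Omega> \<Psi> g. d2_functional \<Omega> \<Psi> g u v v \<le> - 2 * c * (normXm v)\<^sup>2)"
    using assms(23) unfolding X_def normX_def d2f_def by blast
  show ?thesis
    unfolding X_def normX_def d2f_def
    by (rule d2_low[OF \<open>norm_on \<Omega> (X_minus \<Omega> \<Psi> g) normXm\<close> \<open>0 < c\<close> rr(1)]) (use rr(2) in blast)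
qed

end
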